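(* Every cusp form of weight $k$ for ${\rm SL}_2({\mathbb Z})$ with rational Fourier coefficients is presented as a ${\mathbb Q}$-linear combination of symmetric triple Eisenstein series $\widetilde{G}_{k_1,k_2,k_3}^{\sqcup\!\sqcup,S}(\tau)$ for $k_1,k_2,k_3\in {\mathbb N}$ with $k=k_1+k_2+k_3$.
   Context: For $\tau$ in the upper half-plane, order the lattice ${\mathbb Z}\tau+{\mathbb Z}$ by $\lambda<\mu$ iff $\mu-\lambda$ lies in the upper half-plane or on the positive real half-line. For integers $k_1,\ldots,k_d\ge2$ the multiple Eisenstein series is $G_{k_1,\ldots,k_d}(\tau)=\lim_{M\to\infty}\lim_{N\to\infty}\sum_{0<\lambda_1<\cdots<\lambda_d,\ \lambda_j\in{\mathbb Z}_M\tau+{\mathbb Z}_N}\lambda_1^{-k_1}\cdots\lambda_d^{-k_d}$, with ${\mathbb Z}_M=\{m\in{\mathbb Z}: |m|\le M\}$. For every index ${\boldsymbol{k}}=(k_1,\ldots,k_d)\in{\mathbb N}^d$, $G^{\sqcup\!\sqcup}_{{\boldsymbol{k}}}(\tau)$ denotes the shuffle regularization of Bachmann–Tasaka: a $q$-series ($q=e^{2\pi i\tau}$) whose constant term is the shuffle-regularized multiple zeta value $\zeta^{\sqcup\!\sqcup}({\boldsymbol{k}})$, such that ${\boldsymbol{k}}\mapsto G^{\sqcup\!\sqcup}_{{\boldsymbol{k}}}$ satisfies the shuffle relation and $G^{\sqcup\!\sqcup}_{{\boldsymbol{k}}}(\tau)=G_{{\boldsymbol{k}}}(\tau)$ whenever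 all entries of ${\boldsymbol{k}}$ are $\ge2$. The symmetric multiple Eisenstein series is $G^{\sqcup\!\sqcup,S}_{{\boldsymbol{k}}}(\tau)=\sum_{j=0}^d(-1)^{k_{j+1}+\cdots+k_d}G^{\sqcup\!\sqcup}_{k_1,\ldots,k_j}(\tau)G^{\sqcup\!\sqcup}_{k_d,\ldots,k_{j+1}}(\tau)$ (empty index giving $1$), and $\widetilde{G}^{\sqcup\!\sqcup,S}_{{\boldsymbol{k}}}(\tau)=G^{\sqcup\!\sqcup,S}_{{\boldsymbol{k}}}(\tau)/(2\pi i)^{k_1+\cdots+k_d}$. *)

theory Defs
  imports "HOL-Analysis.Analysis"
begin

section \<open>Cusp forms for the full modular group\<close>

abbreviation upper_half_plane :: "complex set" where
  "upper_half_plane \<equiv> {\<tau>. Im \<tau> > 0}"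

definition to_q :: "complex \<Rightarrow> complex" where
  "to_q \<tau> = exp (2 * of_real pi * \<i> * \<tau>)"

definition has_fourier_expansion :: "(complex \<Rightarrow> complex) \<Rightarrow> (nat \<Rightarrow> complex) \<Rightarrow> bool" where
  "has_fourier_expansion f a \<longleftrightarrow>
     (\<forall>\<tau>\<in>upper_half_plane. (\<lambda>n. a n * to_q \<tau> ^ n) sums f \<tau>)"

definition cusp_form :: "nat \<Rightarrow> (complex \<Rightarrow> complex) \<Rightarrow> bool" where
  "cusp_form k f \<longleftrightarrow>
     f holomorphic_on upper_half_plane \<and>
     (\<forall>a b c d :: int. a * d - b * c = 1 \<longrightarrow>
        (\<forall>\<tau>\<in>upper_half_plane.
           f ((of_int a * \<tau> + of_int b) / (of_int c * \<tau> + of_int d))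
             = (of_int c * \<tau> + of_int d) ^ k * f \<tau>)) \<and>
     (\<exists>a. has_fourier_expansion f a \<and> a 0 = 0)"


section \<open>Words and indices\<close>

text \<open>An index \<open>k\<^sub>1, \<dots>, k\<^sub>d\<close> of positive integers is encoded by the word
  \<open>1 0\<^bsup>k\<^sub>1 - 1\<^esup> \<dots> 1 0\<^bsup>k\<^sub>d - 1\<^esup>\<close>. The decoding \<open>index_of\<close> is only meaningful on words
  that are empty or begin with \<open>L1\<close>. The library's \<open>shuffles\<close> returns a set and so forgets
  multiplicities; \<open>shuffle_list\<close> keeps them.\<close>

datatype letter = L0 | L1

definition word_of :: "nat list \<Rightarrow> letter list" where
  "word_of ks = concat (map (\<lambda>n. L1 # replicate (n - 1) L0) ks)"

function index_of :: "letter list \<Rightarrow> nat list" where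
  "index_of [] = []"
| "index_of (L0 # w) = index_of w"
| "index_of (L1 # w) =
     Suc (length (takeWhile (\<lambda>x. x = L0) w)) # index_of (dropWhile (\<lambda>x. x = L0) w)"
  by pat_completeness auto
termination
  by (relation "Wellfounded.measure length") (auto simp: le_imp_less_Suc length_dropWhile_le)

fun shuffle_list :: "'a list \<Rightarrow> 'a list \<Rightarrow> 'a list list" where
  "shuffle_list [] ys = [ys]"
| "shuffle_list xs [] = [xs]"
| "shuffle_list (x # xs) (y # ys) =
     map ((#) x) (shuffle_list xs (y # ys)) @ map ((#) y) (shuffle_list (x # xs) ys)"


section \<open>Shuffle-regularized multiple zeta values\<close>

definition chains :: "nat \<Rightarrow> nat list set" where
  "chains m = {ds. length ds = m \<and> sorted_wrt (<) ds \<and> (\<forall>d\<in>set ds. 0 < d)}"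

text \<open>\<open>\<zeta>(k\<^sub>1, \<dots>, k\<^sub>d) = \<Sum> m\<^sub>1\<^bsup>-k\<^sub>1\<^esup> \<cdots> m\<^sub>d\<^bsup>-k\<^sub>d\<^esup>\<close> over \<open>0 < m\<^sub>1 < \<cdots> < m\<^sub>d\<close>; used only for \<open>k\<^sub>d \<ge> 2\<close>
  or the empty index.\<close>

definition mzv :: "nat list \<Rightarrow> complex" where
  "mzv ks = (\<Sum>\<^sub>\<infinity>ms\<in>chains (length ks). \<Prod>i<length ks. 1 / of_nat (ms ! i) ^ (ks ! i))"

text \<open>The shuffle regularization: the homomorphism from the shuffle algebra that extends
  \<open>mzv\<close> and sends the word \<open>1\<close> to \<open>0\<close>. Modulo multiples (in the shuffle algebra) of the
  word \<open>1\<close>, one has \<open>w 0 1\<^sup>b \<equiv> (-1)\<^sup>b (w \<sqdot> 1\<^sup>b) 0\<close>, where the dot is the shuffle product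
  (Ihara--Kaneko--Zagier); the words \<open>1\<^sup>b\<close> with \<open>b \<ge> 1\<close> go to \<open>0\<close>.\<close>

definition zeta_sh :: "nat list \<Rightarrow> complex" where
  "zeta_sh ks =
     (let v = rev (word_of ks);
          b = length (takeWhile (\<lambda>x. x = L1) v)
      in case dropWhile (\<lambda>x. x = L1) v of
           [] \<Rightarrow> if b = 0 then 1 else 0
         | _ # w \<Rightarrow> (-1) ^ b *
             (\<Sum>u\<leftarrow>shuffle_list (rev w) (replicate b L1). mzv (index_of (u @ [L0]))))"


section \<open>The q-series of Bachmann and Tasaka\<close>

definition compositions :: "nat \<Rightarrow> nat list set" where
  "compositions r = {es. sum_list es = r \<and> 0 \<notin> set es}"

text \<open>Bachmann and Tasaka put
    \<open>H(i\<^sub>1,\<dots>,i\<^sub>m; y\<^sub>1,\<dots>,y\<^sub>m) = \<Sum>\<^bsub>0<d\<^sub>1<\<dots><d\<^sub>m\<^esub> \<Prod>\<^sub>j e\<^bsup>d\<^sub>j y\<^sub>j\<^esup> (q\<^bsup>d\<^sub>j\<^esup> / (1 - q\<^bsup>d\<^sub>j\<^esup>))\<^bsup>i\<^sub>j\<^esup>\<close>,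
    \<open>h(z\<^sub>1,\<dots>,z\<^sub>r) = \<Sum> 1/(i\<^sub>1! \<cdots> i\<^sub>m!) H(i\<^sub>1,\<dots>,i\<^sub>m; z\<^sub>1 + \<dots> + z\<^bsub>i\<^sub>1\<^esub>, z\<^bsub>i\<^sub>1+1\<^esub> + \<dots> + z\<^bsub>i\<^sub>1+i\<^sub>2\<^esub>, \<dots>)\<close>,
  the sum being over the compositions of \<open>r\<close>, and define the q-series
  \<open>g\<^sub>n\<close> for \<open>n = (n\<^sub>1,\<dots>,n\<^sub>r)\<close> by
    \<open>\<Sum>\<^sub>n g\<^sub>n (-2\<pi>i)\<^bsup>-(n\<^sub>1+\<dots>+n\<^sub>r)\<^esup> x\<^sub>1\<^bsup>n\<^sub>1-1\<^esup> \<cdots> x\<^sub>r\<^bsup>n\<^sub>r-1\<^esup> = h(x\<^sub>r - x\<^bsub>r-1\<^esub>, \<dots>, x\<^sub>2 - x\<^sub>1, x\<^sub>1)\<close>.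
  After this substitution \<open>\<Sum>\<^sub>j d\<^sub>j y\<^sub>j\<close> is the linear form \<open>\<Sum>\<^sub>l c\<^sub>l x\<^sub>l\<close> whose coefficients
  are \<open>lin_coeff\<close> (with \<open>l\<close> counted from \<open>0\<close>): each \<open>d\<^sub>j\<close> multiplies \<open>i\<^sub>j\<close> consecutive
  variables \<open>z\<close>, and \<open>x\<^sub>l\<close> occurs positively in \<open>z\<^bsub>r+1-l\<^esub>\<close> and, if \<open>l < r\<close>, negatively in
  \<open>z\<^bsub>r-l\<^esub>\<close>. The coefficient of \<open>x\<^sub>1\<^bsup>n\<^sub>1-1\<^esup> \<cdots> x\<^sub>r\<^bsup>n\<^sub>r-1\<^esup>\<close> in the
  exponential of that form is \<open>\<Prod>\<^sub>l c\<^sub>l\<^bsup>n\<^sub>l-1\<^esup> / (n\<^sub>l-1)!\<close> (where \<open>0\<^sup>0 = 1\<close>).\<close>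

definition lin_coeff :: "nat list \<Rightarrow> nat list \<Rightarrow> nat \<Rightarrow> complex" where
  "lin_coeff es ds l =
     (let e = rev (concat (map2 replicate es ds)) @ [0]
      in of_nat (e ! l) - of_nat (e ! Suc l))"

definition g_sh :: "complex \<Rightarrow> nat list \<Rightarrow> complex" where
  "g_sh \<tau> ns =
     (- 2 * of_real pi * \<i>) ^ sum_list ns *
     (\<Sum>es\<in>compositions (length ns).
        (\<Prod>i\<leftarrow>es. 1 / fact i) *
        (\<Sum>\<^sub>\<infinity>ds\<in>chains (length es).
           (\<Prod>j<length es. (to_q \<tau> ^ (ds ! j) / (1 - to_q \<tau> ^ (ds ! j))) ^ (es ! j)) *
           (\<Prod>l<length ns. lin_coeff es ds l ^ (ns ! l - 1) / fact (ns ! l - 1))))"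


section \<open>Formal iterated integrals and multiple Eisenstein series\<close>

text \<open>Goncharov's formal iterated integrals \<open>I(a; w; b)\<close>, modulo \<open>I(0; 0; 1)\<close>: the algebra is
  then generated by the symbols \<open>I(k\<^sub>1,\<dots>,k\<^sub>d) = I(0; 1 0\<^bsup>k\<^sub>1-1\<^esup> \<dots> 1 0\<^bsup>k\<^sub>d-1\<^esup>; 1)\<close>, and
  \<open>I(0; 0\<^sup>m 1 u; 1) = (-1)\<^sup>m I(0; 1 (0\<^sup>m \<sqdot> u); 1)\<close> with the shuffle product on the right,
  \<open>I(a; w; a) = 0\<close> for nonempty \<open>w\<close>, and \<open>I(1; w; 0) = (-1)\<^bsup>|w|\<^esup> I(0; rev w; 1)\<close>.
  \<open>int_word F w\<close> and \<open>int_sym F a w b\<close> are the images of \<open>I(0; w; 1)\<close> and \<open>I(a; w; b)\<close> under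
  the linear map that sends \<open>I(k\<^sub>1,\<dots>,k\<^sub>d)\<close> to \<open>F [k\<^sub>1,\<dots>,k\<^sub>d]\<close> and \<open>1\<close> to \<open>1\<close>.\<close>

definition int_word :: "(nat list \<Rightarrow> complex) \<Rightarrow> letter list \<Rightarrow> complex" where
  "int_word F w =
     (let m = length (takeWhile (\<lambda>x. x = L0) w)
      in case dropWhile (\<lambda>x. x = L0) w of
           [] \<Rightarrow> if m = 0 then 1 else 0
         | _ # u \<Rightarrow> (-1) ^ m *
             (\<Sum>s\<leftarrow>shuffle_list (replicate m L0) u. F (index_of (L1 # s))))"

definition int_sym ::
    "(nat list \<Rightarrow> complex) \<Rightarrow> letter \<Rightarrow> letter list \<Rightarrow> letter \<Rightarrow> complex" where
  "int_sym F a w b =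
     (if w = [] then 1
      else if a = b then 0
      else if a = L0 then int_word F w
      else (-1) ^ length w * int_word F (rev w))"

text \<open>The shuffle regularization of Bachmann and Tasaka is
  \<open>(\<zeta>\<^bsup>sh\<^esup> \<otimes> g\<^bsup>sh\<^esup>) (\<Delta> (I(k\<^sub>1,\<dots>,k\<^sub>d)))\<close> for Goncharov's coproduct
    \<open>\<Delta> (I(a\<^sub>0; a\<^sub>1 \<dots> a\<^sub>N; a\<^bsub>N+1\<^esub>)) =
       \<Sum>\<^bsub>0=p\<^sub>0<p\<^sub>1<\<dots><p\<^sub>n<p\<^bsub>n+1\<^esub>=N+1\<^esub>
         \<Prod>\<^bsub>j=0..n\<^esub> I(a\<^bsub>p\<^sub>j\<^esub>; a\<^bsub>p\<^sub>j+1\<^esub> \<dots> a\<^bsub>p\<^bsub>j+1\<^esub>-1\<^esub>; a\<^bsub>p\<^bsub>j+1\<^esub>\<^esub>)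
           \<otimes> I(a\<^sub>0; a\<^bsub>p\<^sub>1\<^esub> \<dots> a\<^bsub>p\<^sub>n\<^esub>; a\<^bsub>N+1\<^esub>)\<close>.
  Below, \<open>P = {p\<^sub>1,\<dots>,p\<^sub>n}\<close> and \<open>p = [p\<^sub>0,\<dots>,p\<^bsub>n+1\<^esub>]\<close>.\<close>

definition eisenstein_sh :: "complex \<Rightarrow> nat list \<Rightarrow> complex" where
  "eisenstein_sh \<tau> ks =
     (let N = length (word_of ks);
          a = L0 # word_of ks @ [L1]
      in \<Sum>P\<in>Pow {1..N}.
           (let p = 0 # sorted_list_of_set P @ [N + 1]
            in (\<Prod>j\<le>card P.
                  int_sym zeta_sh (a ! (p ! j)) (map ((!) a) [Suc (p ! j)..<p ! Suc j])
                    (a ! (p ! Suc j)))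
               * int_sym (g_sh \<tau>) L0 (map ((!) a) (sorted_list_of_set P)) L1))"

definition symmetric_eisenstein :: "complex \<Rightarrow> nat list \<Rightarrow> complex" where
  "symmetric_eisenstein \<tau> ks =
     (\<Sum>j\<le>length ks. (-1) ^ sum_list (drop j ks) *
        eisenstein_sh \<tau> (take j ks) * eisenstein_sh \<tau> (rev (drop j ks)))"

definition symmetric_eisenstein_normalized :: "complex \<Rightarrow> nat list \<Rightarrow> complex" where
  "symmetric_eisenstein_normalized \<tau> ks =
     symmetric_eisenstein \<tau> ks / (2 * of_real pi * \<i>) ^ sum_list ks"

end

(* Let G_n be the Eisenstein series of even weight n. For odd x, y >= 2 and even z >= 2, the sum of
   the symmetric triple Eisenstein series over the six permutations of (x, y, z) is
   -4 (G_{x+y} G_z - G_{x+y+z}), because multiple Eisenstein series with entries >= 2 obey the harmonic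
   product. To see the harmonic product for the regularization, evaluate Goncharov's coproduct on words
   of depth <= 3: the zeta factors are the Laurent coefficients that expand products of the functions
   sum_n (t + n)^{-x}, polynomials in pi cot(pi t), into linear combinations of such functions, and the
   q-series are nested sums of these functions at t = w tau.

   It remains to span the cusp forms of weight k >= 12 by the G_n G_c - G_k with n + c = k. A finite linear
   combination of point evaluations that kills these series kills every cusp form f, as follows. Apply it
   in tau to the sum of (lambda + mu z)^{-k} over the integer matrices of positive determinant, where
   (lambda, mu) is the matrix times (tau, 1). In z this is a cusp form whose odd period coefficients, up to
   positive factors, are the values of the functional on the series G_a G_b - rho G_k with constants
   rho >= 1; hence they are nonpositive multiples of its value at G_k. The period relations then force
   them to vanish, and the maximum principle for the Eichler integral minus its reflection shows that the cusp form is 0. A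
   contraction argument passes from the matrices of positive determinant to SL_2(Z), and unfolding the
   reproducing kernel formula gives the value of the functional at f. The same criterion shows that there
   are no cusp forms of weight below 12. Rational coefficients follow since the normalized G_n have
   rational Fourier coefficients. *)
theory Submission
  imports Defs "HOL-Complex_Analysis.Complex_Analysis" "HOL-Probability.Sinc_Integral" "HOL-Computational_Algebra.Fundamental_Theorem_Algebra"
begin

text \<open>Point evaluations detect membership in a finite-dimensional span, which turns the
  spanning claim into one about functionals that kill the Eisenstein products. All matrices of
  positive determinant are summed because the period integrals then become sums of lambda^(-a)
  mu^(-b) over positively oriented pairs of lattice vectors: for even a and b these are half of a
  product of two Eisenstein series, minus the proportional pairs. A fixed determinant would destroy
  this factorization. Proportional pairs contribute \<open>ratio_sum\<close> times one Eisenstein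
  series; this constant is at least 2, the coefficient in \<open>Eis a * Eis b - 2 * Eis k\<close>,
  so all middle periods get the same sign relative to one number. The coefficients of degree 0, 1
  and 2 in the period relation yield an identity with positive weights n (w - n) from which the
  extreme periods cancel, so equal signs are enough. For the triple series, two odd indices and an
  even one make the signs of the symmetrization cancel the products of three series, and indices at
  least 2 keep all zeta values convergent.\<close>

no_notation Infinite_Set_Sum.abs_summable_on (infix "abs'_summable'_on" 50)

section \<open>Absolutely convergent sums\<close>

lemma abs_summable_on_Times:
  fixes f :: "'a \<Rightarrow> 'c::{real_normed_algebra,banach}" and g :: "'b \<Rightarrow> 'c"
  assumes f: "f abs_summable_on A" and g: "g abs_summable_on B"
  shows "(\<lambda>(x, y). f x * g y) abs_summable_on A \<times> B"
proof -
  have "(\<lambda>(x, y). norm (f x) * norm (g y)) summable_on A \<times> B"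
    by (rule summable_on_SigmaI[where g = "\<lambda>x. norm (f x) * (\<Sum>\<^sub>\<infinity>y\<in>B. norm (g y))"])
       (use f g in \<open>auto intro!: has_sum_cmult_right summable_on_cmult_left\<close>)
  then show ?thesis
    by (rule Infinite_Sum.abs_summable_on_comparison_test') (auto simp: norm_mult_ineq)
qed

lemma infsum_Times_mult:
  fixes f :: "'a \<Rightarrow> 'c::{real_normed_algebra,banach}" and g :: "'b \<Rightarrow> 'c"
  assumes f: "f abs_summable_on A" and g: "g abs_summable_on B"
  shows "infsum (\<lambda>(x, y). f x * g y) (A \<times> B) = infsum f A * infsum g B"
proof -
  have "infsum (\<lambda>(x, y). f x * g y) (A \<times> B) = (\<Sum>\<^sub>\<infinity>x\<in>A. \<Sum>\<^sub>\<infinity>y\<in>B. f x * g y)"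
    using abs_summable_summable[OF abs_summable_on_Times[OF f g]] by (rule infsum_Sigma'_banach[symmetric])
  also have "\<dots> = (\<Sum>\<^sub>\<infinity>x\<in>A. f x * infsum g B)"
    using abs_summable_summable[OF g] by (intro infsum_cong infsum_cmult_right) auto
  also have "\<dots> = infsum f A * infsum g B"
    using abs_summable_summable[OF f] by (intro infsum_cmult_left) auto
  finally show ?thesis .
qed

lemma summable_on_bounded:
  fixes f :: "'a \<Rightarrow> 'c::banach" and M :: "'a \<Rightarrow> real"
  assumes "M summable_on A" "\<And>x. x \<in> A \<Longrightarrow> norm (f x) \<le> C * M x"
  shows "f abs_summable_on A" "f summable_on A"
    "norm (infsum f A) \<le> C * infsum M A"
proof -
  have *: "(\<lambda>x. C * M x) summable_on A" using assms(1) by (rule summable_on_cmult_right)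
  show 1: "f abs_summable_on A" by (rule Infinite_Sum.abs_summable_on_comparison_test'[OF * assms(2)])
  then show 2: "f summable_on A" by (rule abs_summable_summable)
  show "norm (infsum f A) \<le> C * infsum M A"
    using norm_infsum_le[OF has_sum_infsum[OF 2] has_sum_infsum[OF *] assms(2)]
    by (simp add: infsum_cmult_right[OF assms(1)])
qed

text \<open>The majorant separates as \<open>G w * M n\<close> with \<open>G\<close> only
  continuous, so bounds whose constant degenerates at the boundary can be used as they stand. On a
  small closed disc \<open>G\<close> is bounded, the convergence is uniform, and uniform limits of
  holomorphic functions may be differentiated termwise.\<close>

lemma has_field_derivative_infsum:
  fixes f :: "'a \<Rightarrow> complex \<Rightarrow> complex"
  assumes S: "open S" "z \<in> S"
    and f: "\<And>n w. n \<in> I \<Longrightarrow> w \<in> S \<Longrightarrow> (f n has_field_derivative f' n w) (at w)"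
    and le: "\<And>n w. n \<in> I \<Longrightarrow> w \<in> S \<Longrightarrow> norm (f n w) \<le> G w * M n"
    and G: "continuous_on S G" and M: "M summable_on I" "\<And>n. n \<in> I \<Longrightarrow> 0 \<le> M n"
  shows "((\<lambda>w. \<Sum>\<^sub>\<infinity>n\<in>I. f n w) has_field_derivative (\<Sum>\<^sub>\<infinity>n\<in>I. f' n z)) (at z)"
    and "(\<lambda>n. f' n z) summable_on I"
proof -
  have "isCont G z" using G S by (simp add: continuous_on_eq_continuous_at)
  then have "eventually (\<lambda>w. w \<in> S \<and> G w < G z + 1) (nhds z)"
    using S by (intro eventually_conj eventually_nhds_in_open order_tendstoD(2)[where y = "G z"])
      (auto simp: isCont_def tendsto_at_iff_tendsto_nhds)
  then obtain r where r: "r > 0" "\<And>w. w \<in> cball z r \<Longrightarrow> w \<in> S \<and> G w \<le> G z + 1"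
    unfolding eventually_nhds_metric
    by (metis (no_types, lifting) dist_commute dual_order.strict_trans1 half_gt_zero_iff less_eq_real_def
        field_sum_of_halves less_add_same_cancel1 mem_cball)
  have le': "norm (f n w) \<le> (G z + 1) * M n" if "n \<in> I" "w \<in> cball z r" for n w
    using le[of n w] r(2)[OF that(2)] M(2)[OF that(1)] that mult_right_mono[of "G w" "G z + 1" "M n"] by force
  have ul: "uniform_limit (cball z r) (\<lambda>X w. \<Sum>n\<in>X. f n w) (\<lambda>w. \<Sum>\<^sub>\<infinity>n\<in>I. f n w) (finite_subsets_at_top I)"
    by (rule Weierstrass_m_test_general[OF le' summable_on_cmult_right[OF M(1)]])
  have "\<forall>\<^sub>F X in finite_subsets_at_top I. continuous_on (cball z r) (\<lambda>w. \<Sum>n\<in>X. f n w) \<and>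
     (\<forall>w\<in>ball z r. ((\<lambda>w. \<Sum>n\<in>X. f n w) has_field_derivative (\<Sum>n\<in>X. f' n w)) (at w))"
  proof (rule eventually_finite_subsets_at_top_weakI, intro conjI ballI)
    fix X assume X: "finite X" "X \<subseteq> I"
    show "continuous_on (cball z r) (\<lambda>w. \<Sum>n\<in>X. f n w)"
      using X r(2) f by (intro continuous_on_sum)
        (meson DERIV_continuous continuous_at_imp_continuous_on subsetD)
    show "((\<lambda>w. \<Sum>n\<in>X. f n w) has_field_derivative (\<Sum>n\<in>X. f' n w)) (at w)" if "w \<in> ball z r" for w
      using X r(2)[of w] that f by (intro DERIV_sum) auto
  qed
  from has_complex_derivative_uniform_limit[OF this ul _ r(1)] obtain g' where g':
    "\<And>w. w \<in> ball z r \<Longrightarrow> ((\<lambda>w. \<Sum>\<^sub>\<infinity>n\<in>I. f n w) has_field_derivative g' w) (at w) \<and>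
        ((\<lambda>X. \<Sum>n\<in>X. f' n w) \<longlongrightarrow> g' w) (finite_subsets_at_top I)"
    by (metis finite_subsets_at_top_neq_bot)
  then have "((\<lambda>n. f' n z) has_sum g' z) I" "((\<lambda>w. \<Sum>\<^sub>\<infinity>n\<in>I. f n w) has_field_derivative g' z) (at z)"
    using r(1) by (auto simp: has_sum_def)
  then show "((\<lambda>w. \<Sum>\<^sub>\<infinity>n\<in>I. f n w) has_field_derivative (\<Sum>\<^sub>\<infinity>n\<in>I. f' n z)) (at z)"
    and "(\<lambda>n. f' n z) summable_on I"
    by (auto simp: has_sum_iff)
qed

section \<open>Lattice vectors and integer matrices\<close>

abbreviation uhp :: "complex set" where "uhp \<equiv> upper_half_plane"

lemma open_uhp: "open uhp" by (rule open_halfspace_Im_gt)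

definition lat :: "complex \<Rightarrow> int \<times> int \<Rightarrow> complex" where
  "lat \<tau> v = of_int (fst v) * \<tau> + of_int (snd v)"

lemma lat_add: "lat \<tau> (u + v) = lat \<tau> u + lat \<tau> v"
  and lat_minus: "lat \<tau> (- v) = - lat \<tau> v"
  and lat_zero [simp]: "lat \<tau> 0 = 0"
  by (auto simp: lat_def algebra_simps)

definition vnorm :: "int \<times> int \<Rightarrow> real" where
  "vnorm v = 1 + \<bar>of_int (fst v)\<bar> + \<bar>of_int (snd v)\<bar>"

lemma vnorm_ge_1: "vnorm v \<ge> 1" by (simp add: vnorm_def)

text \<open>The common majorant of the lattice sums: the exponent 3 exceeds the rank 2 of the
  lattice.\<close>

definition wt :: "int \<times> int \<Rightarrow> real" where "wt v = 1 / vnorm v ^ 3"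

lemma wt_pos: "0 < wt v" using vnorm_ge_1[of v] by (simp add: wt_def)

lemma summable_on_int_powr:
  fixes s :: real assumes "s < -1" shows "(\<lambda>a::int. (1 + \<bar>of_int a\<bar>) powr s) summable_on UNIV"
proof -
  have "summable (\<lambda>n. real n powr s)" using assms by (simp add: summable_real_powr_iff)
  then have "summable (\<lambda>n. real (Suc n) powr s)" by (subst summable_Suc_iff)
  then have *: "(\<lambda>n::nat. (1 + real n) powr s) summable_on UNIV"
    by (intro summable_nonneg_imp_summable_on) (auto simp: add.commute)
  have "(\<lambda>a::int. (1 + \<bar>of_int a\<bar>) powr s) summable_on (range int \<union> range (\<lambda>n. - int n))"
    by (intro summable_on_union; subst summable_on_reindex) (use * in \<open>auto simp: inj_on_def o_def\<close>)
  moreover have "range int \<union> range (\<lambda>n. - int n) = UNIV"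
    by (auto simp: image_iff) (metis int_cases2)
  ultimately show ?thesis by simp
qed

lemma wt_summable: "wt summable_on UNIV"
proof -
  let ?g = "\<lambda>a::int. (1 + \<bar>of_int a\<bar>) powr (-(3/2)) :: real"
  have "?g abs_summable_on UNIV" using summable_on_int_powr[of "-(3/2)"] by simp
  from abs_summable_summable[OF abs_summable_on_Times[OF this this]]
  have s: "(\<lambda>(a, b). ?g a * ?g b) summable_on UNIV \<times> UNIV" .
  \<comment> \<open>Since (1 + |a|)(1 + |b|) is at most \<open>vnorm (a, b) ^ 2\<close>, the cube
    can be shared out as two powers 3/2, each summable over the integers.\<close>
  have "wt (a, b) \<le> ?g a * ?g b" for a b
  proof -
    let ?a = "1 + \<bar>of_int a\<bar> :: real" and ?b = "1 + \<bar>of_int b\<bar> :: real"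
    have "(?a * ?b) powr (3/2) \<le> (vnorm (a, b) ^ 2) powr (3/2)"
      by (intro powr_mono2) (auto simp: vnorm_def power2_eq_square algebra_simps)
    also have "\<dots> = vnorm (a, b) ^ 3"
      using vnorm_ge_1[of "(a, b)"] powr_powr[of "vnorm (a, b)" 2 "3/2"] by simp
    finally have "1 / vnorm (a, b) ^ 3 \<le> 1 / (?a * ?b) powr (3/2)"
      by (intro divide_left_mono mult_pos_pos) (use vnorm_ge_1[of "(a, b)"] in auto)
    also have "\<dots> = ?g a * ?g b" by (simp add: powr_mult powr_minus_divide)
    finally show ?thesis by (simp add: wt_def)
  qed
  then have "wt x \<le> (case x of (a, b) \<Rightarrow> ?g a * ?g b)" for x by (cases x) simp
  then show ?thesis
    using summable_on_comparison_test[OF s, of wt] wt_pos by (simp add: less_imp_le)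
qed

lemma wt_summable_pairs: "(\<lambda>(u, v). wt u * wt v) summable_on S"
proof -
  have "wt abs_summable_on UNIV" using wt_summable wt_pos by (simp add: less_imp_le abs_of_pos)
  from abs_summable_summable[OF abs_summable_on_Times[OF this this]]
  have "(\<lambda>(u, v). wt u * wt v) summable_on UNIV \<times> UNIV" .
  then show ?thesis by (rule summable_on_subset_banach) auto
qed

text \<open>The constant of \<open>norm_kernel_ge\<close>. Being continuous and positive on the
  half-plane, it supplies the factor \<open>G\<close> of
  \<open>has_field_derivative_infsum\<close>.\<close>

definition cst :: "complex \<Rightarrow> real" where "cst z = Im z / (1 + Im z + norm z)"

lemma cst_pos: "z \<in> uhp \<Longrightarrow> 0 < cst z" by (auto simp: cst_def intro!: divide_pos_pos add_pos_nonneg)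

lemma cst_le_1: "z \<in> uhp \<Longrightarrow> cst z \<le> 1" by (auto simp: cst_def divide_le_eq_1)

lemma continuous_on_cst: "continuous_on uhp cst"
  unfolding cst_def by (intro continuous_intros) (auto simp: add_nonneg_eq_0_iff)

lemma norm_kernel_ge_Im:
  assumes "z \<in> uhp" "Im (l * cnj m) \<ge> 0"
  shows "norm (l + m * z) \<ge> norm m * Im z"
proof (cases "m = 0")
  case False
  have "norm m * norm m * Im z \<le> Im ((l + m * z) * cnj m)"
    using assms cmod_power2[of m] by (simp add: algebra_simps power2_eq_square)
  also have "\<dots> \<le> norm (l + m * z) * norm m" by (metis abs_Im_le_cmod abs_le_D1 complex_mod_cnj norm_mult)
  finally show ?thesis using False by (simp add: mult.assoc mult.left_commute mult.commute)
qed auto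

lemma norm_kernel_ge:
  assumes "z \<in> uhp" "Im (l * cnj m) \<ge> 0"
  shows "norm (l + m * z) \<ge> cst z * (norm l + norm m)"
proof -
  let ?L = "norm (l + m * z)"
  have y: "Im z > 0" using assms by simp
  have 1: "norm m * Im z \<le> ?L" by (rule norm_kernel_ge_Im[OF assms])
  have "norm l \<le> ?L + norm m * norm z" by (metis add_diff_cancel_right' norm_mult norm_triangle_ineq4)
  then have "(norm l + norm m) * Im z \<le> (?L + norm m * norm z + norm m) * Im z"
    using y by (intro mult_right_mono) auto
  also have "\<dots> = ?L * Im z + (norm m * Im z) * (1 + norm z)" by (simp add: algebra_simps)
  also have "\<dots> \<le> ?L * Im z + ?L * (1 + norm z)" using 1 by (intro add_left_mono mult_right_mono) auto
  also have "\<dots> = ?L * (1 + Im z + norm z)" by (simp add: algebra_simps)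
  finally have *: "(norm l + norm m) * Im z \<le> ?L * (1 + Im z + norm z)" .
  have "1 + Im z + norm z > 0" using y by (intro add_pos_nonneg) auto
  then show ?thesis using * by (simp add: cst_def pos_divide_le_eq mult.commute)
qed

lemma norm_lat_ge:
  assumes "\<tau> \<in> uhp" "v \<noteq> 0"
  shows "norm (lat \<tau> v) \<ge> cst \<tau> / 2 * vnorm v"
proof -
  have "1 \<le> \<bar>fst v\<bar> + \<bar>snd v\<bar>" using assms(2) by (cases v) (auto simp: zero_prod_def)
  then have "1 \<le> \<bar>real_of_int (fst v)\<bar> + \<bar>of_int (snd v)\<bar>" by linarith
  then have "vnorm v \<le> 2 * (\<bar>of_int (fst v)\<bar> + \<bar>of_int (snd v)\<bar>)" by (simp add: vnorm_def)
  then have "cst \<tau> / 2 * vnorm v \<le> cst \<tau> * (\<bar>of_int (fst v)\<bar> + \<bar>of_int (snd v)\<bar>)"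
    using mult_left_mono[of "vnorm v" _ "cst \<tau> / 2", OF _ less_imp_le] cst_pos[OF assms(1)] by fastforce
  also have "\<dots> \<le> norm (lat \<tau> v)"
    using norm_kernel_ge[OF assms(1), of "of_int (snd v)" "of_int (fst v)"]
    by (simp add: lat_def algebra_simps)
  finally show ?thesis .
qed

lemma lat_nonzero: "\<tau> \<in> uhp \<Longrightarrow> v \<noteq> 0 \<Longrightarrow> lat \<tau> v \<noteq> 0"
  using norm_lat_ge[of \<tau> v] cst_pos[of \<tau>] vnorm_ge_1[of v]
  by (metis half_gt_zero_iff linorder_not_le mult_pos_pos norm_zero zero_less_one order.strict_trans2)

lemma lat_power_le:
  assumes "\<tau> \<in> uhp" "v \<noteq> 0" "n \<ge> 3"
  shows "1 / norm (lat \<tau> v) ^ n \<le> (2 / cst \<tau>) ^ n * wt v"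
proof -
  have c: "cst \<tau> / 2 > 0" using cst_pos[OF assms(1)] by simp
  have "1 / norm (lat \<tau> v) ^ n \<le> 1 / (cst \<tau> / 2 * vnorm v) ^ n"
    using c vnorm_ge_1[of v] norm_lat_ge[OF assms(1,2)] lat_nonzero[OF assms(1,2)]
    by (intro divide_left_mono power_mono mult_pos_pos zero_less_power mult_nonneg_nonneg) auto
  also have "\<dots> = (2 / cst \<tau>) ^ n * (1 / vnorm v ^ n)" by (simp add: power_mult_distrib power_divide)
  also have "\<dots> \<le> (2 / cst \<tau>) ^ n * wt v"
    unfolding wt_def using c vnorm_ge_1[of v] assms(3)
    by (intro mult_left_mono divide_left_mono power_increasing mult_pos_pos zero_less_power) auto
  finally show ?thesis .
qed

definition mdet :: "(int \<times> int) \<times> (int \<times> int) \<Rightarrow> int" where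
  "mdet g = fst (fst g) * snd (snd g) - snd (fst g) * fst (snd g)"

definition SL2 :: "((int \<times> int) \<times> (int \<times> int)) set" where "SL2 = {g. mdet g = 1}"

definition GLpos :: "((int \<times> int) \<times> (int \<times> int)) set" where "GLpos = {g. mdet g > 0}"

lemma SL2_subset_GLpos: "SL2 \<subseteq> GLpos" by (auto simp: SL2_def GLpos_def)

lemma Im_lat_cnj_lat: "Im (lat \<tau> u * cnj (lat \<tau> v)) = of_int (mdet (u, v)) * Im \<tau>"
  by (simp add: lat_def mdet_def algebra_simps)

lemma GLpos_nonzero: "(u, v) \<in> GLpos \<Longrightarrow> u \<noteq> 0 \<and> v \<noteq> 0"
  by (auto simp: GLpos_def mdet_def)

lemma kernel_norm_ge:
  assumes "\<tau> \<in> uhp" "z \<in> uhp" "(u, v) \<in> GLpos"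
  shows "norm (lat \<tau> u + lat \<tau> v * z) \<ge> cst z * (cst \<tau> / 2) * (vnorm u + vnorm v)"
proof -
  have "cst z * (cst \<tau> / 2) * (vnorm u + vnorm v) \<le> cst z * (norm (lat \<tau> u) + norm (lat \<tau> v))"
    using norm_lat_ge[OF assms(1), of u] norm_lat_ge[OF assms(1), of v] GLpos_nonzero[OF assms(3)]
      cst_pos[OF assms(2)]
    by (auto simp: distrib_left mult.assoc intro!: add_mono mult_left_mono)
  also have "\<dots> \<le> norm (lat \<tau> u + lat \<tau> v * z)"
    using assms Im_lat_cnj_lat[of \<tau> u v] by (intro norm_kernel_ge) (auto simp: GLpos_def)
  finally show ?thesis .
qed

lemma kernel_nonzero:
  assumes "\<tau> \<in> uhp" "z \<in> uhp" "(u, v) \<in> GLpos"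
  shows "lat \<tau> u + lat \<tau> v * z \<noteq> 0"
proof -
  have "0 < cst z * (cst \<tau> / 2) * (vnorm u + vnorm v)"
    using cst_pos[OF assms(1)] cst_pos[OF assms(2)] vnorm_ge_1[of u] vnorm_ge_1[of v] by simp
  then show ?thesis using kernel_norm_ge[OF assms] by auto
qed

text \<open>The sum \<open>vnorm u + vnorm v\<close> dominates both summands, so its sixth power
  dominates the product of their cubes. This is the origin of the bound 6 on the weight: the matrix
  sum is majorized by a product of two lattice sums.\<close>

lemma kernel_power_le:
  assumes "\<tau> \<in> uhp" "z \<in> uhp" "g \<in> GLpos" "k \<ge> 6"
  shows "1 / norm (lat \<tau> (fst g) + lat \<tau> (snd g) * z) ^ k
    \<le> (2 / (cst z * cst \<tau>)) ^ k * (wt (fst g) * wt (snd g))"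
proof -
  obtain u v where g: "g = (u, v)" by (cases g)
  define c where "c = cst z * (cst \<tau> / 2)"
  have c: "c > 0" using cst_pos[OF assms(1)] cst_pos[OF assms(2)] by (simp add: c_def)
  let ?s = "vnorm u + vnorm v"
  have s: "?s \<ge> 1" "vnorm u \<ge> 1" "vnorm v \<ge> 1" using vnorm_ge_1[of u] vnorm_ge_1[of v] by auto
  have "vnorm u ^ 3 * vnorm v ^ 3 \<le> ?s ^ 3 * ?s ^ 3"
    using s by (intro mult_mono power_mono) auto
  also have "\<dots> = ?s ^ 6" by (simp flip: power_add)
  also have "\<dots> \<le> ?s ^ k" using s(1) assms(4) by (intro power_increasing) auto
  finally have le: "vnorm u ^ 3 * vnorm v ^ 3 \<le> ?s ^ k" .
  have "1 / norm (lat \<tau> u + lat \<tau> v * z) ^ k \<le> 1 / (c * ?s) ^ k"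
    using kernel_norm_ge[OF assms(1,2)] assms(3) c s g kernel_nonzero[OF assms(1,2)]
    by (intro divide_left_mono power_mono mult_pos_pos zero_less_power) (auto simp: c_def)
  also have "\<dots> = (1 / c) ^ k * (1 / ?s ^ k)" by (simp add: power_mult_distrib power_divide)
  also have "\<dots> \<le> (1 / c) ^ k * (1 / (vnorm u ^ 3 * vnorm v ^ 3))"
    using c s le by (intro mult_left_mono divide_left_mono mult_pos_pos zero_less_power) auto
  finally show ?thesis by (simp add: g wt_def c_def)
qed

section \<open>Periodic functions and invariant functions on the upper half-plane\<close>

text \<open>Smallness is asked only on a strip of width 1; together with periodicity this controls a
  whole neighbourhood of the cusp.\<close>

definition vanishes_at_cusp :: "(complex \<Rightarrow> 'a::real_normed_vector) \<Rightarrow> bool" where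
  "vanishes_at_cusp f \<longleftrightarrow>
     (\<forall>e>0. \<exists>Y>0. \<forall>z. \<bar>Re z\<bar> \<le> 1/2 \<and> Y \<le> Im z \<longrightarrow> norm (f z) < e)"

lemma vanishes_at_cuspI:
  assumes "\<And>z. \<bar>Re z\<bar> \<le> 1/2 \<Longrightarrow> 1 \<le> Im z \<Longrightarrow> norm (f z) \<le> h (Im z)" "(h \<longlongrightarrow> 0) at_top"
  shows "vanishes_at_cusp f"
  unfolding vanishes_at_cusp_def
proof (intro allI impI)
  fix e :: real assume "e > 0"
  with assms(2) have "eventually (\<lambda>y. h y < e) at_top" by (rule order_tendstoD(2))
  then obtain Y where "\<And>y. y \<ge> Y \<Longrightarrow> h y < e" by (auto simp: eventually_at_top_linorder)
  then show "\<exists>Y>0. \<forall>z. \<bar>Re z\<bar> \<le> 1/2 \<and> Y \<le> Im z \<longrightarrow> norm (f z) < e"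
    using assms(1) by (intro exI[of _ "max 1 Y"]) (fastforce intro: le_less_trans)
qed

lemma periodic_of_int:
  assumes "\<And>z. z \<in> uhp \<Longrightarrow> f (z + 1) = f z" "z \<in> uhp"
  shows "f (z + of_int n) = f z"
proof (induction n)
  case (nonneg n)
  show ?case
  proof (induction n)
    case (Suc n)
    show ?case using assms(1)[of "z + of_int (int n)"] assms(2) Suc by (simp add: algebra_simps)
  qed simp
next
  case (neg n)
  show ?case
  proof (induction n)
    case 0
    show ?case using assms(1)[of "z - 1"] assms(2) by simp
  next
    case (Suc n)
    show ?case using assms(1)[of "z + of_int (- int (Suc (Suc n)))"] assms(2) Suc by (simp add: algebra_simps)
  qed
qed

lemma Im_uminus_inverse: "Im (- 1 / z) = Im z / (cmod z)\<^sup>2"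
  by (simp add: Im_divide cmod_power2)

lemma uminus_inverse_in_uhp: "z \<in> uhp \<Longrightarrow> - 1 / z \<in> uhp"
  by (auto simp: Im_uminus_inverse simp del: divide_minus_left intro!: divide_pos_pos)

text \<open>The target region is larger than the usual fundamental domain, which makes the descent
  effective: inside the strip, Im z < 1/2 forces |z|^2 <= 1/2, so inversion at least doubles the
  imaginary part. The induction counts the doublings still needed.\<close>

lemma invariant_reduce:
  assumes T: "\<And>z. z \<in> uhp \<Longrightarrow> N (z + 1) = N z" and S: "\<And>z. z \<in> uhp \<Longrightarrow> N (- 1 / z) = N z"
    and z: "z \<in> uhp"
  obtains z' where "\<bar>Re z'\<bar> \<le> 1/2" "Im z' \<ge> 1/2" "N z' = N z"
proof -
  obtain n where "(1/2) ^ n < Im z" using z real_arch_pow_inv[of "Im z" "1/2"] by auto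
  then have "\<exists>z'. \<bar>Re z'\<bar> \<le> 1/2 \<and> Im z' \<ge> 1/2 \<and> N z' = N z" using z
  proof (induction n arbitrary: z)
    case (0 z)
    let ?z = "z + of_int (- round (Re z))"
    show ?case
      using 0 periodic_of_int[of N, OF T 0(2), of "- round (Re z)"] of_int_round_abs_le[of "Re z"]
      by (intro exI[of _ ?z]) (auto simp: abs_minus_commute)
  next
    case (Suc n z)
    define z1 where "z1 = z + of_int (- round (Re z))"
    have N: "N z1 = N z" unfolding z1_def by (rule periodic_of_int[of N, OF T Suc.prems(2)])
    have z1: "\<bar>Re z1\<bar> \<le> 1/2" "Im z1 = Im z"
      using of_int_round_abs_le[of "Re z"] by (auto simp: z1_def abs_minus_commute)
    show ?case
    proof (cases "Im z1 \<ge> 1/2")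
      case True
      then show ?thesis using N z1 by blast
    next
      case False
      have "(cmod z1)\<^sup>2 \<le> (1/2)\<^sup>2 + (1/2)\<^sup>2"
        unfolding cmod_power2 using z1 False Suc.prems
        by (intro add_mono) (simp_all only: abs_le_square_iff[symmetric], auto)
      moreover have "0 < (cmod z1)\<^sup>2" using z1 Suc.prems by (auto simp: zero_less_power2)
      ultimately have "Im (- 1 / z1) \<ge> 2 * Im z1"
        using Suc.prems(2) z1 by (simp add: Im_uminus_inverse del: divide_minus_left)
          (simp add: field_simps power2_eq_square mult_left_mono[of "(cmod z1)\<^sup>2 * 2" 1 "Im z", simplified power2_eq_square])
      then have *: "(1/2) ^ n < Im (- 1 / z1)" using Suc.prems z1 by simp
      have "z1 \<in> uhp" using z1 Suc.prems by simp
      then show ?thesis using Suc.IH[OF * uminus_inverse_in_uhp] S N by metis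
    qed
  qed
  then show ?thesis using that by blast
qed

text \<open>A positive value \<open>N z1\<close> serves as threshold: above some height
  \<open>N\<close> stays below it, so only a compact rectangle of reduced points competes for the
  maximum.\<close>

lemma invariant_attains_sup:
  fixes N :: "complex \<Rightarrow> real"
  assumes T: "\<And>z. z \<in> uhp \<Longrightarrow> N (z + 1) = N z" and S: "\<And>z. z \<in> uhp \<Longrightarrow> N (- 1 / z) = N z"
    and cont: "continuous_on uhp N" and nonneg: "\<And>z. z \<in> uhp \<Longrightarrow> N z \<ge> 0"
    and cusp: "vanishes_at_cusp N"
  obtains z0 where "z0 \<in> uhp" "\<And>z. z \<in> uhp \<Longrightarrow> N z \<le> N z0"
proof (cases "\<exists>z\<in>uhp. N z > 0")
  case False
  have "N z \<le> N \<i>" if "z \<in> uhp" for z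
  proof -
    have "N z \<le> 0" using False that by force
    then show ?thesis using nonneg[of \<i>] by simp
  qed
  then show ?thesis by (intro that[of \<i>]) auto
next
  case True
  then obtain z1 where z1: "z1 \<in> uhp" "N z1 > 0" by blast
  obtain Y where Y: "Y > 0" "\<And>z. \<bar>Re z\<bar> \<le> 1/2 \<Longrightarrow> Y \<le> Im z \<Longrightarrow> N z < N z1"
    using cusp z1(2) unfolding vanishes_at_cusp_def by fastforce
  define K where "K = cbox (Complex (-1/2) (1/2)) (Complex (1/2) (max Y 1))"
  have K: "z \<in> K \<longleftrightarrow> \<bar>Re z\<bar> \<le> 1/2 \<and> 1/2 \<le> Im z \<and> Im z \<le> max Y 1" for z
    by (auto simp: K_def in_cbox_complex_iff)
  have "K \<subseteq> uhp" by (auto simp: K)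
  then have "continuous_on K N" using cont continuous_on_subset by blast
  moreover have "Complex 0 1 \<in> K" by (simp add: K)
  ultimately obtain z0 where z0: "z0 \<in> K" "\<And>z. z \<in> K \<Longrightarrow> N z \<le> N z0"
    using continuous_attains_sup[of K N] by (auto simp: K_def)
  have in_K: "N z \<le> N z0" if "z \<in> uhp" "N z \<ge> N z1" for z
  proof -
    from invariant_reduce[of N, OF T S that(1)] obtain z' where
      z': "\<bar>Re z'\<bar> \<le> 1/2" "Im z' \<ge> 1/2" "N z' = N z" by metis
    then show ?thesis using z0(2)[of z'] Y(2)[of z'] that by (fastforce simp: K)
  qed
  show ?thesis
    using that[of z0] in_K[of z1] in_K z1 \<open>K \<subseteq> uhp\<close> z0(1) by (metis linear order_trans order_refl subsetD)
qed

section \<open>Fourier expansions in the parameter q\<close>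

lemma DERIV_to_q: "(to_q has_field_derivative 2 * of_real pi * \<i> * to_q z) (at z)"
  unfolding to_q_def[abs_def] by (auto intro!: derivative_eq_intros)

lemma to_q_add_1: "to_q (z + 1) = to_q z"
  by (simp add: to_q_def ring_distribs exp_add)

lemma norm_to_q: "norm (to_q z) = exp (- (2 * pi * Im z))"
  by (simp add: to_q_def)

lemma to_q_nonzero [simp]: "to_q z \<noteq> 0"
  by (simp add: to_q_def)

lemma norm_to_q_less_1: "z \<in> uhp \<Longrightarrow> norm (to_q z) < 1"
  by (simp add: norm_to_q)

text \<open>The function descends to the punctured disc in q. It is defined there through the
  principal logarithm, whose range is just the strip of which \<open>vanishes_at_cusp\<close>
  speaks; so it tends to 0 at q = 0 and the singularity is removable.\<close>

theorem fourier_expansion_exists: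
  assumes holo: "f holomorphic_on uhp" and per: "\<And>z. z \<in> uhp \<Longrightarrow> f (z + 1) = f z"
    and cusp: "vanishes_at_cusp f"
  obtains a where "has_fourier_expansion f a" "a 0 = 0"
proof -
  define L where "L q = Ln q / (2 * of_real pi * \<i>)" for q
  define g where "g q = f (L q)" for q
  have to_q_L: "to_q (L q) = q" if "q \<noteq> 0" for q using that by (simp add: to_q_def L_def)
  have f_cong: "f z = f z'" if "to_q z = to_q z'" "z \<in> uhp" for z z'
  proof -
    have "to_q z' = to_q z" using that(1) by simp
    then obtain n :: int where "2 * of_real pi * \<i> * z' = 2 * of_real pi * \<i> * z + (of_int (2 * n) * pi) * \<i>"
      unfolding to_q_def exp_eq by blast
    then have "2 * of_real pi * \<i> * z' = 2 * of_real pi * \<i> * (z + of_int n)" by (simp add: algebra_simps)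
    then have "z' = z + of_int n" by (simp only: mult_cancel_left) simp
    then show ?thesis using periodic_of_int[of f, OF per that(2)] by simp
  qed
  have L_uhp: "z \<in> uhp" if "to_q z = q" "norm q < 1" for z q
    using that by (auto simp: norm_to_q zero_less_mult_iff)
  have g_to_q: "g (to_q z) = f z" if "z \<in> uhp" for z
    using f_cong[OF to_q_L[symmetric, OF to_q_nonzero] that] by (simp add: g_def)
  have "g holomorphic_on ball 0 1 - {0}"
    unfolding holomorphic_on_def
  proof
    fix q0 :: complex assume q0: "q0 \<in> ball 0 1 - {0}"
    \<comment> \<open>A branch of the logarithm near \<open>q0\<close> that avoids the cut of
      \<open>Ln\<close>; by periodicity of \<open>f\<close> it leads to the same values of
      \<open>g\<close>.\<close>
    define L' where "L' q = (Ln (q / q0) + Ln q0) / (2 * of_real pi * \<i>)" for q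
    define U where "U = ball q0 (norm q0) \<inter> ball 0 1"
    have U: "open U" "q0 \<in> U" using q0 by (auto simp: U_def)
    have nz: "q / q0 \<notin> \<real>\<^sub>\<le>\<^sub>0 \<and> q \<noteq> 0" if "q \<in> U" for q
    proof -
      have "norm (q / q0 - 1) = norm (q - q0) / norm q0" using q0 by (simp add: diff_divide_distrib flip: norm_divide)
      then have "norm (q / q0 - 1) < 1" using that q0 by (simp add: U_def dist_norm norm_minus_commute)
      then have "Re (q / q0) > 0" using abs_Re_le_cmod[of "q / q0 - 1"] by auto
      then show ?thesis by (auto simp: complex_nonpos_Reals_iff)
    qed
    have L': "to_q (L' q) = q" if "q \<in> U" for q
      using nz[OF that] q0 by (simp add: to_q_def L'_def exp_add)
    have "L' holomorphic_on U"
      unfolding L'_def using nz q0 by (intro holomorphic_intros) auto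
    then have "(f \<circ> L') holomorphic_on U"
      by (rule holomorphic_on_compose_gen[OF _ holo]) (use L' L_uhp in \<open>auto simp: U_def\<close>)
    moreover have "(f \<circ> L') q = g q" if "q \<in> U" for q
      using g_to_q[of "L' q"] L'[OF that] L_uhp[of "L' q" q] that by (simp add: U_def)
    ultimately have "g holomorphic_on U" by (simp cong: holomorphic_cong)
    then have "g field_differentiable (at q0)"
      using U by (metis holomorphic_on_imp_differentiable_at)
    then show "g field_differentiable (at q0 within ball 0 1 - {0})"
      by (rule field_differentiable_at_within)
  qed
  moreover have "g \<midarrow>0\<rightarrow> 0"
  proof (rule LIM_I)
    fix e :: real assume "e > 0"
    then obtain Y where Y: "Y > 0" "\<And>z. \<bar>Re z\<bar> \<le> 1/2 \<Longrightarrow> Y \<le> Im z \<Longrightarrow> norm (f z) < e"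
      using cusp unfolding vanishes_at_cusp_def by blast
    have "norm (g q) < e" if q: "q \<noteq> 0" "norm q < exp (- (2 * pi * Y))" for q
    proof -
      have "norm q = exp (- (2 * pi * Im (L q)))" using to_q_L[OF q(1)] norm_to_q[of "L q"] by simp
      then have "Y \<le> Im (L q)" using q(2) by simp
      moreover have "\<bar>Re (L q)\<bar> \<le> 1/2"
        using mpi_less_Im_Ln[OF q(1)] Im_Ln_le_pi[OF q(1)] by (simp add: L_def Re_divide power2_eq_square field_simps abs_le_iff)
      ultimately show ?thesis using Y(2) by (simp add: g_def)
    qed
    then show "\<exists>s>0. \<forall>x. x \<noteq> 0 \<and> norm (x - 0) < s \<longrightarrow> norm (g x - 0) < e"
      by (intro exI[of _ "exp (- (2 * pi * Y))"]) auto
  qed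
  ultimately have h: "(\<lambda>q. if q = 0 then 0 else g q) holomorphic_on ball 0 1" (is "?h holomorphic_on _")
    by (intro removable_singularity) auto
  have "(\<lambda>n. (deriv ^^ n) ?h 0 / fact n * to_q z ^ n) sums f z" if "z \<in> uhp" for z
    using holomorphic_power_series[OF h, of "to_q z"] norm_to_q_less_1[OF that] g_to_q[OF that] by simp
  then show ?thesis
    by (intro that[of "\<lambda>n. (deriv ^^ n) ?h 0 / fact n"]) (auto simp: has_fourier_expansion_def)
qed

lemma fourier_abs_summable:
  assumes "has_fourier_expansion f a" "0 \<le> r" "r < 1"
  shows "summable (\<lambda>n. norm (a n) * r ^ n)"
proof -
  define z where "z = Complex 0 (- ln ((1 + r) / 2) / (2 * pi))"
  have r: "0 < (1 + r) / 2" "(1 + r) / 2 < 1" using assms by auto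
  then have "Im z > 0" by (auto simp: z_def intro!: divide_neg_pos)
  then have "summable (\<lambda>n. a n * to_q z ^ n)"
    using assms(1) by (auto simp: has_fourier_expansion_def dest: sums_summable)
  moreover have "norm (to_q z) = (1 + r) / 2" using r by (simp add: norm_to_q z_def)
  ultimately show ?thesis
    using powser_insidea[of a "to_q z" "of_real r"] assms by (simp add: norm_mult norm_power)
qed

lemma fourier_norm_le:
  assumes f: "has_fourier_expansion f a" "a 0 = 0" and y0: "y0 > 0"
  obtains C where "C \<ge> 0" "\<And>z. Im z \<ge> y0 \<Longrightarrow> norm (f z) \<le> C * exp (- (2 * pi * Im z))"
proof -
  define r where "r = exp (- (2 * pi * y0))"
  have r: "0 < r" "r < 1" using y0 by (auto simp: r_def)
  have "summable (\<lambda>n. norm (a (Suc n)) * r ^ Suc n)"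
    using fourier_abs_summable[OF f(1), of r] r by (subst summable_Suc_iff) auto
  then have sum: "summable (\<lambda>n. norm (a (Suc n)) * r ^ n)"
    using summable_mult_D[of r "\<lambda>n. norm (a (Suc n)) * r ^ n"] r by (simp add: mult_ac)
  show ?thesis
  proof (rule that[of "\<Sum>n. norm (a (Suc n)) * r ^ n"])
    show "0 \<le> (\<Sum>n. norm (a (Suc n)) * r ^ n)" using r by (intro suminf_nonneg sum) simp
    fix z assume z: "Im z \<ge> y0"
    let ?q = "exp (- (2 * pi * Im z))"
    have "(\<lambda>n. a n * to_q z ^ n) sums f z" using f(1) z y0 by (simp add: has_fourier_expansion_def)
    then have "(\<lambda>n. a (Suc n) * to_q z ^ Suc n) sums f z"
      using f(2) by (subst sums_Suc_iff) simp
    then have "f z = (\<Sum>n. a (Suc n) * to_q z ^ Suc n)" by (simp add: sums_iff)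
    moreover have le: "norm (a (Suc n) * to_q z ^ Suc n) \<le> ?q * (norm (a (Suc n)) * r ^ n)" for n
      using z by (auto simp: norm_mult norm_power norm_to_q r_def mult_ac intro!: mult_left_mono power_mono)
    have "norm (\<Sum>n. a (Suc n) * to_q z ^ Suc n) \<le> (\<Sum>n. ?q * (norm (a (Suc n)) * r ^ n))"
      by (intro norm_suminf_le le summable_mult sum)
    ultimately show "norm (f z) \<le> (\<Sum>n. norm (a (Suc n)) * r ^ n) * ?q"
      by (simp only: suminf_mult[OF sum] mult.commute[of _ ?q])
  qed
qed

lemma second_derivative_nonpos_at_max:
  fixes g :: "real \<Rightarrow> real"
  assumes d: "d > 0" and g: "\<And>t. \<bar>t - t0\<bar> < d \<Longrightarrow> (g has_real_derivative g' t) (at t)"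
    and g': "(g' has_real_derivative g'') (at t0)"
    and max: "\<And>t. \<bar>t - t0\<bar> < d \<Longrightarrow> g t \<le> g t0"
  shows "g' t0 = 0" "g'' \<le> 0"
proof -
  show 0: "g' t0 = 0"
    using DERIV_local_max[OF g[of t0] d] max d by (auto simp: abs_minus_commute)
  show "g'' \<le> 0"
  proof (rule ccontr)
    assume "\<not> g'' \<le> 0"
    then obtain e where e: "e > 0" "\<And>h. 0 < h \<Longrightarrow> h < e \<Longrightarrow> 0 < g' (t0 + h)"
      using DERIV_pos_inc_right[OF g'] 0 by auto
    define t1 where "t1 = t0 + min d e / 2"
    have t1: "t0 < t1" "t1 - t0 < d" "t1 - t0 < e" using d e(1) by (auto simp: t1_def min_def)
    have "g t0 < g t1"
    proof (rule DERIV_pos_imp_increasing_open[OF t1(1)])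
      show "\<exists>y. DERIV g x :> y \<and> y > 0" if "t0 < x" "x < t1" for x
        using g[of x] e(2)[of "x - t0"] that t1 by auto
      show "continuous_on {t0..t1} g"
        using t1 by (intro continuous_at_imp_continuous_on ballI DERIV_isCont[OF g]) auto
    qed
    then show False using max[of t1] t1 by simp
  qed
qed

section \<open>A vanishing criterion for cusp forms in terms of their periods\<close>

lemma coeff_one_plus_X_power: "coeff ([:1, 1:] ^ n) i = (of_nat (n choose i) :: 'a::comm_semiring_1)"
proof (cases "i \<le> n")
  case False
  have "degree ([:1, 1::'a:] ^ n) \<le> 1 * n"
    by (metis One_nat_def degree_pCons_eq_if degree_power_le one_neq_zero one_pCons)
  then show ?thesis using False by (simp add: coeff_eq_0 binomial_eq_0)
qed (simp add: coeff_linear_poly_power)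

text \<open>The relation is p(z) = p(z + 1) + (z + 1)^w p(z / (z + 1)) for p = sum of c n z^n.
  Holding at infinitely many points, it is an identity of polynomials, and its coefficients of
  degree 0, 1, 2 determine the sums of c n, n c n and (n choose 2) c n. The weight n (w - n) is the
  combination (w - 1) n - 2 (n choose 2).\<close>

lemma period_relation_coefficients:
  fixes c :: "nat \<Rightarrow> complex"
  assumes w: "w \<ge> 2" and c: "c 0 = 0" "c 2 = 0" and Z: "infinite Z"
    and rel: "\<And>z. z \<in> Z \<Longrightarrow> (\<Sum>n\<le>w. c n * z ^ n)
      = (\<Sum>n\<le>w. c n * (z + 1) ^ n) + (\<Sum>n\<le>w. c n * z ^ n * (z + 1) ^ (w - n))"
  shows "(\<Sum>n\<le>w. c n) = 0" "(\<Sum>n\<le>w. of_nat (n * (w - n)) * c n) = 2 * of_nat (w - 1) * c 1"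
proof -
  define Q where "Q = (\<Sum>n\<le>w. monom (c n) n * [:1, 1:] ^ (w - n))"
  define D where "D = (\<Sum>n\<le>w. monom (c n) n) - (\<Sum>n\<le>w. smult (c n) ([:1, 1:] ^ n)) - Q"
  have "poly D z = 0" if "z \<in> Z" for z
    using rel[OF that] by (simp add: D_def Q_def poly_sum poly_monom add.commute)
  then have "Z \<subseteq> {z. poly D z = 0}" by blast
  then have D: "D = 0" using Z poly_roots_finite finite_subset by blast
  have Q: "coeff Q k = (\<Sum>n\<le>k. c n * of_nat ((w - n) choose (k - n)))" if "k \<le> w" for k
  proof -
    have "coeff Q k = (\<Sum>n\<le>w. if k < n then 0 else c n * of_nat ((w - n) choose (k - n)))"
      by (simp add: Q_def coeff_sum coeff_monom_mult coeff_one_plus_X_power cong: if_cong)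
    also have "\<dots> = (\<Sum>n\<le>k. c n * of_nat ((w - n) choose (k - n)))"
      using that by (intro sum.mono_neutral_cong_right) auto
    finally show ?thesis .
  qed
  have *: "c k = (\<Sum>n\<le>w. of_nat (n choose k) * c n) + coeff Q k" if "k \<le> w" for k
    using arg_cong[OF D, of "\<lambda>p. coeff p k"] that
    by (simp add: D_def coeff_sum coeff_one_plus_X_power mult.commute diff_eq_eq add.commute)
  show 0: "(\<Sum>n\<le>w. c n) = 0" using *[of 0] Q[of 0] c by simp
  have 1: "(\<Sum>n\<le>w. of_nat n * c n) = 0" using *[of 1] Q[of 1] w c by simp
  have 2: "(\<Sum>n\<le>w. of_nat (n choose 2) * c n) = - of_nat (w - 1) * c 1"
  proof -
    have "coeff Q 2 = of_nat (w - 1) * c 1" using Q[of 2] w c by (simp add: numeral_2_eq_2)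
    then have "(\<Sum>n\<le>w. of_nat (n choose 2) * c n) + of_nat (w - 1) * c 1 = 0" using *[of 2] w c by simp
    then show ?thesis by (simp only: mult_minus_left eq_neg_iff_add_eq_0)
  qed
  have "of_nat (n * (w - n)) * c n = of_nat (w - 1) * (of_nat n * c n) - 2 * (of_nat (n choose 2) * c n)"
    if "n \<le> w" for n
  proof -
    have "even (n * (n - 1))" by (cases n) auto
    then have "(n choose 2) * 2 = n * (n - 1)" by (simp add: choose_two)
    from arg_cong[OF this, of "of_nat :: nat \<Rightarrow> complex"]
    have "(of_nat (n choose 2) :: complex) * 2 = of_nat n * (of_nat n - 1)" by (cases n) (simp_all add: algebra_simps)
    then have "2 * (of_nat (n choose 2) * c n) = of_nat n * (of_nat n - 1) * c n"
      by (metis mult.assoc mult.commute)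
    then show ?thesis using that w by (simp add: of_nat_diff algebra_simps)
  qed
  then have "(\<Sum>n\<le>w. of_nat (n * (w - n)) * c n)
      = of_nat (w - 1) * (\<Sum>n\<le>w. of_nat n * c n) - 2 * (\<Sum>n\<le>w. of_nat (n choose 2) * c n)"
    by (simp add: sum_distrib_left sum_subtractf)
  then show "(\<Sum>n\<le>w. of_nat (n * (w - n)) * c n) = 2 * of_nat (w - 1) * c 1"
    using 1 2 by simp
qed

text \<open>Here h is meant as the restriction of a function F to a line through a maximum of |F|^2
  / Im^w, and v is the vertical speed. Comparison with the power of (y + t v) / y clears the
  denominator; the conclusions are the first and second derivative tests at t = 0.\<close>

lemma second_order_max_condition:
  fixes h h1 :: "real \<Rightarrow> complex"
  assumes d: "d > 0" and h: "\<And>t. \<bar>t\<bar> < d \<Longrightarrow> (h has_vector_derivative h1 t) (at t)"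
    and h1: "(h1 has_vector_derivative h2) (at 0)" and y: "y > 0" and w: "w \<ge> 2"
    and le: "\<And>t. \<bar>t\<bar> < d \<Longrightarrow> (cmod (h t))\<^sup>2 \<le> (cmod (h 0))\<^sup>2 * ((y + t * v) / y) ^ w"
  shows "2 * Re (cnj (h 0) * h1 0) = (cmod (h 0))\<^sup>2 * w * v / y"
    "2 * (cmod (h1 0))\<^sup>2 + 2 * Re (cnj (h 0) * h2) \<le> (cmod (h 0))\<^sup>2 * w * (w - 1) * v\<^sup>2 / y\<^sup>2"
proof -
  define G where "G = (cmod (h 0))\<^sup>2"
  define g where "g = (\<lambda>t. (Re (h t))\<^sup>2 + (Im (h t))\<^sup>2 - G * ((y + t * v) / y) ^ w)"
  define g' where "g' = (\<lambda>t. 2 * Re (h t) * Re (h1 t) + 2 * Im (h t) * Im (h1 t)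
      - G * (w * ((y + t * v) / y) ^ (w - 1) * (v / y)))"
  define g'' where "g'' = 2 * (Re (h1 0))\<^sup>2 + 2 * Re (h 0) * Re h2 + 2 * (Im (h1 0))\<^sup>2 + 2 * Im (h 0) * Im h2
      - G * (w * ((w - 1) * ((y + 0 * v) / y) ^ (w - 2) * (v / y)) * (v / y))"
  have dq: "((\<lambda>t. ((y + t * v) / y) ^ n) has_real_derivative n * ((y + t * v) / y) ^ (n - 1) * (v / y)) (at t)" for n t
    using y by (auto intro!: derivative_eq_intros)
  have "(g has_real_derivative g' t) (at t)" if "\<bar>t\<bar> < d" for t
    unfolding g_def g'_def using y
    by (auto intro!: derivative_eq_intros dq h[OF that] simp: mult_ac)
  moreover have "(g' has_real_derivative g'') (at 0)"
  proof -
    have "((\<lambda>t. ((y + t * v) / y) ^ (w - 1)) has_real_derivative (w - 1) * ((y + 0 * v) / y) ^ (w - 2) * (v / y)) (at 0)"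
      using dq[of "w - 1" 0] w by (simp add: numeral_2_eq_2)
    then show ?thesis
      unfolding g'_def g''_def using d y
      by (auto intro!: derivative_eq_intros h h1 simp: power2_eq_square algebra_simps)
  qed
  moreover have "g t \<le> g 0" if "\<bar>t\<bar> < d" for t
    using le[OF that] y by (simp add: g_def cmod_power2 G_def)
  ultimately have "g' 0 = 0" "g'' \<le> 0"
    using second_derivative_nonpos_at_max[of d 0 g g' g''] d by auto
  then show "2 * Re (cnj (h 0) * h1 0) = (cmod (h 0))\<^sup>2 * w * v / y"
    "2 * (cmod (h1 0))\<^sup>2 + 2 * Re (cnj (h 0) * h2) \<le> (cmod (h 0))\<^sup>2 * w * (w - 1) * v\<^sup>2 / y\<^sup>2"
    unfolding G_def[symmetric] cmod_power2[of "h1 0"]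
    using y w by (simp_all add: g'_def g''_def of_nat_diff power2_eq_square algebra_simps add_divide_distrib diff_divide_distrib)
qed

text \<open>M1, M2 and M1', M2' stand for derivatives of a function F in the directions 1 and
  \<open>\<i>\<close> at a maximum of |F|^2 / Im^w; the last hypothesis is a Laplace type equation.
  Adding the two second-order inequalities and multiplying by |M|^2 leaves a square plus a positive
  term bounded by 0.\<close>

lemma no_interior_maximum:
  fixes M M1 M1' M2 M2' :: complex and y w :: real
  assumes y: "y > 0" and w: "w > 0"
    and "2 * Re (cnj M * M1) = 0" "2 * Re (cnj M * M1') = (cmod M)\<^sup>2 * w / y"
    and "2 * (cmod M1)\<^sup>2 + 2 * Re (cnj M * M2) \<le> 0"
    and "2 * (cmod M1')\<^sup>2 + 2 * Re (cnj M * M2') \<le> (cmod M)\<^sup>2 * w * (w - 1) / y\<^sup>2"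
    and "M2 + M2' = of_real (w / y) * (M1' - \<i> * M1)"
  shows "M = 0"
proof (rule ccontr)
  assume "M \<noteq> 0"
  define G where "G = (cmod M)\<^sup>2"
  define \<beta> where "\<beta> = Im (cnj M * M1)"
  define p where "p = w / y"
  have G: "G > 0" using \<open>M \<noteq> 0\<close> by (simp add: G_def)
  have p: "p > 0" using y w by (simp add: p_def)
  have Re1: "Re (cnj M * M1') = G * p / 2" using assms(4) by (simp add: G_def p_def)
  have "G * (cmod M1)\<^sup>2 = (cmod (cnj M * M1))\<^sup>2" by (simp add: G_def norm_mult power_mult_distrib)
  also have "\<dots> = \<beta>\<^sup>2" using assms(3) by (subst cmod_power2) (simp add: \<beta>_def)
  finally have 1: "G * (cmod M1)\<^sup>2 = \<beta>\<^sup>2" .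
  have "G * (cmod M1')\<^sup>2 = (cmod (cnj M * M1'))\<^sup>2" by (simp add: G_def norm_mult power_mult_distrib)
  also have "\<dots> \<ge> (G * p / 2)\<^sup>2"
    by (simp only: cmod_power2 Re1[symmetric] le_add_same_cancel1 zero_le_power2)
  finally have 2: "G * (cmod M1')\<^sup>2 \<ge> (G * p / 2)\<^sup>2" .
  have "Re (cnj M * (M2 + M2')) = p * (Re (cnj M * M1') + \<beta>)"
    unfolding assms(7) p_def \<beta>_def by (simp add: algebra_simps add_divide_distrib diff_divide_distrib)
  then have 3: "Re (cnj M * M2) + Re (cnj M * M2') = p * (G * p / 2 + \<beta>)"
    by (simp only: Re1 distrib_left[of "cnj M"] plus_complex.sel)
  have "2 * (cmod M1)\<^sup>2 + 2 * (cmod M1')\<^sup>2 + 2 * (p * (G * p / 2 + \<beta>)) \<le> G * (p * p) - G * (p / y)"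
  proof -
    have "(cmod M)\<^sup>2 * w * (w - 1) / y\<^sup>2 = G * (p * p) - G * (p / y)"
      using y by (simp add: G_def p_def power2_eq_square field_simps)
    then show ?thesis using assms(5,6) 3 by linarith
  qed
  from mult_left_mono[OF this, of G]
  have "2 * (G * (cmod M1)\<^sup>2) + 2 * (G * (cmod M1')\<^sup>2) + G * (2 * (p * (G * p / 2 + \<beta>))) \<le> G * (G * (p * p)) - G * (G * (p / y))"
    using G by (simp add: algebra_simps)
  then have "2 * \<beta>\<^sup>2 + 2 * (G * p / 2)\<^sup>2 + G * (2 * (p * (G * p / 2 + \<beta>))) + G * (G * (p / y)) \<le> G * (G * (p * p))"
    using 1 2 by linarith
  \<comment> \<open>Completing the square: with the preceding inequality this gives 2 (\<beta> + G p
    / 2)^2 + G^2 p / y <= 0.\<close>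
  moreover have "2 * \<beta>\<^sup>2 + 2 * (G * p / 2)\<^sup>2 + G * (2 * (p * (G * p / 2 + \<beta>))) = 2 * (\<beta> + G * p / 2)\<^sup>2 + G * (G * (p * p))"
    by (simp add: power2_eq_square field_simps)
  moreover have "G * (G * (p / y)) > 0" using G p y by simp
  ultimately show False using zero_le_power2[of "\<beta> + G * p / 2"] by linarith
qed

section \<open>Iterated primitives and Eichler integrals of a cusp form\<close>

context
  fixes f :: "complex \<Rightarrow> complex" and a :: "nat \<Rightarrow> complex"
  assumes exp_f: "has_fourier_expansion f a" and a0: "a 0 = 0"
begin

text \<open>Iterated primitives: \<open>iprim 1 = f\<close>, and \<open>iprim i\<close> is the derivative of \<open>iprim (i + 1)\<close>.\<close>

definition iprim :: "nat \<Rightarrow> complex \<Rightarrow> complex" where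
  "iprim i z = (\<Sum>n. a n * (2 * of_real pi * \<i> * of_nat n) / (2 * of_real pi * \<i> * of_nat n) ^ i * to_q z ^ n)"

text \<open>\<open>eint m i s X\<close> is the integral of \<open>iprim i t * (t - X) ^ m\<close> from \<open>s\<close> to \<open>\<i> \<infinity>\<close>,
  computed by iterated integration by parts.\<close>

primrec eint :: "nat \<Rightarrow> nat \<Rightarrow> complex \<Rightarrow> complex \<Rightarrow> complex" where
  "eint 0 i s X = - iprim (Suc i) s"
| "eint (Suc m) i s X = - iprim (Suc i) s * (s - X) ^ Suc m - of_nat (Suc m) * eint m (Suc i) s X"

lemma eint_unfold: "eint m i s X = - iprim (Suc i) s * (s - X) ^ m - of_nat m * eint (m - 1) (Suc i) s X"
  by (cases m) auto

lemma iprim_expansion: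
  "has_fourier_expansion (iprim i) (\<lambda>n. a n * (2 * of_real pi * \<i> * of_nat n) / (2 * of_real pi * \<i> * of_nat n) ^ i)"
    (is "has_fourier_expansion _ ?c")
  unfolding has_fourier_expansion_def
proof
  fix z assume z: "z \<in> uhp"
  let ?r = "norm (to_q z)"
  define r where "r = (1 + ?r) / 2"
  have r: "?r < r" "r < 1" "0 \<le> r" using norm_to_q_less_1[OF z] by (auto simp: r_def)
  have "summable (\<lambda>n. of_real (norm (a n)) * complex_of_real r ^ n)"
    using fourier_abs_summable[OF exp_f r(3,2)] summable_of_real[of "\<lambda>n. norm (a n) * r ^ n"] by simp
  then have "summable (\<lambda>n. diffs (\<lambda>n. of_real (norm (a n))) n * complex_of_real ?r ^ n)"
    using r by (intro termdiff_converges[of _ r]) (auto intro: powser_inside)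
  then have "summable (\<lambda>n. complex_of_real (norm (a (Suc n)) * of_nat (Suc n) * ?r ^ n))"
    by (simp add: diffs_def mult_ac)
  then have "summable (\<lambda>n. norm (a (Suc n)) * of_nat (Suc n) * ?r ^ n)"
    by (simp only: summable_of_real_iff)
  from summable_mult[OF this, of "2 * pi * ?r"]
  have s: "summable (\<lambda>n. norm (a (Suc n)) * norm (2 * of_real pi * \<i> * of_nat (Suc n)) * ?r ^ Suc n)"
    by (simp add: norm_mult mult_ac del: of_nat_Suc)
  have "norm (?c (Suc n) * to_q z ^ Suc n)
      \<le> norm (a (Suc n)) * norm (2 * of_real pi * \<i> * of_nat (Suc n)) * ?r ^ Suc n" for n
  proof -
    let ?t = "2 * of_real pi * \<i> * of_nat (Suc n) :: complex"
    have "1 * 1 \<le> (2 * pi) * real (Suc n)" using pi_gt3 by (intro mult_mono) auto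
    then have "1 \<le> norm ?t ^ i" by (intro one_le_power) (simp add: norm_mult del: of_nat_Suc)
    then have "norm (a (Suc n)) * norm ?t / norm ?t ^ i \<le> norm (a (Suc n)) * norm ?t / 1"
      by (intro divide_left_mono mult_nonneg_nonneg) auto
    then show ?thesis
      by (simp only: norm_mult norm_divide norm_power div_by_1) (intro mult_right_mono, auto)
  qed
  from summable_comparison_test'[OF s this] have "summable (\<lambda>n. ?c (Suc n) * to_q z ^ Suc n)" .
  then show "(\<lambda>n. ?c n * to_q z ^ n) sums iprim i z"
    unfolding iprim_def by (subst (asm) summable_Suc_iff) (rule summable_sums)
qed

lemma iprim_1: assumes "z \<in> uhp" shows "iprim 1 z = f z"
proof -
  have "iprim 1 z = (\<Sum>n. a n * to_q z ^ n)"
    unfolding iprim_def by (intro suminf_cong) (use a0 in \<open>auto simp: gr0_conv_Suc\<close>)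
  then show ?thesis using exp_f assms by (simp add: has_fourier_expansion_def sums_iff)
qed

lemma DERIV_iprim:
  assumes z: "z \<in> uhp" shows "(iprim (Suc i) has_field_derivative iprim i z) (at z)"
proof -
  let ?p = "\<lambda>n. 2 * of_real pi * \<i> * of_nat n :: complex"
  define c where "c = (\<lambda>n. a n * ?p n / ?p n ^ Suc i)"
  define r where "r = (1 + norm (to_q z)) / 2"
  have r: "norm (to_q z) < r" "r < 1" "0 < r" using norm_to_q_less_1[OF z] by (auto simp: r_def add_pos_nonneg)
  define y where "y = Complex 0 (- ln r / (2 * pi))"
  have y: "y \<in> uhp" "norm (to_q y) = r" using r by (auto simp: y_def norm_to_q intro!: divide_neg_pos)
  have sum: "summable (\<lambda>n. c n * to_q y ^ n)"
    using iprim_expansion[of "Suc i"] y by (auto simp: has_fourier_expansion_def c_def dest: sums_summable)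
  have "((\<lambda>x. \<Sum>n. c n * x ^ n) has_field_derivative (\<Sum>n. diffs c n * to_q z ^ n)) (at (to_q z))"
    using termdiffs_strong[OF sum] r y by simp
  from DERIV_chain2[OF this DERIV_to_q]
  have 1: "(iprim (Suc i) has_field_derivative (\<Sum>n. diffs c n * to_q z ^ n) * (2 * of_real pi * \<i> * to_q z)) (at z)"
    by (simp only: c_def iprim_def[abs_def])
  have "summable (\<lambda>n. diffs c n * to_q z ^ n)"
    using termdiff_converges[of "to_q z" r c] r powser_inside[OF sum] y by simp
  from sums_mult[OF summable_sums[OF this], of "2 * of_real pi * \<i> * to_q z"]
  have "(\<lambda>n. ?p (Suc n) * c (Suc n) * to_q z ^ Suc n) sums
      ((2 * of_real pi * \<i> * to_q z) * (\<Sum>n. diffs c n * to_q z ^ n))"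
    by (simp add: diffs_def mult_ac del: of_nat_Suc)
  moreover have "?p (Suc n) * c (Suc n) = a (Suc n) * ?p (Suc n) / ?p (Suc n) ^ i" for n
  proof -
    have "?p (Suc n) \<noteq> 0" by (simp del: of_nat_Suc)
    then show ?thesis by (simp add: c_def field_simps del: of_nat_Suc)
  qed
  ultimately have "(\<lambda>n. a (Suc n) * ?p (Suc n) / ?p (Suc n) ^ i * to_q z ^ Suc n) sums
      ((2 * of_real pi * \<i> * to_q z) * (\<Sum>n. diffs c n * to_q z ^ n))"
    by (simp only:)
  then have "(\<lambda>n. a n * ?p n / ?p n ^ i * to_q z ^ n) sums
      ((2 * of_real pi * \<i> * to_q z) * (\<Sum>n. diffs c n * to_q z ^ n))"
    using a0 by (subst (asm) sums_Suc_iff) simp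
  then have "iprim i z = (2 * of_real pi * \<i> * to_q z) * (\<Sum>n. diffs c n * to_q z ^ n)"
    by (simp add: iprim_def sums_iff)
  then show ?thesis using 1 by (simp add: mult.commute)
qed

text \<open>The endpoint \<open>s\<close> and the parameter \<open>X\<close> move together with
  complex speeds \<open>u\<close> and \<open>v\<close>: the endpoint contributes minus the
  integrand, the parameter lowers the exponent. Both must move because \<open>refl_eint\<close> ties
  the two arguments to each other.\<close>

lemma DERIV_eint_line:
  assumes "s + t * u \<in> uhp"
  shows "((\<lambda>t. eint m i (s + t * u) (X + t * v)) has_field_derivative
    - u * iprim i (s + t * u) * (s + t * u - (X + t * v)) ^ m - v * of_nat m * eint (m - 1) i (s + t * u) (X + t * v)) (at t)"
proof (induction m arbitrary: i)
  have d: "((\<lambda>t. iprim (Suc i) (s + t * u)) has_field_derivative iprim i (s + t * u) * u) (at t)" for i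
    by (rule DERIV_chain2[where f = "iprim (Suc i)" and g = "\<lambda>t. s + t * u", OF DERIV_iprim[OF assms]])
      (auto intro!: derivative_eq_intros)
  {
    case 0
    show ?case using DERIV_minus[OF d[of i]] by (simp add: mult.commute)
  next
    case (Suc m)
    let ?s = "s + t * u" and ?X = "X + t * v"
    have "((\<lambda>t. s + t * u - (X + t * v)) has_field_derivative u - v) (at t)"
      by (auto intro!: derivative_eq_intros)
    from DERIV_power_Suc[OF this, of m]
    have "((\<lambda>t. (s + t * u - (X + t * v)) ^ Suc m) has_field_derivative of_nat (Suc m) * (?s - ?X) ^ m * (u - v)) (at t)"
      by (simp add: mult_ac)
    from DERIV_diff[OF DERIV_mult[OF DERIV_minus[OF d[of i]] this] DERIV_cmult[OF Suc, of "of_nat (Suc m)" "Suc i"]]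
    show ?case
      by (rule back_subst) (simp add: eint_unfold[of m i] ring_distribs del: of_nat_Suc, simp add: algebra_simps)
  }
qed

lemma DERIV_eint: "s \<in> uhp \<Longrightarrow> ((\<lambda>s. eint m i s X) has_field_derivative - iprim i s * (s - X) ^ m) (at s)"
  using DERIV_eint_line[of 0 s 1 m i X 0] by simp

lemma eint_periodic: "eint m i (s + 1) (X + 1) = eint m i s X"
  by (induction m arbitrary: i) (simp_all add: iprim_def to_q_add_1)

text \<open>For s = \<open>\<i>\<close> the coefficients \<open>eint j i s 0\<close> are the period
  integrals from \<open>\<i>\<close>, so the integral becomes a period polynomial in
  \<open>X\<close>.\<close>

lemma eint_binomial: "eint m i s X = (\<Sum>j\<le>m. of_nat (m choose j) * (- X) ^ (m - j) * eint j i s 0)"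
proof (induction m arbitrary: i)
  case (Suc m)
  have 1: "(\<Sum>j\<le>Suc m. of_nat (Suc m choose j) * (- X) ^ (Suc m - j) * (of_nat j * eint (j - 1) (Suc i) s 0))
     = of_nat (Suc m) * (\<Sum>j\<le>m. of_nat (m choose j) * (- X) ^ (m - j) * eint j (Suc i) s 0)"
  proof -
    have "of_nat (Suc m choose Suc j) * (of_nat (Suc j) :: complex) = of_nat (Suc m) * of_nat (m choose j)" for j
      by (simp only: flip: of_nat_mult) (metis Suc_times_binomial mult.commute)
    then have *: "of_nat (Suc m choose Suc j) * x * ((of_nat (Suc j) :: complex) * y) = of_nat (Suc m) * (of_nat (m choose j) * x * y)"
      for j x y by (metis (no_types, opaque_lifting) mult.assoc mult.left_commute)
    show ?thesis
      unfolding sum_distrib_left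
      by (subst sum.atMost_Suc_shift)
        (simp only: * diff_Suc_Suc diff_Suc_1 of_nat_0 mult_zero_left mult_zero_right add_0)
  qed
  have "(s - X) ^ Suc m = (\<Sum>j\<le>Suc m. of_nat (Suc m choose j) * (- X) ^ (Suc m - j) * s ^ j)"
    using binomial_ring[of s "- X" "Suc m"] by (simp add: mult_ac)
  moreover have "(\<Sum>j\<le>Suc m. of_nat (Suc m choose j) * (- X) ^ (Suc m - j) * eint j i s 0)
     = - iprim (Suc i) s * (\<Sum>j\<le>Suc m. of_nat (Suc m choose j) * (- X) ^ (Suc m - j) * s ^ j)
       - (\<Sum>j\<le>Suc m. of_nat (Suc m choose j) * (- X) ^ (Suc m - j) * (of_nat j * eint (j - 1) (Suc i) s 0))"
    unfolding sum_distrib_left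
    by (subst eint_unfold) (simp add: ring_distribs sum_subtractf mult_ac sum_negf del: sum.atMost_Suc)
  ultimately show ?case using 1 Suc[of "Suc i"] by (simp only: eint.simps)
qed simp

lemma eint_decay:
  obtains C where "C \<ge> 0" "\<And>s X. Im s \<ge> 1/2 \<Longrightarrow> norm (eint m i s X) \<le> C * (1 + norm (s - X)) ^ m * exp (- (2 * pi * Im s))"
proof -
  have "\<exists>C\<ge>0. \<forall>s X. Im s \<ge> 1/2 \<longrightarrow> norm (eint m i s X) \<le> C * (1 + norm (s - X)) ^ m * exp (- (2 * pi * Im s))"
  proof (induction m arbitrary: i)
    case 0
    show ?case
      by (rule fourier_norm_le[OF iprim_expansion[of "Suc i"], of "1/2"]) (use a0 in auto)
  next
    case (Suc m)
    obtain C1 where C1: "C1 \<ge> 0" "\<And>s. Im s \<ge> 1/2 \<Longrightarrow> norm (iprim (Suc i) s) \<le> C1 * exp (- (2 * pi * Im s))"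
      by (rule fourier_norm_le[OF iprim_expansion[of "Suc i"], of "1/2"]) (use a0 in auto)
    obtain C2 where C2: "C2 \<ge> 0" "\<And>s X. Im s \<ge> 1/2 \<Longrightarrow>
        norm (eint m (Suc i) s X) \<le> C2 * (1 + norm (s - X)) ^ m * exp (- (2 * pi * Im s))"
      using Suc by blast
    show ?case
    proof (intro exI[of _ "C1 + of_nat (Suc m) * C2"] conjI allI impI)
      show "0 \<le> C1 + of_nat (Suc m) * C2" using C1 C2 by simp
      fix s X assume s: "Im s \<ge> 1/2"
      let ?e = "exp (- (2 * pi * Im s))" and ?d = "1 + norm (s - X)"
      have "norm (eint (Suc m) i s X) \<le> norm (iprim (Suc i) s) * norm (s - X) ^ Suc m + of_nat (Suc m) * norm (eint m (Suc i) s X)"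
        unfolding eint.simps by (rule order_trans[OF norm_triangle_ineq4]) (simp add: norm_mult norm_power del: of_nat_Suc)
      also have "\<dots> \<le> (C1 * ?e) * ?d ^ Suc m + of_nat (Suc m) * (C2 * ?d ^ Suc m * ?e)"
      proof (intro add_mono mult_mono power_mono)
        have "C2 * ?d ^ m * ?e \<le> C2 * ?d ^ Suc m * ?e"
          using C2(1) by (intro mult_right_mono mult_left_mono power_increasing) auto
        then show "norm (eint m (Suc i) s X) \<le> C2 * ?d ^ Suc m * ?e" using C2(2)[OF s, of X] by linarith
      qed (use C1 s in auto)
      finally show "norm (eint (Suc m) i s X) \<le> (C1 + of_nat (Suc m) * C2) * ?d ^ Suc m * ?e"
        by (simp add: algebra_simps)
    qed
  qed
  then show ?thesis using that by blast
qed

lemma eint_tendsto_0: "((\<lambda>y. eint m i (Complex 0 y) 0) \<longlongrightarrow> 0) at_top"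
proof -
  obtain C where C: "\<And>s X. Im s \<ge> 1/2 \<Longrightarrow> norm (eint m i s X) \<le> C * (1 + norm (s - X)) ^ m * exp (- (2 * pi * Im s))"
    and C0: "C \<ge> 0" using eint_decay by blast
  have "((\<lambda>y. C * 2 ^ m * (y ^ m / exp y)) \<longlongrightarrow> C * 2 ^ m * 0) at_top"
    by (intro tendsto_intros tendsto_power_div_exp_0)
  then have lim: "((\<lambda>y. C * 2 ^ m * (y ^ m / exp y)) \<longlongrightarrow> 0) at_top" by simp
  show ?thesis
  proof (rule Lim_null_comparison[OF _ lim])
    show "\<forall>\<^sub>F y in at_top. norm (eint m i (Complex 0 y) 0) \<le> C * 2 ^ m * (y ^ m / exp y)"
      using eventually_ge_at_top[of 1]
    proof eventually_elim
      case (elim y)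
      have "norm (eint m i (Complex 0 y) 0) \<le> C * (1 + norm (Complex 0 y)) ^ m * exp (- (2 * pi * y))"
        using C[of "Complex 0 y" 0] elim by simp
      also have "\<dots> \<le> C * (2 * y) ^ m * exp (- y)"
        using elim C0 pi_gt3 mult_right_mono[of 1 "2 * pi" y]
        by (intro mult_mono power_mono mult_nonneg_nonneg) (auto simp: cmod_def)
      finally show ?case by (simp add: power_mult_distrib exp_minus divide_inverse)
    qed
  qed
qed

section \<open>Period polynomials and the reflected Eichler integral\<close>

context
  fixes w :: nat
  assumes w: "even w" "w \<ge> 2"
    and f_S: "\<And>z. z \<in> uhp \<Longrightarrow> f (- 1 / z) = z ^ (w + 2) * f z"
begin

text \<open>The form f(t) (t - X)^w dt is carried to itself, up to X^w, when t and X are both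
  inverted. Hence the difference does not depend on the base point, and \<open>\<i>\<close> is
  chosen because inversion fixes it.\<close>

lemma eint_cocycle:
  assumes "s \<in> uhp" "X \<noteq> 0"
  shows "eint w 1 s X - X ^ w * eint w 1 (- 1 / s) (- 1 / X)
    = eint w 1 \<i> X - X ^ w * eint w 1 \<i> (- 1 / X)"
proof -
  let ?r = "\<lambda>s. eint w 1 s X - X ^ w * eint w 1 (- 1 / s) (- 1 / X)"
  have "(?r has_field_derivative 0) (at z within uhp)" if z: "z \<in> uhp" for z
  proof -
    have nz: "z \<noteq> 0" using z by auto
    have uz: "- 1 / z \<in> uhp" using uminus_inverse_in_uhp[OF z] .
    have "((\<lambda>s. - 1 / s) has_field_derivative 1 / z ^ 2) (at z)"
      using nz by (auto intro!: derivative_eq_intros simp: power2_eq_square)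
    from DERIV_diff[OF DERIV_eint[OF z, of w 1 X]
        DERIV_cmult[OF DERIV_chain2[where f = "\<lambda>s. eint w 1 s (- 1 / X)", OF DERIV_eint[OF uz] this], of "X ^ w"]]
    have "(?r has_field_derivative - iprim 1 z * (z - X) ^ w
        - X ^ w * (- iprim 1 (- 1 / z) * (- 1 / z - - 1 / X) ^ w * (1 / z ^ 2))) (at z)" .
    moreover have "X ^ w * (- iprim 1 (- 1 / z) * (- 1 / z - - 1 / X) ^ w * (1 / z ^ 2)) = - iprim 1 z * (z - X) ^ w"
    proof -
      have "- 1 / z - - 1 / X = (z - X) / (z * X)" using nz assms by (simp add: field_simps)
      then show ?thesis
        unfolding iprim_1[OF uz] iprim_1[OF z] f_S[OF z] using nz assms
        by (simp add: power_divide power_mult_distrib power_add field_simps power2_eq_square)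
    qed
    ultimately show ?thesis by (simp add: has_field_derivative_at_within)
  qed
  then obtain c where "\<And>s. s \<in> uhp \<Longrightarrow> ?r s = c"
    using has_field_derivative_zero_constant[of uhp ?r] convex_halfspace_Im_gt by blast
  from this[OF assms(1)] this[of \<i>] show ?thesis by simp
qed

text \<open>The Eichler integral of \<open>f\<close> minus its reflection in the imaginary axis, taken at the
  point \<open>z\<close> itself: a function of weight \<open>-w\<close> up to the odd part of the period polynomial.\<close>

definition refl_eint :: "complex \<Rightarrow> complex" where
  "refl_eint z = eint w 1 z z - eint w 1 (- cnj z) (- z)"

lemma refl_eint_periodic: "refl_eint (z + 1) = refl_eint z"
proof -
  have "- cnj (z + 1) = - cnj z - 1" "- (z + 1) = - z - 1" by simp_all
  then show ?thesis
    using eint_periodic[of w 1 z z] eint_periodic[of w 1 "- cnj z - 1" "- z - 1"]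
    by (simp only: refl_eint_def) simp
qed

text \<open>Subtracting the cocycle at -z from the one at z removes the even powers. For odd n the
  sum of the two integrals from \<open>\<i>\<close> is the n-th moment of f along the whole
  imaginary axis, the half below \<open>\<i>\<close> having been inverted.\<close>

lemma refl_eint_S:
  assumes z: "z \<in> uhp"
  shows "refl_eint z - z ^ w * refl_eint (- 1 / z)
    = - 2 * (\<Sum>n\<le>w. (if odd n then of_nat (w choose n) * (eint n 1 \<i> 0 + eint (w - n) 1 \<i> 0) else 0) * z ^ n)"
proof -
  have nz: "z \<noteq> 0" using z by auto
  let ?T = "\<lambda>j. eint j 1 \<i> 0"
  define r where "r X = eint w 1 \<i> X - X ^ w * eint w 1 \<i> (- 1 / X)" for X
  have r: "r X = (\<Sum>j\<le>w. of_nat (w choose j) * ?T j * ((- X) ^ (w - j) - X ^ j))" if "X \<noteq> 0" for X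
  proof -
    have "X ^ w * (1 / X) ^ (w - j) = X ^ j" if "j \<le> w" for j
      using power_add[of X "w - j" j] \<open>X \<noteq> 0\<close> that by (simp add: power_divide)
    then have "of_nat (w choose j) * ?T j * ((- X) ^ (w - j) - X ^ j) = of_nat (w choose j) * (- X) ^ (w - j) * ?T j
        - X ^ w * (of_nat (w choose j) * (- (- 1 / X)) ^ (w - j) * ?T j)" if "j \<le> w" for j
      using that by (simp add: algebra_simps)
    then show ?thesis
      unfolding r_def eint_binomial[of w 1 \<i> X] eint_binomial[of w 1 \<i> "- 1 / X"]
      by (simp add: sum_distrib_left sum_subtractf)
  qed
  have "refl_eint z - z ^ w * refl_eint (- 1 / z)
     = (eint w 1 z z - z ^ w * eint w 1 (- 1 / z) (- 1 / z))
       - (eint w 1 (- cnj z) (- z) - (- z) ^ w * eint w 1 (- 1 / (- cnj z)) (- 1 / (- z)))"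
    using w(1) by (simp add: refl_eint_def algebra_simps)
  also have "\<dots> = r z - r (- z)"
    using eint_cocycle[OF z nz] eint_cocycle[of "- cnj z" "- z"] z nz by (simp only: r_def) simp
  finally have "refl_eint z - z ^ w * refl_eint (- 1 / z)
      = (\<Sum>j\<le>w. of_nat (w choose j) * ?T j * ((- z) ^ (w - j) - z ^ j - z ^ (w - j) + (- z) ^ j))"
    using r[OF nz] r[of "- z"] nz
    by (simp add: sum_subtractf[symmetric]) (intro sum.cong, auto simp: algebra_simps)
  also have "\<dots> = (\<Sum>j\<le>w. if odd j then - 2 * of_nat (w choose j) * ?T j * z ^ j else 0)
     + (\<Sum>j\<le>w. if odd j then - 2 * of_nat (w choose j) * ?T j * z ^ (w - j) else 0)"
    unfolding sum.distrib[symmetric] using w(1) by (intro sum.cong) (auto simp: algebra_simps)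
  also have "(\<Sum>j\<le>w. if odd j then - 2 * of_nat (w choose j) * ?T j * z ^ (w - j) else 0)
     = (\<Sum>j\<le>w. if odd j then - 2 * of_nat (w choose j) * ?T (w - j) * z ^ j else 0)"
    by (rule sum.reindex_bij_witness[of _ "\<lambda>j. w - j" "\<lambda>j. w - j"])
      (use w(1) in \<open>auto simp: binomial_symmetric[symmetric]\<close>)
  finally show ?thesis
    unfolding sum.distrib[symmetric] sum_distrib_left
    by (rule trans) (intro sum.cong, auto simp: algebra_simps)
qed

lemma refl_eint_decay:
  obtains C where "C \<ge> 0" "\<And>z. Im z \<ge> 1 \<Longrightarrow> norm (refl_eint z) \<le> C * (Im z ^ w * exp (- Im z))"
proof -
  obtain C where C0: "C \<ge> 0" and C: "\<And>s X. Im s \<ge> 1/2 \<Longrightarrow>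
      norm (eint w 1 s X) \<le> C * (1 + norm (s - X)) ^ w * exp (- (2 * pi * Im s))"
    using eint_decay by blast
  show ?thesis
  proof (rule that[of "2 * (C * 3 ^ w)"])
    fix z assume z: "Im z \<ge> 1"
    have le: "norm (eint w 1 s X) \<le> C * 3 ^ w * (Im z ^ w * exp (- Im z))"
      if "Im s = Im z" "norm (s - X) \<le> 2 * Im z" for s X
    proof -
      have "norm (eint w 1 s X) \<le> C * (1 + norm (s - X)) ^ w * exp (- (2 * pi * Im s))"
        using C[of s X] z that by simp
      also have "\<dots> \<le> C * (3 * Im z) ^ w * exp (- Im z)"
        using z that C0 pi_gt3 mult_right_mono[of 1 "2 * pi" "Im z"]
        by (intro mult_mono power_mono mult_nonneg_nonneg) auto
      finally show ?thesis by (simp add: power_mult_distrib mult_ac)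
    qed
    have "- cnj z - - z = 2 * \<i> * of_real (Im z)" by (auto simp: complex_eq_iff)
    then have "norm (- cnj z - - z) = 2 * Im z" using z by (simp add: norm_mult)
    then show "norm (refl_eint z) \<le> 2 * (C * 3 ^ w) * (Im z ^ w * exp (- Im z))"
      using le[of z z] le[of "- cnj z" "- z"] z
        norm_triangle_ineq4[of "eint w 1 z z" "eint w 1 (- cnj z) (- z)"]
      by (simp add: refl_eint_def)
  qed (use C0 in simp)
qed

text \<open>In the first Eichler integral the two arguments coincide, so the boundary term with (s -
  X)^w vanishes and only the moving parameter contributes. In the reflected one s - X = z - cnj z,
  and the boundary terms survive.\<close>

lemma refl_eint_line:
  fixes z u :: complex
  defines "d1 \<equiv> \<lambda>t. - u * of_nat w * eint (w - 1) 1 (z + t * u) (z + t * u)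
       - (cnj u * iprim 1 (- cnj z + t * - cnj u) * ((- cnj z + t * - cnj u) - (- z + t * - u)) ^ w
         + u * of_nat w * eint (w - 1) 1 (- cnj z + t * - cnj u) (- z + t * - u))"
  shows "z + of_real t * u \<in> uhp \<Longrightarrow>
      ((\<lambda>t. refl_eint (z + of_real t * u)) has_vector_derivative d1 (of_real t)) (at t)"
    and "z \<in> uhp \<Longrightarrow> ((\<lambda>t. d1 (of_real t)) has_vector_derivative
      (u\<^sup>2 * of_nat w * of_nat (w - 1) * eint (w - 2) 1 z z
       - (cnj u * (- cnj u * iprim 0 (- cnj z) * (z - cnj z) ^ w
            + iprim 1 (- cnj z) * (of_nat w * (z - cnj z) ^ (w - 1) * (u - cnj u)))
         + u * of_nat w * (cnj u * iprim 1 (- cnj z) * (z - cnj z) ^ (w - 1)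
            + u * of_nat (w - 1) * eint (w - 2) 1 (- cnj z) (- z))))) (at 0)"
proof -
  assume t: "z + of_real t * u \<in> uhp"
  then have t': "- cnj z + of_real t * - cnj u \<in> uhp" by simp
  have "((\<lambda>t. eint w 1 (z + t * u) (z + t * u) - eint w 1 (- cnj z + t * - cnj u) (- z + t * - u))
      has_field_derivative d1 (of_real t)) (at (of_real t))"
    using DERIV_diff[OF DERIV_eint_line[OF t, of w 1 z u] DERIV_eint_line[OF t', of w 1 "- z" "- u"]] w(2)
    by (rule_tac back_subst) (auto simp: d1_def algebra_simps)
  from has_vector_derivative_real_field[OF this]
  show "((\<lambda>t. refl_eint (z + of_real t * u)) has_vector_derivative d1 (of_real t)) (at t)"
    by (simp add: refl_eint_def)
next
  assume z: "z \<in> uhp"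
  have z1: "z + 0 * u \<in> uhp" and z2: "- cnj z + 0 * - cnj u \<in> uhp" using z by simp_all
  have w1: "w - 1 > 0" using w by simp
  have e1: "((\<lambda>t. - u * of_nat w * eint (w - 1) 1 (z + t * u) (z + t * u)) has_field_derivative
      - u * of_nat w * (- u * of_nat (w - 1) * eint (w - 2) 1 z z)) (at 0)"
    using DERIV_cmult[OF DERIV_eint_line[OF z1, of "w - 1" 1 z u], of "- u * of_nat w"] w1
    by (simp add: numeral_2_eq_2 power_0_left)
  have e2: "((\<lambda>t. u * of_nat w * eint (w - 1) 1 (- cnj z + t * - cnj u) (- z + t * - u)) has_field_derivative
      u * of_nat w * (cnj u * iprim 1 (- cnj z) * (z - cnj z) ^ (w - 1) + u * of_nat (w - 1) * eint (w - 2) 1 (- cnj z) (- z))) (at 0)"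
    using DERIV_cmult[OF DERIV_eint_line[OF z2, of "w - 1" 1 "- z" "- u"], of "u * of_nat w"]
    by (simp add: numeral_2_eq_2)
  have "((\<lambda>t. iprim 1 (- cnj z + t * - cnj u)) has_field_derivative iprim 0 (- cnj z) * - cnj u) (at 0)"
  proof -
    have "((\<lambda>t. - cnj z + t * - cnj u) has_field_derivative - cnj u) (at 0)"
      by (auto intro!: derivative_eq_intros)
    from DERIV_chain2[where f = "iprim (Suc 0)" and g = "\<lambda>t. - cnj z + t * - cnj u", OF DERIV_iprim[OF z2] this]
    show ?thesis by simp
  qed
  note eA = this
  have eB: "((\<lambda>t. ((- cnj z + t * - cnj u) - (- z + t * - u)) ^ w) has_field_derivative
      of_nat w * (z - cnj z) ^ (w - 1) * (u - cnj u)) (at 0)"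
    by (auto intro!: derivative_eq_intros)
  have e3: "((\<lambda>t. iprim 1 (- cnj z + t * - cnj u) * ((- cnj z + t * - cnj u) - (- z + t * - u)) ^ w) has_field_derivative
      (- cnj u * iprim 0 (- cnj z) * (z - cnj z) ^ w
            + iprim 1 (- cnj z) * (of_nat w * (z - cnj z) ^ (w - 1) * (u - cnj u)))) (at 0)"
    by (rule back_subst[where P = "\<lambda>d. (_ has_field_derivative d) _", OF DERIV_mult[OF eA eB]]) (simp add: mult_ac)
  from DERIV_diff[OF e1 DERIV_add[OF DERIV_cmult[OF e3, of "cnj u"] e2]]
  have "(d1 has_field_derivative
      (u\<^sup>2 * of_nat w * of_nat (w - 1) * eint (w - 2) 1 z z
       - (cnj u * (- cnj u * iprim 0 (- cnj z) * (z - cnj z) ^ w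
            + iprim 1 (- cnj z) * (of_nat w * (z - cnj z) ^ (w - 1) * (u - cnj u)))
         + u * of_nat w * (cnj u * iprim 1 (- cnj z) * (z - cnj z) ^ (w - 1)
            + u * of_nat (w - 1) * eint (w - 2) 1 (- cnj z) (- z))))) (at (of_real 0))"
    unfolding d1_def by (rule_tac back_subst[where P = "\<lambda>d. (_ has_field_derivative d) _"])
      (simp_all add: mult.assoc power2_eq_square mult.left_commute)
  from has_vector_derivative_real_field[OF this]
  show "((\<lambda>t. d1 (of_real t)) has_vector_derivative
      (u\<^sup>2 * of_nat w * of_nat (w - 1) * eint (w - 2) 1 z z
       - (cnj u * (- cnj u * iprim 0 (- cnj z) * (z - cnj z) ^ w
            + iprim 1 (- cnj z) * (of_nat w * (z - cnj z) ^ (w - 1) * (u - cnj u)))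
         + u * of_nat w * (cnj u * iprim 1 (- cnj z) * (z - cnj z) ^ (w - 1)
            + u * of_nat (w - 1) * eint (w - 2) 1 (- cnj z) (- z))))) (at 0)"
    by simp
qed

text \<open>The two directional derivatives combine to the derivative with respect to cnj z, in
  which only the boundary term of the reflected integral remains. The base point is
  \<open>- cnj z\<close>, since the reflected integral there evaluates f at z.\<close>

lemma refl_eint_zero_imp_zero:
  assumes 0: "\<And>z. z \<in> uhp \<Longrightarrow> refl_eint z = 0" and z: "z \<in> uhp"
  shows "f z = 0"
proof -
  have der0: "D = 0" if D: "((\<lambda>t. refl_eint (- cnj z + of_real t * u)) has_vector_derivative D) (at 0)" for D u
  proof -
    have "open {t. 0 < Im (- cnj z + of_real t * u)}" by (intro open_Collect_less continuous_intros)
    then have "((\<lambda>t. 0) has_vector_derivative D) (at 0)"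
      by (rule has_vector_derivative_transform_within_open[OF D]) (use z 0 in auto)
    then show ?thesis by (rule vector_derivative_unique_at) (rule has_vector_derivative_const)
  qed
  define e1 where "e1 = of_nat w * eint (w - 1) 1 (- cnj z) (- cnj z)"
  define e2 where "e2 = of_nat w * eint (w - 1) 1 z (cnj z)"
  define e where "e = iprim 1 z * (z - cnj z) ^ w"
  have "- e1 - (e + e2) = 0"
    using der0[OF refl_eint_line(1)[of "- cnj z" 0 1, simplified of_real_0]] z by (simp add: e1_def e2_def e_def)
  moreover have "- \<i> * e1 - (- \<i> * e + \<i> * e2) = 0"
    using der0[OF refl_eint_line(1)[of "- cnj z" 0 \<i>, simplified of_real_0]] z by (simp add: e1_def e2_def e_def mult_ac)
  then have "\<i> * (- e1 + e - e2) = 0" by (simp add: algebra_simps)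
  ultimately have "e = 0" by (simp add: eq_neg_iff_add_eq_0 add_eq_0_iff)
  moreover have "z \<noteq> cnj z" using z by (auto simp: complex_eq_iff)
  ultimately show ?thesis using iprim_1[OF z] by (simp add: e_def)
qed

lemma continuous_on_eint:
  assumes "continuous_on A g" "continuous_on A h" "\<And>x. x \<in> A \<Longrightarrow> g x \<in> uhp"
  shows "continuous_on A (\<lambda>x. eint m i (g x) (h x))"
proof (induction m arbitrary: i)
  have *: "continuous_on A (\<lambda>x. iprim (Suc i) (g x))" for i
  proof (rule continuous_on_compose2[OF _ assms(1)])
    show "continuous_on uhp (iprim (Suc i))"
      using DERIV_iprim by (meson DERIV_isCont continuous_at_imp_continuous_on)
  qed (use assms(3) in auto)
  {
    case 0
    show ?case by (auto intro!: continuous_intros *)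
  next
    case (Suc m)
    show ?case by (auto intro!: continuous_intros * assms Suc)
  }
qed

text \<open>Without a period polynomial the function has weight exactly -w, so |F|^2 / Im^w is
  invariant, decays at the cusp and attains its maximum; there \<open>no_interior_maximum\<close>
  applies.\<close>

lemma refl_eint_zero:
  assumes S: "\<And>z. z \<in> uhp \<Longrightarrow> refl_eint z = z ^ w * refl_eint (- 1 / z)" and z: "z \<in> uhp"
  shows "refl_eint z = 0"
proof -
  define N where "N z = (cmod (refl_eint z))\<^sup>2 / Im z ^ w" for z
  have inv: "N (- 1 / z) = N z" if "z \<in> uhp" for z
  proof -
    have "z \<noteq> 0" using that by auto
    then show ?thesis
      by (simp add: N_def S[OF that] Im_uminus_inverse norm_mult norm_power power_mult_distrib power_divide
          del: divide_minus_left) (simp add: power_mult[symmetric] mult.commute)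
  qed
  have cusp: "vanishes_at_cusp N"
  proof -
    obtain C where C: "C \<ge> 0" "\<And>z. Im z \<ge> 1 \<Longrightarrow> norm (refl_eint z) \<le> C * (Im z ^ w * exp (- Im z))"
      using refl_eint_decay by blast
    have "((\<lambda>y. C\<^sup>2 * (y ^ w / exp y)) \<longlongrightarrow> C\<^sup>2 * 0) at_top"
      by (intro tendsto_intros tendsto_power_div_exp_0)
    then have lim: "((\<lambda>y. C\<^sup>2 * (y ^ w / exp y)) \<longlongrightarrow> 0) at_top" by simp
    show ?thesis
    proof (rule vanishes_at_cuspI[OF _ lim])
      fix z assume z: "Im z \<ge> 1"
      have "(cmod (refl_eint z))\<^sup>2 \<le> (C * (Im z ^ w * exp (- Im z)))\<^sup>2" by (intro power_mono C z) simp
      then have "N z \<le> (C * (Im z ^ w * exp (- Im z)))\<^sup>2 / Im z ^ w"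
        unfolding N_def using z by (intro divide_right_mono) auto
      also have "\<dots> = C\<^sup>2 * (Im z ^ w * exp (- Im z)) * exp (- Im z)"
        using z by (simp add: power2_eq_square)
      also have "\<dots> \<le> C\<^sup>2 * (Im z ^ w * exp (- Im z)) * 1"
        using z by (intro mult_left_mono) auto
      finally show "norm (N z) \<le> C\<^sup>2 * (Im z ^ w / exp (Im z))"
        using z by (simp add: N_def exp_minus divide_inverse)
    qed
  qed
  have "continuous_on uhp N"
    unfolding N_def refl_eint_def by (intro continuous_intros continuous_on_eint) auto
  then obtain z0 where z0: "z0 \<in> uhp" "\<And>z. z \<in> uhp \<Longrightarrow> N z \<le> N z0"
    using invariant_attains_sup[of N] inv cusp refl_eint_periodic unfolding N_def
    by (metis (no_types, lifting) Im_complex_of_real add.right_neutral divide_nonneg_nonneg mem_Collect_eq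
        less_imp_le of_real_1 plus_complex.sel(2) zero_le_power zero_le_power2)
  define y where "y = Im z0"
  have y: "y > 0" using z0 by (simp add: y_def)
  have le: "(cmod (refl_eint z))\<^sup>2 \<le> (cmod (refl_eint z0))\<^sup>2 * (Im z / y) ^ w" if "Im z > 0" for z
    using z0(2)[of z] that y by (simp add: N_def y_def field_simps)
  have D: "z0 - cnj z0 = 2 * \<i> * of_real y" by (auto simp: complex_eq_iff y_def)
  note line = refl_eint_line(1)[of z0 _ 1, simplified mult_1_right mult_1_left complex_cnj_one]
  define h1 where "h1 u t = - u * of_nat w * eint (w - 1) 1 (z0 + t * u) (z0 + t * u)
       - (cnj u * iprim 1 (- cnj z0 + t * - cnj u) * ((- cnj z0 + t * - cnj u) - (- z0 + t * - u)) ^ w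
         + u * of_nat w * eint (w - 1) 1 (- cnj z0 + t * - cnj u) (- z0 + t * - u))" for u t
  define h2 where "h2 u = (u\<^sup>2 * of_nat w * of_nat (w - 1) * eint (w - 2) 1 z0 z0
       - (cnj u * (- cnj u * iprim 0 (- cnj z0) * (z0 - cnj z0) ^ w
            + iprim 1 (- cnj z0) * (of_nat w * (z0 - cnj z0) ^ (w - 1) * (u - cnj u)))
         + u * of_nat w * (cnj u * iprim 1 (- cnj z0) * (z0 - cnj z0) ^ (w - 1)
            + u * of_nat (w - 1) * eint (w - 2) 1 (- cnj z0) (- z0))))" for u
  have small: "Im (z0 + of_real t * u) = y + t * Im u" "0 < y + t * Im u" if "\<bar>t\<bar> < y" "\<bar>Im u\<bar> \<le> 1" for t u
  proof -
    have "\<bar>t * Im u\<bar> \<le> \<bar>t\<bar> * 1" unfolding abs_mult using that by (intro mult_left_mono) auto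
    then show "0 < y + t * Im u" using that by linarith
  qed (simp add: y_def)
  have *: "2 * Re (cnj (refl_eint z0) * h1 u 0) = (cmod (refl_eint z0))\<^sup>2 * w * Im u / y"
    "2 * (cmod (h1 u 0))\<^sup>2 + 2 * Re (cnj (refl_eint z0) * h2 u) \<le> (cmod (refl_eint z0))\<^sup>2 * w * (w - 1) * (Im u)\<^sup>2 / y\<^sup>2"
    if "\<bar>Im u\<bar> \<le> 1" for u
    using second_order_max_condition[of y "\<lambda>t. refl_eint (z0 + of_real t * u)" "\<lambda>t. h1 u (of_real t)" "h2 u" y w "Im u"]
      refl_eint_line(1)[of z0 _ u] refl_eint_line(2)[OF z0(1), of u] small[OF _ that] le[of "z0 + of_real _ * u"] y w(2)
    unfolding h1_def[abs_def] h2_def by auto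
  have "y\<^sup>2 > 0" using y by simp
  \<comment> \<open>In the sum over the directions 1 and \<open>\<i>\<close> all terms with the
    square of \<open>u\<close> or of \<open>cnj u\<close> cancel; the mixed derivative that remains
    is of first order.\<close>
  have sum: "h2 1 + h2 \<i> = of_real (w / y) * (h1 \<i> 0 - \<i> * h1 1 0)"
  proof -
    have "(z0 - cnj z0) ^ w = (z0 - cnj z0) * (z0 - cnj z0) ^ (w - 1)"
      using w(2) by (cases w) auto
    moreover have "of_real y \<noteq> (0::complex)" using y by simp
    ultimately show ?thesis
      by (simp add: h1_def h2_def D field_simps power2_eq_square)
  qed
  have "refl_eint z0 = 0"
    using no_interior_maximum[OF y, of w "refl_eint z0" "h1 1 0" "h1 \<i> 0" "h2 1" "h2 \<i>"] *[of 1] *[of \<i>] sum w(2) y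
    by simp
  then have "N z \<le> 0" using z0(2)[OF z] by (simp add: N_def)
  moreover have "Im z ^ w > 0" using z by simp
  ultimately show ?thesis by (simp add: N_def divide_le_0_iff)
qed

text \<open>The outer periods n = 1 and n = w - 1 account for exactly 2 (w - 1) c 1 in the weighted
  period relation, so the middle ones satisfy a relation with positive weights. Being nonnegative
  multiples of one number, they all vanish. The relation sum c n = 0 then removes the outer ones,
  and \<open>refl_eint_zero\<close> applies.\<close>

theorem cusp_form_zero_criterion:
  fixes \<kappa> :: "nat \<Rightarrow> real" and \<gamma> :: complex
  assumes mid: "\<And>n. odd n \<Longrightarrow> 3 \<le> n \<Longrightarrow> n + 3 \<le> w \<Longrightarrow>
      eint n 1 \<i> 0 + eint (w - n) 1 \<i> 0 = of_real (\<kappa> n) * \<gamma>"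
    and \<kappa>: "\<And>n. \<kappa> n \<ge> 0" and z: "z \<in> uhp"
  shows "f z = 0"
proof -
  define c where "c n = (if odd n then of_nat (w choose n) * (eint n 1 \<i> 0 + eint (w - n) 1 \<i> 0) else 0)" for n
  define P where "P z = (\<Sum>n\<le>w. c n * z ^ n)" for z
  have P: "- 2 * P z = refl_eint z - z ^ w * refl_eint (- 1 / z)" if "z \<in> uhp" for z
    using refl_eint_S[OF that] by (simp add: P_def c_def)
  have per: "refl_eint (z - 1) = refl_eint z" for z using refl_eint_periodic[of "z - 1"] by simp
  \<comment> \<open>With u = z / (z + 1) one has u = 1 - 1 / (z + 1) and -1 / u = -1 / z - 1, so
    periodicity of \<open>refl_eint\<close> links P at z, z + 1 and u.\<close>
  have rel: "P z = P (z + 1) + (\<Sum>n\<le>w. c n * z ^ n * (z + 1) ^ (w - n))" if z: "z \<in> uhp" for z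
  proof -
    have nz: "z \<noteq> 0" "z + 1 \<noteq> 0" using z by (auto simp: complex_eq_iff)
    define u where "u = z / (z + 1)"
    have u: "u = - 1 / (z + 1) + 1" "- 1 / u = - 1 / z - 1" using nz by (auto simp: u_def field_simps)
    have "u \<in> uhp" using uminus_inverse_in_uhp[of "z + 1"] z unfolding u by simp
    have "(z + 1) ^ w * P u = (\<Sum>n\<le>w. c n * z ^ n * (z + 1) ^ (w - n))"
      unfolding P_def sum_distrib_left
    proof (intro sum.cong refl)
      fix n assume "n \<in> {..w}"
      then have "(z + 1) ^ w = (z + 1) ^ n * (z + 1) ^ (w - n)" by (simp flip: power_add)
      then show "(z + 1) ^ w * (c n * u ^ n) = c n * z ^ n * (z + 1) ^ (w - n)"
        using nz by (simp add: u_def power_divide)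
    qed
    moreover have "(z + 1) ^ w * u ^ w = z ^ w" using nz by (simp add: u_def power_divide)
    moreover have "refl_eint u = refl_eint (- 1 / (z + 1))" unfolding u(1) by (rule refl_eint_periodic)
    moreover have "refl_eint (- 1 / u) = refl_eint (- 1 / z)" unfolding u(2) by (rule per)
    moreover have "- 2 * ((z + 1) ^ w * P u) = (z + 1) ^ w * refl_eint u - ((z + 1) ^ w * u ^ w) * refl_eint (- 1 / u)"
      using arg_cong[OF P[OF \<open>u \<in> uhp\<close>], of "\<lambda>x. (z + 1) ^ w * x"]
      by (simp only: right_diff_distrib mult.assoc mult.left_commute[of "- 2"])
    moreover have "- 2 * P (z + 1) = refl_eint z - (z + 1) ^ w * refl_eint (- 1 / (z + 1))"
      using P[of "z + 1"] z by (simp add: refl_eint_periodic)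
    ultimately have "- 2 * P z = - 2 * (P (z + 1) + (\<Sum>n\<le>w. c n * z ^ n * (z + 1) ^ (w - n)))"
      using P[OF z] by (simp add: algebra_simps)
    then show ?thesis by (simp only: mult_cancel_left) simp
  qed
  have "infinite uhp" 
    by (rule infinite_super[of "range (\<lambda>n. Complex 0 (real n + 1))"])
      (auto intro!: range_inj_infinite inj_onI)
  note c0 = period_relation_coefficients[of w c uhp, OF w(2) _ _ this rel[unfolded P_def]]
  have sum_c: "(\<Sum>n\<le>w. c n) = 0" "(\<Sum>n\<le>w. of_nat (n * (w - n)) * c n) = 2 * of_nat (w - 1) * c 1"
    using c0 by (auto simp: c_def)
  define S where "S = {n. odd n \<and> 3 \<le> n \<and> n + 3 \<le> w}"
  have finS: "finite S" by (rule finite_subset[of _ "{..w}"]) (auto simp: S_def)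
  \<comment> \<open>Only odd degrees count: the two outer ones and \<open>S\<close>. The bound w >=
    4 keeps 1 and w - 1 apart; w = 2 is treated separately.\<close>
  have split: "(\<Sum>n\<le>w. g n * c n) = g 1 * c 1 + g (w - 1) * c (w - 1) + (\<Sum>n\<in>S. g n * c n)" if "w \<ge> 4" for g
  proof -
    have "(\<Sum>n\<le>w. g n * c n) = (\<Sum>n\<in>insert 1 (insert (w - 1) S). g n * c n)"
    proof (rule sum.mono_neutral_right)
      show "insert 1 (insert (w - 1) S) \<subseteq> {..w}" using that by (auto simp: S_def)
      show "\<forall>i\<in>{..w} - insert 1 (insert (w - 1) S). g i * c i = 0"
      proof
        fix i assume i: "i \<in> {..w} - insert 1 (insert (w - 1) S)"
        have "even i"
        proof (rule ccontr)
          assume "odd i"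
          moreover have "even (w - 2)" using w by simp
          ultimately have "i \<noteq> w - 2" by auto
          then have "i \<ge> 3" "i \<noteq> w" "i \<noteq> w - 2" "i \<noteq> w - 1" using i w \<open>odd i\<close> by (auto elim!: oddE)
          then show False using i \<open>odd i\<close> by (auto simp: S_def)
        qed
        then show "g i * c i = 0" by (simp add: c_def)
      qed
    qed simp
    then show ?thesis using that finS by (auto simp: S_def)
  qed
  have c_sym: "c (w - 1) = c 1" using w binomial_symmetric[of 1 w] by (auto simp: c_def add.commute)
  have mid0: "c n = 0" if "n \<in> S" for n
  proof -
    have w4: "w \<ge> 4" using that by (auto simp: S_def)
    have "(\<Sum>n\<in>S. of_nat (n * (w - n)) * c n) = 0"
      using sum_c(2) split[OF w4, of "\<lambda>n. of_nat (n * (w - n))"] w4 c_sym by (simp add: algebra_simps)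
    also have "(\<Sum>n\<in>S. of_nat (n * (w - n)) * c n)
        = of_real (\<Sum>n\<in>S. real (n * (w - n) * (w choose n)) * \<kappa> n) * \<gamma>"
      unfolding of_real_sum sum_distrib_right by (intro sum.cong) (auto simp: S_def c_def mid[simplified])
    finally have "\<gamma> = 0 \<or> (\<Sum>n\<in>S. real (n * (w - n) * (w choose n)) * \<kappa> n) = 0"
      by (simp only: mult_eq_0_iff of_real_eq_0_iff) blast
    moreover have "(\<Sum>n\<in>S. real (n * (w - n) * (w choose n)) * \<kappa> n) = 0
        \<longleftrightarrow> (\<forall>n\<in>S. real (n * (w - n) * (w choose n)) * \<kappa> n = 0)"
      using \<kappa> by (intro sum_nonneg_eq_0_iff[OF finS]) auto
    ultimately have "\<gamma> = 0 \<or> real (n * (w - n) * (w choose n)) * \<kappa> n = 0" using that by blast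
    moreover have "n * (w - n) * (w choose n) \<noteq> 0" using that by (auto simp: S_def)
    ultimately have "\<gamma> = 0 \<or> \<kappa> n = 0" by (simp only: mult_eq_0_iff[of "real _"] of_nat_eq_0_iff) blast
    then show ?thesis using that by (auto simp: c_def mid[simplified] S_def)
  qed
  have c1: "c 1 = 0"
  proof (cases "w \<ge> 4")
    case True
    then show ?thesis using sum_c(1) split[of "\<lambda>_. 1"] mid0 c_sym by simp
  next
    case False
    then have "w = 2" using w by (auto elim!: evenE)
    then show ?thesis using sum_c(1) by (simp add: c_def numeral_2_eq_2)
  qed
  have P0: "P z = 0" for z
  proof (cases "w \<ge> 4")
    case True
    then show ?thesis
      using split[OF True, of "\<lambda>n. z ^ n"] mid0 c_sym c1 by (simp add: P_def mult.commute)
  next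
    case False
    then have "w = 2" using w by (auto elim!: evenE)
    then show ?thesis using c1 by (simp add: P_def c_def numeral_2_eq_2)
  qed
  show ?thesis
    by (rule refl_eint_zero_imp_zero[OF refl_eint_zero z]) (use P P0 in auto)
qed

end

end

section \<open>Sums over integer matrices\<close>

lemma GLpos_Im_nonneg: "\<tau> \<in> uhp \<Longrightarrow> g \<in> GLpos \<Longrightarrow> 0 \<le> Im (lat \<tau> (fst g) * cnj (lat \<tau> (snd g)))"
  using Im_lat_cnj_lat[of \<tau> "fst g" "snd g"] by (auto simp: GLpos_def)

lemma kernel_nonzero':
  assumes "\<tau> \<in> uhp" "z \<in> uhp" "g \<in> GLpos" shows "lat \<tau> (fst g) + lat \<tau> (snd g) * z \<noteq> 0"
  by (rule kernel_nonzero) (use assms in auto)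

text \<open>For \<open>SL2\<close> this is, up to normalization and a reflection of one variable,
  the reproducing kernel of weight k; for \<open>GLpos\<close> it is a sum of its Hecke translates,
  see \<open>kern_GLpos_has_sum\<close>.\<close>

definition kern :: "((int \<times> int) \<times> (int \<times> int)) set \<Rightarrow> nat \<Rightarrow> complex \<Rightarrow> complex \<Rightarrow> complex" where
  "kern S k \<tau> z = (\<Sum>\<^sub>\<infinity>g\<in>S. 1 / (lat \<tau> (fst g) + lat \<tau> (snd g) * z) ^ k)"

lemma kern_term_le:
  assumes "\<tau> \<in> uhp" "z \<in> uhp" "g \<in> GLpos" "k \<ge> 6"
  shows "norm (1 / (lat \<tau> (fst g) + lat \<tau> (snd g) * z) ^ k)
    \<le> (2 / (cst z * cst \<tau>)) ^ k * (case g of (u, v) \<Rightarrow> wt u * wt v)"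
  using kernel_power_le[OF assms] by (simp add: norm_divide norm_power split_beta)

lemma kern_summable:
  assumes "\<tau> \<in> uhp" "z \<in> uhp" "S \<subseteq> GLpos" "k \<ge> 6"
  shows "(\<lambda>g. 1 / (lat \<tau> (fst g) + lat \<tau> (snd g) * z) ^ k) abs_summable_on S"
    "(\<lambda>g. 1 / (lat \<tau> (fst g) + lat \<tau> (snd g) * z) ^ k) summable_on S"
proof -
  have "norm (1 / (lat \<tau> (fst g) + lat \<tau> (snd g) * z) ^ k)
    \<le> (2 / (cst z * cst \<tau>)) ^ k * (case g of (u, v) \<Rightarrow> wt u * wt v)" if "g \<in> S" for g
    using assms that by (intro kern_term_le) auto
  note * = summable_on_bounded[OF wt_summable_pairs this]
  show "(\<lambda>g. 1 / (lat \<tau> (fst g) + lat \<tau> (snd g) * z) ^ k) abs_summable_on S" by (rule *(1))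
  show "(\<lambda>g. 1 / (lat \<tau> (fst g) + lat \<tau> (snd g) * z) ^ k) summable_on S" by (rule *(2))
qed

lemma kern_holomorphic:
  assumes "\<tau> \<in> uhp" "S \<subseteq> GLpos" "k \<ge> 6"
  shows "kern S k \<tau> holomorphic_on uhp"
proof -
  have "(kern S k \<tau> has_field_derivative
     (\<Sum>\<^sub>\<infinity>g\<in>S. - (of_nat k * lat \<tau> (snd g) * (lat \<tau> (fst g) + lat \<tau> (snd g) * z) ^ (k - 1))
        / ((lat \<tau> (fst g) + lat \<tau> (snd g) * z) ^ k)\<^sup>2)) (at z)" if "z \<in> uhp" for z
    unfolding kern_def[abs_def]
  proof (rule has_field_derivative_infsum(1)[OF open_uhp that, where G = "\<lambda>z. (2 / (cst z * cst \<tau>)) ^ k"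
        and M = "\<lambda>g. case g of (u, v) \<Rightarrow> wt u * wt v"
        and f' = "\<lambda>g z. - (of_nat k * lat \<tau> (snd g) * (lat \<tau> (fst g) + lat \<tau> (snd g) * z) ^ (k - 1))
        / ((lat \<tau> (fst g) + lat \<tau> (snd g) * z) ^ k)\<^sup>2"])
    fix g z assume g: "g \<in> S" and z: "z \<in> uhp"
    then have nz: "lat \<tau> (fst g) + lat \<tau> (snd g) * z \<noteq> 0"
      by (intro kernel_nonzero'[OF assms(1)] subsetD[OF assms(2)])
    show "((\<lambda>z. 1 / (lat \<tau> (fst g) + lat \<tau> (snd g) * z) ^ k) has_field_derivative
       - (of_nat k * lat \<tau> (snd g) * (lat \<tau> (fst g) + lat \<tau> (snd g) * z) ^ (k - 1))
        / ((lat \<tau> (fst g) + lat \<tau> (snd g) * z) ^ k)\<^sup>2) (at z)"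
      using nz by (auto intro!: derivative_eq_intros simp: power2_eq_square)
    show "norm (1 / (lat \<tau> (fst g) + lat \<tau> (snd g) * z) ^ k)
        \<le> (2 / (cst z * cst \<tau>)) ^ k * (case g of (u, v) \<Rightarrow> wt u * wt v)"
      using assms g z by (intro kern_term_le) auto
  next
    show "0 \<le> (case g of (u, v) \<Rightarrow> wt u * wt v)" for g by (auto simp: wt_pos less_imp_le split: prod.splits)
  next
    show "continuous_on uhp (\<lambda>z. (2 / (cst z * cst \<tau>)) ^ k)"
      using assms(1) cst_pos by (intro continuous_intros continuous_on_cst) (auto simp: less_le)
  qed (rule wt_summable_pairs)
  then show ?thesis using open_uhp by (auto simp: holomorphic_on_open)
qed

lemma mdet_transform: "mdet (fst g + snd g, snd g) = mdet g" "mdet (fst g - snd g, snd g) = mdet g"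
    "mdet (- snd g, fst g) = mdet g" "mdet (snd g, - fst g) = mdet g"
  by (simp_all add: mdet_def left_diff_distrib distrib_right)

lemma bij_betw_mat:
  assumes "S \<in> {SL2, GLpos}"
  shows "bij_betw (\<lambda>g. (fst g + snd g, snd g)) S S" "bij_betw (\<lambda>g. (- snd g, fst g)) S S"
    "bij_betw (\<lambda>g. (snd g, - fst g)) S S"
proof -
  have S: "(fst g + snd g, snd g) \<in> S \<and> (fst g - snd g, snd g) \<in> S \<and> (- snd g, fst g) \<in> S \<and> (snd g, - fst g) \<in> S"
    if "g \<in> S" for g
    using assms that by (elim insertE emptyE) (simp_all add: SL2_def GLpos_def mdet_transform)
  show "bij_betw (\<lambda>g. (fst g + snd g, snd g)) S S"
    by (rule bij_betwI[where g = "\<lambda>g. (fst g - snd g, snd g)"]) (simp_all add: Pi_iff S)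
  show "bij_betw (\<lambda>g. (- snd g, fst g)) S S"
    by (rule bij_betwI[where g = "\<lambda>g. (snd g, - fst g)"]) (simp_all add: Pi_iff S)
  show "bij_betw (\<lambda>g. (snd g, - fst g)) S S"
    by (rule bij_betwI[where g = "\<lambda>g. (- snd g, fst g)"]) (simp_all add: Pi_iff S)
qed

lemma kern_T:
  assumes "S \<in> {SL2, GLpos}" shows "kern S k \<tau> (z + 1) = kern S k \<tau> z"
proof -
  have "kern S k \<tau> z = (\<Sum>\<^sub>\<infinity>g\<in>S. 1 / (lat \<tau> (fst g + snd g) + lat \<tau> (snd g) * z) ^ k)"
    unfolding kern_def by (subst infsum_reindex_bij_betw[OF bij_betw_mat(1)[OF assms], symmetric]) simp
  moreover have "lat \<tau> (fst g + snd g) + lat \<tau> (snd g) * z = lat \<tau> (fst g) + lat \<tau> (snd g) * (z + 1)" for g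
    by (simp add: lat_add ring_distribs)
  ultimately show ?thesis by (simp only: kern_def)
qed

lemma kern_S:
  assumes "S \<in> {SL2, GLpos}" "z \<noteq> 0"
  shows "kern S k \<tau> (- 1 / z) = z ^ k * kern S k \<tau> z"
proof -
  have "1 / (lat \<tau> (fst g) + lat \<tau> (snd g) * (- 1 / z)) ^ k = z ^ k * (1 / (lat \<tau> (- snd g) + lat \<tau> (fst g) * z) ^ k)" for g
  proof -
    have "lat \<tau> (fst g) + lat \<tau> (snd g) * (- 1 / z) = (lat \<tau> (- snd g) + lat \<tau> (fst g) * z) / z"
      using assms(2) by (simp add: lat_minus field_simps)
    then show ?thesis by (simp add: power_divide)
  qed
  then have "kern S k \<tau> (- 1 / z) = z ^ k * (\<Sum>\<^sub>\<infinity>g\<in>S. 1 / (lat \<tau> (- snd g) + lat \<tau> (fst g) * z) ^ k)"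
    by (simp only: kern_def infsum_cmult_right')
  also have "(\<Sum>\<^sub>\<infinity>g\<in>S. 1 / (lat \<tau> (- snd g) + lat \<tau> (fst g) * z) ^ k) = kern S k \<tau> z"
    unfolding kern_def by (subst infsum_reindex_bij_betw[OF bij_betw_mat(2)[OF assms(1)], symmetric]) simp
  finally show ?thesis .
qed

lemma cst_ge: "Im z \<ge> 1 \<Longrightarrow> \<bar>Re z\<bar> \<le> 1 \<Longrightarrow> cst z \<ge> 1 / 4"
  using cmod_le[of z] unfolding cst_def by (subst pos_le_divide_eq) (auto intro!: add_pos_nonneg)

text \<open>One of the k factors is spent on the decay 1 / Im z, and the remaining k - 1 >= 6 secure
  summability; hence the weight is at least 7.\<close>

lemma kern_vanishes_at_cusp:
  assumes \<tau>: "\<tau> \<in> uhp" and S: "S \<subseteq> GLpos" and k: "k \<ge> 7"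
  shows "vanishes_at_cusp (kern S k \<tau>)"
proof (rule vanishes_at_cuspI)
  let ?W = "\<Sum>\<^sub>\<infinity>(u, v)\<in>S. wt u * wt v"
  let ?C = "(2 / cst \<tau>) * (8 / cst \<tau>) ^ (k - 1)"
  show "((\<lambda>y. ?C / y * ?W) \<longlongrightarrow> 0) at_top"
    by (intro tendsto_mult_left_zero tendsto_divide_0[OF tendsto_const] filterlim_at_top_imp_at_infinity filterlim_ident)
  fix z assume z: "\<bar>Re z\<bar> \<le> 1/2" "1 \<le> Im z"
  then have zu: "z \<in> uhp" and c4: "cst z \<ge> 1/4" using cst_ge[of z] by auto
  note c = cst_pos[OF \<tau>]
  show "norm (kern S k \<tau> z) \<le> ?C / Im z * ?W"
    unfolding kern_def
  proof (rule summable_on_bounded(3)[OF wt_summable_pairs])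
    fix g assume g: "g \<in> S"
    then have gGL: "g \<in> GLpos" using S by auto
    then have v: "snd g \<noteq> 0" using GLpos_nonzero[of "fst g" "snd g"] by simp
    let ?L = "norm (lat \<tau> (fst g) + lat \<tau> (snd g) * z)"
    have "cst \<tau> / 2 * Im z \<le> norm (lat \<tau> (snd g)) * Im z"
    proof (rule mult_right_mono)
      have "cst \<tau> / 2 * 1 \<le> cst \<tau> / 2 * vnorm (snd g)" using c vnorm_ge_1 by (intro mult_left_mono) auto
      then show "cst \<tau> / 2 \<le> norm (lat \<tau> (snd g))" using norm_lat_ge[OF \<tau> v] by simp
    qed (use z in simp)
    also have "\<dots> \<le> ?L" by (rule norm_kernel_ge_Im[OF zu GLpos_Im_nonneg[OF \<tau> gGL]])
    finally have 1: "1 / ?L \<le> 1 / (cst \<tau> / 2 * Im z)"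
      using c z kernel_nonzero'[OF \<tau> zu gGL] by (intro divide_left_mono mult_pos_pos) auto
    have "1 / ?L ^ (k - 1) \<le> (2 / (cst z * cst \<tau>)) ^ (k - 1) * (wt (fst g) * wt (snd g))"
      using kernel_power_le[OF \<tau> zu gGL, of "k - 1"] k by simp
    also have "\<dots> \<le> (8 / cst \<tau>) ^ (k - 1) * (wt (fst g) * wt (snd g))"
    proof (intro mult_right_mono power_mono)
      have "2 / (cst z * cst \<tau>) \<le> 2 / (1/4 * cst \<tau>)"
        using c c4 by (intro divide_left_mono mult_right_mono mult_pos_pos) auto
      then show "2 / (cst z * cst \<tau>) \<le> 8 / cst \<tau>" by simp
    qed (use c cst_pos[OF zu] wt_pos in \<open>auto simp: less_imp_le intro!: mult_nonneg_nonneg\<close>)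
    finally have 2: "1 / ?L ^ (k - 1) \<le> (8 / cst \<tau>) ^ (k - 1) * (wt (fst g) * wt (snd g))" .
    have "norm (1 / (lat \<tau> (fst g) + lat \<tau> (snd g) * z) ^ k) = 1 / ?L * (1 / ?L ^ (k - 1))"
      using k by (cases k) (auto simp: norm_divide norm_power norm_mult)
    also have "\<dots> \<le> 1 / (cst \<tau> / 2 * Im z) * ((8 / cst \<tau>) ^ (k - 1) * (wt (fst g) * wt (snd g)))"
      using c z by (intro mult_mono 1 2) auto
    finally show "norm (1 / (lat \<tau> (fst g) + lat \<tau> (snd g) * z) ^ k)
        \<le> ?C / Im z * (case g of (u, v) \<Rightarrow> wt u * wt v)"
      by (simp add: split_beta)
  qed
qed

subsection \<open>Primitives\<close>

text \<open>The incomplete beta integral of (1 - t)^n t^m from 0 to X, expanded as a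
  polynomial.\<close>

definition ibeta :: "nat \<Rightarrow> nat \<Rightarrow> complex \<Rightarrow> complex" where
  "ibeta n m X = (\<Sum>j\<le>n. of_nat (n choose j) * (- 1) ^ j * X ^ (m + j + 1) / of_nat (m + j + 1))"

lemma DERIV_ibeta: "(ibeta n m has_field_derivative (1 - X) ^ n * X ^ m) (at X)"
proof -
  have "((\<lambda>X::complex. of_nat (n choose j) * (- 1) ^ j * X ^ (m + j + 1) / of_nat (m + j + 1)) has_field_derivative
      of_nat (n choose j) * (- X) ^ j * X ^ m) (at X)" for j
  proof -
    have "((\<lambda>X::complex. X ^ (m + j + 1)) has_field_derivative of_nat (m + j + 1) * X ^ (m + j)) (at X)"
      using DERIV_power_Suc[OF DERIV_ident, of "m + j" X UNIV] by simp
    note D = DERIV_cdivide[OF DERIV_cmult[OF this, of "of_nat (n choose j) * (- 1) ^ j"], of "of_nat (m + j + 1)"]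
    have "of_nat (m + j + 1) \<noteq> (0::complex)" by (simp only: of_nat_eq_0_iff)
    moreover have "(- X) ^ j = (- 1) ^ j * X ^ j" by (simp flip: power_mult_distrib)
    ultimately show ?thesis
      by (intro DERIV_cong[OF D]) (simp add: power_add mult_ac del: of_nat_add of_nat_Suc)
  qed
  then have "(ibeta n m has_field_derivative (\<Sum>j\<le>n. of_nat (n choose j) * (- X) ^ j * X ^ m)) (at X)"
    unfolding ibeta_def[abs_def] by (rule DERIV_sum)
  moreover have "(\<Sum>j\<le>n. of_nat (n choose j) * (- X) ^ j * X ^ m) = (1 - X) ^ n * X ^ m"
    using binomial_ring[of "- X" 1 n] by (simp add: sum_distrib_right)
  ultimately show ?thesis by simp
qed

lemma ibeta_reflect: "ibeta n m X + ibeta m n (1 - X) = ibeta n m 1"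
proof -
  have "((\<lambda>X. ibeta n m X + ibeta m n (1 - X)) has_field_derivative 0) (at X)" for X
  proof -
    have "((\<lambda>X. ibeta m n (1 - X)) has_field_derivative (1 - (1 - X)) ^ m * (1 - X) ^ n * - 1) (at X)"
      by (rule DERIV_chain2[OF DERIV_ibeta]) (auto intro!: derivative_eq_intros)
    from DERIV_add[OF DERIV_ibeta[of n m X] this] show ?thesis by (simp add: mult.commute)
  qed
  then obtain c where c: "\<And>X. ibeta n m X + ibeta m n (1 - X) = c"
    using has_field_derivative_zero_constant[of UNIV "\<lambda>X. ibeta n m X + ibeta m n (1 - X)"] by auto
  have "ibeta m n 0 = 0" by (simp add: ibeta_def)
  then show ?thesis using c[of X] c[of 1] by simp
qed

lemma ibeta_1_nonneg: obtains b where "b \<ge> 0" "ibeta n m 1 = of_real b"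
proof -
  define B where "B x = (\<Sum>j\<le>n. real (n choose j) * (- 1) ^ j * x ^ (m + j + 1) / real (m + j + 1))" for x
  have B: "ibeta n m (of_real x) = of_real (B x)" for x
    unfolding ibeta_def B_def of_real_sum of_real_divide of_real_mult of_real_power of_real_of_nat_eq of_real_minus of_real_1
    by (rule refl)
  have "(B has_real_derivative (1 - x) ^ n * x ^ m) (at x)" for x
  proof -
    have "((\<lambda>x. ibeta n m (of_real x)) has_vector_derivative (1 - of_real x) ^ n * of_real x ^ m) (at x)"
      by (rule has_vector_derivative_real_field[OF DERIV_ibeta])
    moreover have "(1 - of_real x) ^ n * of_real x ^ m = complex_of_real ((1 - x) ^ n * x ^ m)" by simp
    ultimately have "((\<lambda>x. of_real (B x) :: complex) has_vector_derivative of_real ((1 - x) ^ n * x ^ m)) (at x)"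
      by (simp only: B)
    from has_field_derivative_Re[OF this] show ?thesis by (simp only: Re_complex_of_real)
  qed
  then have ex: "\<exists>y. (B has_real_derivative y) (at x) \<and> 0 \<le> y" if "0 \<le> x" "x \<le> 1" for x
    using that by (intro exI[of _ "(1 - x) ^ n * x ^ m"] conjI mult_nonneg_nonneg) auto
  have "B 0 \<le> B 1" by (rule DERIV_nonneg_imp_nondecreasing[OF zero_le_one ex])
  moreover have "B 0 = 0" by (simp add: B_def)
  ultimately show ?thesis using that[of "B 1"] B[of 1] by simp
qed

lemma norm_ibeta_le:
  assumes "norm X \<le> R" "R \<ge> 1"
  shows "norm (ibeta n m X) \<le> norm X * (2 ^ n * R ^ (m + n))"
proof -
  have "norm (of_nat (n choose j) * (- 1) ^ j * X ^ (m + j + 1) / of_nat (m + j + 1))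
      \<le> norm X * (real (n choose j) * R ^ (m + n))" if "j \<in> {..n}" for j
  proof -
    have "norm (of_nat (n choose j) * (- 1) ^ j * X ^ (m + j + 1) / of_nat (m + j + 1))
        = real (n choose j) * norm X ^ (m + j + 1) / real (m + j + 1)"
      by (simp only: norm_mult norm_divide norm_power norm_of_nat norm_minus_cancel norm_one power_one mult_1_right)
    also have "\<dots> \<le> real (n choose j) * norm X ^ (m + j + 1) / 1"
      by (intro divide_left_mono) auto
    also have "\<dots> = norm X * (real (n choose j) * norm X ^ (m + j))" by simp
    also have "norm X ^ (m + j) \<le> R ^ (m + j)" using assms by (intro power_mono) auto
    also have "R ^ (m + j) \<le> R ^ (m + n)" using assms that by (intro power_increasing) auto
    finally show ?thesis by (simp add: mult_left_mono)
  qed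
  then have "norm (ibeta n m X) \<le> (\<Sum>j\<le>n. norm X * (real (n choose j) * R ^ (m + n)))"
    unfolding ibeta_def by (rule sum_norm_le)
  also have "\<dots> = norm X * ((\<Sum>j\<le>n. real (n choose j)) * R ^ (m + n))"
    by (simp add: sum_distrib_left sum_distrib_right)
  also have "(\<Sum>j\<le>n. real (n choose j)) = 2 ^ n"
    using choose_row_sum[of n] by (simp flip: of_nat_sum)
  finally show ?thesis .
qed

text \<open>The termwise integral of \<open>t ^ n / (\<lambda> + \<mu> t) ^ (n + m + 2)\<close> from \<open>s\<close> to \<open>\<i> \<infinity>\<close>.\<close>

definition kern_prim :: "nat \<Rightarrow> nat \<Rightarrow> complex \<Rightarrow> complex \<Rightarrow> complex" where
  "kern_prim n m \<tau> s = (\<Sum>\<^sub>\<infinity>g\<in>GLpos. ibeta n m (lat \<tau> (fst g) / (lat \<tau> (fst g) + lat \<tau> (snd g) * s))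
      / (lat \<tau> (fst g) ^ (m + 1) * lat \<tau> (snd g) ^ (n + 1)))"

lemma lat_inverse_le:
  assumes \<tau>: "\<tau> \<in> uhp" and g: "g \<in> GLpos" and ab: "a \<ge> 3" "b \<ge> 3"
  shows "1 / (norm (lat \<tau> (fst g)) ^ a * norm (lat \<tau> (snd g)) ^ b)
    \<le> (2 / cst \<tau>) ^ (a + b) * (case g of (u, v) \<Rightarrow> wt u * wt v)"
proof -
  have "fst g \<noteq> 0" "snd g \<noteq> 0" using g GLpos_nonzero[of "fst g" "snd g"] by simp_all
  then have "1 / norm (lat \<tau> (fst g)) ^ a * (1 / norm (lat \<tau> (snd g)) ^ b)
      \<le> ((2 / cst \<tau>) ^ a * wt (fst g)) * ((2 / cst \<tau>) ^ b * wt (snd g))"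
    using \<tau> ab cst_pos[OF \<tau>] wt_pos[of "fst g"] by (intro mult_mono lat_power_le) auto
  then show ?thesis by (simp add: power_add mult_ac split_beta)
qed

lemma norm_kern_ratio_le:
  assumes "\<tau> \<in> uhp" "s \<in> uhp" "g \<in> GLpos"
  shows "norm (lat \<tau> (fst g) / (lat \<tau> (fst g) + lat \<tau> (snd g) * s)) \<le> 1 / cst s"
proof -
  obtain u v where g: "g = (u, v)" by (cases g)
  have "cst s * norm (lat \<tau> u) \<le> cst s * (norm (lat \<tau> u) + norm (lat \<tau> v))"
    using cst_pos[OF assms(2)] by simp
  also have "\<dots> \<le> norm (lat \<tau> u + lat \<tau> v * s)"
    using assms Im_lat_cnj_lat[of \<tau> u v] by (intro norm_kernel_ge) (auto simp: GLpos_def g)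
  finally have *: "cst s * norm (lat \<tau> u) \<le> norm (lat \<tau> u + lat \<tau> v * s)" .
  have "norm (lat \<tau> u + lat \<tau> v * s) > 0" using kernel_nonzero[OF assms(1,2)] assms(3) g by simp
  then show ?thesis using cst_pos[OF assms(2)] * by (simp add: g norm_divide field_simps)
qed

text \<open>Substitution X = lambda / (lambda + mu s): then 1 - X = mu s / (lambda + mu s) and dX =
  - lambda mu ds / (lambda + mu s)^2, so up to powers of lambda and mu the beta integrand becomes
  s^n / (lambda + mu s)^(n + m + 2).\<close>

lemma DERIV_kern_prim:
  assumes \<tau>: "\<tau> \<in> uhp" and s: "s \<in> uhp" and nm: "n \<ge> 2" "m \<ge> 2"
  shows "(kern_prim n m \<tau> has_field_derivative - (kern GLpos (n + m + 2) \<tau> s * s ^ n)) (at s)"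
proof -
  let ?l = "\<lambda>g. lat \<tau> (fst g)" and ?m = "\<lambda>g. lat \<tau> (snd g)"
  have nz: "?l g \<noteq> 0 \<and> ?m g \<noteq> 0" if "g \<in> GLpos" for g
    using lat_nonzero[OF \<tau>] that GLpos_nonzero[of "fst g" "snd g"] by simp
  have "(kern_prim n m \<tau> has_field_derivative
     (\<Sum>\<^sub>\<infinity>g\<in>GLpos. - (s ^ n) * (1 / (?l g + ?m g * s) ^ (n + m + 2)))) (at s)"
    unfolding kern_prim_def[abs_def]
  proof (rule has_field_derivative_infsum(1)[OF open_uhp s])
    fix g w assume g: "g \<in> GLpos" and w: "w \<in> uhp"
    let ?d = "?l g + ?m g * w" and ?X = "?l g / (?l g + ?m g * w)"
    have d: "?d \<noteq> 0" using kernel_nonzero[OF \<tau> w] g by auto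
    have "((\<lambda>w. ?l g / (?l g + ?m g * w)) has_field_derivative - (?l g * ?m g) / ?d\<^sup>2) (at w)"
      using d by (auto intro!: derivative_eq_intros simp: power2_eq_square)
    from DERIV_cdivide[OF DERIV_chain2[OF DERIV_ibeta this], of n m "?l g ^ (m + 1) * ?m g ^ (n + 1)"]
    have "((\<lambda>w. ibeta n m (?l g / (?l g + ?m g * w)) / (?l g ^ (m + 1) * ?m g ^ (n + 1))) has_field_derivative
        (1 - ?X) ^ n * ?X ^ m * (- (?l g * ?m g) / ?d\<^sup>2) / (?l g ^ (m + 1) * ?m g ^ (n + 1))) (at w)" .
    moreover have "1 - ?X = ?m g * w / ?d" using d by (simp add: field_simps)
    moreover have "(?m g * w / ?d) ^ n * ?X ^ m * (- (?l g * ?m g) / ?d\<^sup>2) / (?l g ^ (m + 1) * ?m g ^ (n + 1))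
        = - (w ^ n) * (1 / ?d ^ (n + m + 2))"
      using d nz[OF g] by (simp add: power_divide power_mult_distrib power_add power2_eq_square)
    ultimately show "((\<lambda>w. ibeta n m (?l g / (?l g + ?m g * w)) / (?l g ^ (m + 1) * ?m g ^ (n + 1))) has_field_derivative
        - (w ^ n) * (1 / ?d ^ (n + m + 2))) (at w)" by simp
    have c: "1 / cst w \<ge> 1" using cst_pos[OF w] cst_le_1[OF w] by simp
    have "norm (ibeta n m ?X) \<le> norm ?X * (2 ^ n * (1 / cst w) ^ (m + n))"
      by (intro norm_ibeta_le norm_kern_ratio_le \<tau> w g c)
    also have "\<dots> \<le> 1 / cst w * (2 ^ n * (1 / cst w) ^ (m + n))"
      using cst_pos[OF w] by (intro mult_right_mono norm_kern_ratio_le \<tau> w g) auto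
    finally have le: "norm (ibeta n m ?X) \<le> 1 / cst w * (2 ^ n * (1 / cst w) ^ (m + n))" .
    have "norm (ibeta n m ?X) / (norm (?l g) ^ (m + 1) * norm (?m g) ^ (n + 1))
        \<le> 1 / cst w * (2 ^ n * (1 / cst w) ^ (m + n)) * (1 / (norm (?l g) ^ (m + 1) * norm (?m g) ^ (n + 1)))"
      using divide_right_mono[OF le mult_nonneg_nonneg[OF zero_le_power[OF norm_ge_zero] zero_le_power[OF norm_ge_zero]]]
      by (simp only: times_divide_eq_right mult_1_right)
    also have "\<dots> \<le> 1 / cst w * (2 ^ n * (1 / cst w) ^ (m + n)) * ((2 / cst \<tau>) ^ (m + 1 + (n + 1)) * (case g of (u, v) \<Rightarrow> wt u * wt v))"
      using cst_pos[OF w] nm by (intro mult_left_mono lat_inverse_le \<tau> g) auto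
    finally show "norm (ibeta n m ?X / (?l g ^ (m + 1) * ?m g ^ (n + 1)))
        \<le> 1 / cst w * (2 ^ n * (1 / cst w) ^ (m + n)) * (2 / cst \<tau>) ^ (m + 1 + (n + 1)) * (case g of (u, v) \<Rightarrow> wt u * wt v)"
      by (simp only: norm_divide norm_mult norm_power mult.assoc)
  next
    show "0 \<le> (case g of (u, v) \<Rightarrow> wt u * wt v)" for g by (auto simp: wt_pos less_imp_le split: prod.splits)
  next
    show "continuous_on uhp (\<lambda>w. 1 / cst w * (2 ^ n * (1 / cst w) ^ (m + n)) * (2 / cst \<tau>) ^ (m + 1 + (n + 1)))"
      using assms(1) cst_pos by (intro continuous_intros continuous_on_cst) (auto simp: less_le)
  qed (rule wt_summable_pairs)
  moreover have "(\<Sum>\<^sub>\<infinity>g\<in>GLpos. - (s ^ n) * (1 / (?l g + ?m g * s) ^ (n + m + 2))) = - (kern GLpos (n + m + 2) \<tau> s * s ^ n)"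
    by (simp only: infsum_cmult_right' kern_def) (simp add: mult.commute)
  ultimately show ?thesis by simp
qed

lemma kern_prim_tendsto_0:
  assumes \<tau>: "\<tau> \<in> uhp" and nm: "n \<ge> 3" "m \<ge> 3"
  shows "((\<lambda>y. kern_prim n m \<tau> (Complex 0 y)) \<longlongrightarrow> 0) at_top"
proof -
  let ?W = "\<Sum>\<^sub>\<infinity>(u, v)\<in>GLpos. wt u * wt v"
  let ?C = "2 ^ n * 4 ^ (m + n) * (2 / cst \<tau>) ^ (m + (n + 2))"
  have lim: "((\<lambda>y. ?C / y * ?W) \<longlongrightarrow> 0) at_top"
    by (intro tendsto_mult_left_zero tendsto_divide_0[OF tendsto_const] filterlim_at_top_imp_at_infinity filterlim_ident)
  show ?thesis
  proof (rule Lim_null_comparison[OF _ lim])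
    show "\<forall>\<^sub>F y in at_top. norm (kern_prim n m \<tau> (Complex 0 y)) \<le> ?C / y * ?W"
      using eventually_ge_at_top[of 1]
    proof eventually_elim
      case (elim y)
      define s where "s = Complex 0 y"
      have s: "s \<in> uhp" "Im s = y" using elim by (auto simp: s_def)
      have c4: "cst s \<ge> 1/4" using elim by (intro cst_ge) (auto simp: s_def)
      show ?case
        unfolding kern_prim_def s_def[symmetric]
      proof (rule summable_on_bounded(3)[OF wt_summable_pairs])
        fix g assume g: "g \<in> GLpos"
        let ?l = "lat \<tau> (fst g)" and ?m = "lat \<tau> (snd g)"
        let ?X = "?l / (?l + ?m * s)"
        have nz: "?l \<noteq> 0" "?m \<noteq> 0" using lat_nonzero[OF \<tau>] g GLpos_nonzero[of "fst g" "snd g"] by simp_all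
        have "1 / cst s \<le> 1 / (1/4)" using c4 by (intro divide_left_mono) auto
        then have "norm ?X \<le> 4" using norm_kern_ratio_le[OF \<tau> s(1) g] by simp
        then have 1: "norm (ibeta n m ?X) \<le> norm ?X * (2 ^ n * 4 ^ (m + n))" by (rule norm_ibeta_le) simp
        have "norm ?m * y \<le> norm (?l + ?m * s)"
          using norm_kernel_ge_Im[OF s(1) GLpos_Im_nonneg[OF \<tau> g]] s by simp
        \<comment> \<open>The decay in y costs one power of lambda, which leaves the exponent m, and
          gains one of mu; hence m >= 3.\<close>
        then have 2: "norm ?X \<le> norm ?l / (norm ?m * y)"
          unfolding norm_divide using nz elim kernel_nonzero'[OF \<tau> s(1) g]
          by (intro divide_left_mono mult_pos_pos) auto
        have "norm (ibeta n m ?X) / (norm ?l ^ (m + 1) * norm ?m ^ (n + 1))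
            \<le> (norm ?l / (norm ?m * y) * (2 ^ n * 4 ^ (m + n))) / (norm ?l ^ (m + 1) * norm ?m ^ (n + 1))"
          by (intro divide_right_mono order_trans[OF 1] mult_right_mono 2) auto
        also have "\<dots> = 2 ^ n * 4 ^ (m + n) / y * (1 / (norm ?l ^ m * norm ?m ^ (n + 2)))"
          using nz elim by (simp add: field_simps)
        also have "\<dots> \<le> 2 ^ n * 4 ^ (m + n) / y * ((2 / cst \<tau>) ^ (m + (n + 2)) * (case g of (u, v) \<Rightarrow> wt u * wt v))"
          using elim nm by (intro mult_left_mono lat_inverse_le \<tau> g) auto
        finally show "norm (ibeta n m ?X / (?l ^ (m + 1) * ?m ^ (n + 1))) \<le> ?C / y * (case g of (u, v) \<Rightarrow> wt u * wt v)"
          by (simp only: norm_divide norm_mult norm_power times_divide_eq_left mult.assoc)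
      qed
    qed
  qed
qed

definition GLsum :: "nat \<Rightarrow> nat \<Rightarrow> complex \<Rightarrow> complex" where
  "GLsum a b \<tau> = (\<Sum>\<^sub>\<infinity>g\<in>GLpos. 1 / (lat \<tau> (fst g) ^ a * lat \<tau> (snd g) ^ b))"

text \<open>A quarter turn of the basis exchanges lambda and mu up to sign and, \<open>\<i>\<close>
  being fixed, replaces X by 1 - X. The two incomplete beta values then add up to the complete one,
  which does not depend on the matrix. The sign (-1)^(m + 1) is 1 for odd m.\<close>

lemma kern_prim_i:
  assumes \<tau>: "\<tau> \<in> uhp" and nm: "n \<ge> 2" "m \<ge> 2" "odd m"
  shows "kern_prim n m \<tau> \<i> + kern_prim m n \<tau> \<i> = ibeta n m 1 * GLsum (m + 1) (n + 1) \<tau>"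
proof -
  let ?X = "\<lambda>g. lat \<tau> (fst g) / (lat \<tau> (fst g) + lat \<tau> (snd g) * \<i>)"
  let ?P = "\<lambda>g. lat \<tau> (fst g) ^ (m + 1) * lat \<tau> (snd g) ^ (n + 1)"
  have bij: "bij_betw (\<lambda>g. (snd g, - fst g)) GLpos GLpos" by (rule bij_betw_mat) simp
  have "kern_prim m n \<tau> \<i> = (\<Sum>\<^sub>\<infinity>g\<in>GLpos. ibeta m n (1 - ?X g) / ?P g)"
    unfolding kern_prim_def
  proof (subst infsum_reindex_bij_betw[OF bij, symmetric], intro infsum_cong)
    fix g assume g: "g \<in> GLpos"
    have d: "lat \<tau> (fst g) + lat \<tau> (snd g) * \<i> \<noteq> 0" using kernel_nonzero[OF \<tau>, of \<i>] g by auto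
    have d2: "lat \<tau> (snd g) - lat \<tau> (fst g) * \<i> = - \<i> * (lat \<tau> (fst g) + lat \<tau> (snd g) * \<i>)"
      by (simp add: algebra_simps)
    have *: "x / (- \<i> * D) = x * \<i> / D" if "D \<noteq> 0" for x D :: complex
      using that by (simp add: field_simps)
    have "1 - ?X g = lat \<tau> (snd g) * \<i> / (lat \<tau> (fst g) + lat \<tau> (snd g) * \<i>)"
      using d by (simp add: field_simps)
    then have "lat \<tau> (snd g) / (lat \<tau> (snd g) - lat \<tau> (fst g) * \<i>) = 1 - ?X g"
      unfolding d2 *[OF d] by simp
    then show "ibeta m n (lat \<tau> (fst (snd g, - fst g)) / (lat \<tau> (fst (snd g, - fst g)) + lat \<tau> (snd (snd g, - fst g)) * \<i>))
          / (lat \<tau> (fst (snd g, - fst g)) ^ (n + 1) * lat \<tau> (snd (snd g, - fst g)) ^ (m + 1))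
        = ibeta m n (1 - ?X g) / ?P g"
      using nm(3) by (simp add: lat_minus mult.commute)
  qed
  moreover have sum: "(\<lambda>g. ibeta n m (?X g) / ?P g) summable_on GLpos \<and> (\<lambda>g. ibeta m n (1 - ?X g) / ?P g) summable_on GLpos"
  proof -
    have c: "1 / cst \<i> \<ge> 1" "0 < cst \<i>" using cst_pos[of \<i>] cst_le_1[of \<i>] by simp_all
    have le: "norm (ibeta n' m' Y / ?P g) \<le> (1 + 1 / cst \<i>) * (2 ^ n' * (1 + 1 / cst \<i>) ^ (m' + n')) * (2 / cst \<tau>) ^ (m + 1 + (n + 1))
       * (case g of (u, v) \<Rightarrow> wt u * wt v)" if "g \<in> GLpos" "norm Y \<le> 1 + 1 / cst \<i>" for n' m' Y g
    proof -
      have "norm (ibeta n' m' Y) \<le> norm Y * (2 ^ n' * (1 + 1 / cst \<i>) ^ (m' + n'))"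
        using c by (intro norm_ibeta_le that) auto
      also have "\<dots> \<le> (1 + 1 / cst \<i>) * (2 ^ n' * (1 + 1 / cst \<i>) ^ (m' + n'))"
        using c by (intro mult_right_mono that) auto
      finally have "norm (ibeta n' m' Y / ?P g) \<le> (1 + 1 / cst \<i>) * (2 ^ n' * (1 + 1 / cst \<i>) ^ (m' + n')) *
          (1 / (norm (lat \<tau> (fst g)) ^ (m + 1) * norm (lat \<tau> (snd g)) ^ (n + 1)))"
        by (simp only: norm_divide norm_mult norm_power times_divide_eq_right mult_1_right divide_right_mono
            zero_le_power norm_ge_zero mult_nonneg_nonneg)
      also have "\<dots> \<le> (1 + 1 / cst \<i>) * (2 ^ n' * (1 + 1 / cst \<i>) ^ (m' + n')) *
          ((2 / cst \<tau>) ^ (m + 1 + (n + 1)) * (case g of (u, v) \<Rightarrow> wt u * wt v))"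
        using c nm cst_pos[of \<i>] by (intro mult_left_mono lat_inverse_le \<tau> that) auto
      finally show ?thesis by (simp only: mult.assoc)
    qed
    have b1: "norm (?X g) \<le> 1 + 1 / cst \<i>" and b2: "norm (1 - ?X g) \<le> 1 + 1 / cst \<i>" if "g \<in> GLpos" for g
      using norm_kern_ratio_le[OF \<tau>, of \<i> g] norm_triangle_ineq4[of 1 "?X g"] that by auto
    show ?thesis
      by (intro conjI summable_on_bounded(2)[OF wt_summable_pairs le[OF _ b1]]
          summable_on_bounded(2)[OF wt_summable_pairs le[OF _ b2]])
  qed
  ultimately have "kern_prim n m \<tau> \<i> + kern_prim m n \<tau> \<i>
      = (\<Sum>\<^sub>\<infinity>g\<in>GLpos. ibeta n m (?X g) / ?P g + ibeta m n (1 - ?X g) / ?P g)"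
    unfolding kern_prim_def by (subst infsum_add) auto
  also have "\<dots> = (\<Sum>\<^sub>\<infinity>g\<in>GLpos. ibeta n m 1 * (1 / ?P g))"
    by (simp only: add_divide_distrib[symmetric] ibeta_reflect) simp
  also have "\<dots> = ibeta n m 1 * GLsum (m + 1) (n + 1) \<tau>"
    unfolding GLsum_def by (rule infsum_cmult_right')
  finally show ?thesis .
qed

subsection \<open>Products of Eisenstein series\<close>

lemma infsum_sum:
  fixes f :: "'a \<Rightarrow> 'b \<Rightarrow> 'c::{topological_comm_monoid_add, t2_space}"
  assumes "finite A" "\<And>t. t \<in> A \<Longrightarrow> f t summable_on S"
  shows "(\<lambda>x. \<Sum>t\<in>A. f t x) summable_on S \<and> (\<Sum>\<^sub>\<infinity>x\<in>S. \<Sum>t\<in>A. f t x) = (\<Sum>t\<in>A. \<Sum>\<^sub>\<infinity>x\<in>S. f t x)"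
  using assms
proof (induction A rule: finite_induct)
  case (insert t A)
  then show ?case using infsum_add[of "f t" S "\<lambda>x. \<Sum>t\<in>A. f t x"] summable_on_add[of "f t" S "\<lambda>x. \<Sum>t\<in>A. f t x"] by simp
qed simp

abbreviation nonzero :: "(int \<times> int) set" where "nonzero \<equiv> - {0}"

definition Eis :: "nat \<Rightarrow> complex \<Rightarrow> complex" where
  "Eis n \<tau> = (\<Sum>\<^sub>\<infinity>v\<in>nonzero. 1 / lat \<tau> v ^ n)"

lemma Eis_summable:
  assumes "\<tau> \<in> uhp" "n \<ge> 3"
  shows "(\<lambda>v. 1 / lat \<tau> v ^ n) abs_summable_on nonzero"
proof (rule summable_on_bounded(1))
  show "wt summable_on nonzero" using wt_summable by (rule summable_on_subset_banach) auto
  show "norm (1 / lat \<tau> v ^ n) \<le> (2 / cst \<tau>) ^ n * wt v" if "v \<in> nonzero" for v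
    using lat_power_le[OF assms(1) _ assms(2), of v] that by (simp add: norm_divide norm_power)
qed

definition vscale :: "int \<Rightarrow> int \<times> int \<Rightarrow> int \<times> int" where
  "vscale r x = (r * fst x, r * snd x)"

lemma lat_vscale: "lat \<tau> (vscale r x) = of_int r * lat \<tau> x"
  by (simp add: lat_def vscale_def algebra_simps)

text \<open>Proportional nonzero vectors are of the form r x, s x for exactly one such pair (r, s)
  and one x; r >= 1 fixes the sign.\<close>

definition ratios :: "(int \<times> int) set" where
  "ratios = {(r, s). 1 \<le> r \<and> s \<noteq> 0 \<and> coprime r s}"

text \<open>For even b this is 2 zeta(a) zeta(b) / zeta(a + b). What enters later is the lower bound
  2, provided by the pairs (1, 1) and (1, -1).\<close>

definition ratio_sum :: "nat \<Rightarrow> nat \<Rightarrow> real" where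
  "ratio_sum a b = (\<Sum>\<^sub>\<infinity>(r, s)\<in>ratios. 1 / (of_int r ^ a * of_int s ^ b))"

lemma ratio_summable:
  assumes "a \<ge> 4" "b \<ge> 4"
  shows "(\<lambda>(r, s). 1 / (of_int r ^ a * of_int s ^ b :: real)) abs_summable_on ratios"
proof (rule summable_on_bounded(1))
  show "wt summable_on ratios" using wt_summable by (rule summable_on_subset_banach) auto
  fix x assume "x \<in> ratios"
  then obtain r s where x: "x = (r, s)" "r \<noteq> 0" "s \<noteq> 0" by (auto simp: ratios_def)
  let ?r = "\<bar>real_of_int r\<bar>" and ?s = "\<bar>real_of_int s\<bar>"
  have ge1: "?r \<ge> 1" "?s \<ge> 1" using x by linarith+
  then have "(?r - 1) * (?s - 1) \<ge> 0" by simp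
  then have "vnorm x \<le> 3 * (?r * ?s)" using ge1 mult_mono[of 1 ?r 1 ?s] by (simp add: vnorm_def x algebra_simps)
  then have "vnorm x ^ 3 \<le> (3 * (?r * ?s)) ^ 3" using vnorm_ge_1[of x] by (intro power_mono) auto
  also have "\<dots> = 27 * (?r ^ 3 * ?s ^ 3)" by (simp add: power_mult_distrib)
  also have "\<dots> \<le> 27 * (?r ^ a * ?s ^ b)"
    using ge1 assms by (intro mult_left_mono mult_mono power_increasing) auto
  finally have *: "vnorm x ^ 3 \<le> 27 * (?r ^ a * ?s ^ b)" .
  have "?r ^ a * ?s ^ b > 0" using x by simp
  then have "1 / (?r ^ a * ?s ^ b) \<le> 27 * (1 / vnorm x ^ 3)"
    using * vnorm_ge_1[of x] by (simp add: field_simps)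
  then show "norm (case x of (r, s) \<Rightarrow> 1 / (of_int r ^ a * of_int s ^ b :: real)) \<le> 27 * wt x"
    by (simp add: x wt_def power_abs abs_mult)
qed

lemma ratio_sum_ge_2:
  assumes "a \<ge> 4" "b \<ge> 4" "even b"
  shows "ratio_sum a b \<ge> 2"
proof -
  have "(\<Sum>(r, s)\<in>{(1, 1), (1, - 1)}. 1 / (of_int r ^ a * of_int s ^ b :: real)) \<le> ratio_sum a b"
    unfolding ratio_sum_def
    using abs_summable_summable[OF ratio_summable[OF assms(1,2)]] assms(3)
    by (intro finite_sum_le_infsum) (auto simp: ratios_def)
  then show ?thesis using assms(3) by simp
qed

text \<open>Existence: let u = g (p, q) with (p, q) primitive; the vanishing determinant and Bezout
  make v an integer multiple e (p, q), and the gcd of g and e is moved into the common vector.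
  Uniqueness: reduced fractions of equal value agree once the sign is fixed.\<close>

lemma bij_betw_proportional:
  "bij_betw (\<lambda>(x, y). (vscale (fst y) x, vscale (snd y) x)) (nonzero \<times> ratios) {(u, v). u \<noteq> 0 \<and> v \<noteq> 0 \<and> mdet (u, v) = 0}"
    (is "bij_betw ?h ?X ?Y")
  unfolding bij_betw_def
proof
  show "inj_on ?h ?X"
  proof (rule inj_onI)
    fix X Y assume X: "X \<in> ?X" and Y: "Y \<in> ?X" and h: "?h X = ?h Y"
    obtain x1 x2 r s where Xe: "X = ((x1, x2), (r, s))" by (metis surj_pair)
    obtain y1 y2 r' s' where Ye: "Y = ((y1, y2), (r', s'))" by (metis surj_pair)
    have 0: "(x1, x2) \<noteq> 0" "(y1, y2) \<noteq> 0" and rs: "(r, s) \<in> ratios" "(r', s') \<in> ratios"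
      using X Y by (auto simp: Xe Ye)
    have e: "r * x1 = r' * y1" "r * x2 = r' * y2" "s * x1 = s' * y1" "s * x2 = s' * y2"
      using h by (auto simp: vscale_def Xe Ye)
    have p: "r \<ge> 1" "r' \<ge> 1" "s \<noteq> 0" "s' \<noteq> 0" "coprime r s" "coprime r' s'" using rs by (auto simp: ratios_def)
    have "r * s' * (x * y) = r' * s * (x * y)" if "r * x = r' * y" "s * x = s' * y" for x y
      using that by (metis mult.assoc mult.left_commute)
    then have "r * s' * (x1 * y1) = r' * s * (x1 * y1)" "r * s' * (x2 * y2) = r' * s * (x2 * y2)"
      using e by blast+
    moreover have "x1 * y1 \<noteq> 0 \<or> x2 * y2 \<noteq> 0" using 0 e p by (auto simp: zero_prod_def)
    ultimately have eq: "r * s' = r' * s" by auto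
    then have "r dvd r' * s" "r' dvd r * s'" by (metis dvd_triv_left)+
    then have "r dvd r'" "r' dvd r" using p by (simp_all add: coprime_dvd_mult_left_iff)
    then have "r = r'" using p by (simp add: zdvd_antisym_nonneg)
    then show "X = Y" using eq e p by (auto simp: Xe Ye)
  qed
  show "?h ` ?X = ?Y"
  proof
    show "?h ` ?X \<subseteq> ?Y" by (auto simp: ratios_def vscale_def mdet_def prod_eq_iff)
    show "?Y \<subseteq> ?h ` ?X"
    proof clarify
      fix a b c d :: int
      assume 0: "(a, b) \<noteq> 0" "(c, d) \<noteq> 0" and det: "mdet ((a, b), (c, d)) = 0"
      define g where "g = gcd a b"
      have g: "g > 0" using 0 by (auto simp: g_def zero_prod_def)
      then have "gcd a b \<noteq> 0" by (simp add: g_def)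
      then obtain p q where pq: "a = p * g" "b = q * g" "coprime p q"
        using gcd_coprime_exists[of a b] unfolding g_def by blast
      obtain x y where xy: "x * p + y * q = 1" using bezout_int[of p q] pq(3) by auto
      define e where "e = x * c + y * d"
      have "(p * d) * g = (q * c) * g" using det by (simp add: mdet_def pq algebra_simps)
      then have pd: "p * d = q * c" using g by simp
      have "e * p = c * (x * p + y * q)" "e * q = d * (x * p + y * q)"
        using pd by (simp_all add: e_def algebra_simps)
      then have e: "c = e * p" "d = e * q" using xy by simp_all
      have "e \<noteq> 0" using 0 e by (auto simp: zero_prod_def)
      define h where "h = gcd g e"
      have "gcd g e \<noteq> 0" using g by simp
      then obtain r s where rs: "g = r * h" "e = s * h" "coprime r s"
        using gcd_coprime_exists[of g e] unfolding h_def by blast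
      have "h > 0" using g by (simp add: h_def)
      then have "r \<ge> 1" "s \<noteq> 0" using rs g \<open>e \<noteq> 0\<close> by (auto simp: zero_less_mult_iff)
      then have "(r, s) \<in> ratios" using rs by (simp add: ratios_def)
      moreover have "(h * p, h * q) \<noteq> 0" using \<open>h > 0\<close> pq(3) by (auto simp: zero_prod_def)
      moreover have "((a, b), (c, d)) = ?h ((h * p, h * q), (r, s))"
        by (simp add: vscale_def pq e rs)
      ultimately show "((a, b), (c, d)) \<in> ?h ` ?X" by blast
    qed
  qed
qed

text \<open>The product of the two Eisenstein series runs over pairs of nonzero vectors. The sign of
  the determinant cuts it into two halves, exchanged by u -> -u because a is even, and the
  proportional pairs, which sum to a multiple of \<open>Eis (a + b)\<close>.\<close>

lemma GLsum_eq:
  assumes \<tau>: "\<tau> \<in> uhp" and ab: "even a" "even b" "a \<ge> 4" "b \<ge> 4"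
  shows "2 * GLsum a b \<tau> = Eis a \<tau> * Eis b \<tau> - of_real (ratio_sum a b) * Eis (a + b) \<tau>"
proof -
  let ?F = "\<lambda>(u, v). 1 / (lat \<tau> u ^ a * lat \<tau> v ^ b)"
  let ?P = "nonzero \<times> nonzero"
  let ?N = "{g. mdet g < 0}" and ?Z = "{(u, v). u \<noteq> 0 \<and> v \<noteq> 0 \<and> mdet (u, v) = 0}"
  note sa = Eis_summable[OF \<tau>, of a] and sb = Eis_summable[OF \<tau>, of b]
  have F: "?F = (\<lambda>(u, v). 1 / lat \<tau> u ^ a * (1 / lat \<tau> v ^ b))" by auto
  have sum: "?F summable_on ?P"
    unfolding F using abs_summable_summable[OF abs_summable_on_Times[OF sa sb]] ab by simp
  have total: "infsum ?F ?P = Eis a \<tau> * Eis b \<tau>"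
    unfolding F Eis_def by (rule infsum_Times_mult) (use sa sb ab in auto)
  have un: "?P = (GLpos \<union> ?N) \<union> ?Z" 
    using GLpos_nonzero by (auto simp: GLpos_def) (auto simp: mdet_def)
  have sub: "GLpos \<subseteq> ?P" "?N \<subseteq> ?P" "?Z \<subseteq> ?P" "GLpos \<union> ?N \<subseteq> ?P" using un by auto
  note s = summable_on_subset_banach[OF sum]
  have "infsum ?F ?P = infsum ?F ((GLpos \<union> ?N) \<union> ?Z)" by (rule arg_cong[OF un])
  also have "\<dots> = infsum ?F (GLpos \<union> ?N) + infsum ?F ?Z"
    by (rule infsum_Un_disjoint) (use s[OF sub(4)] s[OF sub(3)] in \<open>auto simp: GLpos_def\<close>)
  also have "infsum ?F (GLpos \<union> ?N) = infsum ?F GLpos + infsum ?F ?N"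
    by (rule infsum_Un_disjoint) (use s[OF sub(1)] s[OF sub(2)] in \<open>auto simp: GLpos_def\<close>)
  also have "infsum ?F ?N = infsum ?F GLpos"
  proof -
    have m: "mdet (- u, v) = - mdet (u, v)" for u v by (simp add: mdet_def)
    have bij: "bij_betw (\<lambda>g. (- fst g, snd g)) GLpos ?N"
      by (rule bij_betwI[where g = "\<lambda>g. (- fst g, snd g)"])
        (use sub(1) m in \<open>fastforce simp: GLpos_def simp del: uminus_Pair\<close>)+
    show ?thesis
      by (subst infsum_reindex_bij_betw[OF bij, symmetric])
        (use ab in \<open>auto simp: lat_minus case_prod_unfold simp del: uminus_Pair\<close>)
  qed
  also have "infsum ?F GLpos = GLsum a b \<tau>" by (simp add: GLsum_def case_prod_unfold)
  also have "infsum ?F ?Z = Eis (a + b) \<tau> * of_real (ratio_sum a b)"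
  proof -
    have "infsum ?F ?Z = (\<Sum>\<^sub>\<infinity>(x, y)\<in>nonzero \<times> ratios. 1 / lat \<tau> x ^ (a + b) * (case y of (r, s) \<Rightarrow> of_real (1 / (of_int r ^ a * of_int s ^ b))))"
      by (subst infsum_reindex_bij_betw[OF bij_betw_proportional, symmetric])
        (auto simp: lat_vscale power_mult_distrib power_add split_beta mult_ac intro!: infsum_cong)
    also have "\<dots> = Eis (a + b) \<tau> * (\<Sum>\<^sub>\<infinity>y\<in>ratios. case y of (r, s) \<Rightarrow> of_real (1 / (of_int r ^ a * of_int s ^ b)))"
      unfolding Eis_def using ratio_summable[OF ab(3,4)] ab
      by (intro infsum_Times_mult Eis_summable \<tau>)
        (auto simp: case_prod_unfold norm_divide norm_mult norm_power abs_mult power_abs)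
    also have "(\<Sum>\<^sub>\<infinity>y\<in>ratios. case y of (r, s) \<Rightarrow> of_real (1 / (of_int r ^ a * of_int s ^ b))) = (of_real (ratio_sum a b) :: complex)"
    proof -
      have "((\<lambda>(r, s). 1 / (of_int r ^ a * of_int s ^ b :: real)) has_sum ratio_sum a b) ratios"
        unfolding ratio_sum_def by (rule has_sum_infsum[OF abs_summable_summable[OF ratio_summable[OF ab(3,4)]]])
      from has_sum_of_real[OF this, where ?'a = complex] show ?thesis
        by (simp add: has_sum_iff case_prod_unfold)
    qed
    finally show ?thesis .
  qed
  finally show ?thesis using total by (simp add: mult.commute)
qed

lemma vanishes_at_cusp_sum:
  fixes g :: "'a \<Rightarrow> complex \<Rightarrow> complex"
  assumes "finite A" "\<And>\<tau>. \<tau> \<in> A \<Longrightarrow> vanishes_at_cusp (g \<tau>)"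
  shows "vanishes_at_cusp (\<lambda>z. \<Sum>\<tau>\<in>A. \<alpha> \<tau> * g \<tau> z)"
  unfolding vanishes_at_cusp_def
proof (intro allI impI)
  fix e :: real assume e: "e > 0"
  define e' where "e' = e / (1 + (\<Sum>\<tau>\<in>A. norm (\<alpha> \<tau>)))"
  have s: "(\<Sum>\<tau>\<in>A. norm (\<alpha> \<tau>)) \<ge> 0" by (intro sum_nonneg) auto
  have e': "e' > 0" using e s by (auto simp: e'_def)
  have "\<forall>\<tau>\<in>A. \<exists>Y>0. \<forall>z. \<bar>Re z\<bar> \<le> 1/2 \<and> Y \<le> Im z \<longrightarrow> norm (g \<tau> z) < e'"
    using assms(2) e' by (simp add: vanishes_at_cusp_def)
  then obtain Y where Y: "\<And>\<tau> z. \<tau> \<in> A \<Longrightarrow> \<bar>Re z\<bar> \<le> 1/2 \<Longrightarrow> Y \<tau> \<le> Im z \<Longrightarrow> norm (g \<tau> z) < e'"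
    "\<And>\<tau>. \<tau> \<in> A \<Longrightarrow> Y \<tau> > 0" by metis
  show "\<exists>Y>0. \<forall>z. \<bar>Re z\<bar> \<le> 1/2 \<and> Y \<le> Im z \<longrightarrow> norm (\<Sum>\<tau>\<in>A. \<alpha> \<tau> * g \<tau> z) < e"
  proof (intro exI[of _ "1 + (\<Sum>\<tau>\<in>A. Y \<tau>)"] conjI allI impI)
    show "0 < 1 + (\<Sum>\<tau>\<in>A. Y \<tau>)" using Y(2) by (intro add_pos_nonneg sum_nonneg) (auto simp: less_imp_le)
    fix z assume z: "\<bar>Re z\<bar> \<le> 1/2 \<and> 1 + (\<Sum>\<tau>\<in>A. Y \<tau>) \<le> Im z"
    have "norm (\<Sum>\<tau>\<in>A. \<alpha> \<tau> * g \<tau> z) \<le> (\<Sum>\<tau>\<in>A. norm (\<alpha> \<tau>) * e')"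
    proof (rule sum_norm_le)
      fix \<tau> assume "\<tau> \<in> A"
      then have "Y \<tau> \<le> (\<Sum>\<tau>\<in>A. Y \<tau>)" using assms(1) Y(2) by (intro member_le_sum) (auto simp: less_imp_le)
      then show "norm (\<alpha> \<tau> * g \<tau> z) \<le> norm (\<alpha> \<tau>) * e'"
        using Y(1)[OF \<open>\<tau> \<in> A\<close>, of z] z by (simp add: norm_mult mult_left_mono)
    qed
    also have "\<dots> = (\<Sum>\<tau>\<in>A. norm (\<alpha> \<tau>)) * e'" by (simp add: sum_distrib_right)
    also have "\<dots> < (1 + (\<Sum>\<tau>\<in>A. norm (\<alpha> \<tau>))) * e'" using e' by simp
    also have "\<dots> = e" using s by (simp add: e'_def)
    finally show "norm (\<Sum>\<tau>\<in>A. \<alpha> \<tau> * g \<tau> z) < e" .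
  qed
qed

theorem combo_kern_GLpos_zero:
  assumes A: "finite A" "A \<subseteq> uhp" and k: "even k" "k \<ge> 8"
    and zero: "\<And>a b. even a \<Longrightarrow> even b \<Longrightarrow> 4 \<le> a \<Longrightarrow> 4 \<le> b \<Longrightarrow> a + b = k \<Longrightarrow>
      (\<Sum>\<tau>\<in>A. \<alpha> \<tau> * (Eis a \<tau> * Eis b \<tau> - 2 * Eis k \<tau>)) = 0"
    and z: "z \<in> uhp"
  shows "(\<Sum>\<tau>\<in>A. \<alpha> \<tau> * kern GLpos k \<tau> z) = 0"
proof -
  define f where "f z = (\<Sum>\<tau>\<in>A. \<alpha> \<tau> * kern GLpos k \<tau> z)" for z
  define w where "w = k - 2"
  have w: "even w" "w \<ge> 2" "k = w + 2" using k by (auto simp: w_def)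
  have A': "\<tau> \<in> uhp" if "\<tau> \<in> A" for \<tau> using A that by blast
  have holo: "f holomorphic_on uhp"
    unfolding f_def using A' k by (intro holomorphic_intros kern_holomorphic) auto
  have per: "f (z + 1) = f z" for z by (simp add: f_def kern_T)
  have "vanishes_at_cusp f"
    unfolding f_def using A' k by (intro vanishes_at_cusp_sum A kern_vanishes_at_cusp) auto
  then obtain a where a: "has_fourier_expansion f a" "a 0 = 0"
    by (rule fourier_expansion_exists[OF holo per])
  have f_S: "f (- 1 / z) = z ^ (w + 2) * f z" if "z \<in> uhp" for z
  proof -
    have "z \<noteq> 0" using that by auto
    then have K: "kern GLpos k \<tau> (- 1 / z) = z ^ k * kern GLpos k \<tau> z" for \<tau> by (intro kern_S) auto
    show ?thesis unfolding f_def K w(3)[symmetric] sum_distrib_left by (intro sum.cong) auto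
  qed
  \<comment> \<open>Both sides are primitives of the same function and tend to 0 along the imaginary
    axis, so they differ by the constant 0.\<close>
  have eint: "eint a n 1 \<i> 0 = (\<Sum>\<tau>\<in>A. \<alpha> \<tau> * kern_prim n (w - n) \<tau> \<i>)" if n: "3 \<le> n" "n + 3 \<le> w" for n
  proof -
    let ?T = "\<lambda>s. \<Sum>\<tau>\<in>A. \<alpha> \<tau> * kern_prim n (w - n) \<tau> s"
    have nw: "n + (w - n) + 2 = k" using n w by simp
    have "((\<lambda>s. eint a n 1 s 0 - ?T s) has_field_derivative 0) (at s within uhp)" if s: "s \<in> uhp" for s
    proof -
      have "(?T has_field_derivative (\<Sum>\<tau>\<in>A. \<alpha> \<tau> * - (kern GLpos k \<tau> s * s ^ n))) (at s)"
        using DERIV_kern_prim[OF A' s, of _ n "w - n"] n nw by (intro DERIV_sum DERIV_cmult) auto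
      moreover have "(\<Sum>\<tau>\<in>A. \<alpha> \<tau> * - (kern GLpos k \<tau> s * s ^ n)) = - iprim a 1 s * (s - 0) ^ n"
        using iprim_1[OF a s] by (simp add: f_def sum_distrib_right sum_negf mult.assoc)
      ultimately have "(?T has_field_derivative - iprim a 1 s * (s - 0) ^ n) (at s)" by simp
      from DERIV_diff[OF DERIV_eint[OF a s, of n 1 0] this] show ?thesis
        by (simp add: has_field_derivative_at_within)
    qed
    then obtain c where c: "\<And>s. s \<in> uhp \<Longrightarrow> eint a n 1 s 0 - ?T s = c"
      using has_field_derivative_zero_constant[of uhp "\<lambda>s. eint a n 1 s 0 - ?T s"] convex_halfspace_Im_gt by blast
    have "((\<lambda>y. eint a n 1 (Complex 0 y) 0 - ?T (Complex 0 y)) \<longlongrightarrow> 0 - (\<Sum>\<tau>\<in>A. \<alpha> \<tau> * 0)) at_top"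
      using n A' by (intro tendsto_intros eint_tendsto_0[OF a] kern_prim_tendsto_0) auto
    moreover have "\<forall>\<^sub>F y in at_top. eint a n 1 (Complex 0 y) 0 - ?T (Complex 0 y) = c"
      by (rule eventually_mono[OF eventually_gt_at_top[of 0]]) (rule c, simp)
    ultimately have "((\<lambda>y::real. c) \<longlongrightarrow> 0) at_top" by (simp add: tendsto_cong)
    then have "c = 0" by (simp add: tendsto_const_iff)
    then show ?thesis using c[of \<i>] by simp
  qed
  \<comment> \<open>The functional kills \<open>Eis a * Eis b - 2 * Eis k\<close>, so it sends
    \<open>2 * GLsum a b\<close> to (2 - \<open>ratio_sum a b\<close>) times its value at
    \<open>Eis k\<close>. The minus sign is left to the common number, and the value 0 outside the
    middle range makes \<kappa> nonnegative everywhere.\<close>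
  define \<kappa> where "\<kappa> n = (if odd n \<and> 3 \<le> n \<and> n + 3 \<le> w
    then Re (ibeta n (w - n) 1) * (ratio_sum (w - n + 1) (n + 1) - 2) / 2 else 0)" for n
  have mid: "eint a n 1 \<i> 0 + eint a (w - n) 1 \<i> 0 = of_real (\<kappa> n) * - (\<Sum>\<tau>\<in>A. \<alpha> \<tau> * Eis k \<tau>)"
    if n: "odd n" "3 \<le> n" "n + 3 \<le> w" for n
  proof -
    let ?m = "w - n"
    have m: "odd ?m" "?m + 3 \<le> w" "3 \<le> ?m" "w - ?m = n" "?m + 1 + (n + 1) = k" using n w by auto
    obtain b where b: "b \<ge> 0" "ibeta n ?m 1 = of_real b" by (rule ibeta_1_nonneg)
    have "eint a n 1 \<i> 0 + eint a ?m 1 \<i> 0 = (\<Sum>\<tau>\<in>A. \<alpha> \<tau> * (kern_prim n ?m \<tau> \<i> + kern_prim ?m n \<tau> \<i>))"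
      using eint[of n] eint[of ?m] n m by (simp add: sum.distrib distrib_left)
    also have "\<dots> = (\<Sum>\<tau>\<in>A. \<alpha> \<tau> * (of_real b * GLsum (?m + 1) (n + 1) \<tau>))"
      using n m A' by (intro sum.cong refl) (subst kern_prim_i, auto simp: b)
    also have "\<dots> = of_real b / 2 * (\<Sum>\<tau>\<in>A. \<alpha> \<tau> * (2 * GLsum (?m + 1) (n + 1) \<tau>))"
      by (simp add: sum_distrib_left mult_ac)
    also have "(\<Sum>\<tau>\<in>A. \<alpha> \<tau> * (2 * GLsum (?m + 1) (n + 1) \<tau>))
        = (\<Sum>\<tau>\<in>A. \<alpha> \<tau> * (Eis (?m + 1) \<tau> * Eis (n + 1) \<tau> - 2 * Eis k \<tau>)
            - of_real (ratio_sum (?m + 1) (n + 1) - 2) * (\<alpha> \<tau> * Eis k \<tau>))"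
    proof (intro sum.cong refl)
      fix \<tau> assume "\<tau> \<in> A"
      have "2 * GLsum (?m + 1) (n + 1) \<tau> = Eis (?m + 1) \<tau> * Eis (n + 1) \<tau> - of_real (ratio_sum (?m + 1) (n + 1)) * Eis k \<tau>"
        using GLsum_eq[OF A'[OF \<open>\<tau> \<in> A\<close>], of "?m + 1" "n + 1"] n m by simp
      then show "\<alpha> \<tau> * (2 * GLsum (?m + 1) (n + 1) \<tau>) = \<alpha> \<tau> * (Eis (?m + 1) \<tau> * Eis (n + 1) \<tau> - 2 * Eis k \<tau>)
            - of_real (ratio_sum (?m + 1) (n + 1) - 2) * (\<alpha> \<tau> * Eis k \<tau>)"
        by (simp only:) (simp add: algebra_simps)
    qed
    also have "\<dots> = - of_real (ratio_sum (?m + 1) (n + 1) - 2) * (\<Sum>\<tau>\<in>A. \<alpha> \<tau> * Eis k \<tau>)"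
      using zero[of "?m + 1" "n + 1"] n m by (simp add: sum_subtractf flip: sum_distrib_left) (simp add: algebra_simps)
    also have "of_real b / 2 * (- of_real (ratio_sum (?m + 1) (n + 1) - 2) * (\<Sum>\<tau>\<in>A. \<alpha> \<tau> * Eis k \<tau>))
        = of_real (\<kappa> n) * - (\<Sum>\<tau>\<in>A. \<alpha> \<tau> * Eis k \<tau>)"
      using n b by (simp add: \<kappa>_def algebra_simps)
    finally show ?thesis .
  qed
  have \<kappa>: "\<kappa> n \<ge> 0" for n
  proof (cases "odd n \<and> 3 \<le> n \<and> n + 3 \<le> w")
    case True
    obtain b where b: "b \<ge> 0" "ibeta n (w - n) 1 = of_real b" by (rule ibeta_1_nonneg)
    have "ratio_sum (w - n + 1) (n + 1) \<ge> 2" using True by (intro ratio_sum_ge_2) auto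
    then show ?thesis using True b by (simp add: \<kappa>_def)
  qed (auto simp: \<kappa>_def)
  have "f z = 0" by (rule cusp_form_zero_criterion[OF a w(1,2) f_S mid \<kappa> z])
  then show ?thesis by (simp add: f_def)
qed

subsection \<open>Passing from all integer matrices to the modular group\<close>

lemma fourier_power_vanishes_at_cusp:
  assumes "has_fourier_expansion f a" "a 0 = 0"
  shows "vanishes_at_cusp (\<lambda>z. Im z ^ m * norm (f z))"
proof -
  obtain C where C: "C \<ge> 0" "\<And>z. Im z \<ge> 1 \<Longrightarrow> norm (f z) \<le> C * exp (- (2 * pi * Im z))"
    using fourier_norm_le[OF assms, of 1] by auto
  have "((\<lambda>y. C * (y ^ m / exp y)) \<longlongrightarrow> C * 0) at_top" by (intro tendsto_intros tendsto_power_div_exp_0)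
  then have lim: "((\<lambda>y. C * (y ^ m / exp y)) \<longlongrightarrow> 0) at_top" by simp
  show ?thesis
  proof (rule vanishes_at_cuspI[OF _ lim])
    fix z assume z: "Im z \<ge> 1"
    have "norm (f z) \<le> C * exp (- (2 * pi * Im z))" by (rule C(2)[OF z])
    also have "\<dots> \<le> C * exp (- Im z)"
      using z C(1) pi_gt3 mult_right_mono[of 1 "2 * pi" "Im z"] by (intro mult_left_mono) auto
    finally have "Im z ^ m * norm (f z) \<le> Im z ^ m * (C * exp (- Im z))" using z by (intro mult_left_mono) auto
    then show "norm (Im z ^ m * norm (f z)) \<le> C * (Im z ^ m / exp (Im z))"
      using z by (simp add: exp_minus divide_inverse mult_ac)
  qed
qed

lemma cusp_form_norm_attains_sup:
  assumes f: "continuous_on uhp f" "has_fourier_expansion f a" "a 0 = 0"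
    and T: "\<And>z. z \<in> uhp \<Longrightarrow> f (z + 1) = f z"
    and S: "\<And>z. z \<in> uhp \<Longrightarrow> f (- 1 / z) = z ^ (2 * m) * f z"
  obtains z0 where "z0 \<in> uhp" "\<And>z. z \<in> uhp \<Longrightarrow> Im z ^ m * norm (f z) \<le> Im z0 ^ m * norm (f z0)"
proof -
  let ?N = "\<lambda>z. Im z ^ m * norm (f z)"
  have 1: "?N (z + 1) = ?N z" if "z \<in> uhp" for z using T[OF that] by simp
  have 2: "?N (- 1 / z) = ?N z" if "z \<in> uhp" for z
  proof -
    have "z \<noteq> 0" using that by auto
    then show ?thesis
      by (simp only: Im_uminus_inverse S[OF that] norm_mult norm_power power_divide power_mult) simp
  qed
  have 3: "continuous_on uhp ?N" using f by (intro continuous_intros)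
  show ?thesis
    by (rule invariant_attains_sup[of ?N, OF 1 2 3 _ fourier_power_vanishes_at_cusp[OF f(2,3)]])
      (use that in auto)
qed

text \<open>Hermite normal forms with rows (A, B) and (0, D), one for each coset g
  \<open>SL2\<close>. A unipotent factor on the right changes B by a multiple of A, hence B <
  A.\<close>

definition hnf :: "(nat \<times> nat \<times> nat) set" where
  "hnf = {(A, B, D). 1 \<le> A \<and> B < A \<and> 1 \<le> D}"

definition hnf_mult :: "(nat \<times> nat \<times> nat) \<times> ((int \<times> int) \<times> (int \<times> int)) \<Rightarrow> (int \<times> int) \<times> (int \<times> int)" where
  "hnf_mult = (\<lambda>((A, B, D), (p, r)). (vscale (int A) p + vscale (int B) r, vscale (int D) r))"

lemma mdet_bilinear:
  "mdet (u + u', v) = mdet (u, v) + mdet (u', v)" "mdet (v, u + u') = mdet (v, u) + mdet (v, u')"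
  "mdet (vscale a u, v) = a * mdet (u, v)" "mdet (u, vscale a v) = a * mdet (u, v)"
  "mdet (u, u) = 0"
  by (auto simp: mdet_def vscale_def algebra_simps)

lemma basis_expansion:
  assumes "mdet (p, r) = 1" shows "u = vscale (mdet (u, r)) p + vscale (mdet (p, u)) r"
proof -
  have "vscale (mdet (u, r)) p + vscale (mdet (p, u)) r = vscale (mdet (p, r)) u"
    by (auto simp: mdet_def vscale_def prod_eq_iff algebra_simps)
  then show ?thesis using assms by (simp add: vscale_def)
qed

lemma vscale_add: "vscale (a + b) u = vscale a u + vscale b u" "vscale a (u + v) = vscale a u + vscale a v"
  "vscale a (vscale b u) = vscale (a * b) u" "vscale 1 u = u"
  by (auto simp: vscale_def prod_eq_iff algebra_simps)

text \<open>D is the gcd of the second row and r its primitive part; p completes r to a basis and is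
  determined up to multiples of r, a freedom used up by reducing B modulo A.\<close>

lemma bij_betw_hnf_mult: "bij_betw hnf_mult (hnf \<times> SL2) GLpos"
  unfolding bij_betw_def
proof
  show "inj_on hnf_mult (hnf \<times> SL2)"
  proof (rule inj_onI)
    fix X Y assume X: "X \<in> hnf \<times> SL2" and Y: "Y \<in> hnf \<times> SL2" and eq: "hnf_mult X = hnf_mult Y"
    obtain A B D p r where Xe: "X = ((A, B, D), (p, r))" by (metis surj_pair)
    obtain A' B' D' p' r' where Ye: "Y = ((A', B', D'), (p', r'))" by (metis surj_pair)
    have b: "1 \<le> A" "B < A" "1 \<le> D" "1 \<le> A'" "B' < A'" "1 \<le> D'" and d: "mdet (p, r) = 1" "mdet (p', r') = 1"
      using X Y by (auto simp: Xe Ye hnf_def SL2_def)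
    have e1: "vscale (int A) p + vscale (int B) r = vscale (int A') p' + vscale (int B') r'"
      and e2: "vscale (int D) r = vscale (int D') r'"
      using eq by (auto simp: Xe Ye hnf_mult_def)
    have "int D = mdet (p, vscale (int D) r)" "int D' = mdet (p', vscale (int D') r')" by (simp_all add: mdet_bilinear d)
    then have "int D = int D' * mdet (p, r')" "int D' = int D * mdet (p', r)"
      using e2 by (metis mdet_bilinear(4))+
    then have "int D dvd int D'" "int D' dvd int D" by (metis dvd_triv_left)+
    then have D: "D = D'" using b by (simp add: dvd_antisym)
    then have r: "r = r'" using e2 b by (auto simp: vscale_def prod_eq_iff)
    have "int A * mdet (p, r) = int A' * mdet (p', r)"
      using arg_cong[OF e1, of "\<lambda>u. mdet (u, r)"] by (simp add: mdet_bilinear r)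
    then have A: "A = A'" using d r by simp
    have "p' = vscale (mdet (p', r)) p + vscale (mdet (p, p')) r" by (rule basis_expansion[OF d(1)])
    then have p': "p' = p + vscale (mdet (p, p')) r" using d r by (simp add: vscale_add)
    have "int B = int A * mdet (p, p') + int B'"
      using arg_cong[OF e1, of "\<lambda>u. mdet (p, u)"] d r A by (simp add: mdet_bilinear)
    moreover have "mdet (p, p') = 0"
    proof (rule ccontr)
      assume "mdet (p, p') \<noteq> 0"
      then have "int A * 1 \<le> int A * \<bar>mdet (p, p')\<bar>" by (intro mult_left_mono) auto
      then have "int A \<le> \<bar>int A * mdet (p, p')\<bar>" by (simp add: abs_mult)
      then show False using calculation b A by linarith
    qed
    ultimately show "X = Y" using p' A D r by (simp add: Xe Ye vscale_def zero_prod_def[symmetric])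
  qed
  show "hnf_mult ` (hnf \<times> SL2) = GLpos"
  proof
    show "hnf_mult ` (hnf \<times> SL2) \<subseteq> GLpos"
      by (auto simp: hnf_mult_def hnf_def SL2_def GLpos_def mdet_bilinear)
    show "GLpos \<subseteq> hnf_mult ` (hnf \<times> SL2)"
    proof
      fix g assume g: "g \<in> GLpos"
      obtain u c d where ge: "g = (u, (c, d))" by (metis surj_pair)
      have "(c, d) \<noteq> 0" using g GLpos_nonzero ge by blast
      define D where "D = gcd c d"
      have D: "D > 0" using \<open>(c, d) \<noteq> 0\<close> by (auto simp: D_def zero_prod_def)
      then have "gcd c d \<noteq> 0" by (simp add: D_def)
      then obtain c' d' where cd: "c = c' * D" "d = d' * D" "coprime c' d'"
        using gcd_coprime_exists[of c d] unfolding D_def by blast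
      define r where "r = (c', d')"
      obtain x y where "x * c' + y * d' = 1" using bezout_int[of c' d'] cd(3) by auto
      then have p0: "mdet ((y, - x), r) = 1" by (simp add: mdet_def r_def algebra_simps)
      have v: "(c, d) = vscale D r" by (simp add: vscale_def cd r_def)
      define A where "A = mdet (u, r)"
      have "D * A > 0" using g by (simp add: GLpos_def ge v mdet_bilinear A_def)
      then have A: "A > 0" using D by (simp add: zero_less_mult_iff)
      define B where "B = mdet ((y, - x), u) mod A"
      define p where "p = (y, - x) + vscale (mdet ((y, - x), u) div A) r"
      have p: "mdet (p, r) = 1" by (simp add: p_def mdet_bilinear p0)
      have "u = vscale A (y, - x) + vscale (mdet ((y, - x), u)) r" unfolding A_def by (rule basis_expansion[OF p0])
      also have "mdet ((y, - x), u) = A * (mdet ((y, - x), u) div A) + B" by (simp add: B_def)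
      finally have "u = vscale A p + vscale B r" by (simp add: p_def vscale_add add.assoc)
      moreover have "0 \<le> B" "B < A" using A by (auto simp: B_def)
      ultimately have "g = hnf_mult ((nat A, nat B, nat D), (p, r))" "(nat A, nat B, nat D) \<in> hnf" "(p, r) \<in> SL2"
        using A D p v by (auto simp: hnf_mult_def ge hnf_def SL2_def)
      then show "g \<in> hnf_mult ` (hnf \<times> SL2)" by blast
    qed
  qed
qed

text \<open>With lambda = A lambda' + B mu' and mu = D mu' the denominator is A times lambda' + mu'
  (D z + B) / A, so each coset contributes the \<open>SL2\<close> kernel at a transformed
  point.\<close>

lemma kern_GLpos_has_sum:
  assumes \<tau>: "\<tau> \<in> uhp" and z: "z \<in> uhp" and k: "k \<ge> 6"
  shows "((\<lambda>(A, B, D). kern SL2 k \<tau> ((of_nat D * z + of_nat B) / of_nat A) / of_nat A ^ k) has_sum kern GLpos k \<tau> z) hnf"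
proof -
  let ?F = "\<lambda>g. 1 / (lat \<tau> (fst g) + lat \<tau> (snd g) * z) ^ k"
  have "(?F has_sum kern GLpos k \<tau> z) GLpos"
    unfolding kern_def using kern_summable(2)[OF \<tau> z subset_refl k] by (rule has_sum_infsum)
  then have "((\<lambda>x. ?F (hnf_mult x)) has_sum kern GLpos k \<tau> z) (hnf \<times> SL2)"
    by (subst has_sum_reindex_bij_betw[OF bij_betw_hnf_mult])
  then show ?thesis
  proof (rule has_sum_SigmaD)
    fix h assume h: "h \<in> hnf"
    obtain A B D where he: "h = (A, B, D)" by (metis surj_pair)
    have AD: "A > 0" "D > 0" using h by (auto simp: he hnf_def)
    let ?z = "(of_nat D * z + of_nat B) / of_nat A"
    have "Im ?z = D * Im z / A" by (simp add: Im_divide_of_nat)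
    then have z': "?z \<in> uhp" using AD z by simp
    have "?F (hnf_mult (h, g)) = 1 / of_nat A ^ k * (1 / (lat \<tau> (fst g) + lat \<tau> (snd g) * ?z) ^ k)" for g
    proof -
      have "lat \<tau> (fst (hnf_mult (h, g))) + lat \<tau> (snd (hnf_mult (h, g))) * z
          = of_nat A * (lat \<tau> (fst g) + lat \<tau> (snd g) * ?z)"
        using AD by (simp add: hnf_mult_def he case_prod_unfold lat_add lat_vscale field_simps)
      then show ?thesis by (simp add: power_mult_distrib)
    qed
    moreover have "((\<lambda>g. 1 / of_nat A ^ k * (1 / (lat \<tau> (fst g) + lat \<tau> (snd g) * ?z) ^ k)) has_sum
        1 / of_nat A ^ k * kern SL2 k \<tau> ?z) SL2"
      unfolding kern_def
      by (intro has_sum_cmult_right has_sum_infsum kern_summable(2)[OF \<tau> z' SL2_subset_GLpos k])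
    ultimately show "((\<lambda>g. ?F (hnf_mult (h, g))) has_sum
        (case h of (A, B, D) \<Rightarrow> kern SL2 k \<tau> ((of_nat D * z + of_nat B) / of_nat A) / of_nat A ^ k)) SL2"
      by (simp add: he)
  qed
qed

text \<open>For n >= 2 and m >= 5 one has n^(-m) <= n^(-2) / 8, and the tail of zeta(2) is at most
  10 / 6 because pi < 4. The bound 5 / 4 suffices for the contraction since (5 / 4)^2 < 2.\<close>

lemma inverse_powers_has_sum:
  assumes "m \<ge> 5"
  obtains s where "((\<lambda>n::nat. 1 / real n ^ m) has_sum s) {1..}" "0 \<le> s" "s \<le> 5 / 4"
proof -
  have sq: "summable (\<lambda>n. 1 / real (n + 1) ^ 2)" "(\<Sum>n. 1 / real (n + 1) ^ 2) = pi\<^sup>2 / 6"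
    using inverse_squares_sums by (auto simp: sums_iff)
  have sq': "summable (\<lambda>n. 1 / real (Suc n + 1) ^ 2)" by (subst summable_Suc_iff) (rule sq(1))
  have "(\<Sum>n. 1 / real (Suc n + 1) ^ 2) = pi\<^sup>2 / 6 - 1"
    using suminf_split_head[OF sq(1)] sq(2) by simp
  moreover have "pi\<^sup>2 \<le> 4\<^sup>2" using pi_less_4 pi_gt_zero by (intro power_mono) auto
  ultimately have le: "(\<Sum>n. 1 / real (Suc n + 1) ^ 2) \<le> 10 / 6" by simp
  have tm: "1 / real (Suc n + 1) ^ m \<le> 1 / 8 * (1 / real (Suc n + 1) ^ 2)" for n
  proof -
    have "8 * real (Suc n + 1) ^ 2 \<le> real (Suc n + 1) ^ 3 * real (Suc n + 1) ^ 2"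
      using power_mono[of 2 "real (Suc n + 1)" 3] by (intro mult_right_mono) auto
    also have "\<dots> = real (Suc n + 1) ^ 5" by (simp flip: power_add)
    also have "\<dots> \<le> real (Suc n + 1) ^ m" using assms by (intro power_increasing) auto
    finally have "8 * real (Suc n + 1) ^ 2 \<le> real (Suc n + 1) ^ m" .
    then have "1 / real (Suc n + 1) ^ m \<le> 1 / (8 * real (Suc n + 1) ^ 2)" by (intro divide_left_mono) auto
    then show ?thesis by simp
  qed
  have s1: "summable (\<lambda>n. 1 / real (Suc n + 1) ^ m)"
    by (rule summable_comparison_test'[OF summable_mult[OF sq', of "1/8"]]) (use tm in auto)
  then have s0: "summable (\<lambda>n. 1 / real (n + 1) ^ m)" by (subst (asm) summable_Suc_iff)
  define s where "s = (\<Sum>n. 1 / real (n + 1) ^ m)"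
  have "s = 1 + (\<Sum>n. 1 / real (Suc n + 1) ^ m)" unfolding s_def using suminf_split_head[OF s0] by simp
  also have "(\<Sum>n. 1 / real (Suc n + 1) ^ m) \<le> (\<Sum>n. 1 / 8 * (1 / real (Suc n + 1) ^ 2))"
    by (intro suminf_le tm s1 summable_mult sq')
  also have "\<dots> \<le> 1 / 4" using le by (simp only: suminf_mult[OF sq'])
  finally have "s \<le> 5 / 4" by simp
  moreover have "((\<lambda>n. 1 / real (n + 1) ^ m) has_sum s) UNIV"
    unfolding s_def by (rule sums_nonneg_imp_has_sum[OF summable_sums[OF s0]]) auto
  then have "((\<lambda>n::nat. 1 / real n ^ m) has_sum s) {1..}"
    by (subst has_sum_reindex_bij_witness[where j = "\<lambda>n. n - 1" and i = "\<lambda>n. n + 1"]) auto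
  moreover from this have "0 \<le> s" by (rule has_sum_nonneg) auto
  ultimately show ?thesis using that by blast
qed

text \<open>In the decomposition by Hermite normal forms the term with \<open>A = D = 1\<close> dominates: at a maximum
  of \<open>(Im z)\<^sup>m |Q z|\<close>, where \<open>Q\<close> is the combination for \<open>SL2\<close>, the other terms add up to less.\<close>

theorem combo_kern_SL2_zero:
  assumes A: "finite A" "A \<subseteq> uhp" and m: "m \<ge> 6"
    and zero: "\<And>z. z \<in> uhp \<Longrightarrow> (\<Sum>\<tau>\<in>A. \<alpha> \<tau> * kern GLpos (2 * m) \<tau> z) = 0" and z: "z \<in> uhp"
  shows "(\<Sum>\<tau>\<in>A. \<alpha> \<tau> * kern SL2 (2 * m) \<tau> z) = 0"
proof -
  define k where "k = 2 * m"
  define Q where "Q z = (\<Sum>\<tau>\<in>A. \<alpha> \<tau> * kern SL2 k \<tau> z)" for z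
  have A': "\<tau> \<in> uhp" if "\<tau> \<in> A" for \<tau> using A that by blast
  have k: "k \<ge> 7" using m by (simp add: k_def)
  have holo: "Q holomorphic_on uhp"
    unfolding Q_def using A' k SL2_subset_GLpos by (intro holomorphic_intros kern_holomorphic) auto
  have per: "Q (z + 1) = Q z" for z by (simp add: Q_def kern_T)
  have "vanishes_at_cusp Q"
    unfolding Q_def using A' k SL2_subset_GLpos by (intro vanishes_at_cusp_sum A kern_vanishes_at_cusp) auto
  then obtain a where a: "has_fourier_expansion Q a" "a 0 = 0"
    by (rule fourier_expansion_exists[OF holo per])
  have Q_S: "Q (- 1 / z) = z ^ (2 * m) * Q z" if "z \<in> uhp" for z
  proof -
    have "z \<noteq> 0" using that by auto
    then have K: "kern SL2 k \<tau> (- 1 / z) = z ^ k * kern SL2 k \<tau> z" for \<tau> by (intro kern_S) auto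
    show ?thesis unfolding Q_def K k_def[symmetric] sum_distrib_left by (intro sum.cong) auto
  qed
  obtain z0 where z0: "z0 \<in> uhp" "\<And>z. z \<in> uhp \<Longrightarrow> Im z ^ m * norm (Q z) \<le> Im z0 ^ m * norm (Q z0)"
    using cusp_form_norm_attains_sup[OF holomorphic_on_imp_continuous_on[OF holo] a per Q_S] by blast
  define N where "N = Im z0 ^ m * norm (Q z0)"
  let ?h = "\<lambda>(A, B, D). Q ((of_nat D * z0 + of_nat B) / of_nat A) / of_nat A ^ k"
  let ?c = "\<lambda>(A, B, D). 1 / (real A ^ m * real D ^ m)"
  have "((\<lambda>x. \<Sum>\<tau>\<in>A. \<alpha> \<tau> * (case x of (A, B, D) \<Rightarrow> kern SL2 k \<tau> ((of_nat D * z0 + of_nat B) / of_nat A) / of_nat A ^ k))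
      has_sum (\<Sum>\<tau>\<in>A. \<alpha> \<tau> * kern GLpos k \<tau> z0)) hnf"
    using infsum_sum[OF A(1), of "\<lambda>\<tau> x. \<alpha> \<tau> * (case x of (A, B, D) \<Rightarrow> kern SL2 k \<tau> ((of_nat D * z0 + of_nat B) / of_nat A) / of_nat A ^ k)" hnf]
      has_sum_cmult_right[OF kern_GLpos_has_sum[OF A' z0(1)]] k by (auto simp: has_sum_iff)
  moreover have "(\<Sum>\<tau>\<in>A. \<alpha> \<tau> * (case x of (A, B, D) \<Rightarrow> kern SL2 k \<tau> ((of_nat D * z0 + of_nat B) / of_nat A) / of_nat A ^ k)) = ?h x" for x
    by (simp add: Q_def sum_divide_distrib case_prod_unfold)
  ultimately have sum0: "(?h has_sum 0) hnf" using zero[OF z0(1)] by (simp add: k_def)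
  obtain s1 where s1: "((\<lambda>n::nat. 1 / real n ^ (m - 1)) has_sum s1) {1..}" "0 \<le> s1" "s1 \<le> 5 / 4"
    by (rule inverse_powers_has_sum[of "m - 1"]) (use m in auto)
  obtain s2 where s2: "((\<lambda>n::nat. 1 / real n ^ m) has_sum s2) {1..}" "0 \<le> s2" "s2 \<le> 5 / 4"
    by (rule inverse_powers_has_sum[of m]) (use m in auto)
  \<comment> \<open>Each pair (A, D) occurs with A values of B, so the total weight is zeta(m - 1)
    zeta(m); m >= 6 keeps both exponents at least 5.\<close>
  have c_sum: "(?c has_sum s1 * s2) hnf"
  proof -
    have inner: "((\<lambda>y. ?c (n, y)) has_sum 1 / real n ^ (m - 1) * s2) ({..<n} \<times> {1..})" if n: "n \<in> {1..}" for n
    proof -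
      have s2': "(\<lambda>n::nat. 1 / real n ^ m) abs_summable_on {1..}" using s2(1) by (simp add: has_sum_iff)
      have fin: "(\<lambda>B::nat. 1 / real n ^ m) abs_summable_on {..<n}" by simp
      have "infsum (\<lambda>(B, D). 1 / real n ^ m * (1 / real D ^ m)) ({..<n} \<times> {1..}) = real n * (1 / real n ^ m) * s2"
        using infsum_Times_mult[OF fin s2'] s2(1) by (simp add: has_sum_iff)
      moreover have "(\<lambda>(B, D). 1 / real n ^ m * (1 / real D ^ m)) summable_on ({..<n} \<times> {1..})"
        by (rule abs_summable_summable[OF abs_summable_on_Times[OF fin s2']])
      ultimately have "((\<lambda>(B, D). 1 / real n ^ m * (1 / real D ^ m)) has_sum real n * (1 / real n ^ m) * s2) ({..<n} \<times> {1..})"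
        by (simp add: has_sum_iff)
      moreover have eq: "real n * (1 / real n ^ m) = 1 / real n ^ (m - 1)" using n m by (cases m) auto
      ultimately show ?thesis
        unfolding eq by (simp only: case_prod_unfold fst_conv snd_conv times_divide_times_eq mult_1_left)
    qed
    have outer: "((\<lambda>n. 1 / real n ^ (m - 1) * s2) has_sum s1 * s2) {1..}"
      by (rule has_sum_cmult_left[OF s1(1)])
    have "?c summable_on Sigma {1..} (\<lambda>n. {..<n} \<times> {1..})"
      by (rule summable_on_SigmaI[OF inner has_sum_imp_summable[OF outer]]) auto
    from has_sum_SigmaI[OF inner outer this]
    have "(?c has_sum s1 * s2) (Sigma {1..} (\<lambda>n. {..<n} \<times> {1..}))" .
    moreover have "Sigma {1..} (\<lambda>n. {..<n} \<times> {1..}) = hnf" by (auto simp: hnf_def)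
    ultimately show ?thesis by simp
  qed
  have y0: "Im z0 ^ m > 0" using z0(1) by simp
  have le: "norm (?h x) \<le> N / Im z0 ^ m * ?c x" if x: "x \<in> hnf" for x
  proof -
    obtain A B D where xe: "x = (A, B, D)" by (metis surj_pair)
    have AD: "A > 0" "D > 0" using x by (auto simp: xe hnf_def)
    let ?z = "(of_nat D * z0 + of_nat B) / of_nat A"
    have im: "Im ?z = D * Im z0 / A" by (simp add: Im_divide_of_nat)
    have "?z \<in> uhp" using AD z0(1) im by simp
    then have "(D * Im z0 / A) ^ m * norm (Q ?z) \<le> N" using z0(2)[of ?z] im by (simp add: N_def)
    then have "norm (Q ?z) \<le> N / (D * Im z0 / A) ^ m" using AD z0(1) by (simp add: pos_le_divide_eq mult.commute)
    then have "norm (Q ?z) / real A ^ k \<le> N / (D * Im z0 / A) ^ m / real A ^ k" by (rule divide_right_mono) simp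
    also have "\<dots> = N / Im z0 ^ m * (1 / (real A ^ m * real D ^ m))"
    proof -
      have "real A ^ k = real A ^ m * real A ^ m" by (simp add: k_def mult_2 power_add)
      then show ?thesis using AD by (simp add: power_mult_distrib power_divide)
    qed
    finally show ?thesis by (simp add: xe norm_divide norm_power)
  qed
  have one: "(1, 0, 1) \<in> hnf" by (simp add: hnf_def)
  have h1: "?h (1, 0, 1) = Q z0" and c1: "?c (1, 0, 1) = 1" by simp_all
  have "(?h has_sum 0 - Q z0) (hnf - {(1, 0, 1)})"
    using has_sum_Diff[OF sum0 has_sum_finite[of "{(1, 0, 1)}" ?h]] one by simp
  moreover have "((\<lambda>x. N / Im z0 ^ m * ?c x) has_sum N / Im z0 ^ m * (s1 * s2 - 1)) (hnf - {(1, 0, 1)})"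
    using has_sum_Diff[OF c_sum has_sum_finite[of "{(1, 0, 1)}" ?c]] one by (intro has_sum_cmult_right) simp
  ultimately have "norm (0 - Q z0) \<le> N / Im z0 ^ m * (s1 * s2 - 1)"
    by (rule norm_infsum_le) (use le in auto)
  then have "Im z0 ^ m * norm (0 - Q z0) \<le> Im z0 ^ m * (N / Im z0 ^ m * (s1 * s2 - 1))"
    using y0 by (intro mult_left_mono) auto
  moreover have "Im z0 ^ m * (N / Im z0 ^ m * (s1 * s2 - 1)) = N * (s1 * s2 - 1)"
    using less_imp_neq[OF y0] by (simp only: mult.assoc[symmetric] times_divide_eq_right nonzero_mult_div_cancel_left)
  moreover have "Im z0 ^ m * norm (0 - Q z0) = N" by (simp add: N_def)
  \<comment> \<open>The contraction: the factor on the right is at most 25 / 16 - 1 = 9 /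
    16.\<close>
  ultimately have "N \<le> N * (s1 * s2 - 1)" by simp
  moreover have "s1 * s2 \<le> (5 / 4) * (5 / 4)" using s1 s2 by (intro mult_mono) auto
  moreover have "N \<ge> 0" using y0 by (simp add: N_def)
  then have "N * (s1 * s2 - 1) \<le> N * (9 / 16)" using calculation by (intro mult_left_mono) auto
  ultimately have "N \<le> 0" by linarith
  then have "Im z ^ m * norm (Q z) \<le> 0" using z0(2)[OF z] by (simp add: N_def)
  moreover have "Im z ^ m > 0" using z by simp
  ultimately have "norm (Q z) \<le> 0" by (simp add: mult_le_0_iff)
  then show ?thesis by (simp add: Q_def k_def)
qed

section \<open>The invariant measure\<close>

text \<open>In the coordinates \<open>z = e\<^sup>t (x + \<i>)\<close> the hyperbolic measure is the Lebesgue measure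
  \<open>dx dt\<close>, and translations, dilations and the inversion of the upper half-plane become
  shears of the plane.\<close>

definition uhp_pt :: "real \<times> real \<Rightarrow> complex" where
  "uhp_pt = (\<lambda>(x, t). of_real (exp t) * (of_real x + \<i>))"

definition uhp_crd :: "complex \<Rightarrow> real \<times> real" where
  "uhp_crd z = (Re z / Im z, ln (Im z))"

lemma Im_uhp_pt [simp]: "Im (uhp_pt p) = exp (snd p)" and Re_uhp_pt [simp]: "Re (uhp_pt p) = exp (snd p) * fst p"
  by (simp_all add: uhp_pt_def split_beta)

lemma uhp_pt_in_uhp: "uhp_pt p \<in> uhp" by simp

lemma uhp_pt_crd: "z \<in> uhp \<Longrightarrow> uhp_pt (uhp_crd z) = z"
  by (simp add: complex_eq_iff uhp_crd_def)

lemma continuous_on_uhp_pt: "continuous_on A uhp_pt"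
  unfolding uhp_pt_def split_beta by (intro continuous_intros)

definition measure_preserving_plane :: "(real \<times> real \<Rightarrow> real \<times> real) \<Rightarrow> bool" where
  "measure_preserving_plane T \<longleftrightarrow> T \<in> borel_measurable borel \<and> distr lborel borel T = lborel"

lemma measure_preserving_planeI:
  assumes T: "T \<in> borel_measurable borel"
    and eq: "\<And>f::real \<times> real \<Rightarrow> ennreal. f \<in> borel_measurable borel \<Longrightarrow>
      (\<integral>\<^sup>+x. \<integral>\<^sup>+t. f (T (x, t)) \<partial>lborel \<partial>lborel) = (\<integral>\<^sup>+x. \<integral>\<^sup>+t. f (x, t) \<partial>lborel \<partial>lborel)"
  shows "measure_preserving_plane T"
  unfolding measure_preserving_plane_def
proof
  show "distr lborel borel T = lborel"
  proof (rule measure_eqI)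
    fix X assume "X \<in> sets (distr lborel borel T)"
    then have X: "X \<in> sets borel" by simp
    have fst: "(\<integral>\<^sup>+p. f p \<partial>lborel) = (\<integral>\<^sup>+x. \<integral>\<^sup>+t. f (x, t) \<partial>lborel \<partial>lborel)" if "f \<in> borel_measurable borel" for f :: "real \<times> real \<Rightarrow> ennreal"
    proof -
      have "f \<in> borel_measurable (lborel \<Otimes>\<^sub>M lborel)" using that by (simp add: lborel_prod)
      from lborel.nn_integral_fst[OF this] show ?thesis by (simp add: lborel_prod)
    qed
    have m: "(\<lambda>p. indicator X (T p) :: ennreal) \<in> borel_measurable borel" using T X by measurable
    have "emeasure (distr lborel borel T) X = (\<integral>\<^sup>+p. indicator X (T p) \<partial>lborel)"
      using T X nn_integral_distr[of T lborel borel "indicator X"] by simp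
    also have "\<dots> = (\<integral>\<^sup>+x. \<integral>\<^sup>+t. indicator X (x, t) \<partial>lborel \<partial>lborel)"
      unfolding fst[OF m] using X by (intro eq borel_measurable_indicator)
    also have "\<dots> = emeasure lborel X" using X by (subst fst[symmetric]) auto
    finally show "emeasure (distr lborel borel T) X = emeasure lborel X" .
  qed simp
qed (rule T)

lemma measure_preserving_plane_comp:
  assumes "measure_preserving_plane S" "measure_preserving_plane T"
  shows "measure_preserving_plane (\<lambda>p. S (T p))"
proof -
  have m: "S \<in> borel_measurable borel" "T \<in> borel_measurable borel" using assms by (auto simp: measure_preserving_plane_def)
  have "distr lborel borel (S \<circ> T) = distr (distr lborel borel T) borel S"
    using m by (subst distr_distr) (auto simp: comp_def)
  then show ?thesis using assms m by (auto simp: measure_preserving_plane_def comp_def)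
qed

lemma measure_preserving_shear:
  assumes "continuous_on UNIV \<phi>" shows "measure_preserving_plane (\<lambda>(x, t). (x + \<phi> t, t))"
proof (rule measure_preserving_planeI)
  have c: "continuous_on UNIV (\<lambda>(x, t). (x + \<phi> t, t))"
    unfolding split_beta by (intro continuous_intros continuous_on_compose2[OF assms]) auto
  then show "(\<lambda>(x, t). (x + \<phi> t, t)) \<in> borel_measurable borel" by (rule borel_measurable_continuous_onI)
  fix f :: "real \<times> real \<Rightarrow> ennreal" assume f: "f \<in> borel_measurable borel"
  then have f': "f \<in> borel_measurable (lborel \<Otimes>\<^sub>M lborel)" by (simp add: lborel_prod)
  have g: "(\<lambda>(x, t). f (x + \<phi> t, t)) \<in> borel_measurable (lborel \<Otimes>\<^sub>M lborel)"
    using measurable_compose[OF borel_measurable_continuous_onI[OF c] f] by (simp add: lborel_prod split_beta)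
  have "(\<integral>\<^sup>+x. f (x + \<phi> t, t) \<partial>lborel) = (\<integral>\<^sup>+x. f (x, t) \<partial>lborel)" for t
    using nn_integral_real_affine[of "\<lambda>x. f (x, t)" 1 "\<phi> t"] measurable_compose[OF _ f, of "\<lambda>x. (x, t)" borel]
    by (simp add: add.commute)
  then have "(\<integral>\<^sup>+t. \<integral>\<^sup>+x. f (x + \<phi> t, t) \<partial>lborel \<partial>lborel) = (\<integral>\<^sup>+t. \<integral>\<^sup>+x. f (x, t) \<partial>lborel \<partial>lborel)" by simp
  then show "(\<integral>\<^sup>+x. \<integral>\<^sup>+t. f ((\<lambda>(x, t). (x + \<phi> t, t)) (x, t)) \<partial>lborel \<partial>lborel) = (\<integral>\<^sup>+x. \<integral>\<^sup>+t. f (x, t) \<partial>lborel \<partial>lborel)"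
    using lborel_pair.Fubini'[OF g] lborel_pair.Fubini'[of "\<lambda>x t. f (x, t)"] f' by simp
qed

lemma measure_preserving_flip_shear:
  assumes "continuous_on UNIV \<psi>" "\<bar>c\<bar> = 1" shows "measure_preserving_plane (\<lambda>(x, t). (c * x, c * t + \<psi> x))"
proof (rule measure_preserving_planeI)
  have c: "continuous_on UNIV (\<lambda>(x, t). (c * x, c * t + \<psi> x))"
    unfolding split_beta by (intro continuous_intros continuous_on_compose2[OF assms(1)]) auto
  then show "(\<lambda>(x, t). (c * x, c * t + \<psi> x)) \<in> borel_measurable borel" by (rule borel_measurable_continuous_onI)
  fix f :: "real \<times> real \<Rightarrow> ennreal" assume f: "f \<in> borel_measurable borel"
  have c0: "c \<noteq> 0" using assms(2) by auto
  have "(\<integral>\<^sup>+t. f (c * x, c * t + \<psi> x) \<partial>lborel) = (\<integral>\<^sup>+t. f (c * x, t) \<partial>lborel)" for x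
    using nn_integral_real_affine[of "\<lambda>t. f (c * x, t)" c "\<psi> x"] measurable_compose[OF _ f, of "\<lambda>t. (c * x, t)" borel] assms(2) c0
    by (simp add: add.commute)
  moreover have "(\<lambda>x. \<integral>\<^sup>+t. f (x, t) \<partial>lborel) \<in> borel_measurable borel"
    using lborel.borel_measurable_nn_integral_fst[of f lborel] f by (simp add: lborel_prod)
  from nn_integral_real_affine[OF this c0, of 0]
  have "(\<integral>\<^sup>+x. \<integral>\<^sup>+t. f (c * x, t) \<partial>lborel \<partial>lborel) = (\<integral>\<^sup>+x. \<integral>\<^sup>+t. f (x, t) \<partial>lborel \<partial>lborel)"
    using assms(2) by simp
  ultimately show "(\<integral>\<^sup>+x. \<integral>\<^sup>+t. f ((\<lambda>(x, t). (c * x, c * t + \<psi> x)) (x, t)) \<partial>lborel \<partial>lborel) = (\<integral>\<^sup>+x. \<integral>\<^sup>+t. f (x, t) \<partial>lborel \<partial>lborel)"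
    by simp
qed

definition moeb :: "real \<Rightarrow> real \<Rightarrow> real \<Rightarrow> real \<Rightarrow> complex \<Rightarrow> complex" where
  "moeb a b c d z = (of_real a * z + of_real b) / (of_real c * z + of_real d)"

lemma moeb_denom_nonzero:
  assumes "a * d - b * c = 1" "z \<in> uhp" shows "of_real c * z + of_real d \<noteq> 0"
  using assms by (auto simp: complex_eq_iff)

lemma Im_moeb:
  assumes "a * d - b * c = 1"
  shows "Im (moeb a b c d z) = Im z / (cmod (of_real c * z + of_real d))\<^sup>2"
proof -
  have "Im (moeb a b c d z) = ((a * d - b * c) * Im z) / (cmod (of_real c * z + of_real d))\<^sup>2"
    by (simp add: moeb_def Im_divide cmod_power2 algebra_simps)
  then show ?thesis by (simp add: assms)
qed

lemma moeb_in_uhp: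
  assumes "a * d - b * c = 1" "z \<in> uhp" shows "moeb a b c d z \<in> uhp"
  using moeb_denom_nonzero[OF assms] assms by (simp add: Im_moeb)

text \<open>For c = 0 the map is a dilation by a^2 followed by a translation; otherwise it is
  composed of the translation by d / c, the dilation by c^2, the inversion and the translation by a
  / c. In the coordinates the inversion is (x, t) -> (-x, -t - ln (1 + x^2)).\<close>

lemma measure_preserving_moeb:
  assumes det: "a * d - b * c = 1"
  shows "measure_preserving_plane (\<lambda>p. uhp_crd (moeb a b c d (uhp_pt p)))"
proof -
  have Tr: "measure_preserving_plane (\<lambda>p. uhp_crd (uhp_pt p + of_real \<beta>))" for \<beta>
  proof -
    have "(\<lambda>p. uhp_crd (uhp_pt p + of_real \<beta>)) = (\<lambda>(x, t). (x + \<beta> * exp (- t), t))"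
      by (auto simp: uhp_crd_def fun_eq_iff field_simps exp_minus)
    then show ?thesis
      using measure_preserving_shear[of "\<lambda>t. \<beta> * exp (- t)"] by (simp add: continuous_intros)
  qed
  have Sc: "measure_preserving_plane (\<lambda>p. uhp_crd (of_real r * uhp_pt p))" if "r > 0" for r
  proof -
    have "(\<lambda>p. uhp_crd (of_real r * uhp_pt p)) = (\<lambda>(x, t). (1 * x, 1 * t + ln r))"
      using that by (auto simp: uhp_crd_def fun_eq_iff ln_mult)
    then show ?thesis using measure_preserving_flip_shear[of "\<lambda>_. ln r" 1] by simp
  qed
  have S: "measure_preserving_plane (\<lambda>p. uhp_crd (- 1 / uhp_pt p))"
  proof -
    have "uhp_crd (- 1 / uhp_pt (x, t)) = (- 1 * x, - 1 * t + - ln (1 + x\<^sup>2))" for x t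
    proof -
      have n: "(cmod (uhp_pt (x, t)))\<^sup>2 = (exp t)\<^sup>2 * (1 + x\<^sup>2)"
        by (simp only: cmod_power2 Im_uhp_pt Re_uhp_pt) (simp add: power_mult_distrib algebra_simps)
      have pos: "1 + x\<^sup>2 > 0" by (simp add: add_pos_nonneg)
      have "Im (- 1 / uhp_pt (x, t)) = exp t / ((exp t)\<^sup>2 * (1 + x\<^sup>2))"
        by (simp only: Im_uminus_inverse n) simp
      also have "\<dots> = exp (- t - ln (1 + x\<^sup>2))" using pos by (simp only: exp_diff exp_minus exp_ln power2_eq_square) (simp add: divide_simps)
      finally have im: "Im (- 1 / uhp_pt (x, t)) = exp (- t - ln (1 + x\<^sup>2))" .
      have "Re (- 1 / uhp_pt (x, t)) = - x * Im (- 1 / uhp_pt (x, t))"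
        by (simp add: Re_divide Im_divide del: divide_minus_left)
      then show ?thesis unfolding uhp_crd_def im by simp
    qed
    then have "(\<lambda>p. uhp_crd (- 1 / uhp_pt p)) = (\<lambda>(x, t). (- 1 * x, - 1 * t + - ln (1 + x\<^sup>2)))" by auto
    moreover have "continuous_on UNIV (\<lambda>x::real. - ln (1 + x\<^sup>2))"
      by (intro continuous_intros) (auto simp: add_nonneg_eq_0_iff)
    ultimately show ?thesis using measure_preserving_flip_shear[of "\<lambda>x. - ln (1 + x\<^sup>2)" "- 1"] by simp
  qed
  show ?thesis
  proof (cases "c = 0")
    case True
    then have ad: "a * d = 1" "a \<noteq> 0" "d \<noteq> 0" using det by auto
    have "moeb a b c d (uhp_pt p) = uhp_pt (uhp_crd (of_real (a\<^sup>2) * uhp_pt p)) + of_real (a * b)" for p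
    proof -
      have d: "d = 1 / a" using ad by (simp add: field_simps)
      have "of_real (a\<^sup>2) * uhp_pt p \<in> uhp" using ad by simp
      then show ?thesis using ad by (simp add: uhp_pt_crd moeb_def True d power2_eq_square algebra_simps)
    qed
    then show ?thesis
      using measure_preserving_plane_comp[OF Tr[of "a * b"] Sc[of "a\<^sup>2"]] ad by simp
  next
    case False
    have "moeb a b c d (uhp_pt p) = uhp_pt (uhp_crd (- 1 / uhp_pt (uhp_crd (of_real (c\<^sup>2) *
        uhp_pt (uhp_crd (uhp_pt p + of_real (d / c))))))) + of_real (a / c)" for p
    proof -
      define z where "z = uhp_pt p"
      have z: "z \<in> uhp" by (simp add: z_def)
      have 1: "z + of_real (d / c) \<in> uhp" using z by simp
      have 2: "of_real (c\<^sup>2) * (z + of_real (d / c)) \<in> uhp" using z False by simp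
      have 3: "- 1 / (of_real (c\<^sup>2) * (z + of_real (d / c))) \<in> uhp" by (rule uminus_inverse_in_uhp[OF 2])
      have nz: "of_real c * z + of_real d \<noteq> 0" by (rule moeb_denom_nonzero[OF det z])
      have e: "of_real (c\<^sup>2) * (z + of_real (d / c)) = of_real c * (of_real c * z + of_real d)"
        using False by (simp add: power2_eq_square field_simps)
      have "- 1 / (of_real c * (of_real c * z + of_real d)) + of_real (a / c)
          = (of_real a * (of_real c * z + of_real d) - 1) / (of_real c * (of_real c * z + of_real d))"
        using False nz by (simp add: divide_simps)
      also have "of_real a * (of_real c * z + of_real d) - 1 = of_real c * (of_real a * z + of_real b)"
      proof -
        have "complex_of_real (a * d - b * c) = 1" using det by simp
        then show ?thesis by (simp add: algebra_simps)
      qed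
      finally have "- 1 / (of_real c * (of_real c * z + of_real d)) + of_real (a / c) = moeb a b c d z"
        using False by (simp add: moeb_def)
      then show ?thesis unfolding z_def[symmetric] uhp_pt_crd[OF 1] uhp_pt_crd[OF 2] uhp_pt_crd[OF 3] by (simp only: e)
    qed
    then show ?thesis
      using measure_preserving_plane_comp[OF Tr[of "a / c"] measure_preserving_plane_comp[OF S
          measure_preserving_plane_comp[OF Sc[of "c\<^sup>2"] Tr[of "d / c"]]]] False by simp
  qed
qed

lemma integral_moeb:
  fixes F :: "complex \<Rightarrow> 'a::{banach, second_countable_topology}"
  assumes det: "a * d - b * c = 1" and F: "(\<lambda>p. F (uhp_pt p)) \<in> borel_measurable borel"
  shows "integrable lborel (\<lambda>p. F (moeb a b c d (uhp_pt p))) \<longleftrightarrow> integrable lborel (\<lambda>p. F (uhp_pt p))"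
    and "(LINT p|lborel. F (moeb a b c d (uhp_pt p))) = (LINT p|lborel. F (uhp_pt p))"
    and "(\<lambda>p. F (moeb a b c d (uhp_pt p))) \<in> borel_measurable borel"
proof -
  let ?T = "\<lambda>p. uhp_crd (moeb a b c d (uhp_pt p))"
  have T: "?T \<in> borel_measurable borel" "distr lborel borel ?T = lborel"
    using measure_preserving_moeb[OF det] by (auto simp: measure_preserving_plane_def)
  have e: "F (moeb a b c d (uhp_pt p)) = F (uhp_pt (?T p))" for p
    using uhp_pt_crd[OF moeb_in_uhp[OF det uhp_pt_in_uhp]] by simp
  show "integrable lborel (\<lambda>p. F (moeb a b c d (uhp_pt p))) \<longleftrightarrow> integrable lborel (\<lambda>p. F (uhp_pt p))"
    unfolding e using T F integrable_distr_eq[of ?T lborel borel "\<lambda>p. F (uhp_pt p)"] by simp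
  show "(LINT p|lborel. F (moeb a b c d (uhp_pt p))) = (LINT p|lborel. F (uhp_pt p))"
    unfolding e using T F integral_distr[of ?T lborel borel "\<lambda>p. F (uhp_pt p)"] by simp
  show "(\<lambda>p. F (moeb a b c d (uhp_pt p))) \<in> borel_measurable borel"
    unfolding e using measurable_compose[OF T(1) F] by simp
qed

section \<open>The reproducing kernel\<close>

text \<open>A quarter of 1 - |zeta|^2, where zeta = (w - i) / (w + i) is the disc coordinate centred
  at \<open>\<i>\<close>; so it depends only on the hyperbolic distance from
  \<open>\<i>\<close>.\<close>

definition berg :: "complex \<Rightarrow> real" where "berg w = Im w / (cmod (w + \<i>))\<^sup>2"

lemma berg_pos: "w \<in> uhp \<Longrightarrow> berg w > 0"
  by (auto simp: berg_def complex_eq_iff)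

lemma berg_uhp_pt: "berg (uhp_pt (x, t)) = 1 / (exp t * x\<^sup>2 + exp t + 2 + exp (- t))"
proof -
  have "(cmod (uhp_pt (x, t) + \<i>))\<^sup>2 = (exp t * x)\<^sup>2 + (exp t + 1)\<^sup>2" by (simp add: cmod_power2)
  also have "\<dots> = exp t * (exp t * x\<^sup>2 + exp t + 2 + exp (- t))"
    by (simp add: algebra_simps power2_eq_square flip: exp_add)
  finally show ?thesis by (simp add: berg_def)
qed

lemma continuous_on_comp_uhp_pt: "continuous_on uhp F \<Longrightarrow> continuous_on A (\<lambda>p. F (uhp_pt p))"
  by (rule continuous_on_compose2[OF _ continuous_on_uhp_pt]) auto

lemma continuous_on_berg: "continuous_on uhp berg"
  unfolding berg_def by (intro continuous_intros) (auto simp: complex_eq_iff)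

text \<open>The reciprocal D of \<open>berg\<close> satisfies D^2 >= 1 + x^2 by the inequality of
  the arithmetic and geometric mean, and D >= 1 + |t|; four factors therefore dominate (1 + x^2)(1 +
  t^2).\<close>

lemma integrable_berg_power:
  assumes "s \<ge> 4" shows "integrable lborel (\<lambda>p. berg (uhp_pt p) ^ s)"
proof -
  let ?g = "\<lambda>x::real. inverse (1 + x\<^sup>2)"
  have g: "integrable lborel ?g"
    using integrable_inverse_1_plus_square by (simp add: set_integrable_def)
  have "integrable (lborel \<Otimes>\<^sub>M lborel) (\<lambda>(x, t). ?g x * ?g t)"
    by (intro lborel_pair.Fubini_integrable) (use g in \<open>auto simp: norm_mult intro!: integrable_mult_left integrable_mult_right\<close>)
  then have int: "integrable lborel (\<lambda>(x, t). ?g x * ?g t)" by (simp add: lborel_prod)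
  show ?thesis
  proof (rule Bochner_Integration.integrable_bound[OF int])
    have "continuous_on UNIV (\<lambda>p. berg (uhp_pt p) ^ s)"
      by (intro continuous_intros continuous_on_comp_uhp_pt continuous_on_berg)
    then show "(\<lambda>p. berg (uhp_pt p) ^ s) \<in> borel_measurable lborel" by (simp add: borel_measurable_continuous_onI)
    have "norm (berg (uhp_pt (x, t)) ^ s) \<le> norm (?g x * ?g t)" for x t
    proof -
      define D where "D = exp t * x\<^sup>2 + exp t + 2 + exp (- t)"
      have D2: "D \<ge> 2" by (simp add: D_def)
      have "1 + x\<^sup>2 \<le> (exp t * (1 + x\<^sup>2)) * exp (- t) * 4" by (simp add: exp_minus field_simps)
      also have "\<dots> \<le> (exp t * (1 + x\<^sup>2) + exp (- t))\<^sup>2"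
        using sum_squares_bound[of "exp t * (1 + x\<^sup>2)" "exp (- t)"] unfolding power2_sum by linarith
      also have "\<dots> \<le> D\<^sup>2" by (intro power_mono) (auto simp: D_def algebra_simps)
      finally have 1: "1 + x\<^sup>2 \<le> D\<^sup>2" .
      have "\<bar>t\<bar> \<le> exp \<bar>t\<bar>" using exp_ge_add_one_self[of "\<bar>t\<bar>"] by linarith
      also have "\<dots> \<le> exp t + exp (- t)" by (cases "t \<ge> 0") auto
      finally have "1 + \<bar>t\<bar> \<le> D" by (simp add: D_def add_increasing)
      then have "(1 + \<bar>t\<bar>)\<^sup>2 \<le> D\<^sup>2" by (intro power_mono) auto
      then have 2: "1 + t\<^sup>2 \<le> D\<^sup>2" by (simp add: power2_sum)
      have "(1 + x\<^sup>2) * (1 + t\<^sup>2) \<le> D\<^sup>2 * D\<^sup>2" using 1 2 by (intro mult_mono) auto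
      also have "\<dots> = D ^ 4" by (simp flip: power_add)
      also have "\<dots> \<le> D ^ s" using D2 assms by (intro power_increasing) auto
      finally have "1 / D ^ s \<le> 1 / ((1 + x\<^sup>2) * (1 + t\<^sup>2))"
        using D2 by (intro divide_left_mono mult_pos_pos) (auto simp: add_pos_nonneg)
      then show ?thesis using D2 unfolding berg_uhp_pt D_def[symmetric]
        by (simp add: power_divide inverse_eq_divide abs_mult)
    qed
    then show "AE p in lborel. norm (berg (uhp_pt p) ^ s) \<le> norm (case p of (x, t) \<Rightarrow> ?g x * ?g t)" by auto
  qed
qed

definition cay :: "complex \<Rightarrow> complex" where "cay u = \<i> * (1 + u) / (1 - u)"

lemma cay_in_uhp: assumes "norm u < 1" shows "cay u \<in> uhp"
proof -
  have "u \<noteq> 1" using assms by auto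
  have "Im (cay u) = (1 - (cmod u)\<^sup>2) / (cmod (1 - u))\<^sup>2"
    unfolding cay_def Im_divide unfolding cmod_power2 by (simp add: power2_eq_square algebra_simps)
  moreover have "(cmod u)\<^sup>2 < 1" using assms by (simp add: power_less_one_iff)
  ultimately show ?thesis using \<open>u \<noteq> 1\<close> by simp
qed

lemma circle_mean_value:
  assumes "H holomorphic_on ball 0 1" "norm \<zeta> < 1"
  shows "((\<lambda>s. H (exp (2 * of_real pi * \<i> * of_real s) * \<zeta>)) has_integral H 0) {0..1}"
proof -
  have "(\<lambda>u. H (u * \<zeta>)) holomorphic_on cball 0 1"
  proof (intro holomorphic_on_compose_gen[OF _ assms(1), unfolded comp_def] holomorphic_intros)
    have "norm u * norm \<zeta> < 1" if "norm u \<le> 1" for u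
      using mult_left_le_one_le[of "norm \<zeta>" "norm u"] that assms(2) by simp
    then show "(\<lambda>u. u * \<zeta>) ` cball 0 1 \<subseteq> ball 0 1" by (auto simp: norm_mult)
  qed
  from Cauchy_integral_circlepath_simple[OF this, of 0]
  have "((\<lambda>u. H (u * \<zeta>) / u) has_contour_integral (2 * of_real pi * \<i> * H 0)) (circlepath 0 1)"
    by simp
  then have "((\<lambda>s. 2 * of_real pi * \<i> * H (exp (2 * of_real pi * \<i> * of_real s) * \<zeta>))
      has_integral (2 * of_real pi * \<i> * H 0)) {0..1}"
    unfolding has_contour_integral_def
    by (rule has_integral_eq[rotated]) (auto simp: vector_derivative_circlepath01, simp add: circlepath)
  from has_integral_mult_right[OF this, of "1 / (2 * of_real pi * \<i>)"] show ?thesis by simp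
qed

text \<open>In the disc coordinate (w - i) / (w + i) these maps are multiplications by exp (2 pi i
  s): the matrix has angle pi s, but the disc turns twice as fast, so s in [0, 1] is one full
  turn.\<close>

lemma rotation:
  fixes s :: real and w :: complex
  defines "k \<equiv> moeb (cos (pi * s)) (sin (pi * s)) (- sin (pi * s)) (cos (pi * s)) w"
  assumes w: "w \<in> uhp"
  shows "k = cay (exp (2 * of_real pi * \<i> * of_real s) * ((w - \<i>) / (w + \<i>)))" "berg k = berg w"
    "norm ((w - \<i>) / (w + \<i>)) < 1"
proof -
  define e where "e = cis (pi * s)"
  define D where "D = of_real (- sin (pi * s)) * w + of_real (cos (pi * s))"
  have det: "cos (pi * s) * cos (pi * s) - sin (pi * s) * - sin (pi * s) = 1"
    using sin_cos_squared_add2[of "pi * s"] by (simp add: power2_eq_square)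
  have D: "D \<noteq> 0" unfolding D_def by (rule moeb_denom_nonzero[OF det w])
  have ee: "e * cnj e = 1" "norm e = 1" "e \<noteq> 0" by (auto simp: e_def cis_mult cis_cnj)
  have e2: "exp (2 * of_real pi * \<i> * of_real s) = e * e"
    by (simp add: e_def cis_conv_exp mult_ac flip: exp_add)
  have wi: "w + \<i> \<noteq> 0" using w by (auto simp: complex_eq_iff)
  have num: "of_real (cos (pi * s)) * w + of_real (sin (pi * s)) - \<i> * D = e * (w - \<i>)"
    "of_real (cos (pi * s)) * w + of_real (sin (pi * s)) + \<i> * D = cnj e * (w + \<i>)"
    by (simp_all add: D_def e_def complex_eq_iff algebra_simps)
  have kk: "k = (of_real (cos (pi * s)) * w + of_real (sin (pi * s))) / D" by (simp add: k_def moeb_def D_def)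
  have km: "k - \<i> = e * (w - \<i>) / D" "k + \<i> = cnj e * (w + \<i>) / D"
    unfolding num[symmetric] kk using D by (simp_all add: field_simps)
  have ki: "k + \<i> \<noteq> 0" using km(2) ee wi D by simp
  have "(k - \<i>) / (k + \<i>) = e * (w - \<i>) / (cnj e * (w + \<i>))" unfolding km using D by simp
  also have "\<dots> = e * e * ((w - \<i>) / (w + \<i>))" using ee wi by (simp add: divide_simps)
  finally have z: "e * e * ((w - \<i>) / (w + \<i>)) = (k - \<i>) / (k + \<i>)" by simp
  have "1 - (k - \<i>) / (k + \<i>) = 2 * \<i> / (k + \<i>)" "1 + (k - \<i>) / (k + \<i>) = 2 * k / (k + \<i>)"
    using ki by (simp_all add: field_simps)
  then show "k = cay (exp (2 * of_real pi * \<i> * of_real s) * ((w - \<i>) / (w + \<i>)))"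
    unfolding e2 z cay_def using ki by simp
  have "Im k = Im w / (cmod D)\<^sup>2" unfolding k_def D_def by (rule Im_moeb[OF det])
  then show "berg k = berg w" using ee wi D unfolding berg_def km(2) by (simp add: norm_divide norm_mult power_divide)
  have "(cmod (w - \<i>))\<^sup>2 < (cmod (w + \<i>))\<^sup>2" using w unfolding cmod_power2 by (simp add: power2_eq_square algebra_simps)
  then have "cmod (w - \<i>) < cmod (w + \<i>)" by (rule power_less_imp_less_base) simp
  then show "norm ((w - \<i>) / (w + \<i>)) < 1" using wi by (simp add: norm_divide)
qed

text \<open>The mean of \<open>g\<close> over the rotations around \<open>\<i>\<close>, which preserve \<open>berg\<close> and the measure, is \<open>g \<i>\<close>.\<close>

lemma reproducing_at_i:
  assumes g: "g holomorphic_on uhp" and B: "\<And>w. w \<in> uhp \<Longrightarrow> norm (g w) * berg w ^ k \<le> B * berg w ^ 4"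
  shows "integrable lborel (\<lambda>p. g (uhp_pt p) * of_real (berg (uhp_pt p) ^ k))"
    and "(LINT p|lborel. g (uhp_pt p) * of_real (berg (uhp_pt p) ^ k)) = g \<i> * (LINT p|lborel. of_real (berg (uhp_pt p) ^ k))"
proof -
  define F where "F w = g w * of_real (berg w ^ k)" for w
  have cg: "continuous_on uhp g" using g by (rule holomorphic_on_imp_continuous_on)
  have cF: "continuous_on uhp F" unfolding F_def by (intro continuous_intros cg continuous_on_berg)
  have mF: "(\<lambda>p. F (uhp_pt p)) \<in> borel_measurable borel"
    by (rule borel_measurable_continuous_onI[OF continuous_on_comp_uhp_pt[OF cF]])
  have int: "integrable lborel (\<lambda>p. F (uhp_pt p))"
  proof (rule Bochner_Integration.integrable_bound[OF integrable_mult_right[OF integrable_berg_power[of 4], of B]])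
    show "AE p in lborel. norm (F (uhp_pt p)) \<le> norm (B * berg (uhp_pt p) ^ 4)"
    proof (intro AE_I2)
      fix p
      have "norm (F (uhp_pt p)) = norm (g (uhp_pt p)) * berg (uhp_pt p) ^ k"
        using berg_pos[OF uhp_pt_in_uhp, of p] by (simp add: F_def norm_mult norm_power)
      also have "\<dots> \<le> B * berg (uhp_pt p) ^ 4" by (rule B) simp
      finally show "norm (F (uhp_pt p)) \<le> norm (B * berg (uhp_pt p) ^ 4)" by simp
    qed
  qed (use mF in auto)
  define rot where "rot s = moeb (cos (pi * s)) (sin (pi * s)) (- sin (pi * s)) (cos (pi * s))" for s
  have det: "cos (pi * s) * cos (pi * s) - sin (pi * s) * - sin (pi * s) = 1" for s
    using sin_cos_squared_add2[of "pi * s"] by (simp add: power2_eq_square)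
  \<comment> \<open>A double integral over the angle and the plane: the integral over the plane does
    not depend on s, by invariance of the measure, and the integral over s is the mean value of g on
    a hyperbolic circle.\<close>
  define \<Phi> where "\<Phi> p s = indicator {0..1::real} s *\<^sub>R F (rot s (uhp_pt p))" for p s
  note im = integral_moeb[OF det mF, folded rot_def]
  have 1: "(LINT p|lborel. \<Phi> p s) = indicator {0..1} s *\<^sub>R (LINT p|lborel. F (uhp_pt p))" for s
    unfolding \<Phi>_def using im(1,2)[of s] int by simp
  have 2: "(LINT s|lborel. \<Phi> p s) = g \<i> * of_real (berg (uhp_pt p) ^ k)" for p
  proof -
    define w where "w = uhp_pt p"
    define \<zeta> where "\<zeta> = (w - \<i>) / (w + \<i>)"
    have w: "w \<in> uhp" by (simp add: w_def)
    have z: "norm \<zeta> < 1" unfolding \<zeta>_def by (rule rotation(3)[OF w])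
    have H: "(\<lambda>u. g (cay u)) holomorphic_on ball 0 1"
    proof (rule holomorphic_on_compose_gen[OF _ g, unfolded comp_def])
      show "cay holomorphic_on ball 0 1" unfolding cay_def by (intro holomorphic_intros) auto
    qed (use cay_in_uhp in auto)
    let ?h = "\<lambda>s. g (cay (exp (2 * of_real pi * \<i> * of_real s) * \<zeta>))"
    have I: "(?h has_integral g \<i>) {0..1}" using circle_mean_value[OF H z] by (simp add: cay_def)
    have "continuous_on {0..1} ?h"
      by (intro continuous_on_compose2[OF holomorphic_on_imp_continuous_on[OF H]] continuous_intros)
        (use z in \<open>auto simp: norm_mult\<close>)
    then have si: "set_integrable lborel {0..1} ?h" by (rule borel_integrable_atLeastAtMost')
    have "(LINT s:{0..1}|lborel. ?h s) = g \<i>"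
      using set_borel_integral_eq_integral(2)[OF si] integral_unique[OF I] by simp
    moreover have "\<Phi> p s = of_real (berg w ^ k) * (indicator {0..1} s *\<^sub>R ?h s)" for s
      unfolding \<Phi>_def F_def using rotation(1,2)[OF w, of s] by (simp add: rot_def \<zeta>_def w_def mult_ac)
    ultimately show ?thesis by (simp only: set_lebesgue_integral_def integral_mult_right_zero w_def mult.commute)
  qed
  have "integrable (lborel \<Otimes>\<^sub>M lborel) (\<lambda>(s, p). \<Phi> p s)"
  proof (rule lborel_pair.Fubini_integrable)
    have "continuous_on UNIV (\<lambda>x. F (rot (fst x) (uhp_pt (snd x))))"
    proof (rule continuous_on_compose2[OF cF])
      show "continuous_on UNIV (\<lambda>x. rot (fst x) (uhp_pt (snd x)))"
        unfolding rot_def moeb_def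
        by (intro continuous_intros continuous_on_compose2[OF continuous_on_uhp_pt[of UNIV]])
          (use moeb_denom_nonzero[OF det uhp_pt_in_uhp] in auto)
      show "(\<lambda>x. rot (fst x) (uhp_pt (snd x))) ` UNIV \<subseteq> uhp"
        unfolding rot_def using moeb_in_uhp[OF det uhp_pt_in_uhp] by blast
    qed
    then have "(\<lambda>x. F (rot (fst x) (uhp_pt (snd x)))) \<in> borel_measurable (lborel \<Otimes>\<^sub>M lborel)"
      by (simp add: lborel_prod borel_measurable_continuous_onI)
    then show "(\<lambda>(s, p). \<Phi> p s) \<in> borel_measurable (lborel \<Otimes>\<^sub>M lborel)"
      unfolding \<Phi>_def case_prod_unfold by measurable
    have "norm (\<Phi> p s) = indicator {0..1} s * norm (F (rot s (uhp_pt p)))" for p s by (simp add: \<Phi>_def)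
    moreover have "(LINT p|lborel. norm (F (rot s (uhp_pt p)))) = (LINT p|lborel. norm (F (uhp_pt p)))" for s
      unfolding rot_def by (rule integral_moeb(2)[OF det]) (use mF in simp)
    ultimately have "(LINT p|lborel. norm (\<Phi> p s)) = indicator {0..1} s * (LINT p|lborel. norm (F (uhp_pt p)))" for s
      by simp
    then show "integrable lborel (\<lambda>s. LINT p|lborel. norm (case (s, p) of (s, p) \<Rightarrow> \<Phi> p s))" by simp
    show "AE s in lborel. integrable lborel (\<lambda>p. case (s, p) of (s, p) \<Rightarrow> \<Phi> p s)"
      using im(1) int by (simp add: \<Phi>_def)
  qed
  from lborel_pair.Fubini_integral[OF this] have "(LINT p|lborel. F (uhp_pt p)) = (LINT p|lborel. g \<i> * of_real (berg (uhp_pt p) ^ k))"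
    unfolding 1 2 by simp
  then show "(LINT p|lborel. g (uhp_pt p) * of_real (berg (uhp_pt p) ^ k)) = g \<i> * (LINT p|lborel. of_real (berg (uhp_pt p) ^ k))"
    unfolding F_def by simp
  show "integrable lborel (\<lambda>p. g (uhp_pt p) * of_real (berg (uhp_pt p) ^ k))" using int by (simp add: F_def)
qed

lemma berg_le_1: "w \<in> uhp \<Longrightarrow> berg w \<le> 1"
proof -
  assume w: "w \<in> uhp"
  have "berg (uhp_pt (x, t)) \<le> 1" for x t
    unfolding berg_uhp_pt by (subst divide_le_eq_1) (auto intro: add_nonneg_nonneg)
  then have "berg (uhp_pt p) \<le> 1" for p by (cases p) auto
  from this[of "uhp_crd w"] show ?thesis using w by (simp add: uhp_pt_crd)
qed

lemma LINT_berg_power_pos: assumes "k \<ge> 4" shows "(LINT p|lborel. berg (uhp_pt p) ^ k) > 0"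
proof -
  have pos: "berg (uhp_pt p) ^ k > 0" for p using berg_pos[OF uhp_pt_in_uhp] by simp
  have "(LINT p|lborel. berg (uhp_pt p) ^ k) \<noteq> 0"
  proof
    assume "(LINT p|lborel. berg (uhp_pt p) ^ k) = 0"
    then have "AE p in lborel. berg (uhp_pt p) ^ k = 0"
      by (subst (asm) integral_nonneg_eq_0_iff_AE[OF integrable_berg_power[OF assms]]) (rule AE_I2, rule less_imp_le, rule pos)
    then have "AE p in (lborel :: (real \<times> real) measure). False"
      by (rule eventually_mono) (use pos in \<open>metis less_irrefl\<close>)
    then show False
      using AE_iff_measurable[of UNIV "lborel :: (real \<times> real) measure" "\<lambda>_. False"] emeasure_lborel_UNIV[where 'a = "real \<times> real"]
      by auto
  qed
  moreover have "(LINT p|lborel. berg (uhp_pt p) ^ k) \<ge> 0" by (rule Bochner_Integration.integral_nonneg) (use pos less_imp_le in blast)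
  ultimately show ?thesis by simp
qed

text \<open>The affine map \<open>A\<close> carries \<open>\<i>\<close> to \<tau>, preserves the
  measure and turns the kernel into \<open>berg ^ (2 * m)\<close> times a holomorphic factor, which
  reduces the claim to \<open>reproducing_at_i\<close>. The bound on Im^m |f| uses up m powers of
  \<open>berg\<close>; of the other m at least four are left for integrability.\<close>

lemma reproducing_kernel:
  assumes f: "f holomorphic_on uhp" and B: "\<And>w. w \<in> uhp \<Longrightarrow> Im w ^ m * norm (f w) \<le> B"
    and m: "m \<ge> 4" and \<tau>: "\<tau> \<in> uhp"
  shows "integrable lborel (\<lambda>p. f (uhp_pt p) * (of_real (Im (uhp_pt p)) / (\<tau> - cnj (uhp_pt p))) ^ (2 * m))"
    and "(LINT p|lborel. f (uhp_pt p) * (of_real (Im (uhp_pt p)) / (\<tau> - cnj (uhp_pt p))) ^ (2 * m))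
      = f \<tau> * ((2 * \<i>) ^ (2 * m) * of_real (LINT p|lborel. berg (uhp_pt p) ^ (2 * m)))"
proof -
  define y where "y = Im \<tau>"
  define A where "A w = of_real y * (w::complex) + of_real (Re \<tau>)" for w
  define F where "F w = f w * (of_real (Im w) / (\<tau> - cnj w)) ^ (2 * m)" for w
  define g where "g w = f (A w) * (w + \<i>) ^ (2 * m)" for w
  have y: "y > 0" using \<tau> by (simp add: y_def)
  have A: "A w \<in> uhp" if "w \<in> uhp" for w using y that by (simp add: A_def)
  have Ai: "A \<i> = \<tau>" by (simp add: A_def y_def complex_eq_iff)
  have det: "sqrt y * (1 / sqrt y) - Re \<tau> / sqrt y * 0 = 1" using y by simp
  have mo: "moeb (sqrt y) (Re \<tau> / sqrt y) 0 (1 / sqrt y) w = A w" for w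
  proof -
    have "complex_of_real (sqrt y) * complex_of_real (sqrt y) = of_real y" using y by (simp flip: of_real_mult)
    moreover have "moeb (sqrt y) (Re \<tau> / sqrt y) 0 (1 / sqrt y) w = (of_real (sqrt y) * of_real (sqrt y)) * w + of_real (Re \<tau>)"
      using y by (simp add: moeb_def field_simps)
    ultimately show ?thesis by (simp only: A_def)
  qed
  have FA: "F (A w) = g w * of_real (berg w ^ (2 * m))" if w: "w \<in> uhp" for w
  proof -
    have nz: "w + \<i> \<noteq> 0" "cnj w - \<i> \<noteq> 0" using w by (auto simp: complex_eq_iff)
    have "\<tau> - cnj (A w) = - (of_real y * (cnj w - \<i>))" by (simp add: A_def y_def complex_eq_iff algebra_simps)
    then have 1: "of_real (Im (A w)) / (\<tau> - cnj (A w)) = - (of_real (Im w) / (cnj w - \<i>))" using y by (simp add: A_def)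
    have "of_real ((cmod (w + \<i>))\<^sup>2) = (w + \<i>) * (cnj w - \<i>)"
      by (simp only: complex_norm_square) simp
    then have 2: "of_real (Im w) / (cnj w - \<i>) = (w + \<i>) * of_real (berg w)"
      using nz unfolding berg_def by (simp add: of_real_divide)
    show ?thesis unfolding F_def g_def 1 2 by (simp add: power_mult_distrib)
  qed
  have gB: "norm (g w) * berg w ^ (2 * m) \<le> (B / y ^ m) * berg w ^ 4" if w: "w \<in> uhp" for w
  proof -
    have b: "0 < berg w" "berg w \<le> 1" using berg_pos[OF w] berg_le_1[OF w] by auto
    have nz: "cmod (w + \<i>) \<noteq> 0" using w by (auto simp: complex_eq_iff)
    have B0: "B \<ge> 0" by (rule order_trans[OF _ B[OF w]]) (use w in simp)
    have "norm (g w) * berg w ^ (2 * m) = norm (f (A w)) * ((cmod (w + \<i>))\<^sup>2 * berg w) ^ m * berg w ^ m"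
      by (simp add: g_def norm_mult norm_power power_mult_distrib flip: power_mult power_add mult_2)
    also have "(cmod (w + \<i>))\<^sup>2 * berg w = Im w" using nz by (simp add: berg_def)
    also have "norm (f (A w)) * Im w ^ m = (Im (A w) ^ m * norm (f (A w))) / y ^ m"
      using y by (simp add: A_def power_mult_distrib)
    also have "\<dots> * berg w ^ m \<le> (B / y ^ m) * berg w ^ m"
      using B[OF A[OF w]] y b by (intro mult_right_mono divide_right_mono) auto
    also have "\<dots> \<le> (B / y ^ m) * berg w ^ 4"
      using b m B0 y by (intro mult_left_mono power_decreasing) auto
    finally show ?thesis .
  qed
  have "g holomorphic_on uhp" unfolding g_def
    by (intro holomorphic_intros holomorphic_on_compose_gen[OF _ f, unfolded comp_def])
      (use A in \<open>auto simp: A_def intro!: holomorphic_intros\<close>)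
  note R = reproducing_at_i[OF this gB]
  have "continuous_on uhp F" unfolding F_def
    by (intro continuous_intros holomorphic_on_imp_continuous_on[OF f]) (use \<tau> in \<open>auto simp: complex_eq_iff\<close>)
  then have mF: "(\<lambda>p. F (uhp_pt p)) \<in> borel_measurable borel"
    by (intro borel_measurable_continuous_onI continuous_on_comp_uhp_pt)
  note im = integral_moeb[OF det mF, unfolded mo FA[OF uhp_pt_in_uhp]]
  show "integrable lborel (\<lambda>p. f (uhp_pt p) * (of_real (Im (uhp_pt p)) / (\<tau> - cnj (uhp_pt p))) ^ (2 * m))"
    using im(1) R(1) by (simp add: F_def)
  have "g \<i> = f \<tau> * (2 * \<i>) ^ (2 * m)" unfolding g_def Ai mult_2[symmetric] ..
  then show "(LINT p|lborel. f (uhp_pt p) * (of_real (Im (uhp_pt p)) / (\<tau> - cnj (uhp_pt p))) ^ (2 * m))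
      = f \<tau> * ((2 * \<i>) ^ (2 * m) * of_real (LINT p|lborel. berg (uhp_pt p) ^ (2 * m)))"
    using im(2) R(2) unfolding integral_complex_of_real F_def by (simp add: mult.assoc)
qed

section \<open>Unfolding\<close>

definition act :: "(int \<times> int) \<times> (int \<times> int) \<Rightarrow> complex \<Rightarrow> complex" where
  "act g w = lat w (fst g) / lat w (snd g)"

definition sl_inv :: "(int \<times> int) \<times> (int \<times> int) \<Rightarrow> (int \<times> int) \<times> (int \<times> int)" where
  "sl_inv g = ((snd (snd g), - snd (fst g)), (- fst (snd g), fst (fst g)))"

definition sl_mult :: "(int \<times> int) \<times> (int \<times> int) \<Rightarrow> (int \<times> int) \<times> (int \<times> int) \<Rightarrow> (int \<times> int) \<times> (int \<times> int)" where
  "sl_mult g h = ((fst (fst g) * fst (fst h) + snd (fst g) * fst (snd h), fst (fst g) * snd (fst h) + snd (fst g) * snd (snd h)),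
     (fst (snd g) * fst (fst h) + snd (snd g) * fst (snd h), fst (snd g) * snd (fst h) + snd (snd g) * snd (snd h)))"

lemma sl_inv_in_SL2: "g \<in> SL2 \<Longrightarrow> sl_inv g \<in> SL2" and sl_inv_inv [simp]: "sl_inv (sl_inv g) = g"
  by (auto simp: SL2_def mdet_def sl_inv_def algebra_simps)

lemma sl_mult_in_SL2: "g \<in> SL2 \<Longrightarrow> h \<in> SL2 \<Longrightarrow> sl_mult g h \<in> SL2"
proof -
  assume "g \<in> SL2" "h \<in> SL2"
  moreover have "mdet (sl_mult g h) = mdet g * mdet h" by (simp add: mdet_def sl_mult_def algebra_simps)
  ultimately show ?thesis by (simp add: SL2_def)
qed

lemma sl_mult_inv:
  assumes "h \<in> SL2" shows "sl_mult (sl_mult g h) (sl_inv h) = g" "sl_mult (sl_mult g (sl_inv h)) h = g"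
proof -
  obtain a b c d where h: "h = ((a, b), (c, d))" by (metis surj_pair)
  obtain p q r s where g: "g = ((p, q), (r, s))" by (metis surj_pair)
  have det: "a * d - b * c = 1" using assms by (simp add: h SL2_def mdet_def)
  have "(x * a + y * c) * d - (x * b + y * d) * c = x * (a * d - b * c)"
    "(x * b + y * d) * a - (x * a + y * c) * b = y * (a * d - b * c)"
    "(x * d - y * c) * a + (y * a - x * b) * c = x * (a * d - b * c)"
    "(x * d - y * c) * b + (y * a - x * b) * d = y * (a * d - b * c)" for x y
    by (simp_all add: algebra_simps)
  then show "sl_mult (sl_mult g h) (sl_inv h) = g" "sl_mult (sl_mult g (sl_inv h)) h = g"
    unfolding det by (simp_all add: g h sl_mult_def sl_inv_def)
qed

lemma lat_snd_nonzero: "g \<in> SL2 \<Longrightarrow> w \<in> uhp \<Longrightarrow> lat w (snd g) \<noteq> 0"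
  by (rule lat_nonzero) (use SL2_subset_GLpos GLpos_nonzero[of "fst g" "snd g"] in auto)

lemma act_eq_moeb: "act g w = moeb (of_int (fst (fst g))) (of_int (snd (fst g))) (of_int (fst (snd g))) (of_int (snd (snd g))) w"
  by (simp add: act_def moeb_def lat_def)

lemma SL2_real_det:
  "g \<in> SL2 \<Longrightarrow> real_of_int (fst (fst g)) * of_int (snd (snd g)) - of_int (snd (fst g)) * of_int (fst (snd g)) = 1"
  unfolding SL2_def mdet_def mem_Collect_eq by (metis of_int_1 of_int_diff of_int_mult)

lemma act_in_uhp: "g \<in> SL2 \<Longrightarrow> w \<in> uhp \<Longrightarrow> act g w \<in> uhp"
  unfolding act_eq_moeb by (intro moeb_in_uhp SL2_real_det)

lemma Im_act: "g \<in> SL2 \<Longrightarrow> Im (act g w) = Im w / (cmod (lat w (snd g)))\<^sup>2"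
  unfolding act_eq_moeb by (subst Im_moeb[OF SL2_real_det]) (auto simp: lat_def)

lemma act_mult:
  assumes "h \<in> SL2" "w \<in> uhp" shows "act g (act h w) = act (sl_mult g h) w"
proof -
  define L M where "L = lat w (fst h)" and "M = lat w (snd h)"
  have nz: "M \<noteq> 0" using assms unfolding M_def by (rule lat_snd_nonzero)
  have 1: "lat (L / M) u = (of_int (fst u) * L + of_int (snd u) * M) / M" for u
    using nz unfolding lat_def[of "L / M"] by (simp add: add_divide_distrib)
  have 2: "lat w (fst u * fst (fst h) + snd u * fst (snd h), fst u * snd (fst h) + snd u * snd (snd h))
      = of_int (fst u) * L + of_int (snd u) * M" for u
    by (simp add: L_def M_def lat_def algebra_simps)
  have "act h w = L / M" by (simp add: act_def L_def M_def)
  then show ?thesis using nz unfolding sl_mult_def by (simp add: act_def 1 2)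
qed

lemma act_inv: "h \<in> SL2 \<Longrightarrow> w \<in> uhp \<Longrightarrow> act h (act (sl_inv h) w) = w"
proof -
  assume h: "h \<in> SL2" and w: "w \<in> uhp"
  have "sl_mult h (sl_inv h) = ((1, 0), (0, 1))" using h by (auto simp: sl_mult_def sl_inv_def SL2_def mdet_def algebra_simps)
  then show ?thesis using act_mult[OF sl_inv_in_SL2[OF h] w, of h] by (simp add: act_def lat_def)
qed

lemma continuous_on_act: "g \<in> SL2 \<Longrightarrow> continuous_on uhp (act g)"
  unfolding act_def
  by (rule continuous_on_divide) (use lat_snd_nonzero in \<open>auto simp: lat_def intro!: continuous_intros\<close>)

lemma berg_act: "g \<in> SL2 \<Longrightarrow> w \<in> uhp \<Longrightarrow> berg (act g w) = Im w / (cmod (lat w (fst g) + lat w (snd g) * \<i>))\<^sup>2"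
proof -
  assume g: "g \<in> SL2" and w: "w \<in> uhp"
  have nz: "lat w (snd g) \<noteq> 0" using g w by (rule lat_snd_nonzero)
  have "act g w + \<i> = (lat w (fst g) + lat w (snd g) * \<i>) / lat w (snd g)" using nz by (simp add: act_def add_divide_distrib)
  then show ?thesis using nz unfolding berg_def Im_act[OF g] by (simp add: norm_divide power_divide)
qed

text \<open>By \<open>berg_act\<close> the sum is, up to Im(w)^4, the series of absolute values of
  the kernel of weight 8 at z = \<open>\<i>\<close>.\<close>

lemma summable_on_berg_act:
  assumes w: "w \<in> uhp" shows "(\<lambda>g. berg (act g w) ^ 4) summable_on SL2"
proof -
  have "(\<lambda>g. 1 / (lat w (fst g) + lat w (snd g) * \<i>) ^ 8) abs_summable_on SL2"
    by (rule kern_summable(1)) (use w SL2_subset_GLpos in auto)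
  then have "(\<lambda>g. Im w ^ 4 * norm (1 / (lat w (fst g) + lat w (snd g) * \<i>) ^ 8)) summable_on SL2"
    by (rule summable_on_cmult_right)
  then show ?thesis
    by (rule summable_on_cong[THEN iffD1, rotated]) (use w in \<open>simp add: berg_act norm_divide norm_power power_divide flip: power_mult\<close>)
qed

lemma infinite_SL2: "infinite SL2"
proof -
  have "inj (\<lambda>n::int. (((1::int), n), ((0::int), (1::int))))" by (auto simp: inj_on_def)
  then have "infinite (range (\<lambda>n::int. (((1::int), n), ((0::int), (1::int)))))"
    using finite_imageD infinite_UNIV_int by blast
  then show ?thesis
    by (rule contrapos_nn) (erule finite_subset[rotated], auto simp: SL2_def mdet_def)
qed

lemma abs_summable_on_sum:
  fixes f :: "'a \<Rightarrow> 'b \<Rightarrow> 'c::real_normed_vector"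
  assumes "finite A" "\<And>t. t \<in> A \<Longrightarrow> f t abs_summable_on S"
  shows "(\<lambda>x. \<Sum>t\<in>A. f t x) abs_summable_on S"
  by (rule Infinite_Sum.abs_summable_on_comparison_test'[OF infsum_sum[OF assms(1), of "\<lambda>t x. norm (f t x)", THEN conjunct1]])
    (use assms in \<open>auto intro: norm_sum\<close>)

text \<open>The translates of \<open>berg\<^sup>4 / S\<close>, where \<open>S\<close> is the invariant sum of the translates of \<open>berg\<^sup>4\<close>,
  form a partition of unity; shifting the group element from it to \<open>F\<close> produces the sum over \<open>SL2\<close>.\<close>

lemma unfolding_zero:
  fixes F :: "complex \<Rightarrow> complex"
  assumes F: "continuous_on uhp F" and int: "integrable lborel (\<lambda>p. F (uhp_pt p))"
    and sm: "\<And>w. w \<in> uhp \<Longrightarrow> (\<lambda>g. F (act (sl_inv g) w)) abs_summable_on SL2"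
    and zero: "\<And>w. w \<in> uhp \<Longrightarrow> (\<Sum>\<^sub>\<infinity>g\<in>SL2. F (act (sl_inv g) w)) = 0"
  shows "(LINT p|lborel. F (uhp_pt p)) = 0"
proof -
  \<comment> \<open>An enumeration of the group turns sums over it into ordinary series that can be
    integrated termwise.\<close>
  define e where "e = from_nat_into SL2"
  have e: "bij_betw e UNIV SL2" unfolding e_def by (rule bij_betw_from_nat_into[OF _ infinite_SL2]) simp
  have eS: "e n \<in> SL2" for n using e by (auto simp: bij_betw_def)
  have enum: "(\<lambda>n. G (e n)) sums (\<Sum>\<^sub>\<infinity>g\<in>SL2. G g) \<and> summable (\<lambda>n. norm (G (e n)))"
    if "G abs_summable_on SL2" for G :: "_ \<Rightarrow> 'a::banach"
  proof -
    have "(\<lambda>n. G (e n)) abs_summable_on UNIV" using summable_on_reindex_bij_betw[OF e, of "\<lambda>g. norm (G g)"] that by simp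
    note ab = this
    have "(\<lambda>n. G (e n)) sums (\<Sum>\<^sub>\<infinity>n. G (e n))"
      by (rule has_sum_imp_sums[OF has_sum_infsum[OF abs_summable_summable[OF ab]]])
    then show ?thesis using ab infsum_reindex_bij_betw[OF e, of G] by (simp add: summable_on_UNIV_nonneg_real_iff)
  qed
  define S where "S w = (\<Sum>\<^sub>\<infinity>g\<in>SL2. berg (act g w) ^ 4)" for w
  have bpos: "berg (act g w) ^ 4 > 0" if "g \<in> SL2" "w \<in> uhp" for g w using berg_pos[OF act_in_uhp[OF that]] by simp
  have Ssums: "(\<lambda>n. berg (act (e n) w) ^ 4) sums S w" if "w \<in> uhp" for w
  proof -
    have "(\<lambda>g. berg (act g w) ^ 4) abs_summable_on SL2"
      using summable_on_berg_act[OF that] by (rule summable_on_cong[THEN iffD1, rotated]) (use bpos[OF _ that] in \<open>simp add: less_imp_le\<close>)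
    from enum[OF this] show ?thesis by (simp add: S_def)
  qed
  have Spos: "S w > 0" if w: "w \<in> uhp" for w
    using sums_unique[OF Ssums[OF w]] suminf_pos[OF sums_summable[OF Ssums[OF w]]] bpos[OF eS w] by simp
  have Sinv: "S (act h w) = S w" if h: "h \<in> SL2" and w: "w \<in> uhp" for h w
  proof -
    have "bij_betw (\<lambda>g. sl_mult g h) SL2 SL2"
      by (rule bij_betwI[where g = "\<lambda>g. sl_mult g (sl_inv h)"])
        (auto simp: sl_mult_inv[OF h] intro: sl_mult_in_SL2 sl_inv_in_SL2 h)
    from infsum_reindex_bij_betw[OF this, of "\<lambda>g. berg (act g w) ^ 4"] show ?thesis
      unfolding S_def act_mult[OF h w] by simp
  qed
  define \<Phi> where "\<Phi> n w = F w / of_real (S w) * of_real (berg (act (e n) w) ^ 4)" for n w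
  have mb: "(\<lambda>p. berg (act (e n) (uhp_pt p)) ^ 4) \<in> borel_measurable borel" for n
    by (intro borel_measurable_continuous_onI continuous_on_comp_uhp_pt continuous_intros
        continuous_on_compose2[OF continuous_on_berg continuous_on_act[OF eS]]) (use act_in_uhp[OF eS] in auto)
  have mS: "(\<lambda>p. S (uhp_pt p)) \<in> borel_measurable borel"
    using borel_measurable_suminf[of "\<lambda>n p. berg (act (e n) (uhp_pt p)) ^ 4", OF mb]
    by (simp add: sums_unique[OF Ssums[OF uhp_pt_in_uhp], symmetric])
  have mF: "(\<lambda>p. F (uhp_pt p)) \<in> borel_measurable borel"
    by (intro borel_measurable_continuous_onI continuous_on_comp_uhp_pt F)
  have m\<Phi>: "(\<lambda>p. \<Phi> n (uhp_pt p)) \<in> borel_measurable borel" for n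
    unfolding \<Phi>_def using mF mS mb[of n] by measurable
  have n\<Phi>: "norm (\<Phi> n w) = norm (F w) / S w * berg (act (e n) w) ^ 4" if "w \<in> uhp" for n w
    using Spos[OF that] bpos[OF eS that] by (simp add: \<Phi>_def norm_mult norm_divide less_imp_le flip: of_real_power)
  have sum_le: "(\<Sum>n<N. norm (\<Phi> n w)) \<le> norm (F w)" if w: "w \<in> uhp" for N w
  proof -
    have "(\<Sum>n<N. norm (\<Phi> n w)) = norm (F w) / S w * (\<Sum>n<N. berg (act (e n) w) ^ 4)"
      by (simp add: n\<Phi>[OF w] sum_distrib_left)
    also have "\<dots> \<le> norm (F w) / S w * S w"
      using Spos[OF w] bpos[OF eS w] sums_unique[OF Ssums[OF w]] sum_le_suminf[OF sums_summable[OF Ssums[OF w]], of "{..<N}"]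
      by (intro mult_left_mono) (auto simp: less_imp_le)
    finally show ?thesis using Spos[OF w] by simp
  qed
  have int\<Phi>: "integrable lborel (\<lambda>p. \<Phi> n (uhp_pt p))" for n
  proof (rule Bochner_Integration.integrable_bound[OF int])
    have "norm (\<Phi> n w) \<le> norm (F w)" if "w \<in> uhp" for w
      using sum_le[OF that, of "Suc n"] sum_nonneg[of "{..<n}" "\<lambda>n. norm (\<Phi> n w)"] by simp
    then show "AE p in lborel. norm (\<Phi> n (uhp_pt p)) \<le> norm (F (uhp_pt p))" by simp
  qed (use m\<Phi> in simp)
  have sumint: "summable (\<lambda>n. LINT p|lborel. norm (\<Phi> n (uhp_pt p)))"
  proof (rule summableI_nonneg_bounded)
    fix N
    have "(\<Sum>n<N. LINT p|lborel. norm (\<Phi> n (uhp_pt p))) = (LINT p|lborel. (\<Sum>n<N. norm (\<Phi> n (uhp_pt p))))"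
      using int\<Phi> by (subst Bochner_Integration.integral_sum) auto
    also have "\<dots> \<le> (LINT p|lborel. norm (F (uhp_pt p)))"
      using int int\<Phi> sum_le[OF uhp_pt_in_uhp] by (intro integral_mono) auto
    finally show "(\<Sum>n<N. LINT p|lborel. norm (\<Phi> n (uhp_pt p))) \<le> (LINT p|lborel. norm (F (uhp_pt p)))" .
  qed simp
  have \<Phi>sums: "(\<lambda>n. \<Phi> n w) sums F w" "summable (\<lambda>n. norm (\<Phi> n w))" if w: "w \<in> uhp" for w
  proof -
    show "summable (\<lambda>n. norm (\<Phi> n w))" by (rule summableI_nonneg_bounded[OF _ sum_le[OF w]]) simp
    from sums_mult[OF sums_of_real[OF Ssums[OF w]], of "F w / of_real (S w)"]
    show "(\<lambda>n. \<Phi> n w) sums F w" using Spos[OF w] by (simp add: \<Phi>_def)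
  qed
  have "(\<lambda>n. LINT p|lborel. \<Phi> n (uhp_pt p)) sums (LINT p|lborel. (\<Sum>n. \<Phi> n (uhp_pt p)))"
    by (rule sums_integral[OF int\<Phi> _ sumint]) (use \<Phi>sums in auto)
  moreover have "(\<Sum>n. \<Phi> n (uhp_pt p)) = F (uhp_pt p)" for p
    using sums_unique[OF \<Phi>sums(1)[OF uhp_pt_in_uhp]] by simp
  ultimately have s1: "(\<lambda>n. LINT p|lborel. \<Phi> n (uhp_pt p)) sums (LINT p|lborel. F (uhp_pt p))" by simp
  define \<Psi> where "\<Psi> n w = \<Phi> n (act (sl_inv (e n)) w)" for n w
  \<comment> \<open>By invariance of \<open>S\<close> the weight \<open>berg w ^ 4 / S w\<close>
    does not depend on n, so summing over n leaves the full group sum of \<open>F\<close>, which is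
    0.\<close>
  have \<Psi>eq: "\<Psi> n w = of_real (berg w ^ 4 / S w) * F (act (sl_inv (e n)) w)" if "w \<in> uhp" for n w
    using that eS by (simp add: \<Psi>_def \<Phi>_def Sinv sl_inv_in_SL2 act_inv)
  have im: "integrable lborel (\<lambda>p. \<Psi> n (uhp_pt p))"
    "(LINT p|lborel. \<Psi> n (uhp_pt p)) = (LINT p|lborel. \<Phi> n (uhp_pt p))"
    "(LINT p|lborel. norm (\<Psi> n (uhp_pt p))) = (LINT p|lborel. norm (\<Phi> n (uhp_pt p)))" for n
  proof -
    note det = SL2_real_det[OF sl_inv_in_SL2[OF eS[of n]]]
    show "integrable lborel (\<lambda>p. \<Psi> n (uhp_pt p))" "(LINT p|lborel. \<Psi> n (uhp_pt p)) = (LINT p|lborel. \<Phi> n (uhp_pt p))"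
      using integral_moeb(1,2)[OF det m\<Phi>] int\<Phi> by (simp_all add: \<Psi>_def act_eq_moeb)
    show "(LINT p|lborel. norm (\<Psi> n (uhp_pt p))) = (LINT p|lborel. norm (\<Phi> n (uhp_pt p)))"
      unfolding \<Psi>_def act_eq_moeb by (rule integral_moeb(2)[OF det]) (use m\<Phi> in simp)
  qed
  have \<Psi>sums: "(\<lambda>n. \<Psi> n w) sums 0" "summable (\<lambda>n. norm (\<Psi> n w))" if w: "w \<in> uhp" for w
  proof -
    note en = enum[OF sm[OF w], unfolded zero[OF w]]
    show "(\<lambda>n. \<Psi> n w) sums 0" unfolding \<Psi>eq[OF w] using sums_mult[OF conjunct1[OF en], of "of_real (berg w ^ 4 / S w)"] by (simp only: mult_zero_right)
    show "summable (\<lambda>n. norm (\<Psi> n w))" unfolding \<Psi>eq[OF w] norm_mult by (rule summable_mult[OF conjunct2[OF en]])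
  qed
  have "(\<lambda>n. LINT p|lborel. \<Psi> n (uhp_pt p)) sums (LINT p|lborel. (\<Sum>n. \<Psi> n (uhp_pt p)))"
    by (rule sums_integral[OF im(1)]) (use \<Psi>sums sumint im(3) in auto)
  moreover have "(\<Sum>n. \<Psi> n (uhp_pt p)) = 0" for p
    using sums_unique[OF \<Psi>sums(1)[OF uhp_pt_in_uhp]] by simp
  ultimately have "(\<lambda>n. LINT p|lborel. \<Phi> n (uhp_pt p)) sums 0" using im(2) by simp
  with s1 show ?thesis by (rule sums_unique2)
qed

text \<open>Integrated against the kernel, f yields a nonzero constant times its value at \<tau>.
  The group translates of the integrand add up to f(w) Im(w)^(2 m) times the \<open>SL2\<close>
  kernel at - cnj w, whose combination vanishes by assumption; by unfolding, the integral is
  0.\<close>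

lemma cusp_form_combo_zero:
  assumes f: "cusp_form (2 * m) f" and m: "m \<ge> 4" and A: "finite A" "A \<subseteq> uhp"
    and zero: "\<And>z. z \<in> uhp \<Longrightarrow> (\<Sum>\<tau>\<in>A. \<alpha> \<tau> * kern SL2 (2 * m) \<tau> z) = 0"
  shows "(\<Sum>\<tau>\<in>A. \<alpha> \<tau> * f \<tau>) = 0"
proof -
  have holo: "f holomorphic_on uhp" using f by (simp add: cusp_form_def)
  have tr: "f (act g w) = lat w (snd g) ^ (2 * m) * f w" if "g \<in> SL2" "w \<in> uhp" for g w
  proof -
    obtain a b c d where g: "g = ((a, b), (c, d))" by (metis surj_pair)
    have "a * d - b * c = 1" using that(1) by (simp add: g SL2_def mdet_def)
    then show ?thesis using f that(2) unfolding cusp_form_def by (simp add: g act_def lat_def)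
  qed
  obtain a where a: "has_fourier_expansion f a" "a 0 = 0" using f by (auto simp: cusp_form_def)
  obtain B where B: "\<And>w. w \<in> uhp \<Longrightarrow> Im w ^ m * norm (f w) \<le> B"
  proof -
    have "f (z + 1) = f z" if "z \<in> uhp" for z using tr[of "((1, 1), (0, 1))" z] that by (simp add: SL2_def mdet_def act_def lat_def)
    moreover have "f (- 1 / z) = z ^ (2 * m) * f z" if "z \<in> uhp" for z
      using tr[of "((0, - 1), (1, 0))" z] that by (simp add: SL2_def mdet_def act_def lat_def)
    ultimately show ?thesis
      using cusp_form_norm_attains_sup[OF holomorphic_on_imp_continuous_on[OF holo] a] that by metis
  qed
  define K where "K \<tau> w = f w * (of_real (Im w) / (\<tau> - cnj w)) ^ (2 * m)" for \<tau> w
  define F where "F w = (\<Sum>\<tau>\<in>A. \<alpha> \<tau> * K \<tau> w)" for w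
  have K: "integrable lborel (\<lambda>p. K \<tau> (uhp_pt p))"
    "(LINT p|lborel. K \<tau> (uhp_pt p)) = f \<tau> * ((2 * \<i>) ^ (2 * m) * of_real (LINT p|lborel. berg (uhp_pt p) ^ (2 * m)))"
    if "\<tau> \<in> A" for \<tau>
    unfolding K_def by (intro reproducing_kernel[OF holo B m]; use that A in blast)+
  \<comment> \<open>The automorphy factor D^(2 m) of f is absorbed by the factors D and cnj D coming
    from the imaginary part and from \<tau> - cnj w.\<close>
  have Kact: "K \<tau> (act (sl_inv g) w) = f w * of_real (Im w) ^ (2 * m) * (1 / (lat \<tau> (fst g) + lat \<tau> (snd g) * (- cnj w)) ^ (2 * m))"
    if g: "g \<in> SL2" and w: "w \<in> uhp" for g w \<tau>
  proof -
    define D where "D = lat w (snd (sl_inv g))"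
    have g': "sl_inv g \<in> SL2" using g by (rule sl_inv_in_SL2)
    have D: "D \<noteq> 0" unfolding D_def by (rule lat_snd_nonzero[OF g' w])
    have "\<tau> - cnj (act (sl_inv g) w) = (lat \<tau> (fst g) + lat \<tau> (snd g) * (- cnj w)) / cnj D"
      using D by (simp add: act_def D_def[symmetric] diff_divide_eq_iff) (simp add: D_def sl_inv_def lat_def algebra_simps)
    moreover have "of_real (Im (act (sl_inv g) w)) = of_real (Im w) / (D * cnj D)"
      unfolding Im_act[OF g'] D_def[symmetric] of_real_divide complex_norm_square[symmetric] by simp
    ultimately have "of_real (Im (act (sl_inv g) w)) / (\<tau> - cnj (act (sl_inv g) w))
        = of_real (Im w) / D / (lat \<tau> (fst g) + lat \<tau> (snd g) * (- cnj w))" using D by simp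
    then show ?thesis unfolding K_def tr[OF g' w] D_def[symmetric] using D by (simp add: power_divide power_mult_distrib)
  qed
  have ks: "(\<lambda>g. 1 / (lat \<tau> (fst g) + lat \<tau> (snd g) * (- cnj w)) ^ (2 * m)) abs_summable_on SL2"
    if "\<tau> \<in> A" "w \<in> uhp" for \<tau> w
    by (rule kern_summable(1)) (use that A m SL2_subset_GLpos in auto)
  have Fact: "F (act (sl_inv g) w) = (\<Sum>\<tau>\<in>A. f w * of_real (Im w) ^ (2 * m) * \<alpha> \<tau> * (1 / (lat \<tau> (fst g) + lat \<tau> (snd g) * (- cnj w)) ^ (2 * m)))"
    if g: "g \<in> SL2" and w: "w \<in> uhp" for g w
    by (simp add: F_def Kact[OF g w] mult_ac)
  have "(LINT p|lborel. F (uhp_pt p)) = 0"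
  proof (rule unfolding_zero)
    show "continuous_on uhp F" unfolding F_def K_def
      by (intro continuous_intros holomorphic_on_imp_continuous_on[OF holo]) (use A in \<open>auto simp: complex_eq_iff\<close>)
    show "integrable lborel (\<lambda>p. F (uhp_pt p))" unfolding F_def using K(1) by auto
    fix w assume w: "w \<in> uhp"
    have ks': "(\<lambda>g. f w * of_real (Im w) ^ (2 * m) * \<alpha> \<tau> * (1 / (lat \<tau> (fst g) + lat \<tau> (snd g) * (- cnj w)) ^ (2 * m))) abs_summable_on SL2"
      if "\<tau> \<in> A" for \<tau> unfolding norm_mult[of "_ * \<alpha> \<tau>"] by (rule summable_on_cmult_right[OF ks[OF that w]])
    have "(\<lambda>g. \<Sum>\<tau>\<in>A. f w * of_real (Im w) ^ (2 * m) * \<alpha> \<tau> * (1 / (lat \<tau> (fst g) + lat \<tau> (snd g) * (- cnj w)) ^ (2 * m))) abs_summable_on SL2"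
      by (rule abs_summable_on_sum[OF A(1) ks'])
    then show "(\<lambda>g. F (act (sl_inv g) w)) abs_summable_on SL2"
      by (rule summable_on_cong[THEN iffD1, rotated]) (simp add: Fact[OF _ w])
    have "(\<Sum>\<^sub>\<infinity>g\<in>SL2. F (act (sl_inv g) w)) = (\<Sum>\<tau>\<in>A. f w * of_real (Im w) ^ (2 * m) * \<alpha> \<tau> * kern SL2 (2 * m) \<tau> (- cnj w))"
      unfolding kern_def infsum_cmult_right'[symmetric]
      by (subst infsum_sum[OF A(1) abs_summable_summable[OF ks'], THEN conjunct2, symmetric], assumption) (intro infsum_cong Fact w)
    also have "\<dots> = f w * of_real (Im w) ^ (2 * m) * (\<Sum>\<tau>\<in>A. \<alpha> \<tau> * kern SL2 (2 * m) \<tau> (- cnj w))"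
      by (simp add: sum_distrib_left mult_ac)
    also have "\<dots> = 0" using zero[of "- cnj w"] w by simp
    finally show "(\<Sum>\<^sub>\<infinity>g\<in>SL2. F (act (sl_inv g) w)) = 0" .
  qed
  also have "(LINT p|lborel. F (uhp_pt p)) = (\<Sum>\<tau>\<in>A. \<alpha> \<tau> * (LINT p|lborel. K \<tau> (uhp_pt p)))"
    unfolding F_def using K(1) by (subst Bochner_Integration.integral_sum) auto
  also have "\<dots> = (\<Sum>\<tau>\<in>A. \<alpha> \<tau> * f \<tau>) * ((2 * \<i>) ^ (2 * m) * of_real (LINT p|lborel. berg (uhp_pt p) ^ (2 * m)))"
    unfolding sum_distrib_right by (intro sum.cong refl) (simp only: K(2) mult.assoc)
  finally show ?thesis using LINT_berg_power_pos[of "2 * m"] m by simp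
qed

section \<open>Cusp forms are spanned by products of Eisenstein series\<close>

text \<open>Finite linear combinations of point evaluations separate \<open>f\<close> from the span of \<open>G\<close>.\<close>

lemma in_span_of_annihilators:
  fixes f :: "'a \<Rightarrow> 'b::field"
  assumes "finite I"
    and "\<And>A \<alpha>. finite A \<Longrightarrow> A \<subseteq> U \<Longrightarrow> (\<forall>i\<in>I. (\<Sum>x\<in>A. \<alpha> x * G i x) = 0) \<Longrightarrow> (\<Sum>x\<in>A. \<alpha> x * f x) = 0"
  shows "\<exists>c. \<forall>x\<in>U. f x = (\<Sum>i\<in>I. c i * G i x)"
  using assms
proof (induction I arbitrary: f rule: finite_induct)
  case empty
  have "f x = 0" if "x \<in> U" for x using empty[of "{x}" "\<lambda>_. 1"] that by simp
  then show ?case by simp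
next
  case (insert j I)
  let ?ev = "\<lambda>A \<alpha> g. \<Sum>x\<in>A. \<alpha> x * g x"
  show ?case
  proof (cases "\<exists>A \<alpha>. finite A \<and> A \<subseteq> U \<and> (\<forall>i\<in>I. ?ev A \<alpha> (G i) = 0) \<and> ?ev A \<alpha> f \<noteq> 0")
    case False
    then obtain c where c: "\<forall>x\<in>U. f x = (\<Sum>i\<in>I. c i * G i x)" using insert.IH[of f] by blast
    have "(\<Sum>i\<in>insert j I. (c(j := 0)) i * G i x) = (\<Sum>i\<in>I. c i * G i x)" for x
      using insert.hyps by (auto intro!: sum.cong)
    then show ?thesis using c by (intro exI[of _ "c(j := 0)"]) simp
  next
    case True
    then obtain B \<beta> where B: "finite B" "B \<subseteq> U" "\<forall>i\<in>I. ?ev B \<beta> (G i) = 0" "?ev B \<beta> f \<noteq> 0" by blast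
    then have Gj: "?ev B \<beta> (G j) \<noteq> 0" using insert.prems[of B \<beta>] by auto
    \<comment> \<open>The functional on \<open>B\<close> kills the \<open>G i\<close> with i in
      \<open>I\<close> but not f, hence not \<open>G j\<close> either; this forces the coefficient
      of \<open>G j\<close>.\<close>
    define r where "r = ?ev B \<beta> f / ?ev B \<beta> (G j)"
    have "\<exists>c. \<forall>x\<in>U. f x - r * G j x = (\<Sum>i\<in>I. c i * G i x)"
    proof (rule insert.IH)
      fix A \<alpha> assume A: "finite A" "A \<subseteq> U" "\<forall>i\<in>I. ?ev A \<alpha> (G i) = 0"
      define s where "s = ?ev A \<alpha> (G j) / ?ev B \<beta> (G j)"
      \<comment> \<open>The functional \<alpha>, corrected by a multiple of \<beta> so that
        \<open>G j\<close> is killed as well.\<close>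
      define \<gamma> where "\<gamma> x = (if x \<in> A then \<alpha> x else 0) - s * (if x \<in> B then \<beta> x else 0)" for x
      have ext: "(\<Sum>x\<in>A \<union> B. (if x \<in> C then \<phi> x else 0) * g x) = ?ev C \<phi> g" if "C \<subseteq> A \<union> B" for C \<phi> and g :: "'a \<Rightarrow> 'b"
        using that A(1) B(1) by (intro sum.mono_neutral_cong_right) simp_all
      have ev: "?ev (A \<union> B) \<gamma> g = ?ev A \<alpha> g - s * ?ev B \<beta> g" for g
        using ext[of A \<alpha> g] ext[of B \<beta> g]
        by (simp add: \<gamma>_def left_diff_distrib sum_subtractf mult.assoc flip: sum_distrib_left)
      have "?ev (A \<union> B) \<gamma> f = 0"
        using A B Gj by (intro insert.prems) (auto simp: ev s_def)
      then have "?ev A \<alpha> f = s * ?ev B \<beta> f" by (simp add: ev)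
      also have "\<dots> = r * ?ev A \<alpha> (G j)" by (simp add: s_def r_def)
      finally show "(\<Sum>x\<in>A. \<alpha> x * (f x - r * G j x)) = 0"
        by (simp add: right_diff_distrib sum_subtractf sum_distrib_left mult_ac)
    qed
    then obtain c where c: "\<forall>x\<in>U. f x - r * G j x = (\<Sum>i\<in>I. c i * G i x)" by blast
    have "(\<Sum>i\<in>insert j I. (c(j := r)) i * G i x) = r * G j x + (\<Sum>i\<in>I. c i * G i x)" for x
      using insert.hyps by (auto intro!: sum.cong)
    moreover have "f x = r * G j x + (\<Sum>i\<in>I. c i * G i x)" if "x \<in> U" for x
      using bspec[OF c that] by (simp add: algebra_simps)
    ultimately show ?thesis by (intro exI[of _ "c(j := r)"]) simp
  qed
qed

section \<open>Uniqueness of Fourier expansions and rational coefficients\<close>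

lemma to_q_surj: assumes "q \<noteq> 0" "norm q < 1" obtains z where "z \<in> uhp" "to_q z = q"
proof
  let ?z = "Ln q / (2 * of_real pi * \<i>)"
  show q: "to_q ?z = q" using assms by (simp add: to_q_def)
  have "exp (- (2 * pi * Im ?z)) < 1" using norm_to_q[of ?z] assms(2) unfolding q by simp
  then show "?z \<in> uhp" using pi_gt_zero by (simp add: zero_less_mult_iff)
qed

lemma fourier_unique:
  assumes "has_fourier_expansion f a" "has_fourier_expansion f b"
  shows "a = b"
proof
  fix n
  define c where "c n = a n - b n" for n
  have c: "(\<lambda>n. c n * q ^ n) sums 0" if q: "q \<noteq> 0" "norm q < 1" for q
  proof -
    obtain z where z: "z \<in> uhp" "to_q z = q" by (rule to_q_surj[OF q])
    show ?thesis
      using assms[unfolded has_fourier_expansion_def, THEN bspec, OF z(1)] sums_diff[of "\<lambda>n. a n * q ^ n" "f z" "\<lambda>n. b n * q ^ n" "f z"]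
      by (simp add: c_def left_diff_distrib z(2))
  qed
  have "c n = 0"
  proof (induction n rule: less_induct)
    case (less n)
    have "(\<lambda>j. c (j + n) * q ^ j) sums 0" if q: "q \<noteq> 0" "norm q < 1" for q
    proof -
      have "(\<lambda>j. c (j + n) * q ^ (j + n)) sums 0"
        using c[OF q] less by (subst sums_iff_shift) simp
      from sums_mult[OF this, of "inverse (q ^ n)"] show ?thesis
        using q by (simp add: power_add field_simps)
    qed
    from powser_limit_0_strong[of 1 "\<lambda>j. c (j + n)", OF _ this] have "((\<lambda>_. 0) \<longlongrightarrow> c n) (at (0::complex))" by simp
    then show ?case by (simp add: tendsto_const_iff)
  qed
  then show "a n = b n" by (simp add: c_def)
qed

lemma fourier_mult:
  assumes f: "has_fourier_expansion f a" and g: "has_fourier_expansion g b"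
  shows "has_fourier_expansion (\<lambda>z. f z * g z) (\<lambda>n. \<Sum>i\<le>n. a i * b (n - i))"
  unfolding has_fourier_expansion_def
proof
  fix z assume z: "z \<in> uhp"
  have q: "0 \<le> norm (to_q z)" "norm (to_q z) < 1" using norm_to_q_less_1[OF z] by auto
  have "f z = (\<Sum>n. a n * to_q z ^ n)" "g z = (\<Sum>n. b n * to_q z ^ n)"
    using f g z by (auto simp: has_fourier_expansion_def sums_unique)
  moreover have "(\<lambda>n. \<Sum>i\<le>n. (a i * to_q z ^ i) * (b (n - i) * to_q z ^ (n - i))) sums ((\<Sum>n. a n * to_q z ^ n) * (\<Sum>n. b n * to_q z ^ n))"
    by (rule Cauchy_product_sums) (use fourier_abs_summable[OF f q] fourier_abs_summable[OF g q] in \<open>simp_all add: norm_mult norm_power\<close>)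
  moreover have "(\<Sum>i\<le>n. (a i * to_q z ^ i) * (b (n - i) * to_q z ^ (n - i))) = (\<Sum>i\<le>n. a i * b (n - i)) * to_q z ^ n" for n
    unfolding sum_distrib_right by (intro sum.cong) (auto simp: mult_ac simp flip: power_add)
  ultimately show "(\<lambda>n. (\<Sum>i\<le>n. a i * b (n - i)) * to_q z ^ n) sums (f z * g z)" by simp
qed

lemma fourier_diff_cmult:
  assumes "has_fourier_expansion f a" "has_fourier_expansion g b"
  shows "has_fourier_expansion (\<lambda>z. f z - r * g z) (\<lambda>n. a n - r * b n)"
  unfolding has_fourier_expansion_def
proof
  fix z assume z: "z \<in> uhp"
  have "(\<lambda>n. a n * to_q z ^ n - r * (b n * to_q z ^ n)) sums (f z - r * g z)"
    using assms z by (intro sums_diff sums_mult) (auto simp: has_fourier_expansion_def)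
  then show "(\<lambda>n. (a n - r * b n) * to_q z ^ n) sums (f z - r * g z)" by (simp add: algebra_simps)
qed

lemma fourier_linear_combination:
  assumes "finite I" "\<And>i. i \<in> I \<Longrightarrow> has_fourier_expansion (G i) (b i)"
  shows "has_fourier_expansion (\<lambda>z. \<Sum>i\<in>I. c i * G i z) (\<lambda>n. \<Sum>i\<in>I. c i * b i n)"
  unfolding has_fourier_expansion_def
proof
  fix z assume z: "z \<in> uhp"
  have "(\<lambda>n. \<Sum>i\<in>I. c i * (b i n * to_q z ^ n)) sums (\<Sum>i\<in>I. c i * G i z)"
    using assms z by (intro sums_sum sums_mult) (auto simp: has_fourier_expansion_def)
  then show "(\<lambda>n. (\<Sum>i\<in>I. c i * b i n) * to_q z ^ n) sums (\<Sum>i\<in>I. c i * G i z)"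
    by (simp add: sum_distrib_right mult.assoc)
qed

text \<open>The duality lemma is applied over the rationals, with Fourier coefficients in place of
  points: a rational functional on sequences that kills all \<open>b i\<close> also kills
  \<open>a\<close>, because \<open>a\<close> is a complex combination of them.\<close>

theorem rational_combination:
  fixes G :: "'i \<Rightarrow> complex \<Rightarrow> complex"
  assumes I: "finite I" and f: "has_fourier_expansion f (\<lambda>n. of_rat (a n))"
    and G: "\<And>i. i \<in> I \<Longrightarrow> has_fourier_expansion (G i) (\<lambda>n. of_rat (b i n))"
    and span: "\<And>z. z \<in> uhp \<Longrightarrow> f z = (\<Sum>i\<in>I. c i * G i z)"
  shows "\<exists>r :: 'i \<Rightarrow> rat. \<forall>z\<in>uhp. f z = (\<Sum>i\<in>I. of_rat (r i) * G i z)"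
proof -
  have "has_fourier_expansion f (\<lambda>n. \<Sum>i\<in>I. c i * of_rat (b i n))"
    using fourier_linear_combination[OF I, of G "\<lambda>i n. of_rat (b i n)" c] G span by (auto simp: has_fourier_expansion_def)
  then have a: "of_rat (a n) = (\<Sum>i\<in>I. c i * of_rat (b i n))" for n using fun_cong[OF fourier_unique[OF f], of _ n] by simp
  have "\<exists>r. \<forall>n\<in>UNIV. a n = (\<Sum>i\<in>I. r i * b i n)"
  proof (rule in_span_of_annihilators[OF I])
    fix A and \<alpha> :: "nat \<Rightarrow> rat"
    assume A: "finite A" "\<forall>i\<in>I. (\<Sum>x\<in>A. \<alpha> x * b i x) = 0"
    have "complex_of_rat (\<Sum>x\<in>A. \<alpha> x * a x) = (\<Sum>x\<in>A. \<Sum>i\<in>I. c i * of_rat (\<alpha> x * b i x))"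
      by (simp add: of_rat_sum of_rat_mult a sum_distrib_left mult_ac)
    also have "\<dots> = (\<Sum>i\<in>I. c i * of_rat (\<Sum>x\<in>A. \<alpha> x * b i x))"
      by (subst sum.swap) (simp add: of_rat_sum sum_distrib_left)
    also have "\<dots> = 0" using A(2) by simp
    finally show "(\<Sum>x\<in>A. \<alpha> x * a x) = 0" by simp
  qed
  then obtain r where r: "a n = (\<Sum>i\<in>I. r i * b i n)" for n by auto
  have "has_fourier_expansion (\<lambda>z. \<Sum>i\<in>I. of_rat (r i) * G i z) (\<lambda>n. of_rat (a n))"
    using fourier_linear_combination[OF I, of G "\<lambda>i n. of_rat (b i n)" "\<lambda>i. of_rat (r i)"] G by (simp add: r of_rat_sum of_rat_mult)
  then show ?thesis using f by (intro exI[of _ r] ballI) (auto simp: has_fourier_expansion_def intro: sums_unique2)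
qed

section \<open>Cusp forms of odd weight or of weight below 12\<close>

lemma cusp_form_S: "cusp_form k f \<Longrightarrow> z \<in> uhp \<Longrightarrow> f (- 1 / z) = z ^ k * f z"
proof -
  assume f: "cusp_form k f" and z: "z \<in> uhp"
  have "(0::int) * 0 - (- 1) * 1 = 1" by simp
  with f z have "f ((of_int 0 * z + of_int (- 1)) / (of_int 1 * z + of_int 0)) = (of_int 1 * z + of_int 0) ^ k * f z"
    unfolding cusp_form_def by blast
  then show ?thesis by simp
qed

lemma cusp_form_T: "cusp_form k f \<Longrightarrow> z \<in> uhp \<Longrightarrow> f (z + 1) = f z"
proof -
  assume f: "cusp_form k f" and z: "z \<in> uhp"
  have "(1::int) * 1 - 1 * 0 = 1" by simp
  with f z have "f ((of_int 1 * z + of_int 1) / (of_int 0 * z + of_int 1)) = (of_int 0 * z + of_int 1) ^ k * f z"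
    unfolding cusp_form_def by blast
  then show ?thesis by simp
qed

lemma cusp_form_odd_weight: "cusp_form k f \<Longrightarrow> odd k \<Longrightarrow> z \<in> uhp \<Longrightarrow> f z = 0"
proof -
  assume f: "cusp_form k f" and z: "z \<in> uhp" and k: "odd k"
  have "(- 1::int) * (- 1) - 0 * 0 = 1" by simp
  with f z have "f ((of_int (- 1) * z + of_int 0) / (of_int 0 * z + of_int (- 1))) = (of_int 0 * z + of_int (- 1)) ^ k * f z"
    unfolding cusp_form_def by blast
  then show ?thesis using k by simp
qed

text \<open>For w = 6 the only middle odd index is 3, for w = 8 they are 3 and 5, one symmetric
  pair, and for smaller w there is none. Thus \<open>cusp_form_zero_criterion\<close> applies with
  all multipliers equal to 1.\<close>

lemma cusp_form_weight_4_to_10: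
  assumes f: "cusp_form k f" and k: "even k" "4 \<le> k" "k < 12" and z: "z \<in> uhp"
  shows "f z = 0"
proof -
  obtain a where a: "has_fourier_expansion f a" "a 0 = 0" using f by (auto simp: cusp_form_def)
  define w where "w = k - 2"
  have w: "even w" "w \<ge> 2" "k = w + 2" using k by (auto simp: w_def)
  define h where "h n = eint a n 1 \<i> 0" for n
  have "h n + h (w - n) = of_real 1 * (h 3 + h (w - 3))" if n: "odd n" "3 \<le> n" "n + 3 \<le> w" for n
  proof -
    have "w = 6 \<or> w = 8" "n < 6" "n \<noteq> 4" using n w k by presburger+
    then have "n = 3 \<or> w = 8 \<and> n = 5" using n by auto
    then show ?thesis by auto
  qed
  from cusp_form_zero_criterion[OF a w(1,2) cusp_form_S[OF f, unfolded w(3)] this[unfolded h_def] _ z] show ?thesis by simp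
qed

text \<open>The square is a cusp form of weight 4, which is within reach of the period
  criterion.\<close>

lemma cusp_form_weight_2:
  assumes f: "cusp_form 2 f" and z: "z \<in> uhp"
  shows "f z = 0"
proof -
  obtain a where a: "has_fourier_expansion f a" "a 0 = 0" using f by (auto simp: cusp_form_def)
  have "cusp_form 4 (\<lambda>z. f z * f z)"
    unfolding cusp_form_def
  proof (intro conjI allI impI ballI)
    show "(\<lambda>z. f z * f z) holomorphic_on uhp" using f by (intro holomorphic_intros) (auto simp: cusp_form_def)
    show "\<exists>a. has_fourier_expansion (\<lambda>z. f z * f z) a \<and> a 0 = 0" using fourier_mult[OF a(1) a(1)] a(2) by force
    fix a b c d :: int and z assume "a * d - b * c = 1" "z \<in> uhp"
    with f have "f ((of_int a * z + of_int b) / (of_int c * z + of_int d)) = (of_int c * z + of_int d)\<^sup>2 * f z"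
      unfolding cusp_form_def by blast
    then show "f ((of_int a * z + of_int b) / (of_int c * z + of_int d)) * f ((of_int a * z + of_int b) / (of_int c * z + of_int d))
        = (of_int c * z + of_int d) ^ 4 * (f z * f z)"
      by (simp only:) (simp add: power2_eq_square power4_eq_xxxx)
  qed
  from cusp_form_weight_4_to_10[OF this _ _ _ z] show ?thesis by simp
qed

text \<open>The modulus is invariant and attains its maximum, so the form is constant; its constant
  term is 0.\<close>

lemma cusp_form_weight_0:
  assumes f: "cusp_form 0 f" and z: "z \<in> uhp"
  shows "f z = 0"
proof -
  have holo: "f holomorphic_on uhp" using f by (simp add: cusp_form_def)
  obtain a where a: "has_fourier_expansion f a" "a 0 = 0" using f by (auto simp: cusp_form_def)
  obtain z0 where z0: "z0 \<in> uhp" "\<And>z. z \<in> uhp \<Longrightarrow> Im z ^ 0 * norm (f z) \<le> Im z0 ^ 0 * norm (f z0)"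
    using cusp_form_norm_attains_sup[OF holomorphic_on_imp_continuous_on[OF holo] a cusp_form_T[OF f], of 0] cusp_form_S[OF f] by auto
  have "f constant_on uhp"
    by (rule maximum_modulus_principle[OF holo _ _ _ _ z0(1)])
      (use z0(2) in \<open>auto intro: open_halfspace_Im_gt convex_connected convex_halfspace_Im_gt\<close>)
  then obtain c where c: "\<And>z. z \<in> uhp \<Longrightarrow> f z = c" by (auto simp: constant_on_def)
  have "has_fourier_expansion f (\<lambda>n. if n = 0 then c else 0)"
    unfolding has_fourier_expansion_def
  proof
    fix z assume "z \<in> uhp"
    show "(\<lambda>n. (if n = 0 then c else 0) * to_q z ^ n) sums f z"
      using sums_single[of 0 "\<lambda>_. c"] c[OF \<open>z \<in> uhp\<close>] by (simp add: if_distrib[of "\<lambda>x. x * _"] cong: if_cong)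
  qed
  from fun_cong[OF fourier_unique[OF this a(1)], of 0] have "c = 0" using a(2) by simp
  then show ?thesis using c[OF z] by simp
qed

lemma cusp_form_low_weight:
  assumes "cusp_form k f" "odd k \<or> k < 12" "z \<in> uhp" shows "f z = 0"
proof (cases "even k")
  case True
  then consider "k = 0" | "k = 2" | "4 \<le> k" by (cases "k = 1 \<or> k = 3") (auto, linarith)
  then show ?thesis
    using assms True cusp_form_weight_0 cusp_form_weight_2 cusp_form_weight_4_to_10[of k f z] by cases auto
qed (use assms cusp_form_odd_weight in blast)

text \<open>The condition n >= 6 leaves room to write n as a sum of two odd indices >= 3 in the
  triple series. Nothing is lost: the product with n = 4 is also the one with n = k - 4, and k >=
  12.\<close>

theorem cusp_form_in_Eis_span:
  assumes f: "cusp_form k f" and k: "even k" "k \<ge> 12"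
  shows "\<exists>c. \<forall>z\<in>uhp. f z = (\<Sum>n | even n \<and> 6 \<le> n \<and> n + 4 \<le> k. c n * (Eis n z * Eis (k - n) z - 2 * Eis k z))"
proof (rule in_span_of_annihilators)
  show "finite {n. even n \<and> 6 \<le> n \<and> n + 4 \<le> k}" by (rule finite_subset[of _ "{..k}"]) auto
  fix A \<alpha>
  assume A: "finite A" "A \<subseteq> uhp" and z: "\<forall>n\<in>{n. even n \<and> 6 \<le> n \<and> n + 4 \<le> k}. (\<Sum>z\<in>A. \<alpha> z * (Eis n z * Eis (k - n) z - 2 * Eis k z)) = 0"
  define m where "m = k div 2"
  have m: "k = 2 * m" "m \<ge> 6" using k by (auto simp: m_def)
  have "(\<Sum>\<tau>\<in>A. \<alpha> \<tau> * (Eis a \<tau> * Eis b \<tau> - 2 * Eis k \<tau>)) = 0"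
    if ab: "even a" "even b" "4 \<le> a" "4 \<le> b" "a + b = k" for a b
  proof (cases "6 \<le> a")
    case True
    then have "(\<Sum>\<tau>\<in>A. \<alpha> \<tau> * (Eis a \<tau> * Eis (k - a) \<tau> - 2 * Eis k \<tau>)) = 0" using z ab by auto
    moreover have "k - a = b" using ab by simp
    ultimately show ?thesis by (simp only:)
  next
    case False
    then have "6 \<le> b" using ab k by simp
    then have "(\<Sum>\<tau>\<in>A. \<alpha> \<tau> * (Eis b \<tau> * Eis (k - b) \<tau> - 2 * Eis k \<tau>)) = 0" using z ab by auto
    moreover have "k - b = a" using ab by simp
    ultimately show ?thesis by (simp only: mult.commute)
  qed
  then have "(\<Sum>\<tau>\<in>A. \<alpha> \<tau> * kern GLpos k \<tau> z) = 0" if "z \<in> uhp" for z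
    using combo_kern_GLpos_zero[OF A k(1) _ _ that] k by simp
  then have "(\<Sum>\<tau>\<in>A. \<alpha> \<tau> * kern SL2 k \<tau> z) = 0" if "z \<in> uhp" for z
    using combo_kern_SL2_zero[OF A m(2) _ that] unfolding m(1) by blast
  then show "(\<Sum>\<tau>\<in>A. \<alpha> \<tau> * f \<tau>) = 0"
    using cusp_form_combo_zero[of m f A \<alpha>] f A m(2) unfolding m(1) by simp
qed

section \<open>The cotangent and its derivatives\<close>

definition ctan :: "complex \<Rightarrow> complex" where
  "ctan t = of_real pi * cos (of_real pi * t) / sin (of_real pi * t)"

text \<open>\<open>cot_poly n\<close> expresses \<open>(-1)\<^sup>n / n!\<close> times the \<open>n\<close>-th derivative of \<open>ctan\<close> through \<open>ctan\<close>.\<close>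

primrec cot_poly :: "nat \<Rightarrow> complex poly" where
  "cot_poly 0 = [:0, 1:]"
| "cot_poly (Suc n) = smult (1 / of_nat (Suc n)) (pderiv (cot_poly n) * [:of_real pi ^ 2, 0, 1:])"

text \<open>For x >= 2 this is the sum of (t + n)^(-x) over all integers n
  (\<open>tangent_eq_inv_sum\<close>), for x = 1 the cotangent. Being polynomials in
  \<open>ctan\<close>, products of these functions can be compared as polynomials.\<close>

definition tangent :: "nat \<Rightarrow> complex \<Rightarrow> complex" where
  "tangent x t = poly (cot_poly (x - 1)) (ctan t)"

lemma tangent_1: "tangent (Suc 0) = ctan"
  by (simp add: tangent_def fun_eq_iff)

lemma sin_pi_nonzero: "t \<in> uhp \<Longrightarrow> sin (of_real pi * t) \<noteq> 0"
proof
  assume t: "t \<in> uhp" and "sin (of_real pi * t) = 0"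
  then obtain n :: int where "of_real pi * t = of_real (n * pi)" by (auto simp: sin_eq_0)
  from arg_cong[OF this, of Im] show False using t by simp
qed

lemma DERIV_ctan:
  assumes "t \<in> uhp" shows "(ctan has_field_derivative - (ctan t ^ 2 + of_real pi ^ 2)) (at t)"
proof -
  let ?s = "sin (of_real pi * t)" and ?c = "cos (of_real pi * t)"
  have s: "?s \<noteq> 0" by (rule sin_pi_nonzero[OF assms])
  have "(ctan has_field_derivative (of_real pi * (- ?s * of_real pi) * ?s - of_real pi * ?c * (?c * of_real pi)) / (?s * ?s)) (at t)"
    unfolding ctan_def[abs_def] using s by (auto intro!: derivative_eq_intros)
  moreover have "(of_real pi * (- ?s * of_real pi) * ?s - of_real pi * ?c * (?c * of_real pi)) / (?s * ?s)
      = - (ctan t ^ 2 + of_real pi ^ 2)"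
    using s by (simp add: ctan_def power2_eq_square divide_simps)
  ultimately show ?thesis by simp
qed

lemma DERIV_tangent:
  assumes "t \<in> uhp" "x \<ge> 1"
  shows "(tangent x has_field_derivative - of_nat x * tangent (Suc x) t) (at t)"
proof -
  obtain n where x: "x = Suc n" using assms(2) by (cases x) auto
  have "of_nat (Suc n) * poly (cot_poly (Suc n)) z = poly (pderiv (cot_poly n)) z * (z ^ 2 + of_real pi ^ 2)" for z
    by (simp add: power2_eq_square algebra_simps del: of_nat_Suc)
  then have "poly (pderiv (cot_poly n)) (ctan t) * - (ctan t ^ 2 + of_real pi ^ 2) = - of_nat (Suc n) * poly (cot_poly (Suc n)) (ctan t)"
    by (simp only: mult_minus_left mult_minus_right)
  with DERIV_chain2[OF poly_DERIV DERIV_ctan[OF assms(1)], of "cot_poly n"]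
  show ?thesis unfolding tangent_def[abs_def] x diff_Suc_1 by (simp only:)
qed

lemma poly_cot_poly_root:
  assumes "n \<ge> 1" "z\<^sup>2 = - (of_real pi)\<^sup>2" shows "poly (cot_poly n) z = 0"
proof -
  have "poly [:of_real pi ^ 2, 0, 1:] z = 0" using assms(2) by (simp add: power2_eq_square)
  then show ?thesis using assms(1) by (cases n) (auto simp del: mult_pCons_right)
qed

lemma tangent_step:
  assumes "t \<in> uhp" "x \<ge> 1" "\<And>t. t \<in> uhp \<Longrightarrow> tangent x t = F t" "(F has_field_derivative D) (at t)"
  shows "tangent (Suc x) t = - D / of_nat x"
proof -
  have "(F has_field_derivative - of_nat x * tangent (Suc x) t) (at t)"
    by (rule has_field_derivative_transform_within_open[OF DERIV_tangent[OF assms(1,2)] open_uhp])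
      (use assms in auto)
  from DERIV_unique[OF this assms(4)] show ?thesis using assms(2) by (auto simp: field_simps)
qed

abbreviation nonzero_ints :: "int set" where "nonzero_ints \<equiv> - {0}"

subsection \<open>Partial fractions\<close>

definition inv_sum :: "int set \<Rightarrow> nat \<Rightarrow> complex \<Rightarrow> complex" where
  "inv_sum S x t = (\<Sum>\<^sub>\<infinity>n\<in>S. 1 / (t + of_int n) ^ x)"

lemma int_inverse_square_summable: "(\<lambda>n::int. 1 / (1 + \<bar>of_int n\<bar>) ^ 2 :: real) summable_on S"
proof -
  have "(\<lambda>n::int. (1 + \<bar>of_int n\<bar>) powr (-2) :: real) summable_on UNIV" by (rule summable_on_int_powr) simp
  then have "(\<lambda>n::int. 1 / (1 + \<bar>of_int n\<bar>) ^ 2 :: real) summable_on UNIV"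
    by (rule summable_on_cong[THEN iffD1, rotated]) (simp add: powr_minus powr_realpow inverse_eq_divide add_pos_nonneg)
  then show ?thesis by (rule summable_on_subset_banach) simp
qed

lemma inverse_power_int_le:
  fixes t :: complex
  assumes c: "c > 0" and x: "x \<ge> 2" and le: "norm (t + of_int n) \<ge> c * (1 + \<bar>of_int n\<bar>)"
  shows "norm (1 / (t + of_int n) ^ x) \<le> (1 / c) ^ x * (1 / (1 + \<bar>of_int n\<bar>) ^ 2)"
proof -
  have p: "c * (1 + \<bar>of_int n\<bar>) > 0" using c by (simp add: add_pos_nonneg)
  have "norm (1 / (t + of_int n) ^ x) \<le> 1 / (c * (1 + \<bar>of_int n\<bar>)) ^ x"
    unfolding norm_divide norm_power norm_one using p le
    by (intro divide_left_mono power_mono mult_pos_pos[OF zero_less_power zero_less_power]) auto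
  also have "\<dots> = (1 / c) ^ x * (1 / (1 + \<bar>of_int n\<bar>) ^ x)" by (simp add: power_mult_distrib power_divide)
  also have "\<dots> \<le> (1 / c) ^ x * (1 / (1 + \<bar>of_int n\<bar>) ^ 2)"
    using c x by (intro mult_left_mono divide_left_mono power_increasing mult_pos_pos zero_less_power) (auto simp: add_pos_nonneg)
  finally show ?thesis .
qed

lemma inv_sum_summable:
  fixes t :: complex
  assumes "c > 0" "x \<ge> 2" "\<And>n. n \<in> S \<Longrightarrow> norm (t + of_int n) \<ge> c * (1 + \<bar>of_int n\<bar>)"
  shows "(\<lambda>n. 1 / (t + of_int n) ^ x) summable_on S" "(\<lambda>n. 1 / (t + of_int n) ^ x) abs_summable_on S"
  by (rule summable_on_bounded(2,1)[OF int_inverse_square_summable inverse_power_int_le]; use assms in blast)+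

lemma DERIV_inv_sum:
  assumes U: "open U" "t \<in> U" and c: "continuous_on U c" "\<And>t. t \<in> U \<Longrightarrow> c t > 0" and x: "x \<ge> 2"
    and le: "\<And>t n. t \<in> U \<Longrightarrow> n \<in> S \<Longrightarrow> norm (t + of_int n) \<ge> c t * (1 + \<bar>of_int n\<bar>)"
  shows "(inv_sum S x has_field_derivative - of_nat x * inv_sum S (Suc x) t) (at t)"
proof -
  have "(inv_sum S x has_field_derivative (\<Sum>\<^sub>\<infinity>n\<in>S. - of_nat x * (1 / (t + of_int n) ^ Suc x))) (at t)"
    unfolding inv_sum_def[abs_def]
  proof (rule has_field_derivative_infsum(1)[OF U, where G = "\<lambda>t. (1 / c t) ^ x" and M = "\<lambda>n. 1 / (1 + \<bar>of_int n\<bar>) ^ 2"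
        and f' = "\<lambda>n t. - of_nat x * (1 / (t + of_int n) ^ Suc x)"])
    fix n w assume n: "n \<in> S" and w: "w \<in> U"
    have "0 < c w * (1 + \<bar>of_int n\<bar>)" using c(2)[OF w] by (simp add: add_pos_nonneg)
    then have nz: "w + of_int n \<noteq> 0" using le[OF w n] by auto
    have "((\<lambda>w. 1 / (w + of_int n) ^ x) has_field_derivative - (of_nat x * (w + of_int n) ^ (x - 1)) / ((w + of_int n) ^ x)\<^sup>2) (at w)"
      using nz by (auto intro!: derivative_eq_intros simp: power2_eq_square)
    moreover have "- (of_nat x * (w + of_int n) ^ (x - 1)) / ((w + of_int n) ^ x)\<^sup>2 = - of_nat x * (1 / (w + of_int n) ^ Suc x)"
      using nz x by (cases x) (simp_all add: power2_eq_square divide_simps del: of_nat_Suc)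
    ultimately show "((\<lambda>w. 1 / (w + of_int n) ^ x) has_field_derivative - of_nat x * (1 / (w + of_int n) ^ Suc x)) (at w)" by simp
    show "norm (1 / (w + of_int n) ^ x) \<le> (1 / c w) ^ x * (1 / (1 + \<bar>of_int n\<bar>) ^ 2)"
      by (rule inverse_power_int_le[OF c(2)[OF w] x le[OF w n]])
  next
    show "continuous_on U (\<lambda>t. (1 / c t) ^ x)" using c by (intro continuous_intros) (auto simp: less_le)
  qed (use int_inverse_square_summable in auto)
  then show ?thesis by (simp only: inv_sum_def infsum_cmult_right')
qed

lemma norm_add_int_ge_uhp: "t \<in> uhp \<Longrightarrow> norm (t + of_int n) \<ge> cst t / 2 * (1 + \<bar>of_int n\<bar>)"
proof -
  assume t: "t \<in> uhp"
  have "cst t / 2 * (1 + \<bar>of_int n\<bar>) \<le> cst t / 2 * vnorm (1, n)"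
    using cst_pos[OF t] by (intro mult_left_mono) (auto simp: vnorm_def)
  also have "\<dots> \<le> norm (lat t (1, n))" by (rule norm_lat_ge[OF t]) (simp add: zero_prod_def)
  finally show ?thesis by (simp add: lat_def)
qed

lemma norm_add_int_ge_ball: "t \<in> ball 0 (1/2) \<Longrightarrow> n \<noteq> 0 \<Longrightarrow> norm (t + of_int n :: complex) \<ge> 1 / 4 * (1 + \<bar>of_int n\<bar>)"
proof -
  assume t: "(t :: complex) \<in> ball 0 (1/2)" and n: "n \<noteq> 0"
  define a where "a = \<bar>real_of_int n\<bar>"
  have "norm (of_int n :: complex) \<le> norm (t + of_int n) + norm t" using norm_triangle_ineq4[of "t + of_int n" t] by simp
  then have "a \<le> norm (t + of_int n) + norm t" by (simp add: a_def)
  moreover have "a \<ge> 1" using n by (simp add: a_def)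
  moreover have "norm t < 1/2" using t by simp
  ultimately have "1 + a \<le> 4 * norm (t + of_int n)" by linarith
  then show ?thesis unfolding a_def[symmetric] by simp
qed

lemma DERIV_inv_sum_uhp:
  assumes "t \<in> uhp" "x \<ge> 2" shows "(inv_sum UNIV x has_field_derivative - of_nat x * inv_sum UNIV (Suc x) t) (at t)"
  by (rule DERIV_inv_sum[OF open_uhp assms(1) _ _ assms(2), of "\<lambda>t. cst t / 2"])
    (use norm_add_int_ge_uhp cst_pos in \<open>auto intro!: continuous_intros continuous_on_cst\<close>)

lemma DERIV_inv_sum_ball:
  assumes "t \<in> ball 0 (1/2)" "x \<ge> 2"
  shows "(inv_sum nonzero_ints x has_field_derivative - of_nat x * inv_sum nonzero_ints (Suc x) t) (at t)"
proof (rule DERIV_inv_sum[OF open_ball assms(1) _ _ assms(2), of "\<lambda>t. 1 / 4"])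
  fix t :: complex and n assume "t \<in> ball 0 (1/2)" "n \<in> nonzero_ints"
  then show "1 / 4 * (1 + \<bar>of_int n\<bar>) \<le> norm (t + of_int n)" by (intro norm_add_int_ge_ball) auto
qed auto

text \<open>Logarithmic derivative of the reflection formula 1 / (Gamma(t) Gamma(1 - t)) = sin (pi
  t) / pi.\<close>

lemma ctan_Digamma:
  assumes t: "t \<in> uhp" shows "ctan t = Digamma (1 - t) - Digamma t"
proof -
  have n: "t \<notin> \<int>\<^sub>\<le>\<^sub>0" "1 - t \<notin> \<int>\<^sub>\<le>\<^sub>0" using t by (auto elim!: nonpos_Ints_cases simp: complex_eq_iff)
  let ?p = "rGamma t * rGamma (1 - t)"
  have "((\<lambda>t. rGamma t * rGamma (1 - t)) has_field_derivative ?p * (Digamma (1 - t) - Digamma t)) (at t)"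
    using n by (auto intro!: derivative_eq_intros DERIV_chain2[OF has_field_derivative_rGamma_no_nonpos_int] simp: algebra_simps)
  moreover have "(\<lambda>t::complex. rGamma t * rGamma (1 - t)) = (\<lambda>t. sin (of_real pi * t) / of_real pi)"
    using rGamma_reflection_complex by auto
  moreover have "((\<lambda>t. sin (of_real pi * t) / of_real pi) has_field_derivative cos (of_real pi * t)) (at t)"
    by (auto intro!: derivative_eq_intros)
  ultimately have "?p * (Digamma (1 - t) - Digamma t) = cos (of_real pi * t)" by (simp only: DERIV_unique)
  then show ?thesis using sin_pi_nonzero[OF t] by (simp add: rGamma_reflection_complex ctan_def field_simps)
qed

text \<open>Differentiating \<open>ctan_Digamma\<close> gives two trigamma series: the one at t
  accounts for n >= 0, the one at 1 - t for n < 0. The partial fractions for larger x follow by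
  differentiation.\<close>

lemma tangent_2: 
  assumes t: "t \<in> uhp" shows "tangent 2 t = inv_sum UNIV 2 t"
proof -
  have n: "t \<notin> \<int>\<^sub>\<le>\<^sub>0" "1 - t \<notin> \<int>\<^sub>\<le>\<^sub>0" using t by (auto elim!: nonpos_Ints_cases simp: complex_eq_iff)
  have nz: "t \<noteq> 0" "1 - t \<noteq> 0" using t by (auto simp: complex_eq_iff)
  have "((\<lambda>t. Digamma (1 - t) - Digamma t) has_field_derivative - Polygamma 1 (1 - t) - Polygamma 1 t) (at t)"
    using n by (auto intro!: derivative_eq_intros)
  from tangent_step[OF t _ _ this, of 1] have 1: "tangent 2 t = Polygamma 1 (1 - t) + Polygamma 1 t"
    by (simp add: tangent_1 ctan_Digamma numeral_2_eq_2)
  have ab: "(\<lambda>n. 1 / (t + of_int n) ^ 2) abs_summable_on S" for S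
    by (rule inv_sum_summable(2)[of "cst t / 2"]) (use norm_add_int_ge_uhp[OF t] cst_pos[OF t] in auto)
  have bij: "bij_betw int UNIV {0..}" "bij_betw (\<lambda>n. - 1 - int n) UNIV {..<0}"
    by (rule bij_betwI[where g = nat], auto) (rule bij_betwI[where g = "\<lambda>n. nat (- 1 - n)"], auto)
  have sums: "(\<lambda>n. 1 / (t + of_int (h n)) ^ 2) sums (\<Sum>\<^sub>\<infinity>n\<in>S. 1 / (t + of_int n) ^ 2)"
    if h: "bij_betw h (UNIV :: nat set) S" for h S
  proof -
    have "((\<lambda>n. 1 / (t + of_int (h n)) ^ 2) has_sum (\<Sum>\<^sub>\<infinity>n\<in>S. 1 / (t + of_int n) ^ 2)) UNIV"
      unfolding has_sum_reindex_bij_betw[OF h, of "\<lambda>n. 1 / (t + of_int n) ^ 2"]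
      by (rule has_sum_infsum[OF abs_summable_summable[OF ab]])
    then show ?thesis by (rule has_sum_imp_sums)
  qed
  note sums[OF bij(1)]
  then have 2: "(\<Sum>\<^sub>\<infinity>n\<in>{0..}. 1 / (t + of_int n) ^ 2) = Polygamma 1 t"
    using Polygamma_LIMSEQ[OF nz(1), of 1] by (simp add: sums_iff inverse_eq_divide numeral_2_eq_2)
  note sums[OF bij(2)]
  moreover have "1 / (t + of_int (- 1 - int n)) ^ 2 = inverse ((1 - t + of_nat n) ^ Suc 1)" for n
  proof -
    have "t + of_int (- 1 - int n) = - (1 - t + of_nat n)" by simp
    then have "(t + of_int (- 1 - int n)) ^ 2 = (1 - t + of_nat n) ^ 2" by (simp only: power2_minus)
    then show ?thesis by (simp add: inverse_eq_divide flip: numeral_2_eq_2)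
  qed
  ultimately have 3: "(\<Sum>\<^sub>\<infinity>n\<in>{..<0}. 1 / (t + of_int n) ^ 2) = Polygamma 1 (1 - t)"
    using Polygamma_LIMSEQ[OF nz(2), of 1] by (simp add: sums_iff)
  have "inv_sum UNIV 2 t = (\<Sum>\<^sub>\<infinity>n\<in>{0..} \<union> {..<0}. 1 / (t + of_int n) ^ 2)"
    unfolding inv_sum_def by (rule infsum_cong_neutral) auto
  also have "\<dots> = Polygamma 1 t + Polygamma 1 (1 - t)"
    unfolding 2[symmetric] 3[symmetric] by (rule infsum_Un_disjoint) (use abs_summable_summable[OF ab] in auto)
  finally show ?thesis using 1 by simp
qed

lemma tangent_eq_inv_sum: "x \<ge> 2 \<Longrightarrow> t \<in> uhp \<Longrightarrow> tangent x t = inv_sum UNIV x t"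
proof (induction x arbitrary: t rule: dec_induct)
  case (step x)
  have "tangent (Suc x) t = - (- of_nat x * inv_sum UNIV (Suc x) t) / of_nat x"
    by (rule tangent_step[OF step.prems _ step.IH DERIV_inv_sum_uhp[OF step.prems step.hyps(1)]]) (use step.hyps in auto)
  then show ?case using step.hyps by simp
qed (rule tangent_2)

subsection \<open>Expansions at the origin and at infinity\<close>

definition zt :: "nat \<Rightarrow> complex" where "zt s = (\<Sum>\<^sub>\<infinity>n\<in>{1..}. 1 / of_nat n ^ s)"

lemma zt_summable:
  assumes "s \<ge> 2" shows "(\<lambda>n. 1 / of_nat n ^ s :: complex) abs_summable_on {1..}"
proof (rule Infinite_Sum.abs_summable_on_comparison_test')
  have "summable (\<lambda>n. norm (1 / real n ^ 2))" using inverse_power_summable[of 2, where 'a = real] by (simp add: inverse_eq_divide)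
  then have "(\<lambda>n. 1 / real n ^ 2) summable_on UNIV" by (rule norm_summable_imp_summable_on)
  then show "(\<lambda>n. 1 / real n ^ 2) summable_on {1..}" by (rule summable_on_subset_banach) simp
  fix n :: nat assume "n \<in> {1..}"
  then have "1 / real n ^ s \<le> 1 / real n ^ 2"
    using assms by (intro divide_left_mono power_increasing) auto
  then show "norm (1 / of_nat n ^ s :: complex) \<le> 1 / real n ^ 2" by (simp add: norm_divide norm_power)
qed

text \<open>The Taylor series at \<open>0\<close> of \<open>\<Sum>\<^bsub>n>0\<^esub> (t + n)\<^bsup>-x\<^esup>\<close> and \<open>\<Sum>\<^bsub>n<0\<^esub> (t + n)\<^bsup>-x\<^esup>\<close>.\<close>

definition zpos :: "nat \<Rightarrow> complex fps" where
  "zpos x = Abs_fps (\<lambda>i. (- of_nat x gchoose i) * zt (x + i))"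

definition zneg :: "nat \<Rightarrow> complex fps" where
  "zneg x = Abs_fps (\<lambda>i. (-1) ^ (x + i) * (- of_nat x gchoose i) * zt (x + i))"

lemma inv_sum_nonzero_ints_0:
  assumes "x \<ge> 2" shows "inv_sum nonzero_ints x 0 = (1 + (-1) ^ x) * zt x"
proof -
  have ab: "(\<lambda>n. 1 / (0 + of_int n :: complex) ^ x) abs_summable_on S" if "S \<subseteq> nonzero_ints" for S
  proof (rule inv_sum_summable(2)[OF _ assms, of "1/4"])
    fix n assume "n \<in> S"
    then show "1 / 4 * (1 + \<bar>of_int n\<bar>) \<le> norm (0 + of_int n :: complex)"
      using that by (intro norm_add_int_ge_ball) auto
  qed simp
  have bij: "bij_betw int {1..} {0<..}" "bij_betw (\<lambda>n. - int n) {1..} {..<0}"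
    by (rule bij_betwI[where g = nat], auto) (rule bij_betwI[where g = "\<lambda>n. nat (- n)"], auto)
  have "inv_sum nonzero_ints x 0 = (\<Sum>\<^sub>\<infinity>n\<in>{0<..} \<union> {..<0}. 1 / (0 + of_int n) ^ x)"
    unfolding inv_sum_def by (rule infsum_cong_neutral) auto
  also have "\<dots> = (\<Sum>\<^sub>\<infinity>n\<in>{0<..}. 1 / (0 + of_int n) ^ x) + (\<Sum>\<^sub>\<infinity>n\<in>{..<0}. 1 / (0 + of_int n) ^ x)"
    by (intro infsum_Un_disjoint abs_summable_summable[OF ab]) auto
  also have "\<dots> = zt x + (\<Sum>\<^sub>\<infinity>n\<in>{1..}. (-1) ^ x * (1 / of_nat n ^ x))"
    unfolding infsum_reindex_bij_betw[OF bij(1), symmetric] infsum_reindex_bij_betw[OF bij(2), symmetric] zt_def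
    by (intro arg_cong2[where f = "(+)"] infsum_cong) (cases "even x"; simp)+
  also have "\<dots> = zt x + (-1) ^ x * zt x" unfolding infsum_cmult_right' zt_def ..
  finally show ?thesis by (simp add: algebra_simps)
qed

text \<open>Differentiation sends the function for x to -x times the one for x + 1, so all Taylor
  coefficients reduce to values at 0; the binomial coefficients obey the same recursion by
  absorption.\<close>

lemma inv_sum_has_fps_expansion:
  assumes "x \<ge> 2" shows "inv_sum nonzero_ints x has_fps_expansion (zpos x + zneg x)"
proof -
  define F where "F x = fps_expansion (inv_sum nonzero_ints x) 0" for x
  have F: "inv_sum nonzero_ints x has_fps_expansion F x" if "x \<ge> 2" for x
  proof -
    have "inv_sum nonzero_ints x holomorphic_on ball 0 (1/2)"
      unfolding holomorphic_on_open[OF open_ball] using DERIV_inv_sum_ball[OF _ that] by blast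
    then show ?thesis unfolding F_def by (rule has_fps_expansion_fps_expansion[rotated 2]) simp_all
  qed
  have F0: "F x $ 0 = (1 + (-1) ^ x) * zt x" if "x \<ge> 2" for x
    using inv_sum_nonzero_ints_0[OF that] by (simp add: F_def fps_expansion_def)
  have FS: "of_nat (Suc i) * F x $ Suc i = - of_nat x * F (Suc x) $ i" if x: "x \<ge> 2" for x i
  proof -
    have "(\<lambda>t. - of_nat x * inv_sum nonzero_ints (Suc x) t) has_fps_expansion fps_const (- of_nat x) * F (Suc x)"
      by (intro has_fps_expansion_cmult_left F) (use x in simp)
    moreover have "eventually (\<lambda>t. deriv (inv_sum nonzero_ints x) t = - of_nat x * inv_sum nonzero_ints (Suc x) t) (nhds 0)"
      by (rule eventually_mono[OF eventually_nhds_in_open[of "ball 0 (1/2)"]])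
        (use DERIV_inv_sum_ball[OF _ x] in \<open>auto simp del: mem_ball_0 intro!: DERIV_imp_deriv\<close>)
    ultimately have "deriv (inv_sum nonzero_ints x) has_fps_expansion fps_const (- of_nat x) * F (Suc x)"
      by (simp only: has_fps_expansion_cong)
    from fps_expansion_unique_complex[OF has_fps_expansion_deriv[OF F[OF x]] this]
    have "fps_deriv (F x) $ i = (fps_const (- of_nat x) * F (Suc x)) $ i" by simp
    then show ?thesis by (simp del: of_nat_Suc)
  qed
  have "F x $ i = (- of_nat x gchoose i) * ((1 + (-1) ^ (x + i)) * zt (x + i))" if "x \<ge> 2" for x i
    using that
  proof (induction i arbitrary: x)
    case 0
    then show ?case by (simp add: F0)
  next
    case (Suc i)
    have "of_nat (Suc i) * F x $ Suc i = - of_nat x * ((- of_nat (Suc x) gchoose i) * ((1 + (-1) ^ (Suc x + i)) * zt (Suc x + i)))"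
      using FS[OF Suc.prems, of i] Suc.IH[of "Suc x"] Suc.prems by simp
    moreover have "of_nat (Suc i) * (- of_nat x gchoose Suc i) = - of_nat x * (- of_nat (Suc x) gchoose i :: complex)"
      using gbinomial_absorption[of i "- of_nat x :: complex"] by (simp add: minus_diff_commute del: of_nat_Suc) (simp add: add.commute)
    ultimately have "of_nat (Suc i) * F x $ Suc i = of_nat (Suc i) * ((- of_nat x gchoose Suc i) * ((1 + (-1) ^ (Suc x + i)) * zt (Suc x + i)))"
      by (simp only: mult.assoc[symmetric])
    then show ?case by (simp only: mult_cancel_left of_nat_eq_0_iff) simp
  qed
  then have "F x = zpos x + zneg x" using assms by (intro fps_ext) (simp add: zpos_def zneg_def algebra_simps)
  then show ?thesis using F[OF assms] by simp
qed

definition qsum :: "nat \<Rightarrow> complex \<Rightarrow> complex" where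
  "qsum j t = (\<Sum>\<^sub>\<infinity>d\<in>{1..}. of_nat d ^ j * to_q t ^ d)"

lemma power_series_coeff_summable:
  assumes "0 \<le> r" "r < 1" shows "(\<lambda>d. real d ^ j * r ^ d) summable_on S"
proof -
  have "\<forall>r. norm r < 1 \<longrightarrow> summable (\<lambda>d. real d ^ j * r ^ d)"
  proof (induction j)
    case (Suc j)
    show ?case
    proof (intro allI impI)
      fix r :: real assume "norm r < 1"
      then have "summable (\<lambda>n. diffs (\<lambda>d. real d ^ j) n * r ^ n)" using Suc by (intro termdiff_converges) auto
      from summable_mult[OF this, of r] have "summable (\<lambda>n. real (Suc n) ^ Suc j * r ^ Suc n)"
        by (simp add: diffs_def mult_ac del: of_nat_Suc)
      then show "summable (\<lambda>d. real d ^ Suc j * r ^ d)" by (subst (asm) summable_Suc_iff)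
    qed
  qed (simp add: summable_geometric)
  then have "summable (\<lambda>d. norm (real d ^ j * r ^ d))" using assms by simp
  then have "(\<lambda>d. real d ^ j * r ^ d) summable_on UNIV" by (rule norm_summable_imp_summable_on)
  then show ?thesis by (rule summable_on_subset_banach) simp
qed

lemma qsum_summable:
  assumes "t \<in> uhp" shows "(\<lambda>d. of_nat d ^ j * to_q t ^ d) abs_summable_on S"
  using power_series_coeff_summable[OF _ norm_to_q_less_1[OF assms]] by (simp add: norm_mult norm_power)

lemma DERIV_qsum:
  assumes "t \<in> uhp" shows "(qsum j has_field_derivative 2 * of_real pi * \<i> * qsum (Suc j) t) (at t)"
proof -
  define U where "U = {w. Im w > Im t / 2}"
  define r where "r = exp (- (pi * Im t))"
  have r: "0 \<le> r" "r < 1" using assms by (auto simp: r_def)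
  have U: "open U" "t \<in> U" using assms by (simp_all only: U_def open_halfspace_Im_gt) simp
  have "(qsum j has_field_derivative (\<Sum>\<^sub>\<infinity>d\<in>{1..}. 2 * of_real pi * \<i> * (of_nat d ^ Suc j * to_q t ^ d))) (at t)"
    unfolding qsum_def[abs_def]
  proof (rule has_field_derivative_infsum(1)[OF U, where G = "\<lambda>_. 1" and M = "\<lambda>d. real d ^ j * r ^ d"
        and f' = "\<lambda>d t. 2 * of_real pi * \<i> * (of_nat d ^ Suc j * to_q t ^ d)"])
    fix d :: nat and w assume d: "d \<in> {1..}" and w: "w \<in> U"
    have "((\<lambda>w. of_nat d ^ j * to_q w ^ d) has_field_derivative of_nat d ^ j * (of_nat d * (2 * of_real pi * \<i> * to_q w) * to_q w ^ (d - 1))) (at w)"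
      by (rule DERIV_cong[OF DERIV_cmult[OF DERIV_power[OF DERIV_to_q]]]) (simp add: mult_ac)
    moreover have "to_q w ^ d = to_q w * to_q w ^ (d - 1)" using d by (cases d) auto
    ultimately show "((\<lambda>w. of_nat d ^ j * to_q w ^ d) has_field_derivative 2 * of_real pi * \<i> * (of_nat d ^ Suc j * to_q w ^ d)) (at w)"
      by (simp add: mult_ac)
    have "norm (to_q w) \<le> r" using w pi_gt_zero by (simp add: norm_to_q r_def U_def)
    then have "norm (to_q w) ^ d \<le> r ^ d" by (rule power_mono) simp
    then show "norm (of_nat d ^ j * to_q w ^ d) \<le> 1 * (real d ^ j * r ^ d)"
      by (simp add: norm_mult norm_power mult_left_mono)
  qed (use power_series_coeff_summable[OF r] r in auto)
  then show ?thesis unfolding qsum_def infsum_cmult_right' .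
qed

lemma ctan_qsum:
  assumes t: "t \<in> uhp" shows "ctan t = - of_real pi * \<i> - 2 * of_real pi * \<i> * qsum 0 t"
proof -
  let ?q = "to_q t"
  have q: "norm ?q < 1" by (rule norm_to_q_less_1[OF t])
  have q1: "?q \<noteq> 1" using q by auto
  define e where "e = exp (\<i> * (of_real pi * t))"
  have e: "e \<noteq> 0" "?q = e * e" by (simp_all add: e_def to_q_def mult_ac flip: exp_add)
  have "(\<lambda>n. ?q ^ Suc n) sums (?q * (1 / (1 - ?q)))" using sums_mult[OF geometric_sums[OF q], of ?q] by simp
  moreover have "((\<lambda>d. ?q ^ d) has_sum qsum 0 t) {1..}"
    using has_sum_infsum[OF abs_summable_summable[OF qsum_summable[OF t, of 0 "{1..}"]]] by (simp add: qsum_def)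
  then have "((\<lambda>n. ?q ^ Suc n) has_sum qsum 0 t) UNIV"
    by (subst (asm) has_sum_reindex_bij_betw[OF bij_betwI[of Suc UNIV "{1..}" "\<lambda>n. n - 1"], symmetric]) auto
  then have "(\<lambda>n. ?q ^ Suc n) sums qsum 0 t" by (rule has_sum_imp_sums)
  ultimately have qs: "qsum 0 t = ?q / (1 - ?q)" by (simp add: sums_iff)
  have "sin (of_real pi * t) = (e - inverse e) / (2 * \<i>)" "cos (of_real pi * t) = (e + inverse e) / 2"
    unfolding sin_exp_eq cos_exp_eq e_def by (simp_all add: exp_minus)
  then have "ctan t = of_real pi * ((e + inverse e) / 2) / ((e - inverse e) / (2 * \<i>))" by (simp only: ctan_def)
  also have "\<dots> = of_real pi * \<i> * ((e + inverse e) / (e - inverse e))" by (simp add: divide_simps)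
  also have "(e + inverse e) / (e - inverse e) = (e * (e + inverse e)) / (e * (e - inverse e))" using e(1) by simp
  also have "\<dots> = (?q + 1) / (?q - 1)" unfolding e(2) using e(1) by (simp add: distrib_left right_diff_distrib)
  also have "of_real pi * \<i> * ((?q + 1) / (?q - 1)) = - of_real pi * \<i> - 2 * of_real pi * \<i> * (?q / (1 - ?q))"
    using q1 by (simp add: divide_simps) (simp add: algebra_simps)
  finally show ?thesis by (simp add: qs)
qed

text \<open>Lipschitz' formula, obtained by differentiating the geometric series of
  \<open>ctan_qsum\<close>.\<close>

lemma tangent_qsum:
  assumes "x \<ge> 2" "t \<in> uhp"
  shows "tangent x t = (- 2 * of_real pi * \<i>) ^ x / fact (x - 1) * qsum (x - 1) t"
  using assms
proof (induction x arbitrary: t rule: dec_induct)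
  case base
  have "((\<lambda>t. - of_real pi * \<i> - 2 * of_real pi * \<i> * qsum 0 t) has_field_derivative - (2 * of_real pi * \<i> * (2 * of_real pi * \<i> * qsum 1 t))) (at t)"
    using DERIV_qsum[OF base, of 0] by (auto intro!: derivative_eq_intros)
  from tangent_step[OF base _ _ this, of 1] show ?case
    by (simp add: tangent_1 ctan_qsum numeral_2_eq_2 power2_eq_square mult_ac)
next
  case (step x)
  have "((\<lambda>t. (- 2 * of_real pi * \<i>) ^ x / fact (x - 1) * qsum (x - 1) t) has_field_derivative
      (- 2 * of_real pi * \<i>) ^ x / fact (x - 1) * (2 * of_real pi * \<i> * qsum (Suc (x - 1)) t)) (at t)"
    by (intro DERIV_cmult DERIV_qsum step.prems)
  from tangent_step[OF step.prems _ step.IH this] have "tangent (Suc x) t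
      = - ((- 2 * of_real pi * \<i>) ^ x / fact (x - 1) * (2 * of_real pi * \<i> * qsum (Suc (x - 1)) t)) / of_nat x"
    using step.hyps by simp
  also have "Suc (x - 1) = x" using step.hyps by simp
  also have "- ((- 2 * of_real pi * \<i>) ^ x / fact (x - 1) * (2 * of_real pi * \<i> * qsum x t)) / of_nat x
      = (- 2 * of_real pi * \<i>) ^ Suc x / (of_nat x * fact (x - 1)) * qsum x t" by (simp add: mult_ac)
  also have "of_nat x * fact (x - 1) = (fact x :: complex)" using step.hyps by (simp add: fact_reduce)
  finally show ?case by simp
qed

subsection \<open>Products of tangent functions\<close>

lemma fps_remainder_tendsto:
  assumes "h has_fps_expansion c"
  shows "((\<lambda>t. h t / t ^ x - (\<Sum>i<x. c $ i / t ^ (x - i))) \<longlongrightarrow> c $ x) (at (0 :: complex))"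
proof -
  have r: "fps_conv_radius c > 0" and ev: "eventually (\<lambda>t. eval_fps c t = h t) (nhds 0)"
    using assms by (auto simp: has_fps_expansion_def)
  have r0: "ereal (norm (0 :: complex)) < fps_conv_radius c" using r unfolding norm_zero zero_ereal_def .
  have "isCont (eval_fps (fps_shift x c)) 0" by (intro continuous_eval_fps) (simp only: fps_conv_radius_shift r0)
  then have "((\<lambda>t. eval_fps (fps_shift x c) t) \<longlongrightarrow> c $ x) (at 0)" by (simp add: isCont_def eval_fps_at_0)
  moreover have "eventually (\<lambda>t. eval_fps (fps_shift x c) t = h t / t ^ x - (\<Sum>i<x. c $ i / t ^ (x - i))) (at 0)"
  proof -
    have "eventually (\<lambda>t. t \<in> eball 0 (fps_conv_radius c)) (nhds (0 :: complex))"
      using r0 by (intro eventually_nhds_in_open) (simp_all only: open_eball in_eball_iff norm_zero dist_self)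
    then have "eventually (\<lambda>t. t \<in> eball 0 (fps_conv_radius c) \<and> eval_fps c t = h t \<and> t \<noteq> 0) (at 0)"
      using ev eventually_neq_at_within by (auto simp: eventually_at_filter elim: eventually_elim2)
    then show ?thesis
    proof (rule eventually_mono, elim conjE)
      fix t :: complex assume t: "t \<in> eball 0 (fps_conv_radius c)" "eval_fps c t = h t" "t \<noteq> 0"
      have nt: "norm t < fps_conv_radius c" using t(1) by (simp add: in_eball_iff)
      have s: "summable (\<lambda>n. c $ n * t ^ n)" by (rule summable_fps[OF nt])
      have "h t = (\<Sum>n. c $ (n + x) * t ^ (n + x)) + (\<Sum>i<x. c $ i * t ^ i)"
        using suminf_split_initial_segment[OF s, of x] t(2) by (simp add: eval_fps_def)
      also have "(\<Sum>n. c $ (n + x) * t ^ (n + x)) = t ^ x * eval_fps (fps_shift x c) t"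
        unfolding eval_fps_def by (subst suminf_mult[symmetric]) (use nt summable_fps[of t "fps_shift x c"] in \<open>simp_all add: power_add mult_ac\<close>)
      finally have "h t / t ^ x = eval_fps (fps_shift x c) t + (\<Sum>i<x. c $ i * t ^ i) / t ^ x"
        using t(3) by (simp add: add_divide_distrib)
      also have "(\<Sum>i<x. c $ i * t ^ i) / t ^ x = (\<Sum>i<x. c $ i / t ^ (x - i))"
        unfolding sum_divide_distrib by (intro sum.cong) (use t(3) in \<open>auto simp: power_diff\<close>)
      finally show "eval_fps (fps_shift x c) t = h t / t ^ x - (\<Sum>i<x. c $ i / t ^ (x - i))" by simp
    qed
  qed
  ultimately show ?thesis by (rule Lim_transform_eventually)
qed

lemma tangent_remainder:
  assumes "x \<ge> 2" "t \<in> uhp" shows "tangent x t = 1 / t ^ x + inv_sum nonzero_ints x t"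
proof -
  have "(\<lambda>n. 1 / (t + of_int n) ^ x) summable_on S" for S
    by (rule inv_sum_summable(1)[of "cst t / 2"]) (use assms norm_add_int_ge_uhp cst_pos in auto)
  from infsum_Un_disjoint[OF this[of "{0}"] this[of nonzero_ints]]
  have "(\<Sum>\<^sub>\<infinity>n\<in>{0} \<union> nonzero_ints. 1 / (t + of_int n) ^ x) = 1 / t ^ x + inv_sum nonzero_ints x t"
    by (simp add: inv_sum_def)
  moreover have "{0} \<union> nonzero_ints = UNIV" by auto
  ultimately show ?thesis using tangent_eq_inv_sum[OF assms] by (simp add: inv_sum_def)
qed

text \<open>Approach to 0 within the half-plane, where the partial fractions of
  \<open>tangent\<close> hold.\<close>

abbreviation cusp0 :: "complex filter" where "cusp0 \<equiv> at 0 within uhp"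

lemma cusp0_nontrivial: "cusp0 \<noteq> bot"
proof -
  have "0 islimpt uhp"
    unfolding islimpt_approachable
  proof (intro allI impI)
    fix e :: real assume "e > 0"
    then show "\<exists>x\<in>uhp. x \<noteq> 0 \<and> dist x 0 < e" by (intro bexI[of _ "Complex 0 (e / 2)"]) (auto simp: cmod_def complex_eq_iff)
  qed
  then show ?thesis by (simp add: trivial_limit_within)
qed

lemma eventually_cusp0_uhp: "eventually (\<lambda>t. t \<in> uhp) cusp0"
  by (simp add: eventually_at_filter)

lemma inv_sum_tendsto: "x \<ge> 2 \<Longrightarrow> (inv_sum nonzero_ints x \<longlongrightarrow> inv_sum nonzero_ints x 0) cusp0"
  using DERIV_isCont[OF DERIV_inv_sum_ball[of 0 x]] by (auto simp: isCont_def intro: tendsto_within_subset)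

lemma uhp_nonzero: "t \<in> uhp \<Longrightarrow> t \<noteq> 0"
  by auto

text \<open>For x >= 2 the remainder is the sum over the nonzero integers. For x = 1 that series
  does not converge absolutely, and the limit comes from the Digamma function, whose pole at 0 is
  removed by the shift to t + 1.\<close>

lemma tangent_remainder_tendsto:
  assumes "x \<ge> 1" shows "\<exists>l. ((\<lambda>t. tangent x t - 1 / t ^ x) \<longlongrightarrow> l) cusp0"
proof (cases "x = 1")
  case True
  have n: "(1 :: complex) \<notin> \<int>\<^sub>\<le>\<^sub>0" by (auto elim!: nonpos_Ints_cases simp: complex_eq_iff)
  have "((\<lambda>t::complex. Digamma (1 - t) - Digamma (t + 1)) \<longlongrightarrow> Digamma (1 - 0) - Digamma (0 + 1)) cusp0"
    by (intro tendsto_diff isCont_tendsto_compose[where g = Digamma] tendsto_intros isCont_Polygamma continuous_ident) (use n in auto)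
  moreover have "eventually (\<lambda>t. Digamma (1 - t) - Digamma (t + 1) = tangent x t - 1 / t ^ x) cusp0"
    by (rule eventually_mono[OF eventually_cusp0_uhp])
      (simp only: True tangent_1 One_nat_def ctan_Digamma Digamma_plus1[OF uhp_nonzero], simp)
  ultimately have "((\<lambda>t. tangent x t - 1 / t ^ x) \<longlongrightarrow> Digamma (1 - 0) - Digamma (0 + 1)) cusp0"
    by (rule Lim_transform_eventually)
  then show ?thesis by blast
next
  case False
  then have x: "x \<ge> 2" using assms by simp
  have "eventually (\<lambda>t. inv_sum nonzero_ints x t = tangent x t - 1 / t ^ x) cusp0"
    by (rule eventually_mono[OF eventually_cusp0_uhp]) (simp add: tangent_remainder[OF x])
  from Lim_transform_eventually[OF inv_sum_tendsto[OF x] this] show ?thesis by blast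
qed

text \<open>The principal part of c(t) / t^x with each pole t^(-j) replaced by the periodic function
  \<open>tangent j\<close>; the simple pole, i = x - 1, is left out.\<close>

definition pp_tangent :: "complex fps \<Rightarrow> nat \<Rightarrow> complex \<Rightarrow> complex" where
  "pp_tangent c x t = (\<Sum>i<x - 1. c $ i * tangent (x - i) t)"

text \<open>A polynomial in \<open>ctan\<close> that stays bounded at the pole \<open>0\<close> is constant. At \<open>\<plusminus>\<i>\<pi>\<close>, the limits
  of \<open>ctan\<close> at \<open>\<mp>\<i>\<infinity>\<close>, only \<open>tangent 1\<close> contributes, and with opposite signs: so the constant and the residue are \<open>0\<close>.\<close>

lemma principal_parts:
  fixes P :: "complex poly"
  assumes L: "finite L" and h: "\<And>l. l \<in> L \<Longrightarrow> h l has_fps_expansion c l" and x: "\<And>l. l \<in> L \<Longrightarrow> x l \<ge> 1"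
    and lim: "((\<lambda>t. poly P (ctan t) - (\<Sum>l\<in>L. h l t / t ^ x l)) \<longlongrightarrow> b) cusp0"
    and root: "poly P (\<i> * of_real pi) = 0" "poly P (- \<i> * of_real pi) = 0"
  shows "poly P (ctan t) = (\<Sum>l\<in>L. pp_tangent (c l) (x l) t)"
proof -
  define Q where "Q = P - (\<Sum>l\<in>L. \<Sum>i<x l. smult (c l $ i) (cot_poly (x l - i - 1)))"
  have Q: "poly Q (ctan t) = poly P (ctan t) - (\<Sum>l\<in>L. \<Sum>i<x l. c l $ i * tangent (x l - i) t)" for t
    by (simp add: Q_def poly_sum tangent_def)
  have "\<forall>x\<ge>1. \<exists>l. ((\<lambda>t. tangent x t - 1 / t ^ x) \<longlongrightarrow> l) cusp0" using tangent_remainder_tendsto by blast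
  then obtain \<rho> where \<rho>: "\<And>x. x \<ge> 1 \<Longrightarrow> ((\<lambda>t. tangent x t - 1 / t ^ x) \<longlongrightarrow> \<rho> x) cusp0" by metis
  let ?A = "\<lambda>t. poly P (ctan t) - (\<Sum>l\<in>L. h l t / t ^ x l)"
  let ?B = "\<lambda>l t. h l t / t ^ x l - (\<Sum>i<x l. c l $ i / t ^ (x l - i))"
  let ?D = "\<lambda>l t. \<Sum>i<x l. c l $ i * (tangent (x l - i) t - 1 / t ^ (x l - i))"
  have "poly Q (ctan t) = ?A t + (\<Sum>l\<in>L. ?B l t) - (\<Sum>l\<in>L. ?D l t)" for t
    by (simp add: Q sum_subtractf right_diff_distrib)
  moreover have "((\<lambda>t. ?A t + (\<Sum>l\<in>L. ?B l t) - (\<Sum>l\<in>L. ?D l t)) \<longlongrightarrow>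
      b + (\<Sum>l\<in>L. c l $ x l) - (\<Sum>l\<in>L. \<Sum>i<x l. c l $ i * \<rho> (x l - i))) cusp0"
    by (intro tendsto_add tendsto_diff lim tendsto_sum tendsto_mult tendsto_const \<rho>
        tendsto_within_subset[OF fps_remainder_tendsto[OF h]]) auto
  ultimately obtain l where l: "((\<lambda>t. poly Q (ctan t)) \<longlongrightarrow> l) cusp0" by simp
  have "filterlim (\<lambda>t. (tangent 1 t - 1 / t ^ 1) + inverse t) at_infinity cusp0"
    by (rule tendsto_add_filterlim_at_infinity[OF \<rho>[of 1]])
      (auto intro: filterlim_mono[OF filterlim_inverse_at_infinity] at_le)
  then have inf: "filterlim ctan at_infinity cusp0" by (simp add: tangent_1 inverse_eq_divide)
  obtain a p where ap: "Q = pCons a p" by (cases Q)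
  have "p = 0"
  proof (rule ccontr)
    assume "p \<noteq> 0"
    from poly_infinity[OF this, of "norm l + 1" a] obtain r where r: "\<And>z. r \<le> norm z \<Longrightarrow> norm l + 1 \<le> norm (poly Q z)"
      unfolding ap by blast
    have "eventually (\<lambda>t. r \<le> norm (ctan t)) cusp0"
    proof -
      have "filterlim (\<lambda>t. norm (ctan t)) at_top cusp0" using inf by (rule filterlim_compose[OF filterlim_norm_at_top])
      then show ?thesis by (simp add: filterlim_at_top)
    qed
    moreover have "eventually (\<lambda>t. norm (poly Q (ctan t)) < norm l + 1) cusp0"
      by (rule order_tendstoD(2)[OF tendsto_norm[OF l]]) simp
    ultimately have "eventually (\<lambda>t. False) cusp0" by eventually_elim (use r in force)
    then show False using cusp0_nontrivial by simp
  qed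
  define k where "k = (\<Sum>l\<in>L. c l $ (x l - 1))"
  have ev: "poly (\<Sum>l\<in>L. \<Sum>i<x l. smult (c l $ i) (cot_poly (x l - i - 1))) z = k * z" if z: "z\<^sup>2 = - (of_real pi)\<^sup>2" for z
  proof -
    have "(\<Sum>i<x l. c l $ i * poly (cot_poly (x l - i - 1)) z) = c l $ (x l - 1) * z" if lL: "l \<in> L" for l
    proof -
      obtain n where n: "x l = Suc n" using x[OF lL] by (cases "x l") auto
      have "(\<Sum>i<n. c l $ i * poly (cot_poly (x l - i - 1)) z) = 0"
        by (intro sum.neutral ballI) (simp add: poly_cot_poly_root[OF _ z] n)
      then show ?thesis by (simp add: n)
    qed
    then show ?thesis by (simp add: poly_sum k_def sum_distrib_right)
  qed
  have "poly Q (\<i> * of_real pi) = a" "poly Q (- \<i> * of_real pi) = a" using ap \<open>p = 0\<close> by simp_all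
  then have "a = - k * (\<i> * of_real pi)" "a = - k * (- \<i> * of_real pi)"
    using root ev[of "\<i> * of_real pi"] ev[of "- \<i> * of_real pi"] unfolding Q_def poly_diff
    by (simp_all add: power_mult_distrib)
  then have "a = 0" "k = 0" by auto
  have "(\<Sum>i<x l. c l $ i * tangent (x l - i) t) = pp_tangent (c l) (x l) t + c l $ (x l - 1) * ctan t" if "l \<in> L" for l
    using x[OF that] by (cases "x l") (simp_all add: pp_tangent_def tangent_1)
  then have "(\<Sum>l\<in>L. \<Sum>i<x l. c l $ i * tangent (x l - i) t) = (\<Sum>l\<in>L. pp_tangent (c l) (x l) t) + k * ctan t"
    by (simp add: sum.distrib k_def sum_distrib_right)
  then show ?thesis using Q[of t] ap \<open>p = 0\<close> \<open>a = 0\<close> \<open>k = 0\<close> by simp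
qed

text \<open>Near 0, \<open>tangent x\<close> is t^(-x) + r_x with r_x regular. Subtracting
  \<open>tangent (x + y)\<close> removes the term t^(-x-y) of the product, and the singular part
  left is r_y t^(-x) + r_x t^(-y).\<close>

lemma tangent_product2:
  assumes x: "x \<ge> 2" and y: "y \<ge> 2"
  shows "tangent x t * tangent y t - tangent (x + y) t
    = pp_tangent (zpos y + zneg y) x t + pp_tangent (zpos x + zneg x) y t"
proof -
  define P where "P = cot_poly (x - 1) * cot_poly (y - 1) - cot_poly (x + y - 1)"
  let ?r = "inv_sum nonzero_ints"
  let ?h = "\<lambda>l::nat. if l = 0 then ?r y else ?r x" and ?c = "\<lambda>l::nat. if l = 0 then zpos y + zneg y else zpos x + zneg x"
  let ?x = "\<lambda>l::nat. if l = 0 then x else y"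
  have P: "poly P (ctan t) = tangent x t * tangent y t - tangent (x + y) t" for t by (simp add: P_def tangent_def)
  have "poly P (ctan t) = (\<Sum>l\<in>{0, 1}. pp_tangent (?c l) (?x l) t)"
  proof (rule principal_parts[where h = ?h])
    show "((\<lambda>t. poly P (ctan t) - (\<Sum>l\<in>{0, 1}. ?h l t / t ^ ?x l)) \<longlongrightarrow> ?r x 0 * ?r y 0 - ?r (x + y) 0) cusp0"
    proof (rule Lim_transform_eventually)
      show "((\<lambda>t. ?r x t * ?r y t - ?r (x + y) t) \<longlongrightarrow> ?r x 0 * ?r y 0 - ?r (x + y) 0) cusp0"
        using x y by (intro tendsto_intros inv_sum_tendsto) auto
      show "eventually (\<lambda>t. ?r x t * ?r y t - ?r (x + y) t = poly P (ctan t) - (\<Sum>l\<in>{0, 1}. ?h l t / t ^ ?x l)) cusp0"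
      proof (rule eventually_mono[OF eventually_cusp0_uhp])
        fix t assume t: "t \<in> uhp"
        have 1: "poly P (ctan t) = (1 / t ^ x + ?r x t) * (1 / t ^ y + ?r y t) - (1 / t ^ x * (1 / t ^ y) + ?r (x + y) t)"
          unfolding P using t x y by (simp add: tangent_remainder power_add)
        have 2: "(\<Sum>l\<in>{0, 1}. ?h l t / t ^ ?x l) = ?r y t * (1 / t ^ x) + ?r x t * (1 / t ^ y)" by simp
        have "a * b - d = (X + a) * (Y + b) - (X * Y + d) - (b * X + a * Y)" for X Y a b d :: complex by algebra
        then show "?r x t * ?r y t - ?r (x + y) t = poly P (ctan t) - (\<Sum>l\<in>{0, 1}. ?h l t / t ^ ?x l)"
          unfolding 1 2 .
      qed
    qed
    show "poly P (\<i> * of_real pi) = 0" "poly P (- \<i> * of_real pi) = 0"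
      using x y by (simp_all add: P_def poly_cot_poly_root power_mult_distrib)
  qed (use x y inv_sum_has_fps_expansion in auto)
  then show ?thesis by (simp add: P)
qed

text \<open>By inclusion and exclusion the left side is the sum of (t + l)^(-x) (t + m)^(-y) (t +
  n)^(-z) over distinct integers l, m, n. At most one of them is 0, so each singular part at 0 is
  one pole times the regular sum over distinct nonzero pairs.\<close>

lemma tangent_product3:
  assumes x: "x \<ge> 2" and y: "y \<ge> 2" and z: "z \<ge> 2"
  defines "R \<equiv> \<lambda>x. zpos x + zneg x"
  shows "tangent x t * tangent y t * tangent z t - tangent (x + y) t * tangent z t - tangent (y + z) t * tangent x t
      - tangent (x + z) t * tangent y t + 2 * tangent (x + y + z) t
    = pp_tangent (R y * R z - R (y + z)) x t + pp_tangent (R x * R z - R (x + z)) y t + pp_tangent (R x * R y - R (x + y)) z t"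
proof -
  let ?p = "\<lambda>x. cot_poly (x - 1)"
  define P where "P = ?p x * ?p y * ?p z - ?p (x + y) * ?p z - ?p (y + z) * ?p x - ?p (x + z) * ?p y + smult 2 (?p (x + y + z))"
  let ?r = "inv_sum nonzero_ints"
  define h where "h l = (\<lambda>t. if l = 0 then ?r y t * ?r z t - ?r (y + z) t else if l = 1 then ?r x t * ?r z t - ?r (x + z) t
    else ?r x t * ?r y t - ?r (x + y) t)" for l :: nat
  define c where "c l = (if l = 0 then R y * R z - R (y + z) else if l = 1 then R x * R z - R (x + z) else R x * R y - R (x + y))" for l :: nat
  let ?x = "\<lambda>l::nat. if l = 0 then x else if l = 1 then y else z"
  have P: "poly P (ctan t) = tangent x t * tangent y t * tangent z t - tangent (x + y) t * tangent z t - tangent (y + z) t * tangent x t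
      - tangent (x + z) t * tangent y t + 2 * tangent (x + y + z) t" for t by (simp add: P_def tangent_def)
  have E: "?r x has_fps_expansion R x" "?r y has_fps_expansion R y" "?r z has_fps_expansion R z"
    "?r (x + y) has_fps_expansion R (x + y)" "?r (y + z) has_fps_expansion R (y + z)" "?r (x + z) has_fps_expansion R (x + z)"
    unfolding R_def by (rule inv_sum_has_fps_expansion, use x y z in simp)+
  let ?g = "\<lambda>t. ?r x t * ?r y t * ?r z t - ?r (x + y) t * ?r z t - ?r (y + z) t * ?r x t - ?r (x + z) t * ?r y t + 2 * ?r (x + y + z) t"
  have "poly P (ctan t) = (\<Sum>l\<in>{0, 1, 2}. pp_tangent (c l) (?x l) t)"
  proof (rule principal_parts[where h = h])
    show "((\<lambda>t. poly P (ctan t) - (\<Sum>l\<in>{0, 1, 2}. h l t / t ^ ?x l)) \<longlongrightarrow> ?g 0) cusp0"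
    proof (rule Lim_transform_eventually)
      show "(?g \<longlongrightarrow> ?g 0) cusp0" using x y z by (intro tendsto_intros inv_sum_tendsto) auto
      show "eventually (\<lambda>t. ?g t = poly P (ctan t) - (\<Sum>l\<in>{0, 1, 2}. h l t / t ^ ?x l)) cusp0"
      proof (rule eventually_mono[OF eventually_cusp0_uhp])
        fix t assume t: "t \<in> uhp"
        have 1: "poly P (ctan t) = (1 / t ^ x + ?r x t) * (1 / t ^ y + ?r y t) * (1 / t ^ z + ?r z t)
          - (1 / t ^ x * (1 / t ^ y) + ?r (x + y) t) * (1 / t ^ z + ?r z t) - (1 / t ^ y * (1 / t ^ z) + ?r (y + z) t) * (1 / t ^ x + ?r x t)
          - (1 / t ^ x * (1 / t ^ z) + ?r (x + z) t) * (1 / t ^ y + ?r y t) + 2 * (1 / t ^ x * (1 / t ^ y) * (1 / t ^ z) + ?r (x + y + z) t)"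
          unfolding P using t x y z by (simp add: tangent_remainder power_add)
        have 2: "(\<Sum>l\<in>{0, 1, 2}. h l t / t ^ ?x l) = (?r y t * ?r z t - ?r (y + z) t) * (1 / t ^ x)
          + (?r x t * ?r z t - ?r (x + z) t) * (1 / t ^ y) + (?r x t * ?r y t - ?r (x + y) t) * (1 / t ^ z)"
          by (simp add: h_def numeral_2_eq_2)
        have "a * b * c - d * c - e * a - f * b + 2 * g
          = (X + a) * (Y + b) * (Z + c) - (X * Y + d) * (Z + c) - (Y * Z + e) * (X + a) - (X * Z + f) * (Y + b) + 2 * (X * Y * Z + g)
          - ((b * c - e) * X + (a * c - f) * Y + (a * b - d) * Z)" for X Y Z a b c d e f g :: complex
          by algebra
        then show "?g t = poly P (ctan t) - (\<Sum>l\<in>{0, 1, 2}. h l t / t ^ ?x l)" unfolding 1 2 .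
      qed
    qed
    show "poly P (\<i> * of_real pi) = 0" "poly P (- \<i> * of_real pi) = 0"
      using x y z by (simp_all add: P_def poly_cot_poly_root power_mult_distrib)
    show "h l has_fps_expansion c l" if "l \<in> {0, 1, 2}" for l
      using that E unfolding h_def c_def by (auto intro!: fps_expansion_intros)
  qed (use x y z in auto)
  then show ?thesis by (simp add: P c_def)
qed

lemma pp_tangent_add: "pp_tangent (c + d) x t = pp_tangent c x t + pp_tangent d x t"
  by (simp add: pp_tangent_def distrib_right sum.distrib)

subsection \<open>Double zeta values and multitangent functions\<close>

definition zt2 :: "nat \<Rightarrow> nat \<Rightarrow> complex" where
  "zt2 a b = (\<Sum>\<^sub>\<infinity>(m, n)\<in>{(m, n). 0 < m \<and> m < n}. 1 / of_nat m ^ a * (1 / of_nat n ^ b))"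

lemma infsum_ordered_pairs:
  fixes f g :: "nat \<Rightarrow> complex"
  assumes f: "f abs_summable_on {1..}" and g: "g abs_summable_on {1..}"
  shows "(\<Sum>\<^sub>\<infinity>(m, n)\<in>{(m, n). 0 < m \<and> m < n}. f m * g n) + (\<Sum>\<^sub>\<infinity>(m, n)\<in>{(m, n). 0 < m \<and> m < n}. g m * f n)
    = infsum f {1..} * infsum g {1..} - (\<Sum>\<^sub>\<infinity>n\<in>{1..}. f n * g n)"
proof -
  let ?F = "\<lambda>(m, n). f m * g n"
  let ?L = "{(m, n). 0 < m \<and> m < n} :: (nat \<times> nat) set" and ?G = "{(m, n). 0 < n \<and> n < m} :: (nat \<times> nat) set"
  let ?D = "(\<lambda>n. (n, n)) ` {1..} :: (nat \<times> nat) set"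
  have s: "?F summable_on S" if "S \<subseteq> {1..} \<times> {1..}" for S
    using abs_summable_summable[OF abs_summable_on_Times[OF f g]] that by (rule summable_on_subset_banach)
  have "infsum f {1..} * infsum g {1..} = infsum ?F ({1..} \<times> {1..})" by (rule infsum_Times_mult[OF f g, symmetric])
  also have "{1..} \<times> {1..} = (?L \<union> ?G) \<union> ?D" by (auto simp: image_iff)
  also have "infsum ?F ((?L \<union> ?G) \<union> ?D) = infsum ?F (?L \<union> ?G) + infsum ?F ?D"
    by (rule infsum_Un_disjoint) (auto intro!: s)
  also have "infsum ?F (?L \<union> ?G) = infsum ?F ?L + infsum ?F ?G"
    by (rule infsum_Un_disjoint) (auto intro!: s)
  also have "infsum ?F ?D = (\<Sum>\<^sub>\<infinity>n\<in>{1..}. f n * g n)" by (subst infsum_reindex) (auto simp: inj_on_def comp_def)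
  also have "infsum ?F ?G = infsum (?F \<circ> prod.swap) ?L"
    by (subst infsum_reindex[symmetric]) (auto intro!: arg_cong[where f = "infsum _"] simp: image_iff)
  also have "?F \<circ> prod.swap = (\<lambda>(m, n). g m * f n)" by (auto simp: mult.commute)
  finally show ?thesis by simp
qed

lemma zt2_symmetric: "a \<ge> 2 \<Longrightarrow> b \<ge> 2 \<Longrightarrow> zt2 a b + zt2 b a = zt a * zt b - zt (a + b)"
  using infsum_ordered_pairs[OF zt_summable zt_summable, of a b] by (simp add: zt2_def zt_def power_add)

text \<open>Taylor coefficients at 0 of the sum of (t + m)^(-y) (t + n)^(-z) over 0 < m < n. Then
  \<open>zneg2\<close> is the same over m < n < 0, obtained from the reflection t -> -t, which
  reverses the order.\<close>

definition zpos2 :: "nat \<Rightarrow> nat \<Rightarrow> complex fps" where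
  "zpos2 y z = Abs_fps (\<lambda>s. \<Sum>i\<le>s. (- of_nat y gchoose i) * (- of_nat z gchoose (s - i)) * zt2 (y + i) (z + (s - i)))"

definition zneg2 :: "nat \<Rightarrow> nat \<Rightarrow> complex fps" where
  "zneg2 y z = Abs_fps (\<lambda>s. (-1) ^ (y + z + s) * zpos2 z y $ s)"

text \<open>Coefficientwise this is the harmonic product of double zeta values; on the diagonal the
  binomial coefficients add up by Vandermonde's identity.\<close>

lemma zpos2_symmetric:
  assumes "y \<ge> 2" "z \<ge> 2" shows "zpos2 y z + zpos2 z y = zpos y * zpos z - zpos (y + z)"
proof (rule fps_ext)
  fix s
  let ?b = "\<lambda>i. (- of_nat y gchoose i) * (- of_nat z gchoose (s - i)) :: complex"
  have "zpos2 z y $ s = (\<Sum>i\<le>s. ?b i * zt2 (z + (s - i)) (y + i))"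
    unfolding zpos2_def fps_nth_Abs_fps
    by (rule sum.reindex_bij_witness[of _ "\<lambda>i. s - i" "\<lambda>i. s - i"]) auto
  then have "(zpos2 y z + zpos2 z y) $ s = (\<Sum>i\<le>s. ?b i * (zt2 (y + i) (z + (s - i)) + zt2 (z + (s - i)) (y + i)))"
    by (simp add: zpos2_def distrib_left sum.distrib)
  also have "\<dots> = (\<Sum>i\<le>s. ?b i * (zt (y + i) * zt (z + (s - i)) - zt (y + z + s)))"
  proof (intro sum.cong refl arg_cong2[where f = "(*)"])
    fix i assume "i \<in> {..s}"
    then have "(y + i) + (z + (s - i)) = y + z + s" by simp
    then show "zt2 (y + i) (z + (s - i)) + zt2 (z + (s - i)) (y + i) = zt (y + i) * zt (z + (s - i)) - zt (y + z + s)"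
      using zt2_symmetric[of "y + i" "z + (s - i)"] assms by (simp only:)
  qed
  also have "\<dots> = (\<Sum>i\<le>s. zpos y $ i * zpos z $ (s - i)) - (\<Sum>i\<le>s. ?b i) * zt (y + z + s)"
    by (simp add: right_diff_distrib sum_subtractf sum_distrib_right zpos_def mult.assoc mult.left_commute[of "zt _"])
  also have "(\<Sum>i\<le>s. ?b i) = (- of_nat (y + z) gchoose s)"
    using gbinomial_Vandermonde[of "- of_nat y :: complex" "- of_nat z" s] by (simp add: atMost_atLeast0)
  finally show "(zpos2 y z + zpos2 z y) $ s = (zpos y * zpos z - zpos (y + z)) $ s"
    by (simp add: fps_mult_nth zpos_def atMost_atLeast0 sum_subtractf)
qed

lemma zneg_nth: "zneg x $ i = (-1) ^ (x + i) * zpos x $ i"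
  by (simp add: zneg_def zpos_def)

lemma zneg2_symmetric:
  assumes "y \<ge> 2" "z \<ge> 2" shows "zneg2 y z + zneg2 z y = zneg y * zneg z - zneg (y + z)"
proof (rule fps_ext)
  fix s
  have "(zneg y * zneg z) $ s = (-1) ^ (y + z + s) * (zpos y * zpos z) $ s"
    unfolding fps_mult_nth sum_distrib_left
  proof (intro sum.cong refl)
    fix i assume "i \<in> {0..s}"
    then have "(-1) ^ (y + z + s) = (-1) ^ (y + i) * ((-1) ^ (z + (s - i)) :: complex)" by (simp add: add_ac flip: power_add)
    then show "zneg y $ i * zneg z $ (s - i) = (-1) ^ (y + z + s) * (zpos y $ i * zpos z $ (s - i))"
      by (simp add: zneg_nth)
  qed
  moreover have "(zpos2 z y + zpos2 y z) $ s = (zpos y * zpos z - zpos (y + z)) $ s" using zpos2_symmetric[OF assms] by (simp add: add.commute)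
  ultimately show "(zneg2 y z + zneg2 z y) $ s = (zneg y * zneg z - zneg (y + z)) $ s"
    by (simp add: zneg2_def zneg_nth add.commute[of z y] add_ac flip: distrib_left right_diff_distrib)
qed

text \<open>The sums of \<open>(t + m)\<^bsup>-x\<^esup> (t + n)\<^bsup>-y\<^esup>\<close> over the integers \<open>m < n\<close>, and of the analogous triple products,
  by partial fractions: each factor is multiplied by the Taylor series of the others at its pole. The terms
  with \<open>tangent 1\<close>, whose coefficients cancel, are left out by \<open>pp_tangent\<close>.\<close>

definition ditangent :: "nat \<Rightarrow> nat \<Rightarrow> complex \<Rightarrow> complex" where
  "ditangent x y t = pp_tangent (zpos y) x t + pp_tangent (zneg x) y t"

definition tritangent :: "nat \<Rightarrow> nat \<Rightarrow> nat \<Rightarrow> complex \<Rightarrow> complex" where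
  "tritangent x y z t = pp_tangent (zpos2 y z) x t + pp_tangent (zneg x * zpos z) y t + pp_tangent (zneg2 x y) z t"

lemma ditangent_symmetric:
  "x \<ge> 2 \<Longrightarrow> y \<ge> 2 \<Longrightarrow> ditangent x y t + ditangent y x t = tangent x t * tangent y t - tangent (x + y) t"
  by (simp add: ditangent_def tangent_product2 pp_tangent_add)

text \<open>The terms are collected by the variable that carries the pole. The other two then run
  through both orders and all positions relative to 0, which adds up to the regular factors of
  \<open>tangent_product3\<close>.\<close>

lemma tritangent_symmetric:
  assumes "x \<ge> 2" "y \<ge> 2" "z \<ge> 2"
  shows "tritangent x y z t + tritangent x z y t + tritangent y x z t + tritangent y z x t + tritangent z x y t + tritangent z y x t
    = tangent x t * tangent y t * tangent z t - tangent (x + y) t * tangent z t - tangent (y + z) t * tangent x t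
      - tangent (x + z) t * tangent y t + 2 * tangent (x + y + z) t"
proof -
  have *: "zpos2 y z + zpos2 z y + zneg y * zpos z + zneg z * zpos y + zneg2 y z + zneg2 z y
      = (zpos y + zneg y) * (zpos z + zneg z) - (zpos (y + z) + zneg (y + z))" if "y \<ge> 2" "z \<ge> 2" for y z
  proof -
    have "p + q = a * b - c \<Longrightarrow> r + s = d * e - f \<Longrightarrow> p + q + d * b + e * a + r + s = (a + d) * (b + e) - (c + f)"
      for a b c d e f p q r s :: "complex fps" by algebra
    from this[OF zpos2_symmetric[OF that] zneg2_symmetric[OF that]] show ?thesis .
  qed
  have "tritangent x y z t + tritangent x z y t + tritangent y x z t + tritangent y z x t + tritangent z x y t + tritangent z y x t
    = pp_tangent (zpos2 y z + zpos2 z y + zneg y * zpos z + zneg z * zpos y + zneg2 y z + zneg2 z y) x t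
    + pp_tangent (zpos2 x z + zpos2 z x + zneg x * zpos z + zneg z * zpos x + zneg2 x z + zneg2 z x) y t
    + pp_tangent (zpos2 x y + zpos2 y x + zneg x * zpos y + zneg y * zpos x + zneg2 x y + zneg2 y x) z t"
    by (simp add: tritangent_def pp_tangent_add)
  then show ?thesis unfolding *[OF assms(2,3)] *[OF assms(1,3)] *[OF assms(1,2)] tangent_product3[OF assms] .
qed

section \<open>Fourier coefficients of Eisenstein series\<close>

text \<open>For w, d >= 1 one has w + d <= 2 w d; this separates the variables in double series over
  r^(w d).\<close>

lemma power_mult_le_sqrt:
  fixes r :: real
  assumes "0 \<le> r" "r \<le> 1" "1 \<le> w" "1 \<le> d" shows "r ^ (w * d) \<le> sqrt r ^ w * sqrt r ^ d"
proof -
  have "w + d \<le> 2 * (w * d)" using mult_le_mono2[OF assms(4), of w] mult_le_mono1[OF assms(3), of d] by linarith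
  then have "sqrt r ^ (2 * (w * d)) \<le> sqrt r ^ (w + d)" using assms by (intro power_decreasing) auto
  then show ?thesis using assms by (simp add: power_mult power_add)
qed

lemma q_double_sum_summable:
  fixes q :: complex
  assumes "norm q < 1" shows "(\<lambda>(w, d). of_nat d ^ j * q ^ (w * d)) abs_summable_on {1..} \<times> {1..}"
proof -
  define s where "s = sqrt (norm q)"
  have s: "0 \<le> s" "s < 1" using assms by (auto simp: s_def real_sqrt_lt_1_iff)
  have a: "(\<lambda>w. s ^ w) abs_summable_on {1..}" "(\<lambda>d. real d ^ j * s ^ d) abs_summable_on {1..}"
    using power_series_coeff_summable[OF s, of 0 "{1..}"] power_series_coeff_summable[OF s, of j "{1..}"] s by (simp_all add: abs_mult)
  show ?thesis
  proof (rule Infinite_Sum.abs_summable_on_comparison_test'[OF abs_summable_summable[OF abs_summable_on_Times[OF a]]])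
    fix p :: "nat \<times> nat" assume p: "p \<in> {1..} \<times> {1..}"
    obtain w d where wd: "p = (w, d)" "1 \<le> w" "1 \<le> d" using p by auto
    have "real d ^ j * norm q ^ (w * d) \<le> real d ^ j * (s ^ w * s ^ d)"
      unfolding s_def using assms wd by (intro mult_left_mono power_mult_le_sqrt) auto
    then show "norm (case p of (w, d) \<Rightarrow> of_nat d ^ j * q ^ (w * d)) \<le> (case p of (x, y) \<Rightarrow> s ^ x * (real y ^ j * s ^ y))"
      by (simp add: wd norm_mult norm_power mult_ac)
  qed
qed

lemma to_q_mult_of_nat: "to_q (of_nat w * t) = to_q t ^ w"
  by (simp add: to_q_def mult_ac flip: exp_of_nat_mult)

lemma of_nat_mult_in_uhp: "1 \<le> w \<Longrightarrow> t \<in> uhp \<Longrightarrow> of_nat w * t \<in> uhp"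
  by simp

text \<open>The Eisenstein series over the positive half of the lattice: row 0 gives the zeta value,
  row w >= 1 the function \<open>tangent x\<close> at w \<tau>. For even x >= 4 it is half of
  \<open>Eis x\<close>.\<close>

definition semi_eis :: "nat \<Rightarrow> complex \<Rightarrow> complex" where
  "semi_eis x \<tau> = zt x + (\<Sum>\<^sub>\<infinity>w\<in>{1..}. tangent x (of_nat w * \<tau>))"

lemma semi_eis_fourier:
  assumes "x \<ge> 2"
  shows "has_fourier_expansion (semi_eis x)
    (\<lambda>n. if n = 0 then zt x else (- 2 * of_real pi * \<i>) ^ x / fact (x - 1) * of_nat (\<Sum>d | d dvd n. d ^ (x - 1)))"
  unfolding has_fourier_expansion_def
proof
  fix \<tau> assume t: "\<tau> \<in> uhp"
  let ?q = "to_q \<tau>" and ?A = "(- 2 * of_real pi * \<i>) ^ x / fact (x - 1) :: complex"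
  let ?F = "\<lambda>(w, d). of_nat d ^ (x - 1) * ?q ^ (w * d)"
  let ?D = "SIGMA n:{1..}. {d. d dvd n} :: (nat \<times> nat) set"
  let ?H = "\<lambda>(n, d). of_nat d ^ (x - 1) * ?q ^ n"
  have s: "?F summable_on {1..} \<times> {1..}" by (rule abs_summable_summable[OF q_double_sum_summable[OF norm_to_q_less_1[OF t]]])
  have bij: "bij_betw (\<lambda>(w, d). (w * d, d)) ({1..} \<times> {1..}) ?D"
    by (rule bij_betwI[where g = "\<lambda>(n, d). (n div d, d)"]) (auto simp: Suc_le_eq dvd_pos_nat dvd_div_eq_0_iff elim: dvdE)
  have "(\<Sum>\<^sub>\<infinity>w\<in>{1..}. tangent x (of_nat w * \<tau>)) = (\<Sum>\<^sub>\<infinity>w\<in>{1..}. ?A * (\<Sum>\<^sub>\<infinity>d\<in>{1..}. ?F (w, d)))"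
    using assms t by (intro infsum_cong) (simp add: tangent_qsum[OF _ of_nat_mult_in_uhp] qsum_def to_q_mult_of_nat power_mult)
  also have "\<dots> = ?A * infsum ?F ({1..} \<times> {1..})"
    unfolding infsum_cmult_right' using infsum_Sigma'_banach[OF s] by simp
  also have "infsum ?F ({1..} \<times> {1..}) = infsum ?H ?D"
    unfolding infsum_reindex_bij_betw[OF bij, symmetric] by (intro infsum_cong) auto
  finally have 1: "(\<Sum>\<^sub>\<infinity>w\<in>{1..}. tangent x (of_nat w * \<tau>)) = ?A * infsum ?H ?D" .
  have sH: "?H summable_on ?D"
    unfolding summable_on_reindex_bij_betw[OF bij, symmetric] by (rule summable_on_cong[THEN iffD1, OF _ s]) auto
  have "((\<lambda>n. \<Sum>d | d dvd n. of_nat d ^ (x - 1) * ?q ^ n) has_sum infsum ?H ?D) {1..}"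
    by (rule has_sum_SigmaD[OF has_sum_infsum[OF sH]]) (auto intro!: has_sum_finite simp: finite_divisors_nat)
  from has_sum_cmult_right[OF this, of ?A]
  have "((\<lambda>n. ?A * of_nat (\<Sum>d | d dvd n. d ^ (x - 1)) * ?q ^ n) has_sum (?A * infsum ?H ?D)) {1..}"
    by (simp add: mult.assoc flip: sum_distrib_right)
  then have "((\<lambda>n. if n = 0 then 0 else ?A * of_nat (\<Sum>d | d dvd n. d ^ (x - 1)) * ?q ^ n) has_sum (?A * infsum ?H ?D)) UNIV"
    by (rule has_sum_cong_neutral[THEN iffD1, rotated -1]) auto
  from has_sum_imp_sums[OF this] sums_single[of 0 "\<lambda>_. zt x"]
  have "(\<lambda>n. (if n = 0 then zt x else 0) + (if n = 0 then 0 else ?A * of_nat (\<Sum>d | d dvd n. d ^ (x - 1)) * ?q ^ n)) sums (zt x + ?A * infsum ?H ?D)"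
    by (intro sums_add) auto
  also have "(\<lambda>n. (if n = 0 then zt x else 0) + (if n = 0 then 0 else ?A * of_nat (\<Sum>d | d dvd n. d ^ (x - 1)) * ?q ^ n))
      = (\<lambda>n. (if n = 0 then zt x else ?A * of_nat (\<Sum>d | d dvd n. d ^ (x - 1))) * ?q ^ n)" by auto
  finally show "(\<lambda>n. (if n = 0 then zt x else ?A * of_nat (\<Sum>d | d dvd n. d ^ (x - 1))) * ?q ^ n) sums semi_eis x \<tau>"
    by (simp only: semi_eis_def 1)
qed

lemma Eis_eq_semi_eis:
  assumes n: "even n" "n \<ge> 4" and t: "\<tau> \<in> uhp"
  shows "Eis n \<tau> = 2 * semi_eis n \<tau>"
proof -
  let ?f = "\<lambda>v. 1 / lat \<tau> v ^ n"
  let ?Z = "Pair 0 ` nonzero_ints" and ?P = "{0<..} \<times> UNIV :: (int \<times> int) set" and ?M = "{..<0} \<times> UNIV :: (int \<times> int) set"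
  have s: "?f summable_on S" if "S \<subseteq> nonzero" for S
    by (rule summable_on_subset_banach[OF abs_summable_summable[OF Eis_summable[OF t]] that]) (use n in simp)
  have sub: "?Z \<subseteq> nonzero" "?P \<subseteq> nonzero" "?M \<subseteq> nonzero" by (auto simp: zero_prod_def)
  have "Eis n \<tau> = infsum ?f ((?Z \<union> ?P) \<union> ?M)" unfolding Eis_def
    by (rule arg_cong[where f = "infsum _"]) (auto simp: zero_prod_def image_iff)
  also have "\<dots> = infsum ?f ?Z + infsum ?f ?P + infsum ?f ?M"
  proof -
    have "(?Z \<union> ?P) \<inter> ?M = {}" "?Z \<inter> ?P = {}" by auto
    then show ?thesis using infsum_Un_disjoint[OF s s, of "?Z \<union> ?P" ?M] infsum_Un_disjoint[OF s s, of ?Z ?P] sub by simp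
  qed
  also have "infsum ?f ?Z = inv_sum nonzero_ints n 0"
    by (subst infsum_reindex) (auto simp: inj_on_def inv_sum_def lat_def comp_def)
  also have "inv_sum nonzero_ints n 0 = 2 * zt n" using n by (simp add: inv_sum_nonzero_ints_0)
  also have "infsum ?f ?M = infsum ?f ?P"
  proof -
    have bij: "bij_betw uminus ?P ?M" by (rule bij_betwI[where g = uminus]) auto
    have "lat \<tau> (- v) = - lat \<tau> v" for v by (simp add: lat_def)
    then show ?thesis unfolding infsum_reindex_bij_betw[OF bij, symmetric] using n by simp
  qed
  also have "infsum ?f ?P = (\<Sum>\<^sub>\<infinity>w\<in>{1..}. tangent n (of_nat w * \<tau>))"
  proof -
    have bij: "bij_betw (\<lambda>(w, b). (int w, b)) ({1..} \<times> UNIV) ?P" by (rule bij_betwI[where g = "\<lambda>(a, b). (nat a, b)"]) auto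
    let ?g = "\<lambda>(w, b). 1 / (of_nat w * \<tau> + of_int b) ^ n"
    have e: "?f (case p of (w, b) \<Rightarrow> (int w, b)) = ?g p" for p by (cases p) (simp add: lat_def)
    have "?g summable_on {1..} \<times> UNIV" using s[OF sub(2)] unfolding summable_on_reindex_bij_betw[OF bij, symmetric] e .
    from infsum_Sigma'_banach[OF this] have "infsum ?g ({1..} \<times> UNIV) = (\<Sum>\<^sub>\<infinity>w\<in>{1..}. inv_sum UNIV n (of_nat w * \<tau>))"
      by (simp add: inv_sum_def)
    also have "\<dots> = (\<Sum>\<^sub>\<infinity>w\<in>{1..}. tangent n (of_nat w * \<tau>))"
      by (intro infsum_cong tangent_eq_inv_sum[symmetric] of_nat_mult_in_uhp) (use n t in auto)
    finally show ?thesis unfolding infsum_reindex_bij_betw[OF bij, symmetric] e .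
  qed
  finally show ?thesis by (simp add: semi_eis_def)
qed

lemma tangent_fourier:
  assumes "x \<ge> 2" shows "has_fourier_expansion (tangent x) (\<lambda>d. (- 2 * of_real pi * \<i>) ^ x / fact (x - 1) * of_nat d ^ (x - 1))"
  unfolding has_fourier_expansion_def
proof
  fix t assume t: "t \<in> uhp"
  have "((\<lambda>d. of_nat d ^ (x - 1) * to_q t ^ d) has_sum qsum (x - 1) t) {1..}"
    unfolding qsum_def by (rule has_sum_infsum[OF abs_summable_summable[OF qsum_summable[OF t]]])
  then have "((\<lambda>d. of_nat d ^ (x - 1) * to_q t ^ d) has_sum qsum (x - 1) t) UNIV"
    by (rule has_sum_cong_neutral[THEN iffD1, rotated -1]) (use assms in \<open>auto simp: power_0_left not_le Suc_le_eq\<close>)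
  from sums_mult[OF has_sum_imp_sums[OF this], of "(- 2 * of_real pi * \<i>) ^ x / fact (x - 1)"]
  show "(\<lambda>d. (- 2 * of_real pi * \<i>) ^ x / fact (x - 1) * of_nat d ^ (x - 1) * to_q t ^ d) sums tangent x t"
    by (simp add: tangent_qsum[OF assms t] mult.assoc)
qed

text \<open>Comparing the coefficients of \<open>q\<close> in \<open>tangent_product2\<close> with \<open>x = 2\<close> gives a recursion for the even zeta values.\<close>

lemma zt_even_rational: "even s \<Longrightarrow> s \<ge> 2 \<Longrightarrow> zt s / (2 * of_real pi * \<i>) ^ s \<in> \<rat>"
proof (induction s rule: less_induct)
  case (less y)
  define p :: complex where "p = 2 * of_real pi * \<i>"
  have p: "p \<noteq> 0" by (simp add: p_def)
  define A where "A x = (- p) ^ x / fact (x - 1)" for x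
  define R where "R x = zpos x + zneg x" for x
  have T: "has_fourier_expansion (tangent x) (\<lambda>d. A x * of_nat d ^ (x - 1))" if "x \<ge> 2" for x
    using tangent_fourier[OF that] by (simp add: A_def p_def)
  have pp: "has_fourier_expansion (pp_tangent c x) (\<lambda>d. \<Sum>i<x - 1. c $ i * (A (x - i) * of_nat d ^ (x - i - 1)))" for c x
    unfolding pp_tangent_def by (rule fourier_linear_combination) (auto simp del: diff_diff_left intro: T[unfolded One_nat_def])
  have F1: "has_fourier_expansion (\<lambda>t. tangent 2 t * tangent y t - 1 * tangent (2 + y) t)
     (\<lambda>d. (\<Sum>i\<le>d. (A 2 * of_nat i ^ (2 - 1)) * (A y * of_nat (d - i) ^ (y - 1))) - 1 * (A (2 + y) * of_nat d ^ (2 + y - 1)))"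
    using less.prems by (intro fourier_diff_cmult fourier_mult T) auto
  have F2: "has_fourier_expansion (\<lambda>t. pp_tangent (R y) 2 t - (- 1) * pp_tangent (R 2) y t)
     (\<lambda>d. (\<Sum>i<2 - 1. R y $ i * (A (2 - i) * of_nat d ^ (2 - i - 1))) - (- 1) * (\<Sum>i<y - 1. R 2 $ i * (A (y - i) * of_nat d ^ (y - i - 1))))"
    by (intro fourier_diff_cmult pp)
  have "(\<lambda>t. tangent 2 t * tangent y t - 1 * tangent (2 + y) t) = (\<lambda>t. pp_tangent (R y) 2 t - (- 1) * pp_tangent (R 2) y t)"
    using tangent_product2[of 2 y] less.prems by (simp add: fun_eq_iff R_def)
  \<comment> \<open>In the coefficient of q the product of the two series drops out, since neither
    has a constant term.\<close>
  from fun_cong[OF fourier_unique[OF F1[unfolded this] F2], of 1]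
  have eq: "- A (2 + y) = R y $ 0 * A 2 + (\<Sum>i<y - 1. R 2 $ i * A (y - i))"
    using less.prems by (simp add: power_0_left)
  have R0: "R y $ 0 = 2 * zt y" using less.prems by (simp add: R_def zneg_nth) (simp add: zpos_def)
  have R2: "R 2 $ i * A (y - i) / p ^ (y + 2) = (if even i then 2 * of_nat (i + 1) * (zt (2 + i) / p ^ (2 + i)) / fact (y - i - 1) else 0)" if "i < y - 1" for i
  proof (cases "even i")
    case True
    have "(- 2 gchoose i) = (of_nat (i + 1) :: complex)"
      using True gbinomial_minus[of "2 :: complex" i] binomial_gbinomial[of "i + 1" i, where 'a = complex] by (simp add: add.commute)
    then have "R 2 $ i = 2 * of_nat (i + 1) * zt (2 + i)" using True by (simp add: R_def zneg_nth) (simp add: zpos_def)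
    moreover have "p ^ (y + 2) = p ^ (y - i) * p ^ (2 + i)" using that by (simp flip: power_add)
    moreover have "(- p) ^ (y - i) = p ^ (y - i)" using True less.prems that by simp
    ultimately show ?thesis using True p by (simp add: A_def)
  qed (simp add: R_def zneg_nth)
  obtain n where n: "y - 1 = Suc n" "n = y - 2" using less.prems by (cases "y - 1") auto
  have even: "even n" using n less.prems by simp
  let ?r = "\<lambda>i. if even i then 2 * of_nat (i + 1) * (zt (2 + i) / p ^ (2 + i)) / fact (y - i - 1) else 0 :: complex"
  have fact: "(fact j :: complex) \<in> \<rat>" for j using Rats_of_nat[of "fact j"] by simp
  have "(\<Sum>i<n. ?r i) \<in> \<rat>"
  proof (rule Rats_sum)
    fix i assume i: "i \<in> {..<n}"
    have "zt (2 + i) / p ^ (2 + i) \<in> \<rat>" if "even i" unfolding p_def by (rule less.IH) (use i n that in auto)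
    moreover have "2 * of_nat (i + 1) * c / fact (y - i - 1) \<in> \<rat>" if "c \<in> \<rat>" for c :: complex
      by (intro Rats_divide Rats_mult that fact Rats_of_nat Rats_number_of)
    ultimately show "?r i \<in> \<rat>" by (cases "even i") (simp_all only: if_True if_False Rats_0 simp_thms)
  qed
  have "- (1 / fact (y + 1)) = - A (2 + y) / p ^ (y + 2)" using p less.prems by (simp add: A_def add.commute)
  also have "\<dots> = R y $ 0 * A 2 / p ^ (y + 2) + (\<Sum>i<y - 1. R 2 $ i * A (y - i) / p ^ (y + 2))"
    unfolding eq by (simp add: add_divide_distrib sum_divide_distrib)
  also have "R y $ 0 * A 2 / p ^ (y + 2) = 2 * (zt y / p ^ y)" using p by (simp add: R0 A_def power_add power2_eq_square)
  also have "(\<Sum>i<y - 1. R 2 $ i * A (y - i) / p ^ (y + 2)) = (\<Sum>i<y - 1. ?r i)" by (intro sum.cong R2) auto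
  \<comment> \<open>The last index i = y - 2 brings in \<open>zt y\<close> again, with factor 2 (y -
    1). Together with the 2 from \<open>R y $ 0\<close> the unknown gets the nonzero coefficient 2
    y; the other zeta values have smaller argument.\<close>
  also have "\<dots> = (\<Sum>i<n. ?r i) + 2 * of_nat (y - 1) * (zt y / p ^ y)"
  proof -
    have "2 + n = y" "n + 1 = y - 1" "y - n - 1 = 1" using n less.prems by auto
    then show ?thesis using even unfolding n(1) by simp
  qed
  finally have "2 * of_nat y * (zt y / p ^ y) = - (1 / fact (y + 1)) - (\<Sum>i<n. ?r i)"
    using less.prems by (simp add: of_nat_diff algebra_simps)
  also have "\<dots> \<in> \<rat>" using \<open>(\<Sum>i<n. ?r i) \<in> \<rat>\<close> 
    by (intro Rats_diff Rats_minus_iff[THEN iffD2] Rats_divide Rats_1 fact)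
  finally have "(2 * of_nat y * (zt y / p ^ y)) / (2 * of_nat y) \<in> \<rat>" by (rule Rats_divide) (intro Rats_mult Rats_of_nat Rats_number_of)
  then show ?case using less.prems by (simp add: p_def)
qed

lemma semi_eis_rational:
  assumes "even x" "x \<ge> 2"
  obtains b :: "nat \<Rightarrow> rat" where "has_fourier_expansion (\<lambda>\<tau>. semi_eis x \<tau> / (2 * of_real pi * \<i>) ^ x) (\<lambda>n. of_rat (b n))"
proof -
  let ?p = "2 * of_real pi * \<i> :: complex"
  obtain z :: rat where z: "zt x / ?p ^ x = of_rat z" using zt_even_rational[OF assms] by (auto elim: Rats_cases)
  define b where "b n = (if n = 0 then z else of_nat (\<Sum>d | d dvd n. d ^ (x - 1)) / of_nat (fact (x - 1)))" for n
  let ?a = "\<lambda>n. if n = 0 then zt x else (- 2 * of_real pi * \<i>) ^ x / fact (x - 1) * of_nat (\<Sum>d | d dvd n. d ^ (x - 1)) :: complex"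
  have "?a n / ?p ^ x = of_rat (b n)" for n
    using assms by (auto simp: b_def of_rat_divide z simp del: of_nat_sum of_nat_fact) simp
  moreover have "has_fourier_expansion (\<lambda>\<tau>. semi_eis x \<tau> / ?p ^ x) (\<lambda>n. ?a n / ?p ^ x)"
    unfolding has_fourier_expansion_def
  proof
    fix \<tau> assume "\<tau> \<in> uhp"
    then have "(\<lambda>n. ?a n * to_q \<tau> ^ n) sums semi_eis x \<tau>" using semi_eis_fourier[OF assms(2)] by (simp add: has_fourier_expansion_def)
    from sums_divide[OF this, of "?p ^ x"] show "(\<lambda>n. ?a n / ?p ^ x * to_q \<tau> ^ n) sums (semi_eis x \<tau> / ?p ^ x)" by simp
  qed
  ultimately show ?thesis using that[of b] by simp
qed

section \<open>Goncharov's coproduct of a word\<close>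

text \<open>The sum over the sets of kept letters, decided letter by letter: \<open>a\<close> is the last kept
  letter, \<open>s\<close> the letters dropped since, \<open>u\<close> the word of kept letters.\<close>

primrec cop :: "(letter \<Rightarrow> letter list \<Rightarrow> letter \<Rightarrow> complex) \<Rightarrow> (letter list \<Rightarrow> complex) \<Rightarrow>
    letter list \<Rightarrow> letter \<Rightarrow> letter list \<Rightarrow> letter list \<Rightarrow> complex" where
  "cop I F [] a s u = I a s L1 * F u"
| "cop I F (b # w) a s u = cop I F w a (s @ [b]) u + I a s b * cop I F w b [] (u @ [b])"

text \<open>The induction runs over the first undecided position \<open>q\<close>, with
  \<open>p0\<close> the last kept one: sets without q lengthen the dropped segment, sets with q
  close it and contribute one factor \<open>I\<close>.\<close>

lemma sum_over_kept_sets: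
  fixes a :: "letter list" and I F
  assumes aN: "a ! Suc N = L1"
  defines "T \<equiv> \<lambda>p0 u P. (\<Prod>j\<le>card P. let p = p0 # sorted_list_of_set P @ [N + 1] in
      I (a ! (p ! j)) (map ((!) a) [Suc (p ! j)..<p ! Suc j]) (a ! (p ! Suc j)))
      * F (u @ map ((!) a) (sorted_list_of_set P))"
  assumes "p0 < q" "q \<le> Suc N"
  shows "(\<Sum>P\<in>Pow {q..N}. T p0 u P) = cop I F (map ((!) a) [q..<Suc N]) (a ! p0) (map ((!) a) [Suc p0..<q]) u"
  using assms(3,4)
proof (induction "Suc N - q" arbitrary: p0 q u)
  case 0
  then have "q = Suc N" by simp
  then show ?case using aN by (simp add: T_def)
next
  case (Suc n)
  then have q: "q \<le> N" "n = Suc N - Suc q" by auto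
  have ins: "{q..N} = insert q {Suc q..N}" using q by auto
  have inj: "inj_on (insert q) (Pow {Suc q..N})" by (rule inj_onI) (metis Diff_insert_absorb PowD atLeastAtMost_iff not_less_eq_eq order_refl subsetD)
  have "(\<Sum>P\<in>Pow {q..N}. T p0 u P) = (\<Sum>P\<in>Pow {Suc q..N}. T p0 u P) + (\<Sum>P\<in>Pow {Suc q..N}. T p0 u (insert q P))"
    unfolding ins Pow_insert by (subst sum.union_disjoint) (auto simp: sum.reindex[OF inj] comp_def)
  also have "(\<Sum>P\<in>Pow {Suc q..N}. T p0 u P) = cop I F (map ((!) a) [Suc q..<Suc N]) (a ! p0) (map ((!) a) [Suc p0..<Suc q]) u"
    by (rule Suc.hyps(1)) (use q Suc.prems in auto)
  also have "(\<Sum>P\<in>Pow {Suc q..N}. T p0 u (insert q P))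
      = (\<Sum>P\<in>Pow {Suc q..N}. I (a ! p0) (map ((!) a) [Suc p0..<q]) (a ! q) * T q (u @ [a ! q]) P)"
  proof (intro sum.cong refl)
    fix P assume "P \<in> Pow {Suc q..N}"
    then have P: "P \<subseteq> {Suc q..N}" "finite P" "q \<notin> P" using finite_subset by auto
    have "sorted_list_of_set (insert q P) = insort q (sorted_list_of_set P)" using P by simp
    also have "\<dots> = q # sorted_list_of_set P" using P by (intro insort_is_Cons) auto
    finally have l: "sorted_list_of_set (insert q P) = q # sorted_list_of_set P" .
    show "T p0 u (insert q P) = I (a ! p0) (map ((!) a) [Suc p0..<q]) (a ! q) * T q (u @ [a ! q]) P"
      using P unfolding T_def l by (simp add: Let_def prod.atMost_Suc_shift del: prod.atMost_Suc)
  qed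
  also have "\<dots> = I (a ! p0) (map ((!) a) [Suc p0..<q]) (a ! q) * cop I F (map ((!) a) [Suc q..<Suc N]) (a ! q) (map ((!) a) [Suc q..<Suc q]) (u @ [a ! q])"
    unfolding sum_distrib_left[symmetric] by (intro arg_cong2[where f = "(*)"] refl Suc.hyps(1)) (use q in auto)
  also have "[Suc p0..<Suc q] = [Suc p0..<q] @ [q]" using Suc.prems by simp
  also have "cop I F (map ((!) a) [Suc q..<Suc N]) (a ! p0) (map ((!) a) ([Suc p0..<q] @ [q])) u
      + I (a ! p0) (map ((!) a) [Suc p0..<q]) (a ! q) * cop I F (map ((!) a) [Suc q..<Suc N]) (a ! q) (map ((!) a) [Suc q..<Suc q]) (u @ [a ! q])
    = cop I F (map ((!) a) [q..<Suc N]) (a ! p0) (map ((!) a) [Suc p0..<q]) u"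
    using q by (simp add: upt_conv_Cons del: upt_Suc)
  finally show ?case .
qed

lemma eisenstein_sh_eq_cop:
  "eisenstein_sh \<tau> ks = cop (int_sym zeta_sh) (\<lambda>u. int_sym (g_sh \<tau>) L0 u L1) (word_of ks) L0 [] []"
proof -
  let ?w = "word_of ks"
  define a where "a = L0 # ?w @ [L1]"
  have a: "a ! Suc (length ?w) = L1" "a ! 0 = L0" by (simp_all add: a_def nth_append)
  have "map ((!) a) [1..<Suc (length ?w)] = ?w"
    by (rule nth_equalityI) (auto simp: a_def nth_append simp del: upt_Suc)
  then show ?thesis
    using sum_over_kept_sets[OF a(1), of 0 1 "int_sym zeta_sh" "\<lambda>u. int_sym (g_sh \<tau>) L0 u L1" "[]"] a(2)
    by (simp add: eisenstein_sh_def a_def[symmetric] Let_def del: upt_Suc)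
qed

section \<open>The coproduct on words of depth at most three\<close>

context
  fixes I :: "letter \<Rightarrow> letter list \<Rightarrow> letter \<Rightarrow> complex" and F :: "letter list \<Rightarrow> complex"
  assumes I_Nil: "I a [] b = 1" and I_same: "s \<noteq> [] \<Longrightarrow> I a s a = 0"
    and I_zeros: "n \<ge> 1 \<Longrightarrow> I a (replicate n L0) b = 0"
begin

abbreviation zs :: "nat \<Rightarrow> letter list" where "zs n \<equiv> replicate n L0"

text \<open>Once a letter has been dropped after a kept \<open>L0\<close>, keeping another
  \<open>L0\<close> would produce the factor I(0; s; 0) = 0, so the whole run of zeros is
  dropped.\<close>

lemma cop_L0_skip: "s \<noteq> [] \<Longrightarrow> cop I F (zs n @ v) L0 s u = cop I F v L0 (s @ zs n) u"
  by (induction n arbitrary: s) (simp_all add: I_same)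

text \<open>A run of zeros after a kept \<open>L0\<close> is kept up to some point and dropped from
  there on.\<close>

lemma cop_L0_zeros: "cop I F (zs n @ v) L0 [] u = (\<Sum>i\<le>n. cop I F v L0 (zs i) (u @ zs (n - i)))"
proof (induction n arbitrary: u)
  case (Suc n)
  have "cop I F (zs (Suc n) @ v) L0 [] u = cop I F v L0 (zs (Suc n)) u + cop I F (zs n @ v) L0 [] (u @ [L0])"
    using cop_L0_skip[of "[L0]" n v u] by (simp add: I_Nil)
  also have "cop I F (zs n @ v) L0 [] (u @ [L0]) = (\<Sum>i\<le>n. cop I F v L0 (zs i) (u @ zs (Suc n - i)))"
    unfolding Suc.IH by (intro sum.cong) (auto simp: Suc_diff_le)
  finally show ?case by simp
qed simp

lemma cop_L0_all_zeros: "cop I F (zs n) L0 [] u = F (u @ zs n)"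
proof -
  have "cop I F (zs n @ []) L0 [] u = (\<Sum>i\<le>n. I L0 (zs i) L1 * F (u @ zs (n - i)))" by (simp only: cop_L0_zeros cop.simps)
  also have "\<dots> = (\<Sum>i\<in>{0}. I L0 (zs i) L1 * F (u @ zs (n - i)))" by (rule sum.mono_neutral_right) (auto simp: I_zeros)
  finally show ?thesis by (simp add: I_Nil)
qed

text \<open>The sum is over the first zero that is kept; from then on the last kept letter is
  \<open>L0\<close>.\<close>

lemma cop_L1_zeros:
  "cop I F (zs n @ v) L1 s u = cop I F v L1 (s @ zs n) u + (\<Sum>i<n. I L1 (s @ zs i) L0 * cop I F (zs (n - 1 - i) @ v) L0 [] (u @ [L0]))"
proof (induction n arbitrary: s)
  case (Suc n)
  have "s @ [L0] @ zs i = s @ zs (Suc i)" for i by simp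
  then show ?case using Suc.IH[of "s @ [L0]"] by (simp add: sum.lessThan_Suc_shift del: sum.lessThan_Suc)
qed simp

lemma cop_L1_Nil_zeros: "n \<ge> 1 \<Longrightarrow> cop I F (zs n @ v) L1 [] u = cop I F v L1 (zs n) u + cop I F (zs (n - 1) @ v) L0 [] (u @ [L0])"
proof -
  assume "n \<ge> 1"
  then have "(\<Sum>i<n. I L1 (zs i) L0 * cop I F (zs (n - 1 - i) @ v) L0 [] (u @ [L0]))
      = (\<Sum>i\<in>{0}. I L1 (zs i) L0 * cop I F (zs (n - 1 - i) @ v) L0 [] (u @ [L0]))"
    by (intro sum.mono_neutral_right) (auto simp: I_zeros)
  then show ?thesis by (simp add: cop_L1_zeros[of n v "[]"] I_Nil)
qed

lemma cop_L1_all_zeros: "n \<ge> 1 \<Longrightarrow> cop I F (zs n) L1 [] u = F (u @ zs n)"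
  using cop_L1_Nil_zeros[of n "[]" u] cop_L0_all_zeros[of "n - 1" "u @ [L0]"] by (cases n) (simp_all add: I_same)

lemma cop_L1_last_zeros: "s \<noteq> [] \<Longrightarrow> cop I F (zs n) L1 s u = (\<Sum>i<n. I L1 (s @ zs i) L0 * F (u @ zs (n - i)))"
proof -
  assume s: "s \<noteq> []"
  have "cop I F (zs n) L1 s u = (\<Sum>i<n. I L1 (s @ zs i) L0 * cop I F (zs (n - 1 - i)) L0 [] (u @ [L0]))"
    using cop_L1_zeros[of n "[]" s u] s by (simp add: I_same)
  also have "\<dots> = (\<Sum>i<n. I L1 (s @ zs i) L0 * F (u @ zs (n - i)))"
  proof (intro sum.cong refl)
    fix i assume "i \<in> {..<n}"
    then have "n - i = Suc (n - 1 - i)" by simp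
    then show "I L1 (s @ zs i) L0 * cop I F (zs (n - 1 - i)) L0 [] (u @ [L0]) = I L1 (s @ zs i) L0 * F (u @ zs (n - i))"
      by (simp only: cop_L0_all_zeros) simp
  qed
  finally show ?thesis .
qed

lemma cop_block_L0:
  assumes "b \<ge> 1"
  shows "cop I F (zs n @ L1 # zs b) L0 [] u = (\<Sum>i\<le>n. I L0 (zs i @ L1 # zs b) L1 * F (u @ zs (n - i))) + F (u @ zs n @ L1 # zs b)"
proof -
  have 1: "cop I F (L1 # zs b) L0 (zs i) U = I L0 (zs i @ L1 # zs b) L1 * F U + (if i = 0 then F (U @ L1 # zs b) else 0)" for i U
    using cop_L0_skip[of "zs i @ [L1]" b "[]" U] cop_L1_all_zeros[OF assms, of "U @ [L1]"] by (simp add: I_Nil I_zeros)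
  show ?thesis unfolding cop_L0_zeros 1 by (simp add: sum.distrib)
qed

lemma cop_block_L1:
  assumes "a \<ge> 1" "b \<ge> 1"
  shows "cop I F (zs a @ L1 # zs b) L1 [] u = (\<Sum>i<a. I L0 (zs i @ L1 # zs b) L1 * F (u @ zs (a - i)))
    + (\<Sum>i<b. I L1 (zs a @ L1 # zs i) L0 * F (u @ zs (b - i))) + F (u @ zs a @ L1 # zs b)"
proof -
  obtain n where n: "a = Suc n" using assms(1) by (cases a) auto
  have "cop I F (L1 # zs b) L1 (zs a) u = (\<Sum>i<b. I L1 (zs a @ L1 # zs i) L0 * F (u @ zs (b - i)))"
    using cop_L1_last_zeros[of "zs a @ [L1]" b u] assms(1) by (simp add: I_zeros)
  then show ?thesis
    using cop_L1_Nil_zeros[OF assms(1), of "L1 # zs b" u] cop_block_L0[OF assms(2), of n "u @ [L0]"]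
    by (simp add: n lessThan_Suc_atMost Suc_diff_le)
qed

lemma cop_two_blocks_L0:
  assumes "b \<ge> 1" "c \<ge> 1"
  shows "cop I F (zs n @ L1 # zs b @ L1 # zs c) L0 [] u
    = (\<Sum>i\<le>n. I L0 (zs i @ L1 # zs b @ L1 # zs c) L1 * F (u @ zs (n - i)))
    + (\<Sum>i\<le>n. I L0 (zs i @ L1 # zs b) L1 * F (u @ zs (n - i) @ L1 # zs c))
    + cop I F (zs b @ L1 # zs c) L1 [] (u @ zs n @ [L1])"
proof -
  have 1: "cop I F (L1 # zs b @ L1 # zs c) L0 (zs i) U = I L0 (zs i @ L1 # zs b @ L1 # zs c) L1 * F U
      + I L0 (zs i @ L1 # zs b) L1 * F (U @ L1 # zs c) + (if i = 0 then cop I F (zs b @ L1 # zs c) L1 [] (U @ [L1]) else 0)" for i U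
    using cop_L0_skip[of "zs i @ [L1]" b "L1 # zs c" U] cop_L0_skip[of "zs i @ L1 # zs b @ [L1]" c "[]" U]
      cop_L1_all_zeros[OF assms(2), of "U @ [L1]"] by (simp add: I_Nil I_zeros)
  show ?thesis unfolding cop_L0_zeros 1 by (simp add: sum.distrib)
qed

text \<open>The first three terms keep the first zero of the first block, the last two drop that
  block altogether; keeping only a later zero of it would give I of a run of zeros, which is 0. For
  zeta values the factors \<open>I\<close> become the coefficients of \<open>zpos2\<close>,
  \<open>zneg\<close> times \<open>zpos\<close> and \<open>zneg2\<close> in
  \<open>tritangent\<close>, and those of the ditangents.\<close>

lemma cop_two_blocks_L1:
  assumes "a \<ge> 1" "b \<ge> 1" "c \<ge> 1"
  shows "cop I F (zs a @ L1 # zs b @ L1 # zs c) L1 [] u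
    = (\<Sum>i<a. I L0 (zs i @ L1 # zs b @ L1 # zs c) L1 * F (u @ zs (a - i)))
    + (\<Sum>i<a. I L0 (zs i @ L1 # zs b) L1 * F (u @ zs (a - i) @ L1 # zs c))
    + cop I F (zs b @ L1 # zs c) L1 [] (u @ zs a @ [L1])
    + (\<Sum>s<b. I L1 (zs a @ L1 # zs s) L0 * ((\<Sum>i<b - s. I L0 (zs i @ L1 # zs c) L1 * F (u @ zs (b - s - i))) + F (u @ zs (b - s) @ L1 # zs c)))
    + (\<Sum>s<c. I L1 (zs a @ L1 # zs b @ L1 # zs s) L0 * F (u @ zs (c - s)))"
proof -
  obtain n where n: "a = Suc n" using assms(1) by (cases a) auto
  have 1: "cop I F (L1 # zs b @ L1 # zs c) L1 (zs a) u = cop I F (L1 # zs c) L1 (zs a @ L1 # zs b) u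
      + (\<Sum>s<b. I L1 (zs a @ L1 # zs s) L0 * cop I F (zs (b - 1 - s) @ L1 # zs c) L0 [] (u @ [L0]))"
    using cop_L1_zeros[of b "L1 # zs c" "zs a @ [L1]" u] assms(1) by (simp add: I_zeros)
  have 2: "cop I F (L1 # zs c) L1 (zs a @ L1 # zs b) u = (\<Sum>s<c. I L1 (zs a @ L1 # zs b @ L1 # zs s) L0 * F (u @ zs (c - s)))"
    using cop_L1_last_zeros[of "zs a @ L1 # zs b @ [L1]" c u] by (simp add: I_same)
  have 3: "(\<Sum>s<b. I L1 (zs a @ L1 # zs s) L0 * cop I F (zs (b - 1 - s) @ L1 # zs c) L0 [] (u @ [L0]))
    = (\<Sum>s<b. I L1 (zs a @ L1 # zs s) L0 * ((\<Sum>i<b - s. I L0 (zs i @ L1 # zs c) L1 * F (u @ zs (b - s - i))) + F (u @ zs (b - s) @ L1 # zs c)))"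
  proof (intro sum.cong refl)
    fix s assume s: "s \<in> {..<b}"
    define m where "m = b - 1 - s"
    have m: "b - s = Suc m" using s by (simp add: m_def)
    show "I L1 (zs a @ L1 # zs s) L0 * cop I F (zs (b - 1 - s) @ L1 # zs c) L0 [] (u @ [L0])
      = I L1 (zs a @ L1 # zs s) L0 * ((\<Sum>i<b - s. I L0 (zs i @ L1 # zs c) L1 * F (u @ zs (b - s - i))) + F (u @ zs (b - s) @ L1 # zs c))"
      unfolding m m_def[symmetric] cop_block_L0[OF assms(3)] by (simp add: lessThan_Suc_atMost Suc_diff_le)
  qed
  show ?thesis
    using cop_L1_Nil_zeros[OF assms(1), of "L1 # zs b @ L1 # zs c" u] cop_two_blocks_L0[OF assms(2,3), of n "u @ [L0]"]
    unfolding 1 2 3 by (simp add: n lessThan_Suc_atMost Suc_diff_le)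
qed

text \<open>Sorted by the first kept letter: none, or one of the three letters \<open>L1\<close>. A
  zero kept first would give the factor I(0; s; 0) = 0.\<close>

lemma cop_three_blocks:
  assumes "a \<ge> 1" "b \<ge> 1" "c \<ge> 1"
  shows "cop I F (L1 # zs a @ L1 # zs b @ L1 # zs c) L0 [] []
    = I L0 (L1 # zs a @ L1 # zs b @ L1 # zs c) L1 * F [] + I L0 (L1 # zs a @ L1 # zs b) L1 * F (L1 # zs c)
    + I L0 (L1 # zs a) L1 * cop I F (zs b @ L1 # zs c) L1 [] [L1] + cop I F (zs a @ L1 # zs b @ L1 # zs c) L1 [] [L1]"
  using cop_L0_skip[of "[L1]" a "L1 # zs b @ L1 # zs c" "[]"] cop_L0_skip[of "L1 # zs a @ [L1]" b "L1 # zs c" "[]"]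
    cop_L0_skip[of "L1 # zs a @ L1 # zs b @ [L1]" c "[]" "[]"] cop_L1_all_zeros[OF assms(3), of "[L1]"]
  by (simp add: I_Nil)

end

section \<open>Zeta values of words\<close>

lemma sum_shuffle_zeros: "(\<Sum>s\<leftarrow>shuffle_list (replicate m x) (replicate p x). G s) = of_nat ((m + p) choose m) * (G (replicate (m + p) x) :: complex)"
proof (induction m arbitrary: p G)
  case (Suc m)
  note IH = Suc.IH
  show ?case
  proof (induction p arbitrary: G)
    case 0
    then show ?case by (cases m) simp_all
  next
    case (Suc p)
    from IH[where p = "Suc p" and G = "\<lambda>s. G (x # s)"] Suc.IH[of "\<lambda>s. G (x # s)"]
    show ?case by (simp add: comp_def algebra_simps)
  qed
qed simp

text \<open>The index i counts the zeros shuffled into the run before \<open>L1\<close>; since the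
  letters are identical, they produce a binomial coefficient.\<close>

lemma sum_shuffle_zeros_one:
  fixes G :: "letter list \<Rightarrow> complex"
  shows "(\<Sum>s\<leftarrow>shuffle_list (replicate m L0) (replicate p L0 @ L1 # v). G s)
    = (\<Sum>i\<le>m. of_nat ((p + i) choose i) * (\<Sum>s\<leftarrow>shuffle_list (replicate (m - i) L0) v. G (replicate (p + i) L0 @ L1 # s)))"
proof (induction "m + p" arbitrary: m p G)
  case 0
  then show ?case by simp
next
  case (Suc n)
  let ?h = "\<lambda>G k j. (\<Sum>s\<leftarrow>shuffle_list (replicate k L0) v. G (replicate j L0 @ L1 # s))"
  show ?case
  proof (cases m)
    case 0
    then show ?thesis by simp
  next
    case (Suc m')
    show ?thesis
    proof (cases p)
      case 0
      have "(\<Sum>s\<leftarrow>shuffle_list (replicate m' L0) (replicate 0 L0 @ L1 # v). G (L0 # s)) = (\<Sum>i\<le>m'. of_nat ((0 + i) choose i) * ?h (\<lambda>s. G (L0 # s)) (m' - i) (0 + i))"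
        by (rule Suc.hyps(1)) (use Suc.hyps(2) Suc 0 in simp)
      then show ?thesis unfolding Suc 0 by (simp add: comp_def sum.atMost_Suc_shift del: sum.atMost_Suc)
    next
      case p: (Suc p')
      have 1: "(\<Sum>s\<leftarrow>shuffle_list (replicate m' L0) (replicate p L0 @ L1 # v). G (L0 # s)) = (\<Sum>i\<le>m'. of_nat ((p + i) choose i) * ?h (\<lambda>s. G (L0 # s)) (m' - i) (p + i))"
        by (rule Suc.hyps(1)) (use Suc.hyps(2) Suc in simp)
      have 2: "(\<Sum>s\<leftarrow>shuffle_list (replicate m L0) (replicate p' L0 @ L1 # v). G (L0 # s)) = (\<Sum>i\<le>m. of_nat ((p' + i) choose i) * ?h (\<lambda>s. G (L0 # s)) (m - i) (p' + i))"
        by (rule Suc.hyps(1)) (use Suc.hyps(2) Suc p in simp)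
      have "(\<Sum>s\<leftarrow>shuffle_list (replicate m L0) (replicate p L0 @ L1 # v). G s)
        = (\<Sum>i\<le>m'. of_nat ((p + i) choose i) * ?h G (m' - i) (Suc (p + i))) + (\<Sum>i\<le>m. of_nat ((p' + i) choose i) * ?h G (m - i) (Suc (p' + i)))"
        using 1 2 unfolding Suc p by (simp add: comp_def)
      also have "(\<Sum>i\<le>m'. of_nat ((p + i) choose i) * ?h G (m' - i) (Suc (p + i))) = (\<Sum>i\<le>m. of_nat (if i = 0 then 0 else (p' + i) choose (i - 1)) * ?h G (m - i) (p + i))"
        unfolding Suc by (simp add: sum.atMost_Suc_shift p del: sum.atMost_Suc)
      also have "\<dots> + (\<Sum>i\<le>m. of_nat ((p' + i) choose i) * ?h G (m - i) (Suc (p' + i)))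
        = (\<Sum>i\<le>m. of_nat ((p + i) choose i) * ?h G (m - i) (p + i))"
        unfolding sum.distrib[symmetric]
      proof (intro sum.cong refl)
        fix i
        have "(p + i) choose i = (if i = 0 then 0 else (p' + i) choose (i - 1)) + ((p' + i) choose i)" by (cases i) (simp_all add: p)
        then show "of_nat (if i = 0 then 0 else (p' + i) choose (i - 1)) * ?h G (m - i) (p + i) + of_nat ((p' + i) choose i) * ?h G (m - i) (Suc (p' + i))
            = of_nat ((p + i) choose i) * ?h G (m - i) (p + i)"
          by (simp only: of_nat_add distrib_right p add_Suc)
      qed
      finally show ?thesis .
    qed
  qed
qed

lemma takeWhile_zs [simp]: "takeWhile (\<lambda>x. x = L0) (replicate n L0 @ L1 # v) = replicate n L0"
  "dropWhile (\<lambda>x. x = L0) (replicate n L0 @ L1 # v) = L1 # v"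
  by (induction n) auto

lemma takeWhile_zs' [simp]: "takeWhile (\<lambda>x. x = L0) (replicate n L0) = replicate n L0" "dropWhile (\<lambda>x. x = L0) (replicate n L0) = []"
  by (induction n) auto

lemma index_of_blocks:
  "index_of (L1 # replicate a L0) = [Suc a]"
  "index_of (L1 # replicate a L0 @ L1 # w) = Suc a # index_of (L1 # w)"
  by simp_all

lemma index_of_word_of: "0 \<notin> set ks \<Longrightarrow> index_of (word_of ks) = ks"
proof (induction ks)
  case (Cons k ks)
  have "word_of ks = [] \<or> (\<exists>v. word_of ks = L1 # v)" by (cases ks) (auto simp: word_of_def)
  then have "takeWhile (\<lambda>x. x = L0) (replicate (k - 1) L0 @ word_of ks) = replicate (k - 1) L0"
    "dropWhile (\<lambda>x. x = L0) (replicate (k - 1) L0 @ word_of ks) = word_of ks" by auto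
  moreover have "word_of (k # ks) = L1 # replicate (k - 1) L0 @ word_of ks" by (simp add: word_of_def)
  ultimately show ?case using Cons by simp
qed (simp add: word_of_def)

lemma zeta_sh_eq_mzv:
  assumes "0 \<notin> set ks" "ks \<noteq> []" "last ks \<ge> 2" shows "zeta_sh ks = mzv ks"
proof -
  obtain js k where ks: "ks = js @ [k]" using assms(2) by (cases ks rule: rev_cases) auto
  obtain n where k: "k - 1 = Suc n" using assms(3) by (cases "k - 1") (auto simp: ks)
  define w where "w = word_of js @ L1 # replicate n L0"
  have w: "word_of ks = w @ [L0]" by (simp add: word_of_def ks k w_def replicate_append_same del: One_nat_def)
  have "shuffle_list w [] = [w]" by (cases w) auto
  then have "zeta_sh ks = mzv (index_of (w @ [L0]))" unfolding zeta_sh_def w by simp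
  then show ?thesis using index_of_word_of[OF assms(1)] w by simp
qed

lemma chains_1: "chains (Suc 0) = (\<lambda>d. [d]) ` {1..}"
  by (auto simp: chains_def length_Suc_conv image_iff)

lemma chains_2: "chains 2 = (\<lambda>(m, n). [m, n]) ` {(m, n). 0 < m \<and> m < n}"
  by (auto simp: chains_def numeral_2_eq_2 length_Suc_conv image_iff)

lemma mzv_1: "mzv [s] = zt s"
  unfolding mzv_def zt_def by (simp add: chains_1 infsum_reindex inj_on_def comp_def)

lemma mzv_2: "mzv [s, t] = zt2 s t"
proof -
  have "mzv [s, t] = infsum (\<lambda>ms. 1 / of_nat (ms ! 0) ^ s * (1 / of_nat (ms ! 1) ^ t)) (chains 2)"
    by (simp add: mzv_def numeral_2_eq_2 lessThan_Suc mult.commute)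
  also have "\<dots> = zt2 s t" unfolding chains_2 zt2_def
    by (subst infsum_reindex) (auto simp: inj_on_def comp_def case_prod_unfold)
  finally show ?thesis .
qed

lemma neg_gchoose: "(- of_nat (Suc p) gchoose i :: complex) = (-1) ^ i * of_nat ((p + i) choose i)"
  using gbinomial_minus[of "of_nat (Suc p) :: complex" i] by (simp add: binomial_gbinomial add_ac)

lemma int_word_L1: "int_word F (L1 # u) = F (index_of (L1 # u))"
  by (simp add: int_word_def del: index_of.simps)

lemma int_word_zeros: "n \<ge> 1 \<Longrightarrow> int_word F (replicate n L0) = 0"
  by (simp add: int_word_def)

text \<open>Shuffling the n leading zeros into the block gives (-1)^n times a binomial coefficient,
  which is the Taylor coefficient of a negative power of t + m: here the coproduct meets the partial
  fractions.\<close>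

lemma int_word_one:
  assumes "b \<ge> 1" shows "int_word zeta_sh (replicate n L0 @ L1 # replicate b L0) = zpos (Suc b) $ n"
proof -
  have "int_word zeta_sh (replicate n L0 @ L1 # replicate b L0) = (-1) ^ n * (of_nat ((n + b) choose n) * zeta_sh [Suc (n + b)])"
    using sum_shuffle_zeros[where G = "\<lambda>s. zeta_sh (index_of (L1 # s))" and m = n and x = L0 and p = b] by (simp add: int_word_def)
  then show ?thesis using assms by (simp add: zeta_sh_eq_mzv mzv_1 zpos_def neg_gchoose add_ac del: of_nat_Suc)
qed

lemma int_word_two:
  assumes "b \<ge> 1" "c \<ge> 1" shows "int_word zeta_sh (replicate n L0 @ L1 # replicate b L0 @ L1 # replicate c L0) = zpos2 (Suc b) (Suc c) $ n"
proof -
  have "int_word zeta_sh (replicate n L0 @ L1 # replicate b L0 @ L1 # replicate c L0)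
    = (-1) ^ n * (\<Sum>i\<le>n. of_nat ((b + i) choose i) * (of_nat ((n - i + c) choose (n - i)) * zeta_sh [Suc (b + i), Suc (n - i + c)]))"
    unfolding int_word_def
    by (simp add: sum_shuffle_zeros_one[of "\<lambda>s. zeta_sh (index_of (L1 # s))" n b "replicate c L0"]
        sum_shuffle_zeros index_of_blocks del: index_of.simps)
  also have "\<dots> = zpos2 (Suc b) (Suc c) $ n"
    unfolding zpos2_def fps_nth_Abs_fps sum_distrib_left
  proof (intro sum.cong refl)
    fix i assume "i \<in> {..n}"
    then have "(-1) ^ n = (-1) ^ i * ((-1) ^ (n - i) :: complex)" by (simp flip: power_add)
    then show "(-1) ^ n * (of_nat ((b + i) choose i) * (of_nat ((n - i + c) choose (n - i)) * zeta_sh [Suc (b + i), Suc (n - i + c)]))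
      = (- of_nat (Suc b) gchoose i) * (- of_nat (Suc c) gchoose (n - i)) * zt2 (Suc b + i) (Suc c + (n - i))"
      using assms by (simp add: zeta_sh_eq_mzv mzv_2 neg_gchoose add_ac del: of_nat_Suc)
  qed
  finally show ?thesis .
qed

lemma int_word_three:
  assumes "a \<ge> 1" "b \<ge> 1" "c \<ge> 1"
  shows "int_word zeta_sh (L1 # replicate a L0 @ L1 # replicate b L0 @ L1 # replicate c L0) = mzv [Suc a, Suc b, Suc c]"
  using assms by (simp add: int_word_L1 index_of_blocks zeta_sh_eq_mzv del: index_of.simps)

lemma int_sym_zeta:
  assumes "b \<ge> 1"
  shows "int_sym zeta_sh L0 (replicate n L0 @ L1 # replicate b L0) L1 = zpos (Suc b) $ n"
    and "int_sym zeta_sh L1 (replicate b L0 @ L1 # replicate n L0) L0 = zneg (Suc b) $ n"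
  using int_word_one[OF assms, of n] by (simp_all add: int_sym_def zneg_nth add_ac)

lemma int_sym_zeta2:
  assumes "b \<ge> 1" "c \<ge> 1"
  shows "int_sym zeta_sh L0 (replicate n L0 @ L1 # replicate b L0 @ L1 # replicate c L0) L1 = zpos2 (Suc b) (Suc c) $ n"
    and "int_sym zeta_sh L1 (replicate b L0 @ L1 # replicate c L0 @ L1 # replicate n L0) L0 = zneg2 (Suc b) (Suc c) $ n"
  using int_word_two[OF assms, of n] int_word_two[OF assms(2,1), of n] by (simp_all add: int_sym_def zneg2_def add_ac)

section \<open>Ordered sums\<close>

definition ordered2 :: "(nat \<times> nat) set" where "ordered2 = {(m, n). 0 < m \<and> m < n}"

definition ordered3 :: "(nat \<times> nat \<times> nat) set" where "ordered3 = {(l, m, n). 0 < l \<and> l < m \<and> m < n}"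

definition osum2 :: "(nat \<Rightarrow> complex) \<Rightarrow> (nat \<Rightarrow> complex) \<Rightarrow> complex" where
  "osum2 f g = (\<Sum>\<^sub>\<infinity>(m, n)\<in>ordered2. f m * g n)"

definition osum3 :: "(nat \<Rightarrow> complex) \<Rightarrow> (nat \<Rightarrow> complex) \<Rightarrow> (nat \<Rightarrow> complex) \<Rightarrow> complex" where
  "osum3 f g h = (\<Sum>\<^sub>\<infinity>(l, m, n)\<in>ordered3. f l * (g m * h n))"

abbreviation abs1 :: "(nat \<Rightarrow> complex) \<Rightarrow> bool" where "abs1 f \<equiv> f abs_summable_on {1..}"

lemma osum2_summable:
  assumes "abs1 f" "abs1 g" "S \<subseteq> {1..} \<times> {1..}"
  shows "(\<lambda>(m, n). f m * g n) summable_on S" "(\<lambda>(m, n). f m * g n) abs_summable_on S"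
  using abs_summable_on_Times[OF assms(1,2)] abs_summable_summable[OF abs_summable_on_Times[OF assms(1,2)]] assms(3)
  by (auto intro: summable_on_subset_banach)

lemma osum3_summable:
  assumes "abs1 f" "abs1 g" "abs1 h" "S \<subseteq> {1..} \<times> {1..} \<times> {1..}"
  shows "(\<lambda>(l, m, n). f l * (g m * h n)) summable_on S"
proof -
  have "(\<lambda>(l, p). f l * (case p of (m, n) \<Rightarrow> g m * h n)) summable_on {1..} \<times> ({1..} \<times> {1..})"
    by (rule abs_summable_summable[OF abs_summable_on_Times[OF assms(1) abs_summable_on_Times[OF assms(2,3)]]])
  then have "(\<lambda>(l, m, n). f l * (g m * h n)) summable_on {1..} \<times> ({1..} \<times> {1..})"
    by (rule summable_on_cong[THEN iffD1, rotated]) auto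
  then show ?thesis by (rule summable_on_subset_banach) (rule assms(4))
qed

lemma abs1_mult: assumes "abs1 f" "abs1 g" shows "abs1 (\<lambda>n. f n * g n)"
proof -
  have "(\<lambda>(m, n). f m * g n) abs_summable_on (\<lambda>n. (n, n)) ` {1..}" by (rule osum2_summable(2)[OF assms]) auto
  then show ?thesis by (subst (asm) summable_on_reindex) (auto simp: inj_on_def comp_def)
qed

lemma abs1_lin: "abs1 f \<Longrightarrow> abs1 g \<Longrightarrow> abs1 (\<lambda>n. f n + c * g n)"
proof -
  assume "abs1 f" "abs1 g"
  then have "(\<lambda>n. norm (f n) + norm c * norm (g n)) summable_on {1..}" by (intro summable_on_add summable_on_cmult_right)
  then show ?thesis
    by (rule Infinite_Sum.abs_summable_on_comparison_test') (auto intro: order_trans[OF norm_triangle_ineq] simp: norm_mult)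
qed

lemma osum2_symmetric:
  assumes "abs1 f" "abs1 g"
  shows "osum2 f g + osum2 g f = infsum f {1..} * infsum g {1..} - infsum (\<lambda>n. f n * g n) {1..}"
  unfolding osum2_def ordered2_def by (rule infsum_ordered_pairs[OF assms])

text \<open>The index of h lies below, between or above the other two, or equals one of
  them.\<close>

lemma osum2_mult:
  assumes f: "abs1 f" and g: "abs1 g" and h: "abs1 h"
  shows "osum2 f g * infsum h {1..} = osum3 h f g + osum3 f h g + osum3 f g h + osum2 (\<lambda>n. f n * h n) g + osum2 f (\<lambda>n. g n * h n)"
proof -
  let ?T = "\<lambda>(l, m, n). f m * (g n * h l)"
  let ?A = "{(l, m, n). 0 < l \<and> l < m \<and> m < n} :: (nat \<times> nat \<times> nat) set" and ?B = "{(l, m, n). 0 < m \<and> m < l \<and> l < n} :: (nat \<times> nat \<times> nat) set"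
    and ?C = "{(l, m, n). 0 < m \<and> m < n \<and> n < l} :: (nat \<times> nat \<times> nat) set" and ?D = "(\<lambda>(m, n). (m, m, n)) ` ordered2"
    and ?E = "(\<lambda>(m, n). (n, m, n)) ` ordered2"
  have s: "?T summable_on S" if "S \<subseteq> {1..} \<times> {1..} \<times> {1..}" for S
    using osum3_summable[OF h f g that] by (rule summable_on_cong[THEN iffD1, rotated]) (auto simp: mult_ac)
  have sub: "?A \<subseteq> {1..} \<times> {1..} \<times> {1..}" "?B \<subseteq> {1..} \<times> {1..} \<times> {1..}" "?C \<subseteq> {1..} \<times> {1..} \<times> {1..}"
    "?D \<subseteq> {1..} \<times> {1..} \<times> {1..}" "?E \<subseteq> {1..} \<times> {1..} \<times> {1..}" by (auto simp: ordered2_def)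
  have "osum2 f g * infsum h {1..} = infsum h {1..} * osum2 f g" by (rule mult.commute)
  also have "\<dots> = (\<Sum>\<^sub>\<infinity>(l, p)\<in>{1..} \<times> ordered2. h l * (case p of (m, n) \<Rightarrow> f m * g n))"
    unfolding osum2_def by (rule infsum_Times_mult[OF h, symmetric], rule osum2_summable(2)[OF f g]) (auto simp: ordered2_def)
  also have "\<dots> = infsum ?T ({1..} \<times> ordered2)" by (intro infsum_cong) auto
  also have "{1..} \<times> ordered2 = (((?A \<union> ?B) \<union> ?C) \<union> ?D) \<union> ?E" by (auto simp: ordered2_def image_iff)
  also have "infsum ?T ((((?A \<union> ?B) \<union> ?C) \<union> ?D) \<union> ?E) = infsum ?T ?A + infsum ?T ?B + infsum ?T ?C + infsum ?T ?D + infsum ?T ?E"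
  proof -
    have d: "?A \<inter> ?B = {}" "(?A \<union> ?B) \<inter> ?C = {}" "((?A \<union> ?B) \<union> ?C) \<inter> ?D = {}" "(((?A \<union> ?B) \<union> ?C) \<union> ?D) \<inter> ?E = {}"
      by (auto simp: ordered2_def)
    note u = Un_least[OF sub(1,2)] 
    note u2 = Un_least[OF u sub(3)]
    note u3 = Un_least[OF u2 sub(4)]
    show ?thesis
      using infsum_Un_disjoint[OF s[OF sub(1)] s[OF sub(2)] d(1)] infsum_Un_disjoint[OF s[OF u] s[OF sub(3)] d(2)]
        infsum_Un_disjoint[OF s[OF u2] s[OF sub(4)] d(3)] infsum_Un_disjoint[OF s[OF u3] s[OF sub(5)] d(4)] by (simp only:)
  qed
  also have "infsum ?T ?A = osum3 h f g" unfolding osum3_def ordered3_def by (intro infsum_cong) (auto simp: mult_ac)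
  also have "infsum ?T ?B = osum3 f h g"
    unfolding osum3_def ordered3_def
    by (rule infsum_reindex_bij_witness[of _ "\<lambda>(l, m, n). (m, l, n)" "\<lambda>(l, m, n). (m, l, n)"]) auto
  also have "infsum ?T ?C = osum3 f g h"
    unfolding osum3_def ordered3_def
    by (rule infsum_reindex_bij_witness[of _ "\<lambda>(a, b, c). (c, a, b)" "\<lambda>(l, m, n). (m, n, l)"]) auto
  also have "infsum ?T ?D = osum2 (\<lambda>n. f n * h n) g"
    unfolding osum2_def by (subst infsum_reindex) (auto simp: inj_on_def comp_def case_prod_unfold mult_ac)
  also have "infsum ?T ?E = osum2 f (\<lambda>n. g n * h n)"
    unfolding osum2_def by (subst infsum_reindex) (auto simp: inj_on_def comp_def case_prod_unfold mult_ac)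
  finally show ?thesis .
qed

lemma osum3_symmetric:
  assumes f: "abs1 f" and g: "abs1 g" and h: "abs1 h"
  shows "osum3 f g h + osum3 f h g + osum3 g f h + osum3 g h f + osum3 h f g + osum3 h g f
    = infsum f {1..} * infsum g {1..} * infsum h {1..} - infsum (\<lambda>n. f n * g n) {1..} * infsum h {1..}
      - infsum (\<lambda>n. g n * h n) {1..} * infsum f {1..} - infsum (\<lambda>n. f n * h n) {1..} * infsum g {1..}
      + 2 * infsum (\<lambda>n. f n * g n * h n) {1..}"
proof -
  have a: "(\<lambda>n. f n * h n * g n) = (\<lambda>n. f n * g n * h n)" "(\<lambda>n. g n * h n * f n) = (\<lambda>n. f n * g n * h n)" by (auto simp: mult_ac)
  show ?thesis
    using osum2_symmetric[OF f g] osum2_symmetric[OF abs1_mult[OF f h] g] osum2_symmetric[OF abs1_mult[OF g h] f]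
      osum2_mult[OF f g h] osum2_mult[OF g f h]
    unfolding a by algebra
qed

lemma osum2_lin:
  assumes "abs1 f" "abs1 f'" "abs1 g"
  shows "osum2 (\<lambda>n. f n + c * f' n) g = osum2 f g + c * osum2 f' g" "osum2 g (\<lambda>n. f n + c * f' n) = osum2 g f + c * osum2 g f'"
proof -
  have s: "ordered2 \<subseteq> {1..} \<times> {1..}" by (auto simp: ordered2_def)
  have "osum2 (\<lambda>n. f n + c * f' n) g = (\<Sum>\<^sub>\<infinity>p\<in>ordered2. (case p of (m, n) \<Rightarrow> f m * g n) + c * (case p of (m, n) \<Rightarrow> f' m * g n))"
    unfolding osum2_def by (intro infsum_cong) (auto simp: algebra_simps)
  also have "\<dots> = osum2 f g + c * osum2 f' g" unfolding osum2_def
    by (subst infsum_add) (auto intro!: summable_on_cmult_right osum2_summable assms s simp: infsum_cmult_right')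
  finally show "osum2 (\<lambda>n. f n + c * f' n) g = osum2 f g + c * osum2 f' g" .
  have "osum2 g (\<lambda>n. f n + c * f' n) = (\<Sum>\<^sub>\<infinity>p\<in>ordered2. (case p of (m, n) \<Rightarrow> g m * f n) + c * (case p of (m, n) \<Rightarrow> g m * f' n))"
    unfolding osum2_def by (intro infsum_cong) (auto simp: algebra_simps)
  also have "\<dots> = osum2 g f + c * osum2 g f'" unfolding osum2_def
    by (subst infsum_add) (auto intro!: summable_on_cmult_right osum2_summable assms s simp: infsum_cmult_right')
  finally show "osum2 g (\<lambda>n. f n + c * f' n) = osum2 g f + c * osum2 g f'" .
qed

lemma infsum_lin:
  assumes "abs1 f" "abs1 f'" shows "infsum (\<lambda>n. f n + c * f' n) {1..} = infsum f {1..} + c * infsum f' {1..}"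
  using assms[THEN abs_summable_summable] by (subst infsum_add) (auto intro: summable_on_cmult_right simp: infsum_cmult_right')

lemma linear_combination_sums:
  fixes f :: "nat \<Rightarrow> nat \<Rightarrow> complex"
  assumes f: "\<And>i. i < k \<Longrightarrow> abs1 (f i)" and g: "abs1 g"
  shows "abs1 (\<lambda>n. \<Sum>i<k. c i * f i n)" "infsum (\<lambda>n. \<Sum>i<k. c i * f i n) {1..} = (\<Sum>i<k. c i * infsum (f i) {1..})"
    "osum2 (\<lambda>n. \<Sum>i<k. c i * f i n) g = (\<Sum>i<k. c i * osum2 (f i) g)" "osum2 g (\<lambda>n. \<Sum>i<k. c i * f i n) = (\<Sum>i<k. c i * osum2 g (f i))"
proof -
  have "abs1 (\<lambda>n. \<Sum>i<k. c i * f i n) \<and> infsum (\<lambda>n. \<Sum>i<k. c i * f i n) {1..} = (\<Sum>i<k. c i * infsum (f i) {1..}) \<and>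
    osum2 (\<lambda>n. \<Sum>i<k. c i * f i n) g = (\<Sum>i<k. c i * osum2 (f i) g) \<and> osum2 g (\<lambda>n. \<Sum>i<k. c i * f i n) = (\<Sum>i<k. c i * osum2 g (f i))"
    using f
  proof (induction k)
    case 0
    then show ?case by (simp add: osum2_def case_prod_unfold)
  next
    case (Suc k)
    then have IH: "abs1 (\<lambda>n. \<Sum>i<k. c i * f i n)" and fk: "abs1 (f k)" by auto
    show ?case unfolding sum.lessThan_Suc
      using Suc abs1_lin[OF IH fk, of "c k"] infsum_lin[OF IH fk, of "c k"] osum2_lin[OF IH fk g, of "c k"] by simp
  qed
  then show "abs1 (\<lambda>n. \<Sum>i<k. c i * f i n)" "infsum (\<lambda>n. \<Sum>i<k. c i * f i n) {1..} = (\<Sum>i<k. c i * infsum (f i) {1..})"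
    "osum2 (\<lambda>n. \<Sum>i<k. c i * f i n) g = (\<Sum>i<k. c i * osum2 (f i) g)" "osum2 g (\<lambda>n. \<Sum>i<k. c i * f i n) = (\<Sum>i<k. c i * osum2 g (f i))"
    by blast+
qed

lemma chains_3: "chains 3 = (\<lambda>(l, m, n). [l, m, n]) ` ordered3"
  by (auto simp: chains_def ordered3_def numeral_3_eq_3 length_Suc_conv image_iff)

lemma mzv_3: "mzv [a, b, c] = osum3 (\<lambda>n. 1 / of_nat n ^ a) (\<lambda>n. 1 / of_nat n ^ b) (\<lambda>n. 1 / of_nat n ^ c)"
proof -
  have "mzv [a, b, c] = infsum (\<lambda>ms. 1 / of_nat (ms ! 0) ^ a * (1 / of_nat (ms ! 1) ^ b * (1 / of_nat (ms ! 2) ^ c))) (chains 3)"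
    by (simp add: mzv_def numeral_3_eq_3 numeral_2_eq_2 lessThan_Suc mult_ac)
  also have "\<dots> = osum3 (\<lambda>n. 1 / of_nat n ^ a) (\<lambda>n. 1 / of_nat n ^ b) (\<lambda>n. 1 / of_nat n ^ c)"
    unfolding chains_3 osum3_def by (subst infsum_reindex) (auto simp: inj_on_def comp_def case_prod_unfold)
  finally show ?thesis .
qed

lemma zt_conv: "zt s = infsum (\<lambda>n. 1 / of_nat n ^ s) {1..}"
  by (simp add: zt_def)

section \<open>The q-series as ordered sums\<close>

lemma bij_betw_gaps:
  "bij_betw (\<lambda>(a, b). (a, a + b)) ({1..} \<times> {1..}) ordered2"
  "bij_betw (\<lambda>(a, b). (b, b + a)) ({1..} \<times> {1..}) ordered2"
  "bij_betw (\<lambda>(a, b, c). (a, a + b, a + b + c)) ({1..} \<times> {1..} \<times> {1..}) ordered3"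
  "bij_betw (\<lambda>(a, b, c). (c, c + b, c + b + a)) ({1..} \<times> {1..} \<times> {1..}) ordered3"
proof -
  show "bij_betw (\<lambda>(a, b). (a, a + b)) ({1..} \<times> {1..}) ordered2"
    by (rule bij_betwI[where g = "\<lambda>(m, n). (m, n - m)"]) (auto simp: ordered2_def)
  show "bij_betw (\<lambda>(a, b). (b, b + a)) ({1..} \<times> {1..}) ordered2"
    by (rule bij_betwI[where g = "\<lambda>(m, n). (n - m, m)"]) (auto simp: ordered2_def)
  show "bij_betw (\<lambda>(a, b, c). (a, a + b, a + b + c)) ({1..} \<times> {1..} \<times> {1..}) ordered3"
    by (rule bij_betwI[where g = "\<lambda>(l, m, n). (l, m - l, n - m)"]) (auto simp: ordered3_def)
  show "bij_betw (\<lambda>(a, b, c). (c, c + b, c + b + a)) ({1..} \<times> {1..} \<times> {1..}) ordered3"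
    by (rule bij_betwI[where g = "\<lambda>(l, m, n). (n - m, m - l, l)"]) (auto simp: ordered3_def)
qed

lemma infsum_Times3_mult:
  fixes f :: "'a \<Rightarrow> complex" and g :: "'b \<Rightarrow> complex" and h :: "'c \<Rightarrow> complex"
  assumes "f abs_summable_on A" "g abs_summable_on B" "h abs_summable_on C"
  shows "(\<Sum>\<^sub>\<infinity>(a, b, c)\<in>A \<times> B \<times> C. f a * (g b * h c)) = infsum f A * (infsum g B * infsum h C)"
proof -
  have "(\<Sum>\<^sub>\<infinity>(a, b, c)\<in>A \<times> B \<times> C. f a * (g b * h c)) = (\<Sum>\<^sub>\<infinity>(a, p)\<in>A \<times> (B \<times> C). f a * (case p of (b, c) \<Rightarrow> g b * h c))"
    by (intro infsum_cong) auto
  also have "\<dots> = infsum f A * infsum (\<lambda>(b, c). g b * h c) (B \<times> C)"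
    by (rule infsum_Times_mult[OF assms(1) abs_summable_on_Times[OF assms(2,3)]])
  finally show ?thesis by (simp add: infsum_Times_mult[OF assms(2,3)])
qed

definition lsum :: "complex \<Rightarrow> nat \<Rightarrow> nat \<Rightarrow> complex" where
  "lsum q i w = (\<Sum>\<^sub>\<infinity>u\<in>{1..}. of_nat u ^ i * q ^ (w * u))"

definition geo :: "complex \<Rightarrow> nat \<Rightarrow> complex" where "geo q d = q ^ d / (1 - q ^ d)"

context
  fixes q :: complex
  assumes q: "norm q < 1"
begin

lemma lsum_summable: assumes "w \<ge> 1" shows "abs1 (\<lambda>u. of_nat u ^ i * q ^ (w * u))"
proof -
  have "norm (q ^ w) < 1" using q assms by (simp add: norm_power power_less_one_iff)
  from power_series_coeff_summable[OF norm_ge_zero this, of i "{1..}"] show ?thesis by (simp add: norm_mult norm_power power_mult)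
qed

lemma geo_eq: assumes "d \<ge> 1" shows "geo q d = (\<Sum>\<^sub>\<infinity>c\<in>{1..}. q ^ (c * d))" "abs1 (\<lambda>c. q ^ (c * d))"
proof -
  have n: "norm (q ^ d) < 1" using q assms by (simp add: norm_power power_less_one_iff)
  show a: "abs1 (\<lambda>c. q ^ (c * d))" using lsum_summable[OF assms, of 0] by (simp add: mult.commute)
  have "((\<lambda>c. q ^ (c * d)) has_sum (\<Sum>\<^sub>\<infinity>c\<in>{1..}. q ^ (c * d))) {1..}"
    by (rule has_sum_infsum[OF abs_summable_summable[OF a]])
  then have "((\<lambda>c. q ^ (Suc c * d)) has_sum (\<Sum>\<^sub>\<infinity>c\<in>{1..}. q ^ (c * d))) UNIV"
    by (subst (asm) has_sum_reindex_bij_betw[OF bij_betwI[of Suc UNIV "{1..}" "\<lambda>n. n - 1"], symmetric]) auto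
  from has_sum_imp_sums[OF this] have "(\<lambda>c. q ^ d * (q ^ d) ^ c) sums (\<Sum>\<^sub>\<infinity>c\<in>{1..}. q ^ (c * d))"
    by (simp add: power_add mult.commute[of _ d] flip: power_mult)
  moreover have "(\<lambda>c. q ^ d * (q ^ d) ^ c) sums (q ^ d * (1 / (1 - q ^ d)))" by (intro sums_mult geometric_sums n)
  ultimately show "geo q d = (\<Sum>\<^sub>\<infinity>c\<in>{1..}. q ^ (c * d))" by (simp add: geo_def sums_iff)
qed

lemma lsum_abs1: "abs1 (lsum q i)"
proof (rule Infinite_Sum.abs_summable_on_comparison_test')
  have "(\<lambda>(w, u). norm (of_nat u ^ i * q ^ (w * u))) summable_on {1..} \<times> {1..}"
    using q_double_sum_summable[OF q, of i] by (simp add: case_prod_unfold)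
  from summable_on_Sigma_banach[OF this] show "(\<lambda>w. \<Sum>\<^sub>\<infinity>u\<in>{1..}. norm (of_nat u ^ i * q ^ (w * u))) summable_on {1..}" by simp
  fix w :: nat assume "w \<in> {1..}"
  then show "norm (lsum q i w) \<le> (\<Sum>\<^sub>\<infinity>u\<in>{1..}. norm (of_nat u ^ i * q ^ (w * u)))"
    unfolding lsum_def by (intro norm_infsum_bound lsum_summable) auto
qed

lemma q_power_antimono: "m \<le> n \<Longrightarrow> norm q ^ n \<le> norm q ^ m"
  using q by (intro power_decreasing) auto

text \<open>Expanding both geometric series gives the exponent u1 x1 + u2 (x1 + x2) = x1 (u1 + u2) +
  x2 u2. Summed over x first, with u2 < u1 + u2 as d1 < d2, it is the left side; summed over u
  first, with levels x1 < x1 + x2, the right side. This is conjugation of partitions.\<close>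

lemma nested_sum2:
  "(\<Sum>\<^sub>\<infinity>(d1, d2)\<in>ordered2. geo q d1 * geo q d2 * (of_nat (d2 - d1) ^ i * of_nat d1 ^ j)) = osum2 (lsum q i) (lsum q j)"
proof -
  let ?N = "{1..} :: nat set"
  define H where "H = (\<lambda>(u :: nat \<times> nat) (x :: nat \<times> nat). of_nat (fst u) ^ i * of_nat (snd u) ^ j
    * q ^ (fst u * fst x + snd u * (fst x + snd x)))"
  \<comment> \<open>Dropping the mixed product u2 x1 from the exponent bounds the terms by a product
    of two double series.\<close>
  have sH: "(\<lambda>(u, x). H u x) summable_on (?N \<times> ?N) \<times> (?N \<times> ?N)"
  proof (rule abs_summable_summable, rule Infinite_Sum.abs_summable_on_comparison_test')
    let ?F = "\<lambda>j (w, d). of_nat d ^ j * q ^ (w * d)"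
    define B where "B = (\<lambda>((x1, u1), (x2, u2)). norm (?F i (x1, u1)) * norm (?F j (x2, u2)))"
    have S: "B summable_on (?N \<times> ?N) \<times> (?N \<times> ?N)"
      using abs_summable_on_Times[OF q_double_sum_summable[OF q, of i] q_double_sum_summable[OF q, of j]]
      by (simp add: B_def case_prod_unfold norm_mult)
    define r where "r = (\<lambda>((u1 :: nat, u2 :: nat), (x1 :: nat, x2 :: nat)). ((x1, u1), (x2, u2)))"
    have bij: "bij_betw r ((?N \<times> ?N) \<times> (?N \<times> ?N)) ((?N \<times> ?N) \<times> (?N \<times> ?N))"
      by (rule bij_betwI[where g = "\<lambda>((x1, u1), (x2, u2)). ((u1, u2), (x1, x2))"]) (auto simp: r_def)
    show "(\<lambda>p. B (r p)) summable_on (?N \<times> ?N) \<times> (?N \<times> ?N)"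
      by (rule iffD2[OF summable_on_reindex_bij_betw[OF bij] S])
    fix p assume "p \<in> (?N \<times> ?N) \<times> (?N \<times> ?N)"
    obtain u1 u2 x1 x2 where p: "p = ((u1, u2), (x1, x2))" by (metis surj_pair)
    have "norm q ^ (u1 * x1 + u2 * (x1 + x2)) \<le> norm q ^ (x1 * u1 + x2 * u2)" by (rule q_power_antimono) (simp add: algebra_simps)
    then show "norm (case p of (u, x) \<Rightarrow> H u x) \<le> B (r p)"
      by (simp add: p B_def r_def H_def norm_mult norm_power power_add mult_ac mult_left_mono)
  qed
  have "(\<Sum>\<^sub>\<infinity>(d1, d2)\<in>ordered2. geo q d1 * geo q d2 * (of_nat (d2 - d1) ^ i * of_nat d1 ^ j))
    = (\<Sum>\<^sub>\<infinity>u\<in>?N \<times> ?N. \<Sum>\<^sub>\<infinity>x\<in>?N \<times> ?N. H u x)"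
    unfolding infsum_reindex_bij_betw[OF bij_betw_gaps(2), symmetric]
  proof (intro infsum_cong, clarsimp simp del: One_nat_def)
    fix c a :: nat assume ca: "1 \<le> c" "1 \<le> a"
    have "(\<Sum>\<^sub>\<infinity>x\<in>?N \<times> ?N. H (c, a) x) = (\<Sum>\<^sub>\<infinity>x\<in>?N \<times> ?N. of_nat c ^ i * of_nat a ^ j * (case x of (x1, x2) \<Rightarrow> q ^ (x1 * (a + c)) * q ^ (x2 * a)))"
      by (intro infsum_cong) (auto simp: H_def algebra_simps power_add)
    also have "\<dots> = of_nat c ^ i * of_nat a ^ j * (geo q (a + c) * geo q a)"
      using ca by (simp add: infsum_cmult_right' infsum_Times_mult geo_eq del: One_nat_def)
    finally show "geo q a * geo q (a + c) * (of_nat c ^ i * of_nat a ^ j) = (\<Sum>\<^sub>\<infinity>x\<in>?N \<times> ?N. H (c, a) x)" by (simp add: mult_ac)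
  qed
  also have "\<dots> = (\<Sum>\<^sub>\<infinity>x\<in>?N \<times> ?N. \<Sum>\<^sub>\<infinity>u\<in>?N \<times> ?N. H u x)" by (rule infsum_swap_banach[OF sH])
  also have "\<dots> = osum2 (lsum q i) (lsum q j)"
    unfolding osum2_def infsum_reindex_bij_betw[OF bij_betw_gaps(1), symmetric]
  proof (intro infsum_cong, clarsimp simp del: One_nat_def)
    fix a b :: nat assume ab: "1 \<le> a" "1 \<le> b"
    have "(\<Sum>\<^sub>\<infinity>u\<in>?N \<times> ?N. H u (a, b)) = (\<Sum>\<^sub>\<infinity>(u1, u2)\<in>?N \<times> ?N. (of_nat u1 ^ i * q ^ (a * u1)) * (of_nat u2 ^ j * q ^ ((a + b) * u2)))"
      by (intro infsum_cong) (auto simp: H_def algebra_simps power_add)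
    then show "(\<Sum>\<^sub>\<infinity>u\<in>?N \<times> ?N. H u (a, b)) = lsum q i a * lsum q j (a + b)"
      using infsum_Times_mult[OF lsum_summable lsum_summable, of a "a + b" i j] ab by (simp add: lsum_def)
  qed
  finally show ?thesis .
qed

lemma nested_sum3:
  "(\<Sum>\<^sub>\<infinity>(d1, d2, d3)\<in>ordered3. geo q d1 * geo q d2 * geo q d3 * (of_nat (d3 - d2) ^ i * (of_nat (d2 - d1) ^ j * of_nat d1 ^ k)))
    = osum3 (lsum q i) (lsum q j) (lsum q k)"
proof -
  let ?N = "{1..} :: nat set"
  let ?M = "?N \<times> ?N \<times> ?N"
  define H where "H = (\<lambda>(u1 :: nat, u2 :: nat, u3 :: nat) (x1 :: nat, x2 :: nat, x3 :: nat). of_nat u1 ^ i * (of_nat u2 ^ j * of_nat u3 ^ k)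
    * q ^ (u1 * x1 + u2 * (x1 + x2) + u3 * (x1 + x2 + x3)))"
  have sH: "(\<lambda>(u, x). H u x) summable_on ?M \<times> ?M"
  proof (rule abs_summable_summable, rule Infinite_Sum.abs_summable_on_comparison_test')
    let ?F = "\<lambda>j (w, d). of_nat d ^ j * q ^ (w * d)"
    define B where "B = (\<lambda>((x1, u1), (x2, u2), (x3, u3)). norm (?F i (x1, u1)) * (norm (?F j (x2, u2)) * norm (?F k (x3, u3))))"
    have S: "B summable_on (?N \<times> ?N) \<times> (?N \<times> ?N) \<times> (?N \<times> ?N)"
      using abs_summable_on_Times[OF q_double_sum_summable[OF q, of i] abs_summable_on_Times[OF q_double_sum_summable[OF q, of j] q_double_sum_summable[OF q, of k]]]
      by (simp add: B_def case_prod_unfold norm_mult)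
    define r where "r = (\<lambda>((u1 :: nat, u2 :: nat, u3 :: nat), (x1 :: nat, x2 :: nat, x3 :: nat)). ((x1, u1), (x2, u2), (x3, u3)))"
    have bij: "bij_betw r (?M \<times> ?M) ((?N \<times> ?N) \<times> (?N \<times> ?N) \<times> (?N \<times> ?N))"
      by (rule bij_betwI[where g = "\<lambda>((x1, u1), (x2, u2), (x3, u3)). ((u1, u2, u3), (x1, x2, x3))"]) (auto simp: r_def)
    show "(\<lambda>p. B (r p)) summable_on ?M \<times> ?M"
      by (rule iffD2[OF summable_on_reindex_bij_betw[OF bij] S])
    fix p assume "p \<in> ?M \<times> ?M"
    obtain u1 u2 u3 x1 x2 x3 where p: "p = ((u1, u2, u3), (x1, x2, x3))" by (metis surj_pair)
    have "norm q ^ (u1 * x1 + u2 * (x1 + x2) + u3 * (x1 + x2 + x3)) \<le> norm q ^ (x1 * u1 + x2 * u2 + x3 * u3)"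
      by (rule q_power_antimono) (simp add: algebra_simps)
    then show "norm (case p of (u, x) \<Rightarrow> H u x) \<le> B (r p)"
      by (simp add: p B_def r_def H_def norm_mult norm_power power_add mult_ac mult_left_mono)
  qed
  have "(\<Sum>\<^sub>\<infinity>(d1, d2, d3)\<in>ordered3. geo q d1 * geo q d2 * geo q d3 * (of_nat (d3 - d2) ^ i * (of_nat (d2 - d1) ^ j * of_nat d1 ^ k)))
    = (\<Sum>\<^sub>\<infinity>u\<in>?M. \<Sum>\<^sub>\<infinity>x\<in>?M. H u x)"
    unfolding infsum_reindex_bij_betw[OF bij_betw_gaps(4), symmetric]
  proof (intro infsum_cong, clarsimp simp del: One_nat_def)
    fix c b a :: nat assume cba: "1 \<le> c" "1 \<le> b" "1 \<le> a"
    have "(\<Sum>\<^sub>\<infinity>x\<in>?M. H (c, b, a) x) = (\<Sum>\<^sub>\<infinity>x\<in>?M. of_nat c ^ i * (of_nat b ^ j * of_nat a ^ k)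
        * (case x of (x1, x2, x3) \<Rightarrow> q ^ (x1 * (a + b + c)) * (q ^ (x2 * (a + b)) * q ^ (x3 * a))))"
      by (intro infsum_cong) (auto simp: H_def algebra_simps power_add)
    also have "\<dots> = of_nat c ^ i * (of_nat b ^ j * of_nat a ^ k) * (geo q (a + b + c) * (geo q (a + b) * geo q a))"
      using cba by (simp add: infsum_cmult_right' infsum_Times3_mult geo_eq del: One_nat_def)
    finally show "geo q a * geo q (a + b) * geo q (a + b + c) * (of_nat c ^ i * (of_nat b ^ j * of_nat a ^ k)) = (\<Sum>\<^sub>\<infinity>x\<in>?M. H (c, b, a) x)"
      by (simp add: mult_ac)
  qed
  also have "\<dots> = (\<Sum>\<^sub>\<infinity>x\<in>?M. \<Sum>\<^sub>\<infinity>u\<in>?M. H u x)" by (rule infsum_swap_banach[OF sH])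
  also have "\<dots> = osum3 (lsum q i) (lsum q j) (lsum q k)"
    unfolding osum3_def infsum_reindex_bij_betw[OF bij_betw_gaps(3), symmetric]
  proof (intro infsum_cong, clarsimp simp del: One_nat_def)
    fix a b c :: nat assume abc: "1 \<le> a" "1 \<le> b" "1 \<le> c"
    have "(\<Sum>\<^sub>\<infinity>u\<in>?M. H u (a, b, c)) = (\<Sum>\<^sub>\<infinity>(u1, u2, u3)\<in>?M. (of_nat u1 ^ i * q ^ (a * u1))
        * ((of_nat u2 ^ j * q ^ ((a + b) * u2)) * (of_nat u3 ^ k * q ^ ((a + b + c) * u3))))"
      by (intro infsum_cong) (auto simp: H_def algebra_simps power_add)
    then show "(\<Sum>\<^sub>\<infinity>u\<in>?M. H u (a, b, c)) = lsum q i a * (lsum q j (a + b) * lsum q k (a + b + c))"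
      using infsum_Times3_mult[OF lsum_summable lsum_summable lsum_summable, of a "a + b" "a + b + c" i j k] abc by (simp add: lsum_def)
  qed
  finally show ?thesis .
qed

end

text \<open>For x >= 2 the sum of lambda^(-x) over row w of the lattice.\<close>

definition level_tangent :: "complex \<Rightarrow> nat \<Rightarrow> nat \<Rightarrow> complex" where
  "level_tangent \<tau> x w = tangent x (of_nat w * \<tau>)"

lemma level_tangent_lsum:
  assumes "\<tau> \<in> uhp" "x \<ge> 2" "w \<ge> 1"
  shows "level_tangent \<tau> x w = (- 2 * of_real pi * \<i>) ^ x / fact (x - 1) * lsum (to_q \<tau>) (x - 1) w"
  using assms by (simp add: level_tangent_def tangent_qsum[OF _ of_nat_mult_in_uhp] qsum_def lsum_def to_q_mult_of_nat power_mult del: One_nat_def)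

lemma compositions_1: "compositions 1 = {[1]}" and compositions_2: "compositions 2 = {[2], [1, 1]}"
  and compositions_3: "compositions 3 = {[3], [2, 1], [1, 2], [1, 1, 1]}"
proof -
  have 0: "compositions 0 = {[]}" by (auto simp: compositions_def) (metis list.set_intros(1) neq_Nil_conv)
  have S: "compositions (Suc n) = (\<Union>a\<in>{1..Suc n}. (#) a ` compositions (Suc n - a))" for n
  proof -
    have "es \<in> compositions (Suc n) \<longleftrightarrow> (\<exists>a fs. es = a # fs \<and> 1 \<le> a \<and> a \<le> Suc n \<and> fs \<in> compositions (Suc n - a))" for es
      by (cases es) (auto simp: compositions_def)
    then show ?thesis by (intro set_eqI) (simp only: UN_iff image_iff, fastforce)
  qed
  have i: "{1..Suc 0} = {1}" "{1..Suc (Suc 0)} = {1, 2}" "{1..Suc (Suc (Suc 0))} = {1, 2, 3}" by auto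
  show 1: "compositions 1 = {[1]}" by (simp add: S 0)
  show 2: "compositions 2 = {[2], [1, 1]}" unfolding numeral_2_eq_2 S i using 1 by (auto simp: 0 numeral_2_eq_2)
  show "compositions 3 = {[3], [2, 1], [1, 2], [1, 1, 1]}"
    unfolding numeral_3_eq_3 S i using 1 2 by (auto simp: 0 numeral_2_eq_2 numeral_3_eq_3)
qed

lemma g_sh_1:
  assumes "\<tau> \<in> uhp" "x \<ge> 2" shows "g_sh \<tau> [x] = infsum (level_tangent \<tau> x) {1..}"
proof -
  let ?q = "to_q \<tau>"
  have q: "norm ?q < 1" by (rule norm_to_q_less_1[OF assms(1)])
  have s: "(\<lambda>(w, d). of_nat d ^ (x - 1) * ?q ^ (w * d)) summable_on {1..} \<times> {1..}"
    by (rule abs_summable_summable[OF q_double_sum_summable[OF q]])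
  have "g_sh \<tau> [x] = (- 2 * of_real pi * \<i>) ^ x * (\<Sum>\<^sub>\<infinity>d\<in>{1..}. geo ?q d * (of_nat d ^ (x - 1) / fact (x - 1)))"
    by (simp add: g_sh_def compositions_1[unfolded One_nat_def] chains_1 infsum_reindex inj_on_def comp_def lin_coeff_def geo_def)
  also have "(\<Sum>\<^sub>\<infinity>d\<in>{1..}. geo ?q d * (of_nat d ^ (x - 1) / fact (x - 1))) = 1 / fact (x - 1) * (\<Sum>\<^sub>\<infinity>d\<in>{1..}. \<Sum>\<^sub>\<infinity>c\<in>{1..}. of_nat d ^ (x - 1) * ?q ^ (c * d))"
  proof -
    have "(\<Sum>\<^sub>\<infinity>c\<in>{1..}. of_nat d ^ (x - 1) * ?q ^ (c * d)) = of_nat d ^ (x - 1) * geo ?q d" if "d \<in> {1..}" for d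
      using that geo_eq(1)[OF q, of d] infsum_cmult_right'[of "of_nat d ^ (x - 1)" "\<lambda>c. ?q ^ (c * d)"] by (simp del: One_nat_def)
    then have "(\<Sum>\<^sub>\<infinity>d\<in>{1..}. geo ?q d * (of_nat d ^ (x - 1) / fact (x - 1)))
        = (\<Sum>\<^sub>\<infinity>d\<in>{1..}. 1 / fact (x - 1) * (\<Sum>\<^sub>\<infinity>c\<in>{1..}. of_nat d ^ (x - 1) * ?q ^ (c * d)))"
      by (intro infsum_cong) (simp only:, simp)
    then show ?thesis by (simp only: infsum_cmult_right')
  qed
  also have "(\<Sum>\<^sub>\<infinity>d\<in>{1..}. \<Sum>\<^sub>\<infinity>c\<in>{1..}. of_nat d ^ (x - 1) * ?q ^ (c * d)) = infsum (lsum ?q (x - 1)) {1..}"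
    unfolding lsum_def by (rule infsum_swap_banach[symmetric]) (use s in simp)
  also have "(- 2 * of_real pi * \<i>) ^ x * (1 / fact (x - 1) * infsum (lsum ?q (x - 1)) {1..}) = infsum (level_tangent \<tau> x) {1..}"
    unfolding infsum_cmult_right'[symmetric] by (intro infsum_cong) (use assms in \<open>simp add: level_tangent_lsum\<close>)
  finally show ?thesis .
qed

text \<open>Only the composition [1, 1] contributes: the part 2 makes two neighbouring entries
  equal, so a \<open>lin_coeff\<close> is 0, and it is raised to a positive power because the
  indices are at least 2.\<close>

lemma g_sh_2:
  assumes "\<tau> \<in> uhp" "x \<ge> 2" "y \<ge> 2" shows "g_sh \<tau> [x, y] = osum2 (level_tangent \<tau> x) (level_tangent \<tau> y)"
proof -
  let ?q = "to_q \<tau>" and ?k = "\<lambda>x. (- 2 * of_real pi * \<i>) ^ x / fact (x - 1) :: complex"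
  have q: "norm ?q < 1" by (rule norm_to_q_less_1[OF assms(1)])
  have "g_sh \<tau> [x, y] = (- 2 * of_real pi * \<i>) ^ (x + y) * (\<Sum>\<^sub>\<infinity>(d1, d2)\<in>ordered2. geo ?q d1 * geo ?q d2
      * ((of_nat d2 - of_nat d1) ^ (x - 1) / fact (x - 1) * (of_nat d1 ^ (y - 1) / fact (y - 1))))"
    using assms(2,3)
    by (simp add: g_sh_def compositions_2[unfolded numeral_2_eq_2] chains_1 chains_2[unfolded numeral_2_eq_2] infsum_reindex inj_on_def comp_def
        case_prod_unfold lin_coeff_def geo_def numeral_2_eq_2 lessThan_Suc mult_ac power_0_left ordered2_def)
  also have "\<dots> = (- 2 * of_real pi * \<i>) ^ (x + y) * (1 / (fact (x - 1) * fact (y - 1)) * osum2 (lsum ?q (x - 1)) (lsum ?q (y - 1)))"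
    unfolding nested_sum2[OF q, symmetric] infsum_cmult_right'[symmetric]
    by (intro arg_cong2[where f = "(*)"] refl infsum_cong) (auto simp: ordered2_def of_nat_diff)
  also have "\<dots> = osum2 (level_tangent \<tau> x) (level_tangent \<tau> y)"
    unfolding osum2_def infsum_cmult_right'[symmetric]
    by (intro infsum_cong) (use assms in \<open>auto simp: ordered2_def level_tangent_lsum power_add\<close>)
  finally show ?thesis .
qed

lemma g_sh_3:
  assumes "\<tau> \<in> uhp" "x \<ge> 2" "y \<ge> 2" "z \<ge> 2"
  shows "g_sh \<tau> [x, y, z] = osum3 (level_tangent \<tau> x) (level_tangent \<tau> y) (level_tangent \<tau> z)"
proof -
  let ?q = "to_q \<tau>"
  have q: "norm ?q < 1" by (rule norm_to_q_less_1[OF assms(1)])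
  have "g_sh \<tau> [x, y, z] = (- 2 * of_real pi * \<i>) ^ (x + y + z) * (\<Sum>\<^sub>\<infinity>(d1, d2, d3)\<in>ordered3. geo ?q d1 * geo ?q d2 * geo ?q d3
      * ((of_nat d3 - of_nat d2) ^ (x - 1) / fact (x - 1) * ((of_nat d2 - of_nat d1) ^ (y - 1) / fact (y - 1) * (of_nat d1 ^ (z - 1) / fact (z - 1)))))"
    using assms(2-4)
    by (simp add: g_sh_def compositions_3[unfolded numeral_3_eq_3 numeral_2_eq_2] chains_1 chains_2[unfolded numeral_2_eq_2] chains_3[unfolded numeral_3_eq_3]
        infsum_reindex inj_on_def comp_def case_prod_unfold lin_coeff_def geo_def numeral_2_eq_2 lessThan_Suc mult_ac add.assoc power_0_left prod_eq_iff)
  also have "\<dots> = (- 2 * of_real pi * \<i>) ^ (x + y + z) * (1 / (fact (x - 1) * (fact (y - 1) * fact (z - 1)))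
      * osum3 (lsum ?q (x - 1)) (lsum ?q (y - 1)) (lsum ?q (z - 1)))"
    unfolding nested_sum3[OF q, symmetric] infsum_cmult_right'[symmetric]
    by (intro arg_cong2[where f = "(*)"] refl infsum_cong) (auto simp: ordered3_def of_nat_diff)
  also have "\<dots> = osum3 (level_tangent \<tau> x) (level_tangent \<tau> y) (level_tangent \<tau> z)"
    unfolding osum3_def infsum_cmult_right'[symmetric]
    by (intro infsum_cong) (use assms in \<open>auto simp: ordered3_def level_tangent_lsum power_add\<close>)
  finally show ?thesis .
qed

lemma level_tangent_abs1: assumes "\<tau> \<in> uhp" "x \<ge> 2" shows "abs1 (level_tangent \<tau> x)"
proof -
  have "abs1 (\<lambda>w. (- 2 * of_real pi * \<i>) ^ x / fact (x - 1) * lsum (to_q \<tau>) (x - 1) w)"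
    unfolding norm_mult by (rule summable_on_cmult_right[OF lsum_abs1[OF norm_to_q_less_1[OF assms(1)]]])
  then show ?thesis by (rule summable_on_cong[THEN iffD1, rotated]) (use assms in \<open>simp add: level_tangent_lsum\<close>)
qed

section \<open>Multiple Eisenstein series of depth at most three\<close>

definition level_pp :: "complex \<Rightarrow> complex fps \<Rightarrow> nat \<Rightarrow> nat \<Rightarrow> complex" where
  "level_pp \<tau> c x w = pp_tangent c x (of_nat w * \<tau>)"

text \<open>The contribution of ordered pairs lying in the same row w; \<open>level_tri\<close>
  plays this role for triples.\<close>

definition level_di :: "complex \<Rightarrow> nat \<Rightarrow> nat \<Rightarrow> nat \<Rightarrow> complex" where
  "level_di \<tau> x y w = ditangent x y (of_nat w * \<tau>)"

definition level_tri :: "complex \<Rightarrow> nat \<Rightarrow> nat \<Rightarrow> nat \<Rightarrow> nat \<Rightarrow> complex" where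
  "level_tri \<tau> x y z w = tritangent x y z (of_nat w * \<tau>)"

lemma int_sym_zeta_sh_Nil: "int_sym zeta_sh a [] b = 1" and int_sym_zeta_sh_same: "s \<noteq> [] \<Longrightarrow> int_sym zeta_sh a s a = 0"
  and int_sym_zeta_sh_zeros: "n \<ge> 1 \<Longrightarrow> int_sym zeta_sh a (replicate n L0) b = 0"
  by (auto simp: int_sym_def int_word_zeros[unfolded One_nat_def])

lemma int_sym_L1: "int_sym F L0 (L1 # u) L1 = F (index_of (L1 # u))"
  by (simp add: int_sym_def int_word_L1 del: index_of.simps)

lemmas cop_facts = int_sym_zeta_sh_Nil int_sym_zeta_sh_same int_sym_zeta_sh_zeros

context
  fixes \<tau> :: complex assumes tau: "\<tau> \<in> uhp"
begin

abbreviation L :: "nat \<Rightarrow> nat \<Rightarrow> complex" where "L \<equiv> level_tangent \<tau>"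
abbreviation s1 :: "(nat \<Rightarrow> complex) \<Rightarrow> complex" where "s1 f \<equiv> infsum f {1..}"
abbreviation gw :: "letter list \<Rightarrow> complex" where "gw u \<equiv> int_sym (g_sh \<tau>) L0 u L1"
abbreviation copr :: "letter list \<Rightarrow> letter \<Rightarrow> letter list \<Rightarrow> letter list \<Rightarrow> complex" where
  "copr \<equiv> cop (int_sym zeta_sh) (\<lambda>u. int_sym (g_sh \<tau>) L0 u L1)"

lemma L_abs1: "x \<ge> 2 \<Longrightarrow> abs1 (L x)"
  by (rule level_tangent_abs1[OF tau])

lemma gw_blocks:
  "a \<ge> 1 \<Longrightarrow> gw (L1 # zs a) = s1 (L (Suc a))"
  "a \<ge> 1 \<Longrightarrow> b \<ge> 1 \<Longrightarrow> gw (L1 # zs a @ L1 # zs b) = osum2 (L (Suc a)) (L (Suc b))"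
  "a \<ge> 1 \<Longrightarrow> b \<ge> 1 \<Longrightarrow> c \<ge> 1 \<Longrightarrow> gw (L1 # zs a @ L1 # zs b @ L1 # zs c) = osum3 (L (Suc a)) (L (Suc b)) (L (Suc c))"
  by (simp_all add: int_sym_L1 index_of_blocks g_sh_1[OF tau] g_sh_2[OF tau] g_sh_3[OF tau] del: index_of.simps)

lemma level_pp_sums:
  assumes g: "abs1 g"
  shows "abs1 (level_pp \<tau> c (Suc a))"
    and "(\<Sum>i<a. c $ i * s1 (L (Suc (a - i)))) = s1 (level_pp \<tau> c (Suc a))"
    and "(\<Sum>i<a. c $ i * osum2 (L (Suc (a - i))) g) = osum2 (level_pp \<tau> c (Suc a)) g"
    and "(\<Sum>i<a. c $ i * osum2 g (L (Suc (a - i)))) = osum2 g (level_pp \<tau> c (Suc a))"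
proof -
  have "level_pp \<tau> c (Suc a) = (\<lambda>w. \<Sum>i<a. c $ i * L (Suc (a - i)) w)"
    by (auto simp: fun_eq_iff level_pp_def pp_tangent_def level_tangent_def Suc_diff_le intro!: sum.cong)
  moreover have "abs1 (L (Suc (a - i)))" if "i < a" for i using that by (intro L_abs1) auto
  ultimately show "abs1 (level_pp \<tau> c (Suc a))"
    "(\<Sum>i<a. c $ i * s1 (L (Suc (a - i)))) = s1 (level_pp \<tau> c (Suc a))"
    "(\<Sum>i<a. c $ i * osum2 (L (Suc (a - i))) g) = osum2 (level_pp \<tau> c (Suc a)) g"
    "(\<Sum>i<a. c $ i * osum2 g (L (Suc (a - i)))) = osum2 g (level_pp \<tau> c (Suc a))"
    using linear_combination_sums[OF _ g, of a "\<lambda>i. L (Suc (a - i))" "\<lambda>i. c $ i"] by simp_all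
qed

lemma level_pp_abs1: "abs1 (level_pp \<tau> c (Suc a))"
  by (rule level_pp_sums(1)[of "\<lambda>_. 0"]) simp

lemma abs1_add: "abs1 f \<Longrightarrow> abs1 g \<Longrightarrow> abs1 (\<lambda>n. f n + g n)"
  using abs1_lin[of f g 1] by simp

lemma sums_add:
  assumes "abs1 f" "abs1 f'" "abs1 g"
  shows "s1 (\<lambda>n. f n + f' n) = s1 f + s1 f'" "osum2 (\<lambda>n. f n + f' n) g = osum2 f g + osum2 f' g"
    "osum2 g (\<lambda>n. f n + f' n) = osum2 g f + osum2 g f'"
  using infsum_lin[OF assms(1,2), of 1] osum2_lin[OF assms, of 1] by simp_all

lemma level_di_eq: "level_di \<tau> x y = (\<lambda>w. level_pp \<tau> (zpos y) x w + level_pp \<tau> (zneg x) y w)"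
  by (simp add: fun_eq_iff level_di_def ditangent_def level_pp_def)

lemma level_tri_eq: "level_tri \<tau> x y z = (\<lambda>w. level_pp \<tau> (zpos2 y z) x w + level_pp \<tau> (zneg x * zpos z) y w + level_pp \<tau> (zneg2 x y) z w)"
  by (simp add: fun_eq_iff level_tri_def tritangent_def level_pp_def)

lemma level_di_abs1: "abs1 (level_di \<tau> (Suc a) (Suc b))"
  unfolding level_di_eq by (intro abs1_add level_pp_abs1)

lemma copr_block_L1:
  assumes "a \<ge> 1" "b \<ge> 1"
  shows "copr (zs a @ L1 # zs b) L1 [] [L1] = s1 (level_di \<tau> (Suc a) (Suc b)) + osum2 (L (Suc a)) (L (Suc b))"
proof -
  have "copr (zs a @ L1 # zs b) L1 [] [L1] = (\<Sum>i<a. zpos (Suc b) $ i * s1 (L (Suc (a - i)))) + (\<Sum>i<b. zneg (Suc a) $ i * s1 (L (Suc (b - i))))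
      + osum2 (L (Suc a)) (L (Suc b))"
    using assms by (simp add: cop_block_L1[OF cop_facts] int_sym_zeta gw_blocks)
  also have "(\<Sum>i<a. zpos (Suc b) $ i * s1 (L (Suc (a - i)))) = s1 (level_pp \<tau> (zpos (Suc b)) (Suc a))"
    by (rule level_pp_sums(2)[OF level_pp_abs1])
  also have "(\<Sum>i<b. zneg (Suc a) $ i * s1 (L (Suc (b - i)))) = s1 (level_pp \<tau> (zneg (Suc a)) (Suc b))"
    by (rule level_pp_sums(2)[OF level_pp_abs1])
  finally show ?thesis by (simp only: level_di_eq sums_add(1)[OF level_pp_abs1 level_pp_abs1 level_pp_abs1])
qed

lemma copr_block_L1':
  assumes "a \<ge> 1" "b \<ge> 1" "c \<ge> 1"
  shows "copr (zs b @ L1 # zs c) L1 [] (L1 # zs a @ [L1])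
    = osum2 (L (Suc a)) (level_di \<tau> (Suc b) (Suc c)) + osum3 (L (Suc a)) (L (Suc b)) (L (Suc c))"
proof -
  have La: "abs1 (L (Suc a))" using assms by (intro L_abs1) simp
  have "copr (zs b @ L1 # zs c) L1 [] (L1 # zs a @ [L1]) = (\<Sum>i<b. zpos (Suc c) $ i * osum2 (L (Suc a)) (L (Suc (b - i))))
      + (\<Sum>i<c. zneg (Suc b) $ i * osum2 (L (Suc a)) (L (Suc (c - i)))) + osum3 (L (Suc a)) (L (Suc b)) (L (Suc c))"
    using assms by (simp add: cop_block_L1[OF cop_facts] int_sym_zeta gw_blocks)
  also have "(\<Sum>i<b. zpos (Suc c) $ i * osum2 (L (Suc a)) (L (Suc (b - i)))) = osum2 (L (Suc a)) (level_pp \<tau> (zpos (Suc c)) (Suc b))"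
    by (rule level_pp_sums(4)[OF La])
  also have "(\<Sum>i<c. zneg (Suc b) $ i * osum2 (L (Suc a)) (L (Suc (c - i)))) = osum2 (L (Suc a)) (level_pp \<tau> (zneg (Suc b)) (Suc c))"
    by (rule level_pp_sums(4)[OF La])
  finally show ?thesis by (simp only: level_di_eq sums_add(3)[OF level_pp_abs1 level_pp_abs1 La])
qed

lemma copr_two_blocks_L1:
  assumes "a \<ge> 1" "b \<ge> 1" "c \<ge> 1"
  shows "copr (zs a @ L1 # zs b @ L1 # zs c) L1 [] [L1] = s1 (level_tri \<tau> (Suc a) (Suc b) (Suc c))
    + osum2 (level_di \<tau> (Suc a) (Suc b)) (L (Suc c)) + osum2 (L (Suc a)) (level_di \<tau> (Suc b) (Suc c)) + osum3 (L (Suc a)) (L (Suc b)) (L (Suc c))"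
proof -
  have Lc: "abs1 (L (Suc c))" using assms by (intro L_abs1) simp
  have "copr (zs a @ L1 # zs b @ L1 # zs c) L1 [] [L1]
    = (\<Sum>i<a. zpos2 (Suc b) (Suc c) $ i * s1 (L (Suc (a - i))))
    + (\<Sum>i<a. zpos (Suc b) $ i * osum2 (L (Suc (a - i))) (L (Suc c)))
    + copr (zs b @ L1 # zs c) L1 [] (L1 # zs a @ [L1])
    + (\<Sum>s<b. zneg (Suc a) $ s * ((\<Sum>i<b - s. zpos (Suc c) $ i * s1 (L (Suc (b - s - i)))) + osum2 (L (Suc (b - s))) (L (Suc c))))
    + (\<Sum>s<c. zneg2 (Suc a) (Suc b) $ s * s1 (L (Suc (c - s))))"
    using assms by (simp add: cop_two_blocks_L1[OF cop_facts] int_sym_zeta int_sym_zeta2 gw_blocks)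
  \<comment> \<open>The nested sum runs over s + i < b; collecting the terms by s + i yields the
    coefficients of the product of the two power series.\<close>
  also have "(\<Sum>s<b. zneg (Suc a) $ s * ((\<Sum>i<b - s. zpos (Suc c) $ i * s1 (L (Suc (b - s - i)))) + osum2 (L (Suc (b - s))) (L (Suc c))))
      = s1 (level_pp \<tau> (zneg (Suc a) * zpos (Suc c)) (Suc b)) + osum2 (level_pp \<tau> (zneg (Suc a)) (Suc b)) (L (Suc c))"
  proof -
    have "(\<Sum>s<b. zneg (Suc a) $ s * (\<Sum>i<b - s. zpos (Suc c) $ i * s1 (L (Suc (b - s - i)))))
        = (\<Sum>s<b. \<Sum>i<b - s. zneg (Suc a) $ s * zpos (Suc c) $ i * s1 (L (Suc (b - (s + i)))))"
      by (simp add: sum_distrib_left mult.assoc)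
    also have "\<dots> = (\<Sum>(s, i)\<in>{(s, i). s + i < b}. zneg (Suc a) $ s * zpos (Suc c) $ i * s1 (L (Suc (b - (s + i)))))"
      by (subst sum.Sigma) (auto intro!: sum.cong)
    also have "\<dots> = (\<Sum>k<b. \<Sum>s\<le>k. zneg (Suc a) $ s * zpos (Suc c) $ (k - s) * s1 (L (Suc (b - (s + (k - s))))))"
      by (rule sum.triangle_reindex)
    also have "\<dots> = (\<Sum>k<b. (zneg (Suc a) * zpos (Suc c)) $ k * s1 (L (Suc (b - k))))"
      by (simp add: fps_mult_nth sum_distrib_right atMost_atLeast0)
    also have "\<dots> = s1 (level_pp \<tau> (zneg (Suc a) * zpos (Suc c)) (Suc b))" by (rule level_pp_sums(2)[OF level_pp_abs1])
    finally show ?thesis by (simp add: distrib_left sum.distrib level_pp_sums(3)[OF Lc])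
  qed
  finally show ?thesis
    unfolding copr_block_L1'[OF assms] level_pp_sums(2)[OF Lc] level_pp_sums(3)[OF Lc] level_tri_eq level_di_eq[of "Suc a"]
      sums_add(1)[OF abs1_add[OF level_pp_abs1 level_pp_abs1] level_pp_abs1 Lc] sums_add(1)[OF level_pp_abs1 level_pp_abs1 Lc]
      sums_add(2)[OF level_pp_abs1 level_pp_abs1 Lc] by simp
qed

lemma zpos_0: "zpos x $ 0 = zt x" and zpos2_0: "zpos2 x y $ 0 = zt2 x y"
  by (simp_all add: zpos_def zpos2_def)

lemma eisenstein_sh_0: "eisenstein_sh \<tau> [] = 1"
  by (simp add: eisenstein_sh_eq_cop word_of_def int_sym_def)

lemma eisenstein_sh_1:
  assumes "x \<ge> 2" shows "eisenstein_sh \<tau> [x] = semi_eis x \<tau>"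
proof -
  obtain a where a: "x = Suc a" "a \<ge> 1" using assms by (cases x) auto
  show ?thesis
    using cop_block_L0[where I = "int_sym zeta_sh" and n = 0 and u = "[]" and F = gw, OF cop_facts a(2)] a int_sym_zeta(1)[OF a(2), of 0]
    by (simp add: eisenstein_sh_eq_cop word_of_def gw_blocks zpos_0 semi_eis_def level_tangent_def[abs_def] int_sym_def[of _ _ "[]"])
qed

text \<open>The four terms sort the pairs lambda1 < lambda2 by rows: both in row 0, only the first
  in row 0, both in one row w >= 1, in two rows w >= 1.\<close>

lemma eisenstein_sh_2:
  assumes "x \<ge> 2" "y \<ge> 2"
  shows "eisenstein_sh \<tau> [x, y] = zt2 x y + zt x * s1 (L y) + s1 (level_di \<tau> x y) + osum2 (L x) (L y)"
proof -
  obtain a where a: "x = Suc a" "a \<ge> 1" using assms by (cases x) auto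
  obtain b where b: "y = Suc b" "b \<ge> 1" using assms by (cases y) auto
  show ?thesis
    using cop_two_blocks_L0[where I = "int_sym zeta_sh" and n = 0 and u = "[]" and F = gw, OF cop_facts a(2) b(2)] a b int_sym_zeta(1)[OF a(2), of 0] int_sym_zeta2(1)[OF a(2) b(2), of 0]
    by (simp add: eisenstein_sh_eq_cop word_of_def gw_blocks zpos_0 zpos2_0 copr_block_L1 int_sym_def[of _ _ "[]"])
qed

lemma eisenstein_sh_3:
  assumes "x \<ge> 2" "y \<ge> 2" "z \<ge> 2"
  shows "eisenstein_sh \<tau> [x, y, z] = mzv [x, y, z] + zt2 x y * s1 (L z) + zt x * (s1 (level_di \<tau> y z) + osum2 (L y) (L z))
    + (s1 (level_tri \<tau> x y z) + osum2 (level_di \<tau> x y) (L z) + osum2 (L x) (level_di \<tau> y z) + osum3 (L x) (L y) (L z))"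
proof -
  obtain a where a: "x = Suc a" "a \<ge> 1" using assms by (cases x) auto
  obtain b where b: "y = Suc b" "b \<ge> 1" using assms by (cases y) auto
  obtain c where c: "z = Suc c" "c \<ge> 1" using assms by (cases z) auto
  have "int_sym zeta_sh L0 (L1 # zs a @ L1 # zs b @ L1 # zs c) L1 = mzv [x, y, z]"
    using int_word_three[OF a(2) b(2) c(2)] by (simp add: int_sym_def a b c)
  then show ?thesis
    using cop_three_blocks[where I = "int_sym zeta_sh" and F = gw, OF cop_facts a(2) b(2) c(2)] a b c int_sym_zeta(1)[OF a(2), of 0] int_sym_zeta2(1)[OF a(2) b(2), of 0]
    by (simp add: eisenstein_sh_eq_cop word_of_def gw_blocks zpos_0 zpos2_0 copr_block_L1 copr_two_blocks_L1 int_sym_def[of _ _ "[]"])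
qed

text \<open>Both halves \<open>\<zeta>\<close> and the sum over the levels obey the harmonic product, hence so does their concatenation.\<close>

lemma level_di_symmetric:
  assumes "x \<ge> 2" "y \<ge> 2"
  shows "(\<lambda>w. level_di \<tau> x y w + level_di \<tau> y x w) = (\<lambda>w. L x w * L y w + (- 1) * L (x + y) w)"
  using ditangent_symmetric[OF assms] by (simp add: fun_eq_iff level_di_def level_tangent_def)

lemma di_abs1: "x \<ge> 2 \<Longrightarrow> y \<ge> 2 \<Longrightarrow> abs1 (level_di \<tau> x y)"
  using level_di_abs1[of "x - 1" "y - 1"] by simp

lemma s1_di_symmetric:
  assumes "x \<ge> 2" "y \<ge> 2"
  shows "s1 (level_di \<tau> x y) + s1 (level_di \<tau> y x) = s1 (\<lambda>w. L x w * L y w) - s1 (L (x + y))"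
  using infsum_lin[OF abs1_mult[OF L_abs1[OF assms(1)] L_abs1[OF assms(2)]] L_abs1, of "x + y" "- 1"]
    sums_add(1)[OF di_abs1[OF assms] di_abs1[OF assms(2,1)] L_abs1[OF assms(1)]] assms
  unfolding level_di_symmetric[OF assms] by simp

lemma s1_level_symmetric:
  assumes "x \<ge> 2" "y \<ge> 2"
  shows "s1 (level_di \<tau> x y) + s1 (level_di \<tau> y x) + osum2 (L x) (L y) + osum2 (L y) (L x) = s1 (L x) * s1 (L y) - s1 (L (x + y))"
  using s1_di_symmetric[OF assms] osum2_symmetric[OF L_abs1[OF assms(1)] L_abs1[OF assms(2)]] by (simp add: algebra_simps)

lemma osum2_di_symmetric:
  assumes "x \<ge> 2" "y \<ge> 2" "z \<ge> 2"
  shows "osum2 (level_di \<tau> x y) (L z) + osum2 (level_di \<tau> y x) (L z) + osum2 (L z) (level_di \<tau> x y) + osum2 (L z) (level_di \<tau> y x)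
    = (s1 (\<lambda>w. L x w * L y w) - s1 (L (x + y))) * s1 (L z) - (s1 (\<lambda>w. L x w * L y w * L z w) - s1 (\<lambda>w. L (x + y) w * L z w))"
proof -
  note Lz = L_abs1[OF assms(3)] and d = di_abs1[OF assms(1,2)] di_abs1[OF assms(2,1)]
  note Lxy = abs1_mult[OF L_abs1[OF assms(1)] L_abs1[OF assms(2)]]
  let ?D = "\<lambda>w. level_di \<tau> x y w + level_di \<tau> y x w"
  have xy: "abs1 (L (x + y))" using assms by (intro L_abs1) simp
  have "osum2 ?D (L z) + osum2 (L z) ?D = s1 ?D * s1 (L z) - s1 (\<lambda>w. ?D w * L z w)"
    by (rule osum2_symmetric[OF abs1_add[OF d] Lz])
  moreover have "s1 (\<lambda>w. ?D w * L z w) = s1 (\<lambda>w. L x w * L y w * L z w + (- 1) * (L (x + y) w * L z w))"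
  proof (intro infsum_cong)
    fix w
    show "?D w * L z w = L x w * L y w * L z w + (- 1) * (L (x + y) w * L z w)"
      unfolding fun_cong[OF level_di_symmetric[OF assms(1,2)], of w] by (simp add: algebra_simps)
  qed
  moreover have "\<dots> = s1 (\<lambda>w. L x w * L y w * L z w) - s1 (\<lambda>w. L (x + y) w * L z w)"
    using infsum_lin[OF abs1_mult[OF Lxy Lz] abs1_mult[OF xy Lz], of "- 1"] by simp
  ultimately show ?thesis
    unfolding sums_add(1)[OF d Lz] sums_add(2)[OF d Lz] sums_add(3)[OF d Lz] s1_di_symmetric[OF assms(1,2)] by (simp add: add_ac)
qed

lemma s1_tri_symmetric:
  assumes "x \<ge> 2" "y \<ge> 2" "z \<ge> 2"
  shows "s1 (level_tri \<tau> x y z) + s1 (level_tri \<tau> x z y) + s1 (level_tri \<tau> y x z) + s1 (level_tri \<tau> y z x) + s1 (level_tri \<tau> z x y) + s1 (level_tri \<tau> z y x)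
    = s1 (\<lambda>w. L x w * L y w * L z w) - s1 (\<lambda>w. L (x + y) w * L z w) - s1 (\<lambda>w. L (y + z) w * L x w) - s1 (\<lambda>w. L (x + z) w * L y w) + 2 * s1 (L (x + y + z))"
proof -
  have t: "abs1 (level_tri \<tau> x y z)" if "x \<ge> 2" "y \<ge> 2" "z \<ge> 2" for x y z
    using that level_pp_abs1[of _ "x - 1"] level_pp_abs1[of _ "y - 1"] level_pp_abs1[of _ "z - 1"] unfolding level_tri_eq by (intro abs1_add) simp_all
  note m3 = abs1_mult[OF abs1_mult[OF L_abs1[OF assms(1)] L_abs1[OF assms(2)]] L_abs1[OF assms(3)]]
  note t6 = t[OF assms(1,2,3)] t[OF assms(1,3,2)] t[OF assms(2,1,3)] t[OF assms(2,3,1)] t[OF assms(3,1,2)] t[OF assms(3,2,1)]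
  note a = abs1_add[OF t6(1,2)]
  note b = abs1_add[OF a t6(3)]
  note c = abs1_add[OF b t6(4)]
  note d = abs1_add[OF c t6(5)]
  have "s1 (\<lambda>w. level_tri \<tau> x y z w + level_tri \<tau> x z y w + level_tri \<tau> y x z w + level_tri \<tau> y z x w + level_tri \<tau> z x y w + level_tri \<tau> z y x w)
    = s1 (level_tri \<tau> x y z) + s1 (level_tri \<tau> x z y) + s1 (level_tri \<tau> y x z) + s1 (level_tri \<tau> y z x) + s1 (level_tri \<tau> z x y) + s1 (level_tri \<tau> z y x)"
    unfolding sums_add(1)[OF d t6(6) a] sums_add(1)[OF c t6(5) a] sums_add(1)[OF b t6(4) a] sums_add(1)[OF a t6(3) a] sums_add(1)[OF t6(1,2) a] ..
  also have "(\<lambda>w. level_tri \<tau> x y z w + level_tri \<tau> x z y w + level_tri \<tau> y x z w + level_tri \<tau> y z x w + level_tri \<tau> z x y w + level_tri \<tau> z y x w)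
    = (\<lambda>w. L x w * L y w * L z w + (- 1) * (L (x + y) w * L z w) + (- 1) * (L (y + z) w * L x w) + (- 1) * (L (x + z) w * L y w) + 2 * L (x + y + z) w)"
    using tritangent_symmetric[OF assms] by (simp add: fun_eq_iff level_tri_def level_tangent_def)
  finally have 1: "s1 (\<lambda>w. L x w * L y w * L z w + (- 1) * (L (x + y) w * L z w) + (- 1) * (L (y + z) w * L x w) + (- 1) * (L (x + z) w * L y w) + 2 * L (x + y + z) w)
    = s1 (level_tri \<tau> x y z) + s1 (level_tri \<tau> x z y) + s1 (level_tri \<tau> y x z) + s1 (level_tri \<tau> y z x) + s1 (level_tri \<tau> z x y) + s1 (level_tri \<tau> z y x)" .
  note p = m3 abs1_mult[OF L_abs1[OF trans_le_add1[OF assms(1), of y]] L_abs1[OF assms(3)]]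
    abs1_mult[OF L_abs1[OF trans_le_add1[OF assms(2), of z]] L_abs1[OF assms(1)]]
    abs1_mult[OF L_abs1[OF trans_le_add1[OF assms(1), of z]] L_abs1[OF assms(2)]] L_abs1[OF trans_le_add1[OF trans_le_add1[OF assms(1)]], of y z]
  note q = abs1_lin[OF p(1,2), of "- 1"]
  note r = abs1_lin[OF q p(3), of "- 1"]
  note u = abs1_lin[OF r p(4), of "- 1"]
  show ?thesis
    unfolding 1[symmetric] infsum_lin[OF u p(5)] infsum_lin[OF r p(4)] infsum_lin[OF q p(3)] infsum_lin[OF p(1,2)] by simp
qed

section \<open>Sums over the permutations of the index\<close>

lemma eisenstein_sh_symmetric2:
  assumes "x \<ge> 2" "y \<ge> 2"
  shows "eisenstein_sh \<tau> [x, y] + eisenstein_sh \<tau> [y, x] = semi_eis x \<tau> * semi_eis y \<tau> - semi_eis (x + y) \<tau>"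
proof -
  have s: "semi_eis x \<tau> = zt x + s1 (L x)" for x by (simp add: semi_eis_def level_tangent_def[abs_def])
  show ?thesis
    using zt2_symmetric[OF assms] s1_level_symmetric[OF assms] unfolding eisenstein_sh_2[OF assms] eisenstein_sh_2[OF assms(2,1)] s by algebra
qed

lemma mzv_symmetric3:
  assumes "x \<ge> 2" "y \<ge> 2" "z \<ge> 2"
  shows "mzv [x, y, z] + mzv [x, z, y] + mzv [y, x, z] + mzv [y, z, x] + mzv [z, x, y] + mzv [z, y, x]
    = zt x * zt y * zt z - zt (x + y) * zt z - zt (y + z) * zt x - zt (x + z) * zt y + 2 * zt (x + y + z)"
  using osum3_symmetric[OF zt_summable[OF assms(1)] zt_summable[OF assms(2)] zt_summable[OF assms(3)]]
  unfolding mzv_3 zt_conv by (simp add: power_add)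

lemma eisenstein_sh_symmetric3:
  assumes "x \<ge> 2" "y \<ge> 2" "z \<ge> 2"
  shows "eisenstein_sh \<tau> [x, y, z] + eisenstein_sh \<tau> [x, z, y] + eisenstein_sh \<tau> [y, x, z] + eisenstein_sh \<tau> [y, z, x]
      + eisenstein_sh \<tau> [z, x, y] + eisenstein_sh \<tau> [z, y, x]
    = semi_eis x \<tau> * semi_eis y \<tau> * semi_eis z \<tau> - semi_eis (x + y) \<tau> * semi_eis z \<tau> - semi_eis (y + z) \<tau> * semi_eis x \<tau>
      - semi_eis (x + z) \<tau> * semi_eis y \<tau> + 2 * semi_eis (x + y + z) \<tau>"
proof -
  have s: "semi_eis x \<tau> = zt x + s1 (L x)" for x by (simp add: semi_eis_def level_tangent_def[abs_def])
  let ?T = "s1 (level_tri \<tau> x y z) + s1 (level_tri \<tau> x z y) + s1 (level_tri \<tau> y x z) + s1 (level_tri \<tau> y z x) + s1 (level_tri \<tau> z x y) + s1 (level_tri \<tau> z y x)"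
  let ?Q = "\<lambda>x y z. osum2 (level_di \<tau> x y) (L z) + osum2 (level_di \<tau> y x) (L z) + osum2 (L z) (level_di \<tau> x y) + osum2 (L z) (level_di \<tau> y x)"
  let ?O = "osum3 (L x) (L y) (L z) + osum3 (L x) (L z) (L y) + osum3 (L y) (L x) (L z) + osum3 (L y) (L z) (L x) + osum3 (L z) (L x) (L y) + osum3 (L z) (L y) (L x)"
  have m: "L y w * L z w * L x w = L x w * L y w * L z w" "L x w * L z w * L y w = L x w * L y w * L z w" for w by (simp_all add: mult_ac)
  have levels: "?T + (?Q x y z + ?Q y z x + ?Q x z y) + ?O
    = s1 (L x) * s1 (L y) * s1 (L z) - s1 (L (x + y)) * s1 (L z) - s1 (L (y + z)) * s1 (L x) - s1 (L (x + z)) * s1 (L y) + 2 * s1 (L (x + y + z))"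
    unfolding s1_tri_symmetric[OF assms] osum2_di_symmetric[OF assms] osum2_di_symmetric[OF assms(2,3,1)] osum2_di_symmetric[OF assms(1,3,2)]
      osum3_symmetric[OF L_abs1[OF assms(1)] L_abs1[OF assms(2)] L_abs1[OF assms(3)]] m by (simp add: algebra_simps)
  let ?U = "\<lambda>y z. s1 (level_di \<tau> y z) + s1 (level_di \<tau> z y) + osum2 (L y) (L z) + osum2 (L z) (L y)"
  have "eisenstein_sh \<tau> [x, y, z] + eisenstein_sh \<tau> [x, z, y] + eisenstein_sh \<tau> [y, x, z] + eisenstein_sh \<tau> [y, z, x]
      + eisenstein_sh \<tau> [z, x, y] + eisenstein_sh \<tau> [z, y, x]
    = (mzv [x, y, z] + mzv [x, z, y] + mzv [y, x, z] + mzv [y, z, x] + mzv [z, x, y] + mzv [z, y, x])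
      + ((zt2 x y + zt2 y x) * s1 (L z) + (zt2 y z + zt2 z y) * s1 (L x) + (zt2 x z + zt2 z x) * s1 (L y))
      + (zt x * ?U y z + zt y * ?U x z + zt z * ?U x y) + (?T + (?Q x y z + ?Q y z x + ?Q x z y) + ?O)"
    using assms by (simp add: eisenstein_sh_3 distrib_left distrib_right)
  then show ?thesis
    unfolding levels mzv_symmetric3[OF assms] zt2_symmetric[OF assms(1,2)] zt2_symmetric[OF assms(2,3)] zt2_symmetric[OF assms(1,3)]
      s1_level_symmetric[OF assms(1,2)] s1_level_symmetric[OF assms(2,3)] s1_level_symmetric[OF assms(1,3)] s
    by (simp add: algebra_simps)
qed

lemma symmetric_eisenstein_3:
  "symmetric_eisenstein \<tau> [x, y, z] = eisenstein_sh \<tau> [x, y, z] + (-1) ^ z * eisenstein_sh \<tau> [x, y] * eisenstein_sh \<tau> [z]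
    + (-1) ^ (y + z) * eisenstein_sh \<tau> [x] * eisenstein_sh \<tau> [z, y] + (-1) ^ (x + y + z) * eisenstein_sh \<tau> [z, y, x]"
  by (simp add: symmetric_eisenstein_def eisenstein_sh_0 numeral_3_eq_3 add_ac)

text \<open>As x + y + z is even, the uncut and the fully reversed terms give twice the symmetric
  sum of depth 3. In the mixed terms the single factor of index x, y or z carries the sign -, - or
  +. With these signs the products of three series cancel, and so do the products with
  \<open>semi_eis x\<close> or \<open>semi_eis y\<close>.\<close>

theorem symmetric_eisenstein_permutations:
  assumes "x \<ge> 2" "y \<ge> 2" "z \<ge> 2" "odd x" "odd y" "even z"
  shows "symmetric_eisenstein \<tau> [x, y, z] + symmetric_eisenstein \<tau> [x, z, y] + symmetric_eisenstein \<tau> [y, x, z] + symmetric_eisenstein \<tau> [y, z, x]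
      + symmetric_eisenstein \<tau> [z, x, y] + symmetric_eisenstein \<tau> [z, y, x]
    = - 4 * (semi_eis (x + y) \<tau> * semi_eis z \<tau> - semi_eis (x + y + z) \<tau>)"
proof -
  let ?E = "eisenstein_sh \<tau>"
  have "symmetric_eisenstein \<tau> [x, y, z] + symmetric_eisenstein \<tau> [x, z, y] + symmetric_eisenstein \<tau> [y, x, z] + symmetric_eisenstein \<tau> [y, z, x]
      + symmetric_eisenstein \<tau> [z, x, y] + symmetric_eisenstein \<tau> [z, y, x]
    = 2 * (?E [x, y, z] + ?E [x, z, y] + ?E [y, x, z] + ?E [y, z, x] + ?E [z, x, y] + ?E [z, y, x])
      + 2 * ((?E [x, y] + ?E [y, x]) * ?E [z] - (?E [x, z] + ?E [z, x]) * ?E [y] - (?E [y, z] + ?E [z, y]) * ?E [x])"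
    using assms(4-6) by (simp add: symmetric_eisenstein_3 algebra_simps)
  also have "\<dots> = - 4 * (semi_eis (x + y) \<tau> * semi_eis z \<tau> - semi_eis (x + y + z) \<tau>)"
    unfolding eisenstein_sh_symmetric3[OF assms(1-3)] eisenstein_sh_symmetric2[OF assms(1,2)] eisenstein_sh_symmetric2[OF assms(1,3)]
      eisenstein_sh_symmetric2[OF assms(2,3)] eisenstein_sh_1[OF assms(1)] eisenstein_sh_1[OF assms(2)] eisenstein_sh_1[OF assms(3)]
    by (simp add: algebra_simps)
  finally show ?thesis .
qed

end

section \<open>Cusp forms as combinations of symmetric triple Eisenstein series\<close>

text \<open>Here x + y = n, and x = 3 is the smallest odd index >= 2. A list is used because x = y
  for n = 6, where each triple must be counted twice.\<close>

definition eis_perms :: "nat \<Rightarrow> nat \<Rightarrow> (nat \<times> nat \<times> nat) list" where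
  "eis_perms k n = (let x = 3; y = n - 3; z = k - n in [(x, y, z), (x, z, y), (y, x, z), (y, z, x), (z, x, y), (z, y, x)])"

lemma sum_eis_perms:
  assumes "even k" "even n" "6 \<le> n" "n + 4 \<le> k" "\<tau> \<in> uhp"
  shows "(\<Sum>(k1, k2, k3)\<leftarrow>eis_perms k n. symmetric_eisenstein_normalized \<tau> [k1, k2, k3])
    = - 4 * ((semi_eis n \<tau> * semi_eis (k - n) \<tau> - semi_eis k \<tau>) / (2 * of_real pi * \<i>) ^ k)"
proof -
  have e: "3 + (n - 3) = n" "n + (k - n) = k" using assms by auto
  have "n - 3 \<ge> 2" "k - n \<ge> 2" "odd (n - 3)" "even (k - n)" using assms by auto
  from symmetric_eisenstein_permutations[OF assms(5) _ this(1,2) _ this(3,4), of 3]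
  have "symmetric_eisenstein \<tau> [3, n - 3, k - n] + symmetric_eisenstein \<tau> [3, k - n, n - 3] + symmetric_eisenstein \<tau> [n - 3, 3, k - n]
      + symmetric_eisenstein \<tau> [n - 3, k - n, 3] + symmetric_eisenstein \<tau> [k - n, 3, n - 3] + symmetric_eisenstein \<tau> [k - n, n - 3, 3]
    = - 4 * (semi_eis n \<tau> * semi_eis (k - n) \<tau> - semi_eis k \<tau>)" by (simp only: e) simp
  moreover have "sum_list [k1, k2, k3] = k" if "(k1, k2, k3) \<in> set (eis_perms k n)" for k1 k2 k3
    using that assms by (auto simp: eis_perms_def Let_def)
  ultimately show ?thesis
    using e(2) assms by (simp add: eis_perms_def Let_def symmetric_eisenstein_normalized_def add_divide_distrib[symmetric] add_ac)
qed

theorem theorem1p1: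
  fixes k :: nat and f :: "complex \<Rightarrow> complex" and a :: "nat \<Rightarrow> complex"
  assumes "cusp_form k f"
    and "has_fourier_expansion f a"
    and "\<And>n. a n \<in> \<rat>"
  shows "\<exists>c :: nat \<times> nat \<times> nat \<Rightarrow> rat. \<forall>\<tau>\<in>upper_half_plane.
    f \<tau> = (\<Sum>(k1, k2, k3)\<in>{(k1, k2, k3). 1 \<le> k1 \<and> 1 \<le> k2 \<and> 1 \<le> k3 \<and> k = k1 + k2 + k3}.
             of_rat (c (k1, k2, k3)) * symmetric_eisenstein_normalized \<tau> [k1, k2, k3])"
proof (cases "odd k \<or> k < 12")
  case True
  then show ?thesis using cusp_form_low_weight[OF assms(1)] by (intro exI[of _ "\<lambda>_. 0"]) (simp add: case_prod_unfold)
next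
  case False
  then have k: "even k" "k \<ge> 12" by auto
  define N where "N = {n. even n \<and> 6 \<le> n \<and> n + 4 \<le> k}"
  define T where "T = {(k1, k2, k3). 1 \<le> k1 \<and> 1 \<le> k2 \<and> 1 \<le> k3 \<and> k = k1 + k2 + k3}"
  define P :: complex where "P = 2 * of_real pi * \<i>"
  \<comment> \<open>The powers of 2 pi i make the Fourier coefficients rational, including the
    constant terms, which are even zeta values.\<close>
  define G where "G n \<tau> = semi_eis n \<tau> / P ^ n * (semi_eis (k - n) \<tau> / P ^ (k - n)) - 1 * (semi_eis k \<tau> / P ^ k)" for n \<tau>
  have P: "P \<noteq> 0" by (simp add: P_def)
  have finN: "finite N" by (rule finite_subset[of _ "{..k}"]) (auto simp: N_def)
  have finT: "finite T" by (rule finite_subset[of _ "{..k} \<times> {..k} \<times> {..k}"]) (auto simp: T_def)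
  have G_eq: "G n \<tau> = (semi_eis n \<tau> * semi_eis (k - n) \<tau> - semi_eis k \<tau>) / P ^ k" if "n \<in> N" for n \<tau>
  proof -
    have "P ^ k = P ^ n * P ^ (k - n)" using that by (simp add: N_def flip: power_add)
    then show ?thesis by (simp add: G_def diff_divide_distrib)
  qed
  have "\<exists>b :: nat \<Rightarrow> rat. has_fourier_expansion (G n) (\<lambda>j. of_rat (b j))" if n: "n \<in> N" for n
  proof -
    have e: "even n" "n \<ge> 2" "even (k - n)" "k - n \<ge> 2" "k \<ge> 2" using n k by (auto simp: N_def)
    obtain b1 where b1: "has_fourier_expansion (\<lambda>\<tau>. semi_eis n \<tau> / P ^ n) (\<lambda>j. of_rat (b1 j))"
      unfolding P_def by (rule semi_eis_rational[OF e(1,2)])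
    obtain b2 where b2: "has_fourier_expansion (\<lambda>\<tau>. semi_eis (k - n) \<tau> / P ^ (k - n)) (\<lambda>j. of_rat (b2 j))"
      unfolding P_def by (rule semi_eis_rational[OF e(3,4)])
    obtain b3 where b3: "has_fourier_expansion (\<lambda>\<tau>. semi_eis k \<tau> / P ^ k) (\<lambda>j. of_rat (b3 j))"
      unfolding P_def by (rule semi_eis_rational[OF k(1) e(5)])
    from fourier_diff_cmult[OF fourier_mult[OF b1 b2] b3, of 1]
    have "has_fourier_expansion (G n) (\<lambda>j. of_rat ((\<Sum>i\<le>j. b1 i * b2 (j - i)) - b3 j))"
      by (simp add: G_def[abs_def] of_rat_diff of_rat_sum of_rat_mult)
    then show ?thesis by (rule exI[of _ "\<lambda>j. (\<Sum>i\<le>j. b1 i * b2 (j - i)) - b3 j"])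
  qed
  then obtain b :: "nat \<Rightarrow> nat \<Rightarrow> rat" where b: "\<And>n. n \<in> N \<Longrightarrow> has_fourier_expansion (G n) (\<lambda>j. of_rat (b n j))" by metis
  have "\<exists>r. a n = of_rat r" for n using assms(3)[of n] by (auto elim: Rats_cases)
  then obtain a' :: "nat \<Rightarrow> rat" where a': "\<And>n. a n = of_rat (a' n)" by metis
  obtain c where c: "\<And>z. z \<in> uhp \<Longrightarrow> f z = (\<Sum>n\<in>N. c n * (Eis n z * Eis (k - n) z - 2 * Eis k z))"
    using cusp_form_in_Eis_span[OF assms(1) k] unfolding N_def by blast
  \<comment> \<open>The factor 4 arises because each \<open>Eis\<close> is twice the corresponding
    \<open>semi_eis\<close>.\<close>
  have span: "f z = (\<Sum>n\<in>N. (4 * P ^ k * c n) * G n z)" if z: "z \<in> uhp" for z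
    unfolding c[OF z]
  proof (intro sum.cong refl)
    fix n assume n: "n \<in> N"
    have "Eis n z = 2 * semi_eis n z" "Eis (k - n) z = 2 * semi_eis (k - n) z" "Eis k z = 2 * semi_eis k z"
      using n k z by (auto simp: N_def intro!: Eis_eq_semi_eis)
    then show "c n * (Eis n z * Eis (k - n) z - 2 * Eis k z) = (4 * P ^ k * c n) * G n z"
      using P by (simp add: G_eq[OF n])
  qed
  have "has_fourier_expansion f (\<lambda>n. of_rat (a' n))" using assms(2) a' by (simp flip: a')
  from rational_combination[OF finN this b span]
  obtain r :: "nat \<Rightarrow> rat" where r: "\<And>z. z \<in> uhp \<Longrightarrow> f z = (\<Sum>n\<in>N. of_rat (r n) * G n z)" by blast
  \<comment> \<open>The coefficient of a triple collects every n and every position in which it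
    occurs; - 1 / 4 undoes the factor of \<open>sum_eis_perms\<close>.\<close>
  define e where "e t = (\<Sum>n\<in>N. - r n / 4 * (\<Sum>p\<leftarrow>eis_perms k n. if p = t then 1 else 0))" for t
  have "f \<tau> = (\<Sum>(k1, k2, k3)\<in>T. of_rat (e (k1, k2, k3)) * symmetric_eisenstein_normalized \<tau> [k1, k2, k3])" if \<tau>: "\<tau> \<in> uhp" for \<tau>
  proof -
    define S where "S = (\<lambda>(k1, k2, k3). symmetric_eisenstein_normalized \<tau> [k1, k2, k3])"
    have perms: "set (eis_perms k n) \<subseteq> T" if "n \<in> N" for n
      using that by (auto simp: eis_perms_def Let_def N_def T_def)
    have list: "(\<Sum>t\<in>T. of_rat (\<Sum>p\<leftarrow>ps. if p = t then 1 else 0) * S t) = (\<Sum>p\<leftarrow>ps. S p)" if "set ps \<subseteq> T" for ps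
      using that
    proof (induction ps)
      case (Cons q ps)
      have "(\<Sum>t\<in>T. of_rat (if q = t then 1 else 0) * S t) = (\<Sum>t\<in>T. if q = t then S t else 0)" by (intro sum.cong) auto
      then have "(\<Sum>t\<in>T. of_rat (if q = t then 1 else 0) * S t) = S q" using Cons.prems finT by (simp add: sum.delta)
      then show ?case using Cons by (simp add: of_rat_add distrib_right sum.distrib)
    qed simp
    have "(\<Sum>t\<in>T. of_rat (e t) * S t) = (\<Sum>n\<in>N. of_rat (- r n / 4) * (\<Sum>t\<in>T. of_rat (\<Sum>p\<leftarrow>eis_perms k n. if p = t then 1 else 0) * S t))"
      unfolding e_def of_rat_sum of_rat_mult sum_distrib_right sum_distrib_left by (subst sum.swap) (simp add: mult.assoc)
    also have "\<dots> = (\<Sum>n\<in>N. of_rat (- r n / 4) * (\<Sum>p\<leftarrow>eis_perms k n. S p))"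
      by (intro sum.cong refl arg_cong2[where f = "(*)"] list perms)
    also have "\<dots> = (\<Sum>n\<in>N. of_rat (r n) * G n \<tau>)"
    proof (intro sum.cong refl)
      fix n assume n: "n \<in> N"
      have "(\<Sum>p\<leftarrow>eis_perms k n. S p) = - 4 * G n \<tau>"
        using sum_eis_perms[of k n \<tau>] n k \<tau> G_eq[OF n] unfolding S_def P_def N_def by simp
      then show "of_rat (- r n / 4) * (\<Sum>p\<leftarrow>eis_perms k n. S p) = of_rat (r n) * G n \<tau>"
        by (simp add: of_rat_divide of_rat_minus)
    qed
    finally show ?thesis using r[OF \<tau>] by (simp add: S_def case_prod_unfold)
  qed
  then show ?thesis unfolding T_def by blast
qed

end
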